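(* Let $\omega(p)=|p|^2$ for $p\in\mathbb{R}^3$, and let $s>1/2$. (i) The initial-value problem $$\partial_t f=\mathcal{Q}[f],\qquad f(0)=f_0$$ is locally well-posed in $L^2_s$ in the following sense. For any $R>0$ there is $T\gtrsim_s R^{-2}$ (that is, $T\ge c_sR^{-2}$ with a constant $c_s>0$ depending only on $s$) such that for any initial data $f_0\in L^2_s$ with $\|f_0\|_{L^2_s}\le R$ there is a unique solution $f\in C^1([0,T]:L^2_s)$ of the initial-value problem. Furthermore, $\|f(t)\|_{L^2_s}\le 2R$ for any $t\in[0,T]$, and the map $f_0\mapsto f$ (defined for $\|f_0\|_{L^2_s}\le R$) is continuous from $L^2_s$ to $C^1([0,T]:L^2_s)$. (ii) If $f_0\ge 0$, then $f(t)$ is non-negative for any $t\in[0,T]$.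
   Context: Function space: for $s\ge0$, with $\langle x\rangle=(1+|x|^2)^{1/2}$, $L^2_s$ is the space of functions on $\mathbb{R}^3$ with $\|f\|_{L^2_s}:=\|\langle x\rangle^s f\|_{L^2(\mathbb{R}^3)}<\infty$. Collision operator: $\mathcal{Q}[f]=\mathcal{T}_1(f,f,f)+\mathcal{T}_2(f,f,f)-2\mathcal{T}_3(f,f,f)$, where, writing $\omega_i=\omega(p_i)$, $\omega=\omega(p)$, and $$d\nu_p=\delta(p+p_1-p_2-p_3)\,\delta(\omega+\omega_1-\omega_2-\omega_3)\,dp_1dp_2dp_3\quad\text{on }\mathbb{R}^9,$$ $\mathcal{T}_1(f,g,h)(p)=\int f(p_1)g(p_2)h(p_3)\,d\nu_p$, $\mathcal{T}_2(f,g,h)(p)=\int f(p)g(p_2)h(p_3)\,d\nu_p$, $\mathcal{T}_3(f,g,h)(p)=\int f(p)g(p_1)h(p_2)\,d\nu_p$. Meaning of the delta functions: the first delta eliminates $p_3=p+p_1-p_2$; then for fixed $p,p_1$, with $\mathfrak{G}(z)=\omega(p+p_1-z)+\omega(z)-\omega(p)-\omega(p_1)$ and $\mathcal{S}_{p,p_1}=\{z\in\mathbb{R}^3:\mathfrak{G}(z)=0\}$ with surface measure $\mu$, one has $\int \Phi(p_1,p_2,p_3)\,d\nu_p=\int_{\mathbb{R}^3}\Big(\int_{\mathcal{S}_{p,p_1}}\Phi(p_1,z,p+p_1-z)\frac{d\mu(z)}{|\nabla_z\mathfrak{G}(z)|}\Big)dp_1$. *)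

theory Defs
  imports "HOL-Analysis.Analysis"
begin

section \<open>Surface measure\<close>

text \<open>The surface measure of a surface in \<open>\<real>\<^sup>3\<close> is the two-dimensional Hausdorff measure. The
  factor \<open>pi / 4\<close> is the usual normalisation (area of the planar disc of diameter 1), for which
  the measure is the classical area on smooth surfaces.\<close>

definition hausdorff2_pre :: "real \<Rightarrow> 'a::metric_space set \<Rightarrow> ennreal" where
  "hausdorff2_pre \<delta> A =
     (INF U \<in> {U :: nat \<Rightarrow> 'a set. A \<subseteq> (\<Union>i. U i) \<and> (\<forall>i. bounded (U i) \<and> diameter (U i) \<le> \<delta>)}.
        (\<Sum>i. ennreal (pi / 4 * (diameter (U i))\<^sup>2)))"

definition hausdorff2_outer :: "'a::metric_space set \<Rightarrow> ennreal" where
  "hausdorff2_outer A = (SUP \<delta> \<in> {0<..}. hausdorff2_pre \<delta> A)"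

text \<open>Hausdorff outer measure is a metric outer measure, hence countably additive on the Borel
  sets, so that \<^const>\<open>measure_of\<close> does not take its default value here.\<close>

definition hausdorff2 :: "'a::metric_space measure" where
  "hausdorff2 = measure_of UNIV (sets borel) hausdorff2_outer"


section \<open>The collision operator\<close>

definition grad :: "('a::real_inner \<Rightarrow> real) \<Rightarrow> 'a \<Rightarrow> 'a" where
  "grad F x = (THE D. GDERIV F x :> D)"

definition resonance :: "(real^3 \<Rightarrow> real) \<Rightarrow> real^3 \<Rightarrow> real^3 \<Rightarrow> real^3 \<Rightarrow> real" where
  "resonance \<omega> p p1 z = \<omega> (p + p1 - z) + \<omega> z - \<omega> p - \<omega> p1"

definition resonant_set :: "(real^3 \<Rightarrow> real) \<Rightarrow> real^3 \<Rightarrow> real^3 \<Rightarrow> (real^3) set" where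
  "resonant_set \<omega> p p1 = {z. resonance \<omega> p p1 z = 0}"

text \<open>The integral of \<open>\<Phi>(p\<^sub>1, p\<^sub>2, p\<^sub>3)\<close> against
  \<open>\<delta>(p + p\<^sub>1 - p\<^sub>2 - p\<^sub>3) \<delta>(\<omega> + \<omega>\<^sub>1 - \<omega>\<^sub>2 - \<omega>\<^sub>3) dp\<^sub>1 dp\<^sub>2 dp\<^sub>3\<close>.\<close>

definition nu_integral ::
  "(real^3 \<Rightarrow> real) \<Rightarrow> real^3 \<Rightarrow> (real^3 \<Rightarrow> real^3 \<Rightarrow> real^3 \<Rightarrow> real) \<Rightarrow> real" where
  "nu_integral \<omega> p \<Phi> =
     (LINT p1|lborel. (LINT z:resonant_set \<omega> p p1|hausdorff2.
        \<Phi> p1 z (p + p1 - z) / norm (grad (resonance \<omega> p p1) z)))"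

definition T1 :: "(real^3 \<Rightarrow> real) \<Rightarrow> (real^3 \<Rightarrow> real) \<Rightarrow> (real^3 \<Rightarrow> real) \<Rightarrow> (real^3 \<Rightarrow> real) \<Rightarrow> real^3 \<Rightarrow> real"
  where "T1 \<omega> f g h p = nu_integral \<omega> p (\<lambda>p1 p2 p3. f p1 * g p2 * h p3)"

definition T2 :: "(real^3 \<Rightarrow> real) \<Rightarrow> (real^3 \<Rightarrow> real) \<Rightarrow> (real^3 \<Rightarrow> real) \<Rightarrow> (real^3 \<Rightarrow> real) \<Rightarrow> real^3 \<Rightarrow> real"
  where "T2 \<omega> f g h p = nu_integral \<omega> p (\<lambda>p1 p2 p3. f p * g p2 * h p3)"

definition T3 :: "(real^3 \<Rightarrow> real) \<Rightarrow> (real^3 \<Rightarrow> real) \<Rightarrow> (real^3 \<Rightarrow> real) \<Rightarrow> (real^3 \<Rightarrow> real) \<Rightarrow> real^3 \<Rightarrow> real"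
  where "T3 \<omega> f g h p = nu_integral \<omega> p (\<lambda>p1 p2 p3. f p * g p1 * h p2)"

definition collision :: "(real^3 \<Rightarrow> real) \<Rightarrow> (real^3 \<Rightarrow> real) \<Rightarrow> real^3 \<Rightarrow> real" where
  "collision \<omega> f p = T1 \<omega> f f f p + T2 \<omega> f f f p - 2 * T3 \<omega> f f f p"


section \<open>Weighted \<open>L\<^sup>2\<close> spaces and curves in them\<close>

text \<open>Elements of \<open>L\<^sup>2\<^sub>s\<close> are given by Borel representatives; equality in \<open>L\<^sup>2\<^sub>s\<close> is equality
  almost everywhere and is written out wherever it is used.\<close>

definition bracket :: "real^3 \<Rightarrow> real" where
  "bracket x = sqrt (1 + (norm x)\<^sup>2)"

definition L2w :: "real \<Rightarrow> (real^3 \<Rightarrow> real) set" where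
  "L2w s = {f \<in> borel_measurable lborel. integrable lborel (\<lambda>x. (bracket x powr s * f x)\<^sup>2)}"

definition L2w_norm :: "real \<Rightarrow> (real^3 \<Rightarrow> real) \<Rightarrow> real" where
  "L2w_norm s f = sqrt (LINT x|lborel. (bracket x powr s * f x)\<^sup>2)"

definition continuous_L2w :: "real \<Rightarrow> real \<Rightarrow> (real \<Rightarrow> real^3 \<Rightarrow> real) \<Rightarrow> bool" where
  "continuous_L2w s T f \<longleftrightarrow>
     (\<forall>t\<in>{0..T}. f t \<in> L2w s \<and>
        ((\<lambda>u. L2w_norm s (\<lambda>p. f u p - f t p)) \<longlongrightarrow> 0) (at t within {0..T}))"

definition has_L2w_deriv ::
  "real \<Rightarrow> real \<Rightarrow> (real \<Rightarrow> real^3 \<Rightarrow> real) \<Rightarrow> real \<Rightarrow> (real^3 \<Rightarrow> real) \<Rightarrow> bool" where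
  "has_L2w_deriv s T f t g \<longleftrightarrow> g \<in> L2w s \<and>
     ((\<lambda>u. L2w_norm s (\<lambda>p. (f u p - f t p) / (u - t) - g p)) \<longlongrightarrow> 0) (at t within {0..T})"

text \<open>The derivative is unique only almost everywhere, so some representative is chosen.\<close>

definition L2w_deriv :: "real \<Rightarrow> real \<Rightarrow> (real \<Rightarrow> real^3 \<Rightarrow> real) \<Rightarrow> real \<Rightarrow> real^3 \<Rightarrow> real" where
  "L2w_deriv s T f t = (SOME g. has_L2w_deriv s T f t g)"

definition C1_L2w :: "real \<Rightarrow> real \<Rightarrow> (real \<Rightarrow> real^3 \<Rightarrow> real) set" where
  "C1_L2w s T = {f. continuous_L2w s T f \<and> (\<forall>t\<in>{0..T}. \<exists>g. has_L2w_deriv s T f t g) \<and>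
                    continuous_L2w s T (L2w_deriv s T f)}"

definition C1_norm :: "real \<Rightarrow> real \<Rightarrow> (real \<Rightarrow> real^3 \<Rightarrow> real) \<Rightarrow> real" where
  "C1_norm s T f = (SUP t\<in>{0..T}. L2w_norm s (f t)) + (SUP t\<in>{0..T}. L2w_norm s (L2w_deriv s T f t))"

definition solves_ivp ::
  "(real^3 \<Rightarrow> real) \<Rightarrow> real \<Rightarrow> real \<Rightarrow> (real^3 \<Rightarrow> real) \<Rightarrow> (real \<Rightarrow> real^3 \<Rightarrow> real) \<Rightarrow> bool" where
  "solves_ivp \<omega> s T f0 f \<longleftrightarrow> f \<in> C1_L2w s T \<and>
     (\<forall>t\<in>{0..T}. AE p in lborel. L2w_deriv s T f t p = collision \<omega> (f t) p) \<and>
     (AE p in lborel. f 0 p = f0 p)"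

end

theory Submission
  imports Defs
begin

text \<open>For \<open>\<omega>(p) = |p|\<^sup>2\<close> the resonant set is the sphere with antipodal points \<open>p\<close> and \<open>p\<^sub>1\<close>, so that
  \<open>p\<^sub>2, p\<^sub>3 = (p + p\<^sub>1) / 2 \<plusminus> |p - p\<^sub>1| \<phi> / 2\<close> with \<open>\<phi>\<close> on the unit sphere and \<open>d\<nu>\<close> becomes a multiple of
  \<open>|p - p\<^sub>1| dp\<^sub>1 d\<phi>\<close>. The Hausdorff measure enters only up to a constant factor: it is finite and rotation
  invariant on the sphere, and such a measure is unique up to a factor.

  Each of the three trilinear operators is bounded on \<open>L\<^sup>2\<^sub>s\<close> for \<open>s > 1/2\<close>. By inscribed angles,
  \<open>|p - p\<^sub>1| dp\<^sub>1 d\<phi>\<close> is comparable to \<open>|w \<bullet> \<psi>| dw d\<psi>\<close> with \<open>p\<^sub>1 = p + w\<close> and \<open>p\<^sub>2 = p + (w \<bullet> \<psi>) \<psi>\<close>, where \<open>p\<^sub>3 - p\<close> is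
  the component of \<open>w\<close> orthogonal to \<open>\<psi>\<close>; the Cauchy--Schwarz inequality with suitable weights then bounds the
  integrals of \<open>g(p\<^sub>2) h(p\<^sub>3)\<close> and \<open>g(p\<^sub>1) h(p\<^sub>2)\<close> uniformly in \<open>p\<close>. For the gain term \<open>f(p\<^sub>1) g(p\<^sub>2) h(p\<^sub>3)\<close>, conservation of
  energy moves the weight \<open>\<langle>p\<rangle>\<^sup>s\<close> to \<open>p\<^sub>2\<close> or \<open>p\<^sub>3\<close>, and the Cauchy--Schwarz inequality, the boundedness of the
  Newtonian potential of \<open>\<langle>x\<rangle>\<^sup>-\<^sup>1\<close> on spheres and the symmetry \<open>(p, p\<^sub>1) \<leftrightarrow> (p\<^sub>2, p\<^sub>3)\<close> give the estimate.

  Hence the equation is an ordinary differential equation with a locally Lipschitz, cubic vector field in a Hilbert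
  space, and \<open>Q[f] + C M\<^sup>2 f\<close> is non-negative for non-negative \<open>f\<close> of norm at most \<open>M\<close>, so that the fixed-point iteration
  for the equation with integrating factor \<open>exp (C M\<^sup>2 t)\<close> preserves the cone of non-negative functions.\<close>

section \<open>Two-dimensional Hausdorff measure\<close>

text \<open>The data are classes modulo null sets of R^3, while the collision integral reads its
  arguments on spheres, which are null sets; that it acts on classes is therefore not evident. It
  follows from the Lipschitz estimate, because two representatives of one class have distance zero.
  As nothing is known to be integrable beforehand, all bounds are first proved for
  \<open>coll\<close>, an integral with values in \<open>ennreal\<close>, and then transferred to
  the Bochner integrals of the definition. The exponent 1/2 is the threshold at which <x>^(-2s) /
  |x| is integrable over a plane: the power 2s + 1 at infinity has to exceed 2. Planar kernels are
  split into products, so that only powers on the line are integrated. The loss term is the only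
  negative one. It carries the factor f(p), and the integral multiplying it is bounded uniformly in
  p; this is why a multiple of f compensates it. The cone is described by inner products with test
  vectors, which makes it closed and lets its inequalities pass under the time integral.\<close>

lemma diameter_image_lipschitz:
  fixes f :: "'a::metric_space \<Rightarrow> 'b::real_normed_vector"
  assumes "k \<ge> 0" and lip: "\<And>x y. dist (f x) (f y) \<le> k * dist x y" and U: "bounded U"
  shows "bounded (f ` U)" "diameter (f ` U) \<le> k * diameter U"
proof -
  have d: "dist (f x) (f y) \<le> k * diameter U" if "x \<in> U" "y \<in> U" for x y
    using order_trans[OF lip mult_left_mono[OF diameter_bounded_bound[OF U that] \<open>k \<ge> 0\<close>]] .
  show "bounded (f ` U)" unfolding bounded_two_points using d by blast
  show "diameter (f ` U) \<le> k * diameter U"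
    by (rule diameter_le) (use d assms diameter_ge_0[OF U] in \<open>auto simp: dist_norm\<close>)
qed

text \<open>The image of a cover is a cover of the image, its diameters grow at most by the factor
  \<open>k\<close>, and the sums are quadratic in the diameters. The changed mesh \<delta> / k
  disappears in the supremum over \<delta>.\<close>

lemma hausdorff2_outer_lipschitz:
  fixes f :: "'a::metric_space \<Rightarrow> 'b::real_normed_vector"
  assumes k: "k > 0" and lip: "\<And>x y. dist (f x) (f y) \<le> k * dist x y"
  shows "hausdorff2_outer (f ` A) \<le> ennreal (k\<^sup>2) * hausdorff2_outer A"
proof -
  \<comment> \<open>The factor 1 / k^2 stands on the left so that the right side is a bare infimum,
    which is bounded cover by cover.\<close>
  have pre: "hausdorff2_pre \<delta> (f ` A) * ennreal (1 / k\<^sup>2) \<le> hausdorff2_pre (\<delta> / k) A" for \<delta>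
    unfolding hausdorff2_pre_def[of "\<delta> / k" A]
  proof (rule INF_greatest)
    fix U assume "U \<in> {U :: nat \<Rightarrow> 'a set. A \<subseteq> (\<Union>i. U i) \<and> (\<forall>i. bounded (U i) \<and> diameter (U i) \<le> \<delta> / k)}"
    then have U: "A \<subseteq> (\<Union>i. U i)" "\<And>i. bounded (U i)" "\<And>i. diameter (U i) \<le> \<delta> / k" by auto
    note di = diameter_image_lipschitz[OF less_imp_le[OF k] lip U(2)]
    have "hausdorff2_pre \<delta> (f ` A) \<le> (\<Sum>i. ennreal (pi / 4 * (diameter (f ` U i))\<^sup>2))"
      unfolding hausdorff2_pre_def
    proof (rule INF_lower, safe)
      show "f x \<in> (\<Union>i. f ` U i)" if "x \<in> A" for x using U(1) that by blast
      show "bounded (f ` U i)" for i using di by blast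
      show "diameter (f ` U i) \<le> \<delta>" for i
        using order_trans[OF di(2)[of i] mult_left_mono[OF U(3)[of i]]] k by auto
    qed
    then have "hausdorff2_pre \<delta> (f ` A) * ennreal (1 / k\<^sup>2) \<le>
        (\<Sum>i. ennreal (pi / 4 * (diameter (f ` U i))\<^sup>2)) * ennreal (1 / k\<^sup>2)"
      by (rule mult_right_mono) simp
    also have "\<dots> = (\<Sum>i. ennreal (pi / 4 * (diameter (f ` U i))\<^sup>2) * ennreal (1 / k\<^sup>2))" by simp
    also have "\<dots> \<le> (\<Sum>i. ennreal (pi / 4 * (diameter (U i))\<^sup>2))"
    proof (rule suminf_le)
      fix i
      have "(diameter (f ` U i))\<^sup>2 \<le> (k * diameter (U i))\<^sup>2"
        using di[of i] diameter_ge_0[OF di(1)[of i]] by (intro power_mono) auto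
      then have "pi / 4 * (diameter (f ` U i))\<^sup>2 * (1 / k\<^sup>2) \<le> pi / 4 * (diameter (U i))\<^sup>2"
        using k by (simp add: field_simps)
      then show "ennreal (pi / 4 * (diameter (f ` U i))\<^sup>2) * ennreal (1 / k\<^sup>2) \<le> ennreal (pi / 4 * (diameter (U i))\<^sup>2)"
        by (simp add: ennreal_leI flip: ennreal_mult)
    qed auto
    finally show "hausdorff2_pre \<delta> (f ` A) * ennreal (1 / k\<^sup>2) \<le> (\<Sum>i. ennreal (pi / 4 * (diameter (U i))\<^sup>2))" .
  qed
  have "hausdorff2_pre \<delta> (f ` A) \<le> ennreal (k\<^sup>2) * hausdorff2_outer A" if "\<delta> > 0" for \<delta>
  proof -
    have "hausdorff2_pre \<delta> (f ` A) = ennreal (k\<^sup>2) * (hausdorff2_pre \<delta> (f ` A) * ennreal (1 / k\<^sup>2))"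
      using k by (simp add: mult.assoc mult.left_commute flip: ennreal_mult)
    also have "\<dots> \<le> ennreal (k\<^sup>2) * hausdorff2_outer A"
      unfolding hausdorff2_outer_def
      by (intro mult_left_mono order_trans[OF pre] SUP_upper) (use that k in auto)
    finally show ?thesis .
  qed
  then show ?thesis unfolding hausdorff2_outer_def[of "f ` A"] by (auto intro!: SUP_least)
qed

text \<open>The Lipschitz bounds for \<open>f\<close> and for its inverse, with constants
  \<open>k\<close> and \<open>1 / k\<close>, are the two inequalities.\<close>

lemma hausdorff2_outer_similarity:
  fixes f :: "'a::real_normed_vector \<Rightarrow> 'a"
  assumes k: "k > 0" and sim: "\<And>x y. dist (f x) (f y) = k * dist x y" and "surj f"
  shows "hausdorff2_outer (f ` A) = ennreal (k\<^sup>2) * hausdorff2_outer A"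
proof (rule antisym)
  show "hausdorff2_outer (f ` A) \<le> ennreal (k\<^sup>2) * hausdorff2_outer A"
    by (rule hausdorff2_outer_lipschitz) (use k sim in auto)
  have inj: "inj f" using sim k by (metis dist_eq_0_iff injI mult_eq_0_iff order_less_irrefl)
  have "dist (inv f x) (inv f y) \<le> 1 / k * dist x y" for x y
    using sim[of "inv f x" "inv f y"] k surj_f_inv_f[OF \<open>surj f\<close>] by (simp add: field_simps)
  then have "hausdorff2_outer (inv f ` f ` A) \<le> ennreal ((1 / k)\<^sup>2) * hausdorff2_outer (f ` A)"
    using k by (intro hausdorff2_outer_lipschitz) auto
  then have "ennreal (k\<^sup>2) * hausdorff2_outer A \<le> ennreal (k\<^sup>2) * (ennreal ((1 / k)\<^sup>2) * hausdorff2_outer (f ` A))"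
    using inj by (intro mult_left_mono) (auto simp: image_comp)
  also have "\<dots> = hausdorff2_outer (f ` A)"
    using k by (simp add: power_divide flip: ennreal_mult mult.assoc)
  finally show "ennreal (k\<^sup>2) * hausdorff2_outer A \<le> hausdorff2_outer (f ` A)" .
qed

lemma hausdorff2_outer_mono: "A \<subseteq> B \<Longrightarrow> hausdorff2_outer A \<le> hausdorff2_outer B"
  unfolding hausdorff2_outer_def hausdorff2_pre_def
  by (intro SUP_mono' INF_superset_mono) auto

text \<open>A grid of n^2 squares of side 1 / n, each of diameter at most 2 / n, contributes n^2 (pi
  / 4) (2 / n)^2 = pi, whatever n is.\<close>

lemma hausdorff2_outer_square: "hausdorff2_outer ({0..1} \<times> {0..1} :: (real \<times> real) set) \<le> ennreal pi"
  unfolding hausdorff2_outer_def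
proof (rule SUP_least)
  fix \<delta> :: real assume "\<delta> \<in> {0<..}"
  then have d: "\<delta> > 0" by simp
  obtain n :: nat where n: "real n > 2 / \<delta>" using reals_Archimedean2 by blast
  have "2 / \<delta> > 0" using d by simp
  then have n0: "n > 0" using n by (metis gr0I less_trans of_nat_0 order_less_irrefl)
  have n2: "2 / real n \<le> \<delta>" using n d n0 by (simp add: field_simps)
  define Q where "Q i = {real i / n..(real i + 1) / n}" for i
  \<comment> \<open>Covers are sequences, so the n^2 cells are numbered row by row and the rest is
    filled with empty sets, whose diameter is 0.\<close>
  define U where "U k = (if k < n * n then Q (k div n) \<times> Q (k mod n) else {})" for k
  have diam: "diameter (Q i \<times> Q j) \<le> 2 / n" for i j
  proof (rule diameter_le)
    fix x y assume "x \<in> Q i \<times> Q j" "y \<in> Q i \<times> Q j"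
    then have "\<bar>fst x - fst y\<bar> \<le> (real i + 1) / n - real i / n" "\<bar>snd x - snd y\<bar> \<le> (real j + 1) / n - real j / n"
      by (auto simp: Q_def)
    then have "\<bar>fst x - fst y\<bar> + \<bar>snd x - snd y\<bar> \<le> 2 / n" by (simp flip: diff_divide_distrib)
    moreover have "norm (x - y) \<le> \<bar>fst x - fst y\<bar> + \<bar>snd x - snd y\<bar>"
      unfolding norm_prod_def by (simp add: sqrt_sum_squares_le_sum_abs)
    ultimately show "norm (x - y) \<le> 2 / n" by simp
  qed simp
  have bdd: "bounded (Q i \<times> Q j)" for i j unfolding Q_def by (intro bounded_Times) auto
  \<comment> \<open>For x = 1 the floor would give the index n, outside the grid; this point belongs
    to the last cell.\<close>
  have loc: "\<exists>i<n. x \<in> Q i" if "x \<in> {0..1}" for x :: real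
  proof (cases "x = 1")
    case True
    then have "x \<in> Q (n - 1)" using n0 by (auto simp: Q_def of_nat_diff field_simps)
    then show ?thesis using n0 by (intro exI[of _ "n - 1"]) auto
  next
    case False
    let ?i = "nat \<lfloor>x * n\<rfloor>"
    have "real ?i = of_int \<lfloor>x * n\<rfloor>" using that by simp
    moreover have "of_int \<lfloor>x * n\<rfloor> \<le> x * n" "x * n < of_int \<lfloor>x * n\<rfloor> + 1" by linarith+
    ultimately have "real ?i \<le> x * n" "x * n \<le> real ?i + 1" by linarith+
    then have "x \<in> Q ?i" using n0 by (auto simp: Q_def field_simps)
    moreover have "x * n < n" using False that n0 by simp
    then have "?i < n" using \<open>real ?i \<le> x * n\<close> by linarith
    ultimately show ?thesis by blast
  qed
  have "hausdorff2_pre \<delta> ({0..1} \<times> {0..1} :: (real \<times> real) set) \<le> (\<Sum>k. ennreal (pi / 4 * (diameter (U k))\<^sup>2))"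
    unfolding hausdorff2_pre_def
  proof (rule INF_lower, safe)
    fix a b :: real assume "a \<in> {0..1}" "b \<in> {0..1}"
    then obtain i j where ij: "i < n" "a \<in> Q i" "j < n" "b \<in> Q j" using loc by metis
    have "j + i * n < n * n"
    proof -
      have "j + i * n < n + i * n" using ij by simp
      also have "\<dots> = Suc i * n" by simp
      also have "\<dots> \<le> n * n" using ij by (intro mult_right_mono) auto
      finally show ?thesis .
    qed
    then have "(a, b) \<in> U (j + i * n)" using ij by (simp add: U_def)
    then show "(a, b) \<in> (\<Union>i. U i)" by blast
  next
    show "bounded (U i)" for i using bdd by (simp add: U_def)
    show "diameter (U i) \<le> \<delta>" for i using order_trans[OF diam n2] d by (simp add: U_def)
  qed
  also have "\<dots> = (\<Sum>k<n*n. ennreal (pi / 4 * (diameter (U k))\<^sup>2))"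
    by (rule suminf_finite) (auto simp: U_def)
  also have "\<dots> \<le> (\<Sum>k<n*n. ennreal (pi / 4 * (2 / n)\<^sup>2))"
  proof (rule sum_mono)
    fix k assume "k \<in> {..<n * n}"
    have "diameter (U k) \<le> 2 / n" "0 \<le> diameter (U k)"
      using diam bdd n0 by (auto simp: U_def intro: diameter_ge_0)
    then show "ennreal (pi / 4 * (diameter (U k))\<^sup>2) \<le> ennreal (pi / 4 * (2 / n)\<^sup>2)"
      by (intro ennreal_leI mult_left_mono power_mono) auto
  qed
  also have "\<dots> = ennreal pi"
    using n0 by (simp add: power_divide power2_eq_square ennreal_of_nat_eq_real_of_nat flip: ennreal_mult)
  finally show "hausdorff2_pre \<delta> ({0..1} \<times> {0..1} :: (real \<times> real) set) \<le> ennreal pi" .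
qed

lemma abs_sin_diff_le: "\<bar>sin a - sin b\<bar> \<le> \<bar>a - b\<bar>" for a b :: real
proof -
  have "\<bar>sin a - sin b\<bar> = 2 * \<bar>sin ((a - b) / 2)\<bar> * \<bar>cos ((a + b) / 2)\<bar>"
    by (simp add: sin_diff_sin abs_mult)
  also have "\<dots> \<le> 2 * \<bar>(a - b) / 2\<bar> * 1"
    by (intro mult_mono abs_sin_x_le_abs_x mult_left_mono) auto
  finally show ?thesis by simp
qed

lemma abs_cos_diff_le: "\<bar>cos a - cos b\<bar> \<le> \<bar>a - b\<bar>" for a b :: real
  using abs_sin_diff_le[of "a + pi / 2" "b + pi / 2"] by (simp add: sin_add)

lemma abs_mult_diff_le:
  fixes a b c d :: real
  assumes "\<bar>b\<bar> \<le> 1" "\<bar>c\<bar> \<le> 1"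
  shows "\<bar>a * b - c * d\<bar> \<le> \<bar>a - c\<bar> + \<bar>b - d\<bar>"
proof -
  have "a * b - c * d = (a - c) * b + c * (b - d)" by (simp add: algebra_simps)
  also have "\<bar>\<dots>\<bar> \<le> \<bar>a - c\<bar> * \<bar>b\<bar> + \<bar>c\<bar> * \<bar>b - d\<bar>" by (metis abs_mult abs_triangle_ineq)
  also have "\<dots> \<le> \<bar>a - c\<bar> * 1 + 1 * \<bar>b - d\<bar>" using assms by (intro add_mono mult_mono) auto
  finally show ?thesis by simp
qed

text \<open>Spherical coordinates on the unit square, with angles multiplied by 7 > 2 pi so that
  both run through a full period. Each coordinate is a product of at most two factors with Lipschitz
  constant 7 and absolute value at most 1, hence has constant 14; the three coordinates add up to
  42.\<close>

lemma hausdorff2_outer_unit_sphere: "hausdorff2_outer (sphere 0 1 :: (real^3) set) < \<infinity>"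
proof -
  define f :: "real \<times> real \<Rightarrow> real^3" where
    "f z = vector [cos (7 * fst z) * cos (7 * snd z), cos (7 * fst z) * sin (7 * snd z), sin (7 * fst z)]" for z
  have lip: "dist (f x) (f y) \<le> 42 * dist x y" for x y
  proof -
    have d: "\<bar>fst x - fst y\<bar> \<le> dist x y" "\<bar>snd x - snd y\<bar> \<le> dist x y"
      using dist_fst_le[of x y] dist_snd_le[of x y] by (auto simp: dist_real_def)
    have c: "\<bar>f x $ i - f y $ i\<bar> \<le> 14 * dist x y" for i
    proof -
      have s: "\<bar>sin (7 * fst x) - sin (7 * fst y)\<bar> \<le> 7 * dist x y" "\<bar>cos (7 * fst x) - cos (7 * fst y)\<bar> \<le> 7 * dist x y"
        "\<bar>sin (7 * snd x) - sin (7 * snd y)\<bar> \<le> 7 * dist x y" "\<bar>cos (7 * snd x) - cos (7 * snd y)\<bar> \<le> 7 * dist x y"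
        using d abs_sin_diff_le[of "7 * fst x" "7 * fst y"] abs_cos_diff_le[of "7 * fst x" "7 * fst y"]
          abs_sin_diff_le[of "7 * snd x" "7 * snd y"] abs_cos_diff_le[of "7 * snd x" "7 * snd y"]
        by linarith+
      consider "i = 1" | "i = 2" | "i = 3" using exhaust_3 by blast
      then show ?thesis
      proof cases
        case 1
        then show ?thesis
          using abs_mult_diff_le[of "cos (7 * snd x)" "cos (7 * fst y)" "cos (7 * fst x)" "cos (7 * snd y)"] s
          by (simp add: f_def)
      next
        case 2
        then show ?thesis
          using abs_mult_diff_le[of "sin (7 * snd x)" "cos (7 * fst y)" "cos (7 * fst x)" "sin (7 * snd y)"] s
          by (simp add: f_def)
      next
        case 3
        then show ?thesis using s by (simp add: f_def)
      qed
    qed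
    have "dist (f x) (f y) \<le> (\<Sum>i\<in>UNIV. \<bar>(f x - f y) $ i\<bar>)" unfolding dist_norm by (rule norm_le_l1_cart)
    also have "\<dots> \<le> (\<Sum>i\<in>(UNIV :: 3 set). 14 * dist x y)" by (intro sum_mono) (simp add: c)
    finally show ?thesis by simp
  qed
  have "sphere 0 1 \<subseteq> f ` ({0..1} \<times> {0..1})"
  proof
    fix x :: "real^3" assume "x \<in> sphere 0 1"
    then have x: "(x$1)\<^sup>2 + (x$2)\<^sup>2 + (x$3)\<^sup>2 = 1"
      by (simp add: norm_eq_sqrt_inner inner_vec_def sum_3 power2_eq_square)
    define r where "r = sqrt ((x$1)\<^sup>2 + (x$2)\<^sup>2)"
    have r2: "r\<^sup>2 = (x$1)\<^sup>2 + (x$2)\<^sup>2" by (simp add: r_def)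
    obtain \<alpha> where a: "0 \<le> \<alpha>" "\<alpha> < 2 * pi" "r = cos \<alpha>" "x$3 = sin \<alpha>"
      using sincos_total_2pi[of r "x$3"] x r2 by auto
    obtain \<beta> where b: "0 \<le> \<beta>" "\<beta> < 2 * pi" "x$1 = r * cos \<beta>" "x$2 = r * sin \<beta>"
    proof (cases "r = 0")
      case True
      then have "x$1 = 0" "x$2 = 0" using r2 by (auto simp: sum_power2_eq_zero_iff)
      then show thesis using that[of 0] True by simp
    next
      case False
      then have "(x$1 / r)\<^sup>2 + (x$2 / r)\<^sup>2 = 1" by (simp add: power_divide r2[symmetric] flip: add_divide_distrib)
      then obtain t where "0 \<le> t" "t < 2 * pi" "x$1 / r = cos t" "x$2 / r = sin t" using sincos_total_2pi by metis
      then show thesis using that[of t] False by (simp add: field_simps)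
    qed
    have pi7: "2 * pi < 7" using pi_approx by simp
    have "x = f (\<alpha> / 7, \<beta> / 7)" using a b by (simp add: f_def vec_eq_iff forall_3)
    moreover have "(\<alpha> / 7, \<beta> / 7) \<in> {0..1} \<times> {0..1}" using a b pi7 by auto
    ultimately show "x \<in> f ` ({0..1} \<times> {0..1})" by blast
  qed
  then have "hausdorff2_outer (sphere 0 1 :: (real^3) set) \<le> hausdorff2_outer (f ` ({0..1} \<times> {0..1}))"
    by (rule hausdorff2_outer_mono)
  also have "\<dots> \<le> ennreal (42\<^sup>2) * hausdorff2_outer ({0..1} \<times> {0..1} :: (real \<times> real) set)"
    by (rule hausdorff2_outer_lipschitz) (use lip in auto)
  also have "\<dots> \<le> ennreal (42\<^sup>2) * ennreal pi"
    by (intro mult_left_mono hausdorff2_outer_square) simp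
  also have "\<dots> < \<infinity>" by (simp add: ennreal_mult_less_top)
  finally show ?thesis .
qed

lemma sets_hausdorff2 [simp, measurable_cong]: "sets (hausdorff2 :: 'a::metric_space measure) = sets borel"
  and space_hausdorff2 [simp]: "space (hausdorff2 :: 'a measure) = UNIV"
  using sigma_algebra.sigma_sets_eq[OF sets.sigma_algebra_axioms[of "borel :: 'a measure"]]
  by (simp_all add: hausdorff2_def sets_measure_of_conv space_measure_of_conv)

text \<open>In the second case the definition of \<^const>\<open>hausdorff2\<close> would take its default value. This case
  does not occur, but treating it in parallel is simpler than proving that Hausdorff outer measure is additive.\<close>

lemma emeasure_hausdorff2_cases:
  "(\<forall>A\<in>sets borel. emeasure (hausdorff2 :: 'a measure) A = hausdorff2_outer A) \<or>
   (\<forall>A. emeasure (hausdorff2 :: 'a::metric_space measure) A = 0)"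
  unfolding hausdorff2_def emeasure_measure_of_conv
  using sigma_algebra.sigma_sets_eq[OF sets.sigma_algebra_axioms[of "borel :: 'a measure"]]
  by (cases "measure_space UNIV (sets borel) (hausdorff2_outer :: 'a set \<Rightarrow> ennreal)") auto

text \<open>Both alternatives of \<open>emeasure_hausdorff2_cases\<close> satisfy the identity: the
  first by the scaling of the outer measure, the second because both sides vanish.\<close>

lemma emeasure_hausdorff2_similarity:
  fixes f :: "'a::real_normed_vector \<Rightarrow> 'a"
  assumes "k > 0" and "\<And>x y. dist (f x) (f y) = k * dist x y" and "surj f"
    and "A \<in> sets borel" "f ` A \<in> sets borel"
  shows "emeasure hausdorff2 (f ` A) = ennreal (k\<^sup>2) * emeasure hausdorff2 A"
  using emeasure_hausdorff2_cases[where 'a='a] hausdorff2_outer_similarity[OF assms(1-3), of A] assms(4,5)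
  by auto

lemma emeasure_hausdorff2_unit_sphere: "emeasure hausdorff2 (sphere 0 1 :: (real^3) set) < \<infinity>"
  using emeasure_hausdorff2_cases[where 'a="real^3"] hausdorff2_outer_unit_sphere by auto

section \<open>Uniformly distributed measures\<close>

text \<open>Fubini applied to the pairs of points of \<open>U\<close> at distance less than \<open>r\<close>, followed by Fatou's
  lemma for \<open>r \<rightarrow> 0\<close> (Christensen's argument).\<close>

lemma uniformly_distributed_open_le:
  fixes M N :: "'a::{metric_space,second_countable_topology} measure"
  assumes [measurable_cong]: "sets M = sets borel" "sets N = sets borel"
    and fin: "finite_measure M" "finite_measure N"
    and S: "AE x in M. x \<in> S" "AE x in N. x \<in> S"
    and m: "\<And>x r. x \<in> S \<Longrightarrow> r > 0 \<Longrightarrow> emeasure M (ball x r) = m r"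
    and n: "\<And>x r. x \<in> S \<Longrightarrow> r > 0 \<Longrightarrow> emeasure N (ball x r) = n r"
    and npos: "\<And>r. r > 0 \<Longrightarrow> n r > 0"
    and nfin: "\<And>r. r > 0 \<Longrightarrow> n r < \<infinity>"
    and ratio: "\<And>r. r > 0 \<Longrightarrow> b * m r = a * n r"
    and U: "open U"
  shows "b * emeasure M U \<le> a * emeasure N U"
proof -
  interpret M: finite_measure M by fact
  interpret N: finite_measure N by fact
  interpret MN: pair_sigma_finite M N ..
  have [simp]: "space M = UNIV" "space N = UNIV"
    using assms(1,2)[THEN sets_eq_imp_space_eq] by auto
  have [measurable]: "U \<in> sets borel" using U by simp
  define r where "r k = inverse (real (Suc k))" for k
  have r: "r k > 0" for k by (simp add: r_def)
  have r_lim: "r \<longlonglongrightarrow> 0" unfolding r_def by (rule LIMSEQ_inverse_real_of_nat)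
  define I :: "nat \<Rightarrow> 'a \<Rightarrow> 'a \<Rightarrow> ennreal" where
    "I k x y = (if x \<in> U \<and> y \<in> U \<and> dist x y < r k then 1 else 0)" for k x y
  have I_meas [measurable]: "(\<lambda>(x, y). I k x y) \<in> borel_measurable (borel \<Otimes>\<^sub>M borel)" for k
    unfolding I_def by measurable
  have I_meas' [measurable]: "(\<lambda>(x, y). I k x y) \<in> borel_measurable (M \<Otimes>\<^sub>M N)" for k
    using I_meas[of k] by measurable
  have inner_N: "(\<integral>\<^sup>+y. I k x y \<partial>N) = (if x \<in> U then emeasure N (U \<inter> ball x (r k)) else 0)" for k x
  proof -
    have "(\<integral>\<^sup>+y. I k x y \<partial>N) = (\<integral>\<^sup>+y. (if x \<in> U then 1 else 0) * indicator (U \<inter> ball x (r k)) y \<partial>N)"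
      by (intro nn_integral_cong) (auto simp: I_def indicator_def)
    then show ?thesis by (simp add: nn_integral_cmult_indicator)
  qed
  have inner_M: "(\<integral>\<^sup>+x. I k x y \<partial>M) = (if y \<in> U then emeasure M (U \<inter> ball y (r k)) else 0)" for k y
  proof -
    have "(\<integral>\<^sup>+x. I k x y \<partial>M) = (\<integral>\<^sup>+x. (if y \<in> U then 1 else 0) * indicator (U \<inter> ball y (r k)) x \<partial>M)"
      by (intro nn_integral_cong) (auto simp: I_def indicator_def dist_commute)
    then show ?thesis by (simp add: nn_integral_cmult_indicator)
  qed
  \<comment> \<open>Integrating in the other order bounds the pairs by m(r) N(U), and b m = a n
    turns the factor m(r) into n(r), which cancels.\<close>
  have step: "b * ((\<integral>\<^sup>+x. (\<integral>\<^sup>+y. I k x y \<partial>N) \<partial>M) / n (r k)) \<le> a * emeasure N U" for k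
  proof -
    have "(\<integral>\<^sup>+x. (\<integral>\<^sup>+y. I k x y \<partial>N) \<partial>M) = (\<integral>\<^sup>+y. (\<integral>\<^sup>+x. I k x y \<partial>M) \<partial>N)"
      by (rule MN.Fubini'[symmetric]) measurable
    also have "\<dots> \<le> (\<integral>\<^sup>+y. m (r k) * indicator U y \<partial>N)"
    proof (rule nn_integral_mono_AE)
      show "AE y in N. (\<integral>\<^sup>+x. I k x y \<partial>M) \<le> m (r k) * indicator U y"
        using S(2)
      proof eventually_elim
        case (elim y)
        have "emeasure M (U \<inter> ball y (r k)) \<le> emeasure M (ball y (r k))" by (intro emeasure_mono) auto
        then show ?case using m[OF elim r] by (auto simp: inner_M)
      qed
    qed
    also have "\<dots> = m (r k) * emeasure N U" by (simp add: nn_integral_cmult_indicator)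
    finally have "b * ((\<integral>\<^sup>+x. (\<integral>\<^sup>+y. I k x y \<partial>N) \<partial>M) / n (r k)) \<le> b * (m (r k) * emeasure N U / n (r k))"
      by (intro mult_left_mono divide_right_mono_ennreal) auto
    also have "\<dots> = (b * m (r k)) * emeasure N U / n (r k)" by (simp add: ennreal_times_divide mult.assoc)
    also have "\<dots> = (n (r k) * (a * emeasure N U)) / n (r k)" using ratio[OF r] by (simp add: ac_simps)
    also have "\<dots> = a * emeasure N U"
      using npos[OF r, of k] nfin[OF r, of k]
      by (metis ennreal_mult_divide_eq mult.commute less_irrefl infinity_ennreal_def)
    finally show ?thesis .
  qed
  have "b * emeasure M U = (\<integral>\<^sup>+x. b * indicator U x \<partial>M)" by (simp add: nn_integral_cmult_indicator)
  \<comment> \<open>For x in U a small ball about x lies in U, so the normalised inner integral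
    equals 1 for all large k.\<close>
  also have "\<dots> \<le> (\<integral>\<^sup>+x. liminf (\<lambda>k. b * ((\<integral>\<^sup>+y. I k x y \<partial>N) / n (r k))) \<partial>M)"
  proof (rule nn_integral_mono_AE)
    show "AE x in M. b * indicator U x \<le> liminf (\<lambda>k. b * ((\<integral>\<^sup>+y. I k x y \<partial>N) / n (r k)))"
      using S(1)
    proof eventually_elim
      case (elim x)
      show ?case
      proof (cases "x \<in> U")
        case True
        then obtain e where e: "e > 0" "ball x e \<subseteq> U" using U by (auto simp: open_contains_ball)
        have "eventually (\<lambda>k. b * ((\<integral>\<^sup>+y. I k x y \<partial>N) / n (r k)) = b) sequentially"
          using order_tendstoD(2)[OF r_lim e(1)]
        proof eventually_elim
          case (elim k)
          then have "U \<inter> ball x (r k) = ball x (r k)" using e(2) by auto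
          then have "(\<integral>\<^sup>+y. I k x y \<partial>N) = n (r k)" using True n[OF \<open>x \<in> S\<close> r] by (simp add: inner_N)
          then show ?case using npos[OF r, of k] nfin[OF r, of k] by simp
        qed
        then have "(\<lambda>k. b * ((\<integral>\<^sup>+y. I k x y \<partial>N) / n (r k))) \<longlonglongrightarrow> b" by (rule tendsto_eventually)
        then have "liminf (\<lambda>k. b * ((\<integral>\<^sup>+y. I k x y \<partial>N) / n (r k))) = b"
          by (intro lim_imp_Liminf) auto
        then show ?thesis by (simp add: indicator_def)
      qed simp
    qed
  qed
  also have "\<dots> \<le> liminf (\<lambda>k. \<integral>\<^sup>+x. b * ((\<integral>\<^sup>+y. I k x y \<partial>N) / n (r k)) \<partial>M)"
    by (rule nn_integral_liminf) measurable
  also have "\<dots> = liminf (\<lambda>k. b * ((\<integral>\<^sup>+x. (\<integral>\<^sup>+y. I k x y \<partial>N) \<partial>M) / n (r k)))"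
    by (simp add: nn_integral_cmult nn_integral_divide)
  also have "\<dots> \<le> a * emeasure N U"
    by (rule order_trans[OF Liminf_mono[OF always_eventually[OF allI[OF step]]]]) (simp add: Liminf_const)
  finally show ?thesis .
qed

text \<open>Counting pairs at distance less than r over the whole space gives M(UNIV) n(r) = N(UNIV)
  m(r), so the two ball functions are proportional. The preceding inequality, used in both
  directions, then yields equality on open sets, which generate the Borel sets. The case of
  vanishing M is split off because the reversed inequality divides by m.\<close>

lemma uniformly_distributed_unique:
  fixes M N :: "'a::{metric_space,second_countable_topology} measure"
  assumes sets [measurable_cong]: "sets M = sets borel" "sets N = sets borel"
    and fin: "finite_measure M" "finite_measure N"
    and S: "AE x in M. x \<in> S" "AE x in N. x \<in> S"
    and m: "\<And>x r. x \<in> S \<Longrightarrow> r > 0 \<Longrightarrow> emeasure M (ball x r) = m r"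
    and n: "\<And>x r. x \<in> S \<Longrightarrow> r > 0 \<Longrightarrow> emeasure N (ball x r) = n r"
    and npos: "\<And>r. r > 0 \<Longrightarrow> n r > 0"
    and "S \<noteq> {}"
  obtains \<kappa> :: real where "\<kappa> \<ge> 0" "\<And>A. A \<in> sets borel \<Longrightarrow> emeasure M A = ennreal \<kappa> * emeasure N A"
proof -
  interpret M: finite_measure M by fact
  interpret N: finite_measure N by fact
  interpret MN: pair_sigma_finite M N ..
  have [simp]: "space M = UNIV" "space N = UNIV"
    using sets[THEN sets_eq_imp_space_eq] by auto
  obtain x0 where x0: "x0 \<in> S" using \<open>S \<noteq> {}\<close> by blast
  have mfin: "m r < \<infinity>" and nfin: "n r < \<infinity>" if "r > 0" for r
    using m[OF x0 that] n[OF x0 that] M.emeasure_finite N.emeasure_finite by (metis top.not_eq_extremum infinity_ennreal_def)+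
  have fubini: "emeasure M UNIV * n r = emeasure N UNIV * m r" if "r > 0" for r
  proof -
    define I :: "'a \<Rightarrow> 'a \<Rightarrow> ennreal" where "I x y = (if dist x y < r then 1 else 0)" for x y
    have [measurable]: "(\<lambda>(x, y). I x y) \<in> borel_measurable (borel \<Otimes>\<^sub>M borel)" unfolding I_def by measurable
    then have m2: "(\<lambda>(x, y). I x y) \<in> borel_measurable (M \<Otimes>\<^sub>M N)" by measurable
    have "(\<integral>\<^sup>+x. (\<integral>\<^sup>+y. I x y \<partial>N) \<partial>M) = (\<integral>\<^sup>+y. (\<integral>\<^sup>+x. I x y \<partial>M) \<partial>N)"
      by (rule MN.Fubini'[OF m2, symmetric])
    moreover have "(\<integral>\<^sup>+x. (\<integral>\<^sup>+y. I x y \<partial>N) \<partial>M) = (\<integral>\<^sup>+x. n r \<partial>M)"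
    proof (rule nn_integral_cong_AE)
      have "I x = indicator (ball x r)" for x by (auto simp: I_def indicator_def)
      then have "(\<integral>\<^sup>+y. I x y \<partial>N) = emeasure N (ball x r)" for x by simp
      then show "AE x in M. (\<integral>\<^sup>+y. I x y \<partial>N) = n r" using S(1) n that by auto
    qed
    moreover have "(\<integral>\<^sup>+y. (\<integral>\<^sup>+x. I x y \<partial>M) \<partial>N) = (\<integral>\<^sup>+y. m r \<partial>N)"
    proof (rule nn_integral_cong_AE)
      have "(\<lambda>x. I x y) = indicator (ball y r)" for y by (auto simp: I_def indicator_def dist_commute)
      then have "(\<integral>\<^sup>+x. I x y \<partial>M) = emeasure M (ball y r)" for y by simp
      then show "AE y in N. (\<integral>\<^sup>+x. I x y \<partial>M) = m r" using S(2) m that by auto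
    qed
    ultimately show ?thesis by (simp add: mult.commute)
  qed
  have bpos: "emeasure N UNIV > 0"
    using npos[of 1] n[OF x0, of 1] emeasure_mono[of "ball x0 1" UNIV N] by (auto simp: less_le_trans)
  show thesis
  proof (cases "emeasure M UNIV = 0")
    case True
    then have "emeasure M A = ennreal 0 * emeasure N A" if "A \<in> sets borel" for A
      using emeasure_mono[of A UNIV M] by simp
    then show thesis using that[of 0] by simp
  next
    case False
    have mpos: "m r > 0" if "r > 0" for r
      using fubini[OF that] False npos[OF that] by (metis mult_eq_0_iff not_gr_zero)
    have open_eq: "emeasure N UNIV * emeasure M U = emeasure M UNIV * emeasure N U" if "open U" for U
    proof (rule antisym)
      show "emeasure N UNIV * emeasure M U \<le> emeasure M UNIV * emeasure N U"
        by (rule uniformly_distributed_open_le[OF sets fin S m n npos nfin])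
          (use fubini that in auto)
      show "emeasure M UNIV * emeasure N U \<le> emeasure N UNIV * emeasure M U"
        by (rule uniformly_distributed_open_le[OF sets(2,1) fin(2,1) S(2,1) n m mpos mfin])
          (use fubini that in auto)
    qed
    define \<kappa> where "\<kappa> = measure M UNIV / measure N UNIV"
    have b: "measure N UNIV > 0" using bpos by (simp add: N.emeasure_eq_measure)
    have "M = scale_measure (ennreal \<kappa>) N"
    proof (rule measure_eqI_generator_eq[where E="{S. open S}" and A="\<lambda>_. UNIV" and \<Omega>=UNIV])
      show "Int_stable {S :: 'a set. open S}" by (auto simp: Int_stable_def)
      show "sets M = sigma_sets UNIV {S. open S}" "sets (scale_measure (ennreal \<kappa>) N) = sigma_sets UNIV {S. open S}"
        using sets by (simp_all add: borel_def)
      fix X :: "'a set" assume "X \<in> {S. open S}"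
      from open_eq[of X] this have "measure N UNIV * measure M X = measure M UNIV * measure N X"
        by (simp add: M.emeasure_eq_measure N.emeasure_eq_measure flip: ennreal_mult)
      then have "measure M X = \<kappa> * measure N X" using b by (simp add: \<kappa>_def field_simps)
      then show "emeasure M X = emeasure (scale_measure (ennreal \<kappa>) N) X"
        by (simp add: M.emeasure_eq_measure N.emeasure_eq_measure \<kappa>_def flip: ennreal_mult)
    qed (auto simp: M.emeasure_finite)
    then show thesis using that[of \<kappa>] by (metis \<kappa>_def divide_nonneg_nonneg emeasure_scale_measure measure_nonneg)
  qed
qed

section \<open>Integration over the resonant sphere\<close>

text \<open>A multiple of the surface measure of the unit sphere, as the image of Lebesgue measure on the unit ball
  under radial projection.\<close>

definition sph :: "(real^3) measure" where
  "sph = distr (density lborel (indicator (ball 0 1))) borel sgn"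

lemma borel_measurable_sgn_vec [measurable (raw)]:
  fixes f :: "'b \<Rightarrow> 'a::euclidean_space"
  assumes [measurable]: "f \<in> borel_measurable M"
  shows "(\<lambda>x. sgn (f x)) \<in> borel_measurable M"
  unfolding sgn_div_norm by measurable

lemma ball_in_borel [measurable]: "ball x r \<in> sets borel"
  by simp

lemma sphere_in_borel [measurable]: "sphere (x :: 'a::euclidean_space) r \<in> sets borel"
  by (intro borel_closed closed_sphere)

lemma sets_sph [simp, measurable_cong]: "sets sph = sets borel"
  and space_sph [simp]: "space sph = UNIV"
  by (simp_all add: sph_def)

lemma nn_integral_sph:
  assumes [measurable]: "F \<in> borel_measurable borel"
  shows "(\<integral>\<^sup>+\<phi>. F \<phi> \<partial>sph) = (\<integral>\<^sup>+y. indicator (ball 0 1) y * F (sgn y) \<partial>lborel)"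
proof -
  have "(\<integral>\<^sup>+\<phi>. F \<phi> \<partial>sph) = (\<integral>\<^sup>+y. F (sgn y) \<partial>density lborel (indicator (ball (0 :: real^3) 1)))"
    unfolding sph_def by (rule nn_integral_distr) measurable
  also have "\<dots> = (\<integral>\<^sup>+y. indicator (ball 0 1) y * F (sgn y) \<partial>lborel)"
    by (rule nn_integral_density) measurable
  finally show ?thesis .
qed

lemma emeasure_sph:
  assumes [measurable]: "A \<in> sets borel"
  shows "emeasure sph A = emeasure lborel {y \<in> ball 0 1. sgn y \<in> A}"
proof -
  have "emeasure sph A = (\<integral>\<^sup>+y. indicator (ball 0 1) y * indicator A (sgn y) \<partial>lborel)"
    by (simp flip: nn_integral_indicator add: nn_integral_sph)
  also have "\<dots> = (\<integral>\<^sup>+y. indicator {y \<in> ball 0 1. sgn y \<in> A} y \<partial>lborel)"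
    by (intro nn_integral_cong) (auto simp: indicator_def)
  also have "\<dots> = emeasure lborel {y \<in> ball 0 1. sgn y \<in> A}"
    by (rule nn_integral_indicator) measurable
  finally show ?thesis .
qed

lemma emeasure_ball_finite: "emeasure lborel (ball (x :: 'a::euclidean_space) r) < \<infinity>"
  using emeasure_bounded_finite[of "ball x r"] by (simp add: less_top)

interpretation sph: finite_measure sph
proof
  have "emeasure sph UNIV \<le> emeasure lborel (ball (0 :: real^3) 1)"
    by (subst emeasure_sph) (auto intro!: emeasure_mono)
  then show "emeasure sph (space sph) \<noteq> \<infinity>" using emeasure_ball_finite[of "0 :: real^3" 1] by auto
qed

lemma AE_lborel_neq: "AE y in lborel. (y :: 'a::euclidean_space) \<noteq> c"
  by (rule AE_I[of _ _ "{c}"]) auto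

lemma AE_sph_norm: "AE \<phi> in sph. norm \<phi> = 1"
proof -
  have "AE y in density lborel (indicator (ball (0 :: real^3) 1)). norm (sgn y) = 1"
    using AE_lborel_neq[of "0 :: real^3"] by (subst AE_density) (measurable, auto simp: norm_sgn)
  then show ?thesis unfolding sph_def by (subst AE_distr_iff) (measurable; simp)+
qed

text \<open>A rotation taking x to x' carries the part of the unit ball that projects into the first
  ball to the part that projects into the second, and it preserves volume.\<close>

lemma emeasure_sph_ball_rotate:
  assumes xy: "norm x = 1" "norm x' = 1"
  shows "emeasure sph (ball x r) = emeasure sph (ball x' r)"
proof -
  obtain f :: "real^3 \<Rightarrow> real^3" where f: "orthogonal_transformation f" "f x = x'"
    using orthogonal_transformation_exists[of x x'] xy by auto
  define A where "A z = {y \<in> ball 0 1. sgn y \<in> ball z r}" for z :: "real^3"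
  have Am [measurable]: "A z \<in> sets borel" for z
  proof -
    have "A z = ball 0 1 \<inter> sgn -` ball z r" by (auto simp: A_def)
    also have "\<dots> \<in> sets borel"
      using measurable_sets_borel[of sgn borel "ball z r"] by (auto intro!: sets.Int)
    finally show ?thesis .
  qed
  have Al: "A z \<in> lmeasurable" for z
    by (rule bounded_set_imp_lmeasurable) (auto intro!: bounded_subset[OF bounded_ball[of 0 1]] simp: A_def)
  have lin: "linear f" using f by (simp add: orthogonal_transformation_linear)
  have sgnf: "f (sgn y) = sgn (f y)" for y
    using f by (simp add: sgn_div_norm linear_cmul[OF lin] orthogonal_transformation_norm)
  have distf: "dist (f y) (f z) = dist y z" for y z
    using f by (simp add: dist_norm orthogonal_transformation_norm flip: linear_diff[OF lin])
  have "f ` A x = A x'"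
  proof
    show "f ` A x \<subseteq> A x'"
      using f by (auto simp: A_def orthogonal_transformation_norm distf simp flip: sgnf)
    show "A x' \<subseteq> f ` A x"
    proof
      fix y assume y: "y \<in> A x'"
      obtain z where z: "y = f z" using f by (metis orthogonal_transformation_surj surjE)
      have "z \<in> A x"
        using y f unfolding z A_def by (auto simp: orthogonal_transformation_norm distf simp flip: sgnf)
      then show "y \<in> f ` A x" using z by blast
    qed
  qed
  then have "measure lebesgue (A x') = measure lebesgue (A x)"
    using measure_orthogonal_image[OF f(1) Al[of x]] by simp
  then have "measure lborel (A x') = measure lborel (A x)" by (simp add: measure_completion)
  moreover have "emeasure lborel (A z) = measure lborel (A z)" for z
  proof (rule emeasure_eq_ennreal_measure)
    have "emeasure lborel (A z) \<le> emeasure lborel (ball (0 :: real^3) 1)"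
      by (rule emeasure_mono) (auto simp: A_def)
    then show "emeasure lborel (A z) \<noteq> top" using emeasure_ball_finite[of "0 :: real^3" 1] by auto
  qed
  ultimately have "emeasure lborel (A x) = emeasure lborel (A x')" by simp
  then show ?thesis unfolding A_def emeasure_sph[OF ball_in_borel] .
qed

text \<open>Radial projection is continuous away from 0, so the set projecting into the ball
  contains a neighbourhood of x / 2.\<close>

lemma emeasure_sph_ball_pos:
  assumes "norm x = 1" "r > 0"
  shows "emeasure sph (ball x r) > 0"
proof -
  define U where "U = {y \<in> ball 0 1 - {0}. sgn y \<in> ball x r}"
  have cont: "continuous_on (ball 0 1 - {0}) (sgn :: real^3 \<Rightarrow> real^3)"
    using continuous_on_sgn[OF continuous_on_id, of "ball 0 1 - {0 :: real^3}"] by (simp add: id_def)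
  have "open U" unfolding U_def
    using continuous_open_preimage[OF cont open_Diff[OF open_ball closed_singleton] open_ball[of x r]]
    by (simp only: vimage_def Int_def mem_Collect_eq)
  moreover have "x /\<^sub>R 2 \<in> U" using assms by (auto simp: U_def sgn_div_norm)
  ultimately obtain e where e: "e > 0" "ball (x /\<^sub>R 2) e \<subseteq> U" by (auto simp: open_contains_ball)
  have "0 < emeasure lborel (ball (x /\<^sub>R 2) e)"
    using content_ball_pos[OF e(1), of "x /\<^sub>R 2"]
      emeasure_eq_ennreal_measure[of lborel "ball (x /\<^sub>R 2) e"] emeasure_ball_finite[of "x /\<^sub>R 2" e]
    by (simp add: less_top)
  also have "\<dots> \<le> emeasure sph (ball x r)"
    unfolding emeasure_sph[OF borel_open[OF open_ball]]
    by (rule emeasure_mono) (use e in \<open>auto simp: U_def\<close>)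
  finally show ?thesis .
qed

text \<open>Restricted Hausdorff measure and \<open>sph\<close> are both rotation invariant, so the
  measure of a ball centred on the sphere depends on its radius only, and uniqueness of uniformly
  distributed measures applies. The factor is claimed to be non-negative, not positive, which covers
  the default value of \<open>hausdorff2\<close>.\<close>

lemma hausdorff2_unit_sphere_eq_sph:
  obtains \<kappa> :: real where "\<kappa> \<ge> 0"
    "\<And>A. A \<in> sets borel \<Longrightarrow> emeasure hausdorff2 (A \<inter> sphere (0 :: real^3) 1) = ennreal \<kappa> * emeasure sph A"
proof -
  define M where "M = density hausdorff2 (indicator (sphere (0 :: real^3) 1))"
  have M: "emeasure M A = emeasure hausdorff2 (A \<inter> sphere 0 1)" if [measurable]: "A \<in> sets borel" for A
  proof -
    have "emeasure M A = (\<integral>\<^sup>+x. indicator (sphere 0 1) x * indicator A x \<partial>hausdorff2)"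
      unfolding M_def by (rule emeasure_density) measurable
    also have "\<dots> = (\<integral>\<^sup>+x. indicator (A \<inter> sphere 0 1) x \<partial>hausdorff2)"
      by (intro nn_integral_cong) (auto simp: indicator_def)
    also have "\<dots> = emeasure hausdorff2 (A \<inter> sphere 0 1)" by (rule nn_integral_indicator) measurable
    finally show ?thesis .
  qed
  have sets_M [simp]: "sets M = sets borel" and space_M: "space M = UNIV" by (simp_all add: M_def)
  have finM: "finite_measure M"
    by (rule finite_measureI) (use emeasure_hausdorff2_unit_sphere in \<open>simp add: M space_M\<close>)
  define e :: "real^3" where "e = axis 1 1"
  have e: "norm e = 1" by (simp add: e_def)
  have rot: "emeasure M (ball x r) = emeasure M (ball e r)" if nx: "norm x = 1" for x r
  proof -
    obtain f :: "real^3 \<Rightarrow> real^3" where f: "orthogonal_transformation f" "f e = x"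
      using orthogonal_transformation_exists[of e x] e nx by auto
    have lin: "linear f" using f(1) by (rule orthogonal_transformation_linear)
    have n: "norm (f y) = norm y" for y using f(1) by (rule orthogonal_transformation_norm)
    have d: "dist (f y) (f z) = 1 * dist y z" for y z
      unfolding dist_norm linear_diff[OF lin, symmetric] n by simp
    have surj: "surj f" using f(1) by (rule orthogonal_transformation_surj)
    have im: "f ` (ball e r \<inter> sphere 0 1) = ball x r \<inter> sphere 0 1"
    proof (intro equalityI subsetI)
      fix y assume "y \<in> f ` (ball e r \<inter> sphere 0 1)"
      then obtain z where z: "y = f z" "dist e z < r" "norm z = 1" by auto
      then show "y \<in> ball x r \<inter> sphere 0 1" using d[of e z] n[of z] unfolding f(2) by simp
    next
      fix y assume y: "y \<in> ball x r \<inter> sphere 0 1"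
      obtain z where z: "y = f z" using surj by (rule surjE)
      have "z \<in> ball e r \<inter> sphere 0 1"
        using y d[of e z] n[of z] unfolding z f(2) by simp
      then show "y \<in> f ` (ball e r \<inter> sphere 0 1)" unfolding z by (rule imageI)
    qed
    have "emeasure hausdorff2 (f ` (ball e r \<inter> sphere 0 1)) = ennreal (1\<^sup>2) * emeasure hausdorff2 (ball e r \<inter> sphere 0 1)"
      by (rule emeasure_hausdorff2_similarity[OF _ d surj]) (simp_all only: im zero_less_one sets.Int ball_in_borel sphere_in_borel)
    then show ?thesis unfolding im by (simp add: M)
  qed
  show thesis
  proof (rule uniformly_distributed_unique[of M sph "{x. norm x = 1}" "\<lambda>r. emeasure M (ball e r)" "\<lambda>r. emeasure sph (ball e r)"])
    show "AE x in M. x \<in> {x. norm x = 1}" unfolding M_def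
      by (subst AE_density) (auto simp: indicator_def)
    show "AE x in sph. x \<in> {x. norm x = 1}" using AE_sph_norm by simp
    show "{x :: real^3. norm x = 1} \<noteq> {}" using e by blast
    show "\<And>\<kappa>. 0 \<le> \<kappa> \<Longrightarrow> (\<And>A. A \<in> sets borel \<Longrightarrow> emeasure M A = ennreal \<kappa> * emeasure sph A) \<Longrightarrow> thesis"
      using that M by metis
    show "emeasure M (ball x r) = emeasure M (ball e r)" if "x \<in> {x. norm x = 1}" for x r
      using that by (intro rot) simp
    show "emeasure sph (ball x r) = emeasure sph (ball e r)" if "x \<in> {x. norm x = 1}" for x r
      using that by (intro emeasure_sph_ball_rotate e) simp
    show "0 < emeasure sph (ball e r)" if "0 < r" for r by (rule emeasure_sph_ball_pos[OF e that])
  qed (rule sets_M sets_sph finM sph.finite_measure_axioms)+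
qed

text \<open>The constant relating two-dimensional Hausdorff measure on the unit sphere to \<^const>\<open>sph\<close>;
  its value plays no role.\<close>

definition sph_const :: real where
  "sph_const = (SOME \<kappa>. \<kappa> \<ge> 0 \<and>
     (\<forall>A\<in>sets borel. emeasure hausdorff2 (A \<inter> sphere (0 :: real^3) 1) = ennreal \<kappa> * emeasure sph A))"

lemma sph_const_nonneg: "sph_const \<ge> 0"
  and emeasure_hausdorff2_unit_sphere_eq:
    "A \<in> sets borel \<Longrightarrow> emeasure hausdorff2 (A \<inter> sphere (0 :: real^3) 1) = ennreal sph_const * emeasure sph A"
proof -
  have "sph_const \<ge> 0 \<and>
     (\<forall>A\<in>sets borel. emeasure hausdorff2 (A \<inter> sphere (0 :: real^3) 1) = ennreal sph_const * emeasure sph A)"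
    unfolding sph_const_def by (rule someI_ex) (metis hausdorff2_unit_sphere_eq_sph)
  then show "sph_const \<ge> 0"
    "A \<in> sets borel \<Longrightarrow> emeasure hausdorff2 (A \<inter> sphere (0 :: real^3) 1) = ennreal sph_const * emeasure sph A" by auto
qed

lemma emeasure_hausdorff2_sphere:
  fixes c :: "real^3"
  assumes r: "\<rho> > 0" and A: "A \<in> sets borel"
  shows "emeasure hausdorff2 (A \<inter> sphere c \<rho>) =
    ennreal (sph_const * \<rho>\<^sup>2) * emeasure sph ((\<lambda>\<phi>. c + \<rho> *\<^sub>R \<phi>) -` A)"
proof -
  let ?f = "\<lambda>\<phi>. c + \<rho> *\<^sub>R \<phi>"
  have m: "?f -` A \<in> sets borel" using measurable_sets_borel[OF _ A, of ?f] by simp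
  have "bij ?f"
    using r by (intro o_bij[of "\<lambda>z. (z - c) /\<^sub>R \<rho>"]) (auto simp: fun_eq_iff)
  then have surj: "surj ?f" by (simp add: bij_is_surj)
  have eq: "?f ` (?f -` A \<inter> sphere 0 1) = A \<inter> sphere c \<rho>"
  proof
    show "?f ` (?f -` A \<inter> sphere 0 1) \<subseteq> A \<inter> sphere c \<rho>" using r by (auto simp: dist_norm)
    show "A \<inter> sphere c \<rho> \<subseteq> ?f ` (?f -` A \<inter> sphere 0 1)"
    proof
      fix z assume z: "z \<in> A \<inter> sphere c \<rho>"
      have "z = ?f ((z - c) /\<^sub>R \<rho>)" using r by simp
      moreover have "norm ((z - c) /\<^sub>R \<rho>) = 1" using z r by (auto simp: dist_norm norm_minus_commute)
      ultimately show "z \<in> ?f ` (?f -` A \<inter> sphere 0 1)" using z by (intro image_eqI[of _ ?f "(z - c) /\<^sub>R \<rho>"]) auto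
    qed
  qed
  have "emeasure hausdorff2 (?f ` (?f -` A \<inter> sphere 0 1)) = ennreal (\<rho>\<^sup>2) * emeasure hausdorff2 (?f -` A \<inter> sphere 0 1)"
    by (rule emeasure_hausdorff2_similarity[OF r _ surj])
       (use r m A in \<open>auto simp: dist_norm eq simp flip: scaleR_diff_right\<close>)
  then have "emeasure hausdorff2 (A \<inter> sphere c \<rho>) = ennreal (\<rho>\<^sup>2) * (ennreal sph_const * emeasure sph (?f -` A))"
    unfolding eq emeasure_hausdorff2_unit_sphere_eq[OF m] .
  then show ?thesis
    using sph_const_nonneg by (simp add: ennreal_mult ac_simps)
qed

lemma set_integral_sphere_hausdorff2:
  fixes c :: "real^3" and F :: "real^3 \<Rightarrow> real"
  assumes r: "\<rho> > 0" and [measurable]: "F \<in> borel_measurable borel"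
  shows "(LINT z:sphere c \<rho>|hausdorff2. F z) = (LINT \<phi>|sph. sph_const * \<rho>\<^sup>2 * F (c + \<rho> *\<^sub>R \<phi>))"
proof -
  let ?f = "\<lambda>\<phi>. c + \<rho> *\<^sub>R \<phi>"
  have k: "sph_const * \<rho>\<^sup>2 \<ge> 0" using sph_const_nonneg by simp
  have "density hausdorff2 (\<lambda>z. ennreal (indicator (sphere c \<rho>) z)) =
     density (distr sph borel ?f) (\<lambda>_. ennreal (sph_const * \<rho>\<^sup>2))"
  proof (rule measure_eqI)
    fix A :: "(real^3) set" assume "A \<in> sets (density hausdorff2 (\<lambda>z. ennreal (indicator (sphere c \<rho>) z)))"
    then have [measurable]: "A \<in> sets borel" by simp
    have "emeasure (density hausdorff2 (\<lambda>z. ennreal (indicator (sphere c \<rho>) z))) A =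
       (\<integral>\<^sup>+x. ennreal (indicator (sphere c \<rho>) x) * indicator A x \<partial>hausdorff2)"
      by (rule emeasure_density) measurable
    also have "\<dots> = (\<integral>\<^sup>+x. indicator (A \<inter> sphere c \<rho>) x \<partial>hausdorff2)"
      by (intro nn_integral_cong) (auto simp: indicator_def)
    also have "\<dots> = emeasure hausdorff2 (A \<inter> sphere c \<rho>)" by (rule nn_integral_indicator) measurable
    also have "\<dots> = ennreal (sph_const * \<rho>\<^sup>2) * emeasure sph (?f -` A)" by (rule emeasure_hausdorff2_sphere[OF r]) simp
    also have "\<dots> = emeasure (density (distr sph borel ?f) (\<lambda>_. ennreal (sph_const * \<rho>\<^sup>2))) A"
      by (simp add: emeasure_density nn_integral_cmult_indicator emeasure_distr)
    finally show "emeasure (density hausdorff2 (\<lambda>z. ennreal (indicator (sphere c \<rho>) z))) A =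
      emeasure (density (distr sph borel ?f) (\<lambda>_. ennreal (sph_const * \<rho>\<^sup>2))) A" .
  qed simp
  note eq = this
  have "(LINT z:sphere c \<rho>|hausdorff2. F z) = (LINT z|density hausdorff2 (\<lambda>z. ennreal (indicator (sphere c \<rho>) z)). F z)"
    unfolding set_lebesgue_integral_def by (rule integral_density[symmetric]) auto
  also have "\<dots> = (LINT z|distr sph borel ?f. (sph_const * \<rho>\<^sup>2) *\<^sub>R F z)"
    unfolding eq by (rule integral_density) (use k in auto)
  also have "\<dots> = (LINT \<phi>|sph. sph_const * \<rho>\<^sup>2 * F (?f \<phi>))"
    by (subst integral_distr) auto
  finally show ?thesis .
qed

section \<open>Gradient and zero set of the resonance function\<close>

lemma GDERIV_eq:
  assumes "GDERIV f x :> D" "GDERIV f x :> E"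
  shows "D = E"
proof -
  have "(\<lambda>h. h \<bullet> D) = (\<lambda>h. h \<bullet> E)"
    using has_derivative_unique assms unfolding gderiv_def by blast
  then have "(D - E) \<bullet> (D - E) = 0" by (metis inner_diff_right right_minus_eq)
  then show ?thesis by simp
qed

lemma grad_resonance:
  "grad (resonance (\<lambda>p. (norm p)\<^sup>2) p p1) z = 4 *\<^sub>R (z - (p + p1) /\<^sub>R 2)"
proof -
  define w where "w = p + p1"
  have "((\<lambda>z. (norm (w - z))\<^sup>2 + (norm z)\<^sup>2 - (norm p)\<^sup>2 - (norm p1)\<^sup>2) has_derivative
         (\<lambda>h. (w - z) \<bullet> (0 - h) + (0 - h) \<bullet> (w - z) + (z \<bullet> h + h \<bullet> z) - 0 - 0)) (at z)"
    unfolding power2_norm_eq_inner by (intro derivative_intros)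
  moreover have "(w - z) \<bullet> (0 - h) + (0 - h) \<bullet> (w - z) + (z \<bullet> h + h \<bullet> z) - 0 - 0 = h \<bullet> (4 *\<^sub>R (z - w /\<^sub>R 2))" for h
    by (simp add: inner_diff_left inner_diff_right inner_commute[of w h] inner_commute[of z h])
  ultimately have "GDERIV (resonance (\<lambda>p. (norm p)\<^sup>2) p p1) z :> 4 *\<^sub>R (z - w /\<^sub>R 2)"
    unfolding gderiv_def resonance_def w_def by simp
  then show ?thesis unfolding grad_def w_def
    by (intro the_equality) (blast dest: GDERIV_eq)+
qed

text \<open>With the midpoint c, z = c + y and p, p1 = c \<plusminus> d, the parallelogram law turns
  the resonance function into 2 (|y|^2 - |d|^2), as the terms with |c|^2 cancel.\<close>

lemma resonant_set_eq: "resonant_set (\<lambda>p. (norm p)\<^sup>2) p p1 = sphere ((p + p1) /\<^sub>R 2) (norm (p - p1) / 2)"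
proof -
  have "resonance (\<lambda>p. (norm p)\<^sup>2) p p1 z = 2 * ((norm (z - (p + p1) /\<^sub>R 2))\<^sup>2 - (norm (p - p1) / 2)\<^sup>2)" for z
  proof -
    define c d y where "c = (p + p1) /\<^sub>R 2" and "d = (p - p1) /\<^sub>R 2" and "y = z - (p + p1) /\<^sub>R 2"
    have z: "z = c + y" by (simp add: c_def y_def)
    have p: "p = c + d" by (simp add: c_def d_def vec_eq_iff field_simps)
    have p1: "p1 = c - d" by (simp add: c_def d_def vec_eq_iff field_simps)
    have "norm (p - p1) / 2 = norm d" by (simp add: d_def)
    have "resonance (\<lambda>p. (norm p)\<^sup>2) p p1 z = (norm (c - y))\<^sup>2 + (norm (c + y))\<^sup>2 - (norm (c + d))\<^sup>2 - (norm (c - d))\<^sup>2"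
      unfolding resonance_def z p p1 by (simp add: algebra_simps)
    moreover have "(norm (c - u))\<^sup>2 + (norm (c + u))\<^sup>2 = 2 * (norm c)\<^sup>2 + 2 * (norm u)\<^sup>2" for u
      unfolding power2_norm_eq_inner
      by (simp add: inner_add_left inner_add_right inner_diff_left inner_diff_right)
    moreover have "A + B - E - D = 2 * (Y - Z)" if "A + B = 2 * C + 2 * Y" "D + E = 2 * C + 2 * Z" for A B C D E Y Z :: real
      using that by auto
    ultimately have "(norm (c - y))\<^sup>2 + (norm (c + y))\<^sup>2 - (norm (c + d))\<^sup>2 - (norm (c - d))\<^sup>2
        = 2 * ((norm y)\<^sup>2 - (norm d)\<^sup>2)" by blast
    with \<open>resonance _ p p1 z = _\<close> show ?thesis unfolding \<open>norm (p - p1) / 2 = norm d\<close> y_def[symmetric] by simp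
  qed
  then have "resonance (\<lambda>p. (norm p)\<^sup>2) p p1 z = 0 \<longleftrightarrow> norm (z - (p + p1) /\<^sub>R 2) = norm (p - p1) / 2" for z
    using power2_eq_iff_nonneg[of "norm (z - (p + p1) /\<^sub>R 2)" "norm (p - p1) / 2"] by auto
  moreover have "z \<in> sphere c r \<longleftrightarrow> norm (z - c) = r" for z c :: "real^3" and r
    by (simp add: dist_norm norm_minus_commute)
  ultimately show ?thesis unfolding resonant_set_def by blast
qed

definition p2_of :: "real^3 \<Rightarrow> real^3 \<Rightarrow> real^3 \<Rightarrow> real^3" where
  "p2_of p p1 \<phi> = (p + p1) /\<^sub>R 2 + (norm (p - p1) / 2) *\<^sub>R \<phi>"

definition p3_of :: "real^3 \<Rightarrow> real^3 \<Rightarrow> real^3 \<Rightarrow> real^3" where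
  "p3_of p p1 \<phi> = (p + p1) /\<^sub>R 2 - (norm (p - p1) / 2) *\<^sub>R \<phi>"

text \<open>On the sphere of radius r = |p - p1| / 2 the gradient has norm 4 r, so the area factor
  r^2 divided by it is |p - p1| / 8.\<close>

lemma nu_integral_eq:
  assumes m: "\<And>p1. (\<lambda>z. \<Phi> p1 z (p + p1 - z)) \<in> borel_measurable borel"
  shows "nu_integral (\<lambda>p. (norm p)\<^sup>2) p \<Phi> =
    (LINT p1|lborel. LINT \<phi>|sph. sph_const / 8 * norm (p - p1) * \<Phi> p1 (p2_of p p1 \<phi>) (p3_of p p1 \<phi>))"
  unfolding nu_integral_def
proof (intro Bochner_Integration.integral_cong refl)
  fix p1
  let ?c = "(p + p1) /\<^sub>R 2" and ?r = "norm (p - p1) / 2"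
  let ?F = "\<lambda>z. \<Phi> p1 z (p + p1 - z) / norm (grad (resonance (\<lambda>p. (norm p)\<^sup>2) p p1) z)"
  show "(LINT z:resonant_set (\<lambda>p. (norm p)\<^sup>2) p p1|hausdorff2. ?F z) =
     (LINT \<phi>|sph. sph_const / 8 * norm (p - p1) * \<Phi> p1 (p2_of p p1 \<phi>) (p3_of p p1 \<phi>))"
  proof (cases "p = p1")
    case True
    \<comment> \<open>The sphere degenerates to the point p, where the gradient vanishes; division
      by zero gives 0, in agreement with the factor |p - p1| on the right.\<close>
    have "(LINT z:resonant_set (\<lambda>p. (norm p)\<^sup>2) p p1|hausdorff2. ?F z) = (LINT z|(hausdorff2 :: (real^3) measure). 0)"
      unfolding set_lebesgue_integral_def resonant_set_eq grad_resonance
      by (intro Bochner_Integration.integral_cong) (auto simp: True indicator_def scaleR_2[symmetric])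
    then show ?thesis using True by simp
  next
    case False
    then have r: "?r > 0" by simp
    note [measurable] = m
    have "(LINT z:resonant_set (\<lambda>p. (norm p)\<^sup>2) p p1|hausdorff2. ?F z) =
       (LINT \<phi>|sph. sph_const * ?r\<^sup>2 * ?F (?c + ?r *\<^sub>R \<phi>))"
      unfolding resonant_set_eq grad_resonance by (rule set_integral_sphere_hausdorff2[OF r]) measurable
    also have "\<dots> = (LINT \<phi>|sph. sph_const / 8 * norm (p - p1) * \<Phi> p1 (p2_of p p1 \<phi>) (p3_of p p1 \<phi>))"
    proof (rule integral_cong_AE)
      have p3: "p + p1 - (?c + ?r *\<^sub>R \<phi>) = p3_of p p1 \<phi>" for \<phi>
        by (simp add: p3_of_def vec_eq_iff field_simps)
      show "(\<lambda>\<phi>. sph_const * ?r\<^sup>2 * ?F (?c + ?r *\<^sub>R \<phi>)) \<in> borel_measurable sph"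
        unfolding grad_resonance by measurable
      have "(\<lambda>\<phi>. \<Phi> p1 (p2_of p p1 \<phi>) (p + p1 - p2_of p p1 \<phi>)) \<in> borel_measurable sph"
        unfolding p2_of_def by measurable
      then show "(\<lambda>\<phi>. sph_const / 8 * norm (p - p1) * \<Phi> p1 (p2_of p p1 \<phi>) (p3_of p p1 \<phi>)) \<in> borel_measurable sph"
        unfolding p3[symmetric] p2_of_def by measurable
      show "AE \<phi> in sph. sph_const * ?r\<^sup>2 * ?F (?c + ?r *\<^sub>R \<phi>) =
          sph_const / 8 * norm (p - p1) * \<Phi> p1 (p2_of p p1 \<phi>) (p3_of p p1 \<phi>)"
        using AE_sph_norm
      proof eventually_elim
        case (elim \<phi>)
        then have "norm (4 *\<^sub>R (?c + ?r *\<^sub>R \<phi> - ?c)) = 2 * norm (p - p1)" by simp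
        then have "?F (?c + ?r *\<^sub>R \<phi>) = \<Phi> p1 (p2_of p p1 \<phi>) (p3_of p p1 \<phi>) / (2 * norm (p - p1))"
          unfolding grad_resonance p3 by (simp only: p2_of_def)
        then show ?case
          using False by (simp only:) (simp add: power2_eq_square)
      qed
    qed
    finally show ?thesis .
  qed
qed

section \<open>Integration over balls, lines and planes\<close>

lemma nn_integral_lborel_affine:
  fixes F :: "'a::euclidean_space \<Rightarrow> ennreal"
  assumes [measurable]: "F \<in> borel_measurable borel" and c: "c \<noteq> 0"
  shows "(\<integral>\<^sup>+x. F x \<partial>lborel) = ennreal (\<bar>c\<bar> ^ DIM('a)) * (\<integral>\<^sup>+x. F (t + c *\<^sub>R x) \<partial>lborel)"
  by (subst lborel_affine[OF c, of t])
     (simp add: nn_integral_density nn_integral_distr nn_integral_cmult)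

lemma nn_integral_lborel_shift:
  fixes F :: "'a::euclidean_space \<Rightarrow> ennreal"
  assumes "F \<in> borel_measurable borel"
  shows "(\<integral>\<^sup>+x. F (t + x) \<partial>lborel) = (\<integral>\<^sup>+x. F x \<partial>lborel)"
  using nn_integral_lborel_affine[OF assms, of 1 t] by simp

lemma nn_integral_lborel_uminus:
  fixes F :: "'a::euclidean_space \<Rightarrow> ennreal"
  assumes "F \<in> borel_measurable borel"
  shows "(\<integral>\<^sup>+x. F (- x) \<partial>lborel) = (\<integral>\<^sup>+x. F x \<partial>lborel)"
  using nn_integral_lborel_affine[OF assms, of "-1" 0] by simp

lemma nn_integral_swap:
  fixes F :: "'a::euclidean_space \<Rightarrow> 'b::euclidean_space \<Rightarrow> ennreal"
  assumes "(\<lambda>(x, y). F x y) \<in> borel_measurable (borel \<Otimes>\<^sub>M borel)"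
  shows "(\<integral>\<^sup>+x. (\<integral>\<^sup>+y. F x y \<partial>lborel) \<partial>lborel) = (\<integral>\<^sup>+y. (\<integral>\<^sup>+x. F x y \<partial>lborel) \<partial>lborel)"
proof (rule lborel_pair.Fubini'[symmetric])
  show "(\<lambda>(x, y). F x y) \<in> borel_measurable (lborel \<Otimes>\<^sub>M lborel)" using assms by measurable
qed

lemma nn_integral_power_tail:
  assumes a: "a > 0"
  shows "(\<integral>\<^sup>+\<rho>. ennreal (a ^ 3 / \<rho> ^ 4) * indicator {a<..} \<rho> \<partial>lborel) = ennreal (1 / 3)"
proof -
  have "(\<integral>\<^sup>+\<rho>. ennreal (a ^ 3 / \<rho> ^ 4) * indicator {a<..} \<rho> \<partial>lborel) =
      (\<integral>\<^sup>+\<rho>. ennreal (a ^ 3 / \<rho> ^ 4) * indicator {a..} \<rho> \<partial>lborel)"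
    using AE_lborel_neq[of a] by (intro nn_integral_cong_AE) (auto simp: indicator_def)
  also have "\<dots> = ennreal (0 - (- (a ^ 3) / (3 * a ^ 3)))"
  proof (rule nn_integral_FTC_atLeast[where F="\<lambda>x. - (a ^ 3) / (3 * x ^ 3)" and T=0])
    show "DERIV (\<lambda>x. - (a ^ 3) / (3 * x ^ 3)) x :> a ^ 3 / x ^ 4" if "a \<le> x" for x
      using a that by (auto intro!: derivative_eq_intros simp: field_simps power_numeral_reduce)
    show "((\<lambda>x. - (a ^ 3) / (3 * x ^ 3)) \<longlongrightarrow> 0) at_top"
      by (intro tendsto_divide_0[OF tendsto_const] filterlim_at_top_imp_at_infinity
          filterlim_tendsto_pos_mult_at_top[OF tendsto_const] filterlim_pow_at_top filterlim_ident) auto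
  qed (use a in auto)
  also have "0 - (- (a ^ 3) / (3 * a ^ 3)) = 1 / 3" using a by simp
  finally show ?thesis .
qed

text \<open>Since \<open>sph\<close> comes from the volume of the unit ball, its total mass is a
  third of the area of the sphere; hence the factor 3. The radial variable on the ray through y is
  rescaled by |y|, the integrals are exchanged, and y is replaced by x / \<rho>; what remains is the
  integral of |x|^3 / \<rho>^4 over \<rho> > |x|, which is 1/3.\<close>

lemma nn_integral_polar:
  fixes F :: "real^3 \<Rightarrow> ennreal"
  assumes [measurable]: "F \<in> borel_measurable borel"
  shows "(\<integral>\<^sup>+x. F x \<partial>lborel) =
    3 * (\<integral>\<^sup>+\<phi>. (\<integral>\<^sup>+r. indicator {0<..} r * (ennreal (r\<^sup>2) * F (r *\<^sub>R \<phi>)) \<partial>lborel) \<partial>sph)"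
proof -
  define G where "G \<phi> = (\<integral>\<^sup>+r. indicator {0<..} r * (ennreal (r\<^sup>2) * F (r *\<^sub>R \<phi>)) \<partial>lborel)" for \<phi>
  have Gm: "G \<in> borel_measurable borel" unfolding G_def by measurable
  define H :: "real^3 \<Rightarrow> real \<Rightarrow> ennreal" where "H y \<rho> = indicator (ball 0 1) y * (indicator {0<..} \<rho> * (ennreal (norm y ^ 3 * \<rho>\<^sup>2) * F (\<rho> *\<^sub>R y)))" for y \<rho>
  have Hm [measurable]: "(\<lambda>(y, \<rho>). H y \<rho>) \<in> borel_measurable (borel \<Otimes>\<^sub>M borel)" unfolding H_def by measurable
  have G: "indicator (ball 0 1) y * G (sgn y) = (\<integral>\<^sup>+\<rho>. H y \<rho> \<partial>lborel)" if y: "y \<noteq> 0" for y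
  proof -
    have "G (sgn y) = ennreal \<bar>norm y\<bar> * (\<integral>\<^sup>+\<rho>. indicator {0<..} (0 + norm y * \<rho>) * (ennreal ((0 + norm y * \<rho>)\<^sup>2) * F ((0 + norm y * \<rho>) *\<^sub>R sgn y)) \<partial>lborel)"
      unfolding G_def by (rule nn_integral_real_affine) (use y in auto)
    also have "\<dots> = (\<integral>\<^sup>+\<rho>. ennreal \<bar>norm y\<bar> * (indicator {0<..} (0 + norm y * \<rho>) * (ennreal ((0 + norm y * \<rho>)\<^sup>2) * F ((0 + norm y * \<rho>) *\<^sub>R sgn y))) \<partial>lborel)"
      by (rule nn_integral_cmult[symmetric]) measurable
    also have "\<dots> = (\<integral>\<^sup>+\<rho>. indicator {0<..} \<rho> * (ennreal (norm y ^ 3 * \<rho>\<^sup>2) * F (\<rho> *\<^sub>R y)) \<partial>lborel)"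
    proof (rule nn_integral_cong)
      fix \<rho> :: real
      have 1: "(0 + norm y * \<rho>) *\<^sub>R sgn y = \<rho> *\<^sub>R y" using y by (simp add: sgn_div_norm)
      have 2: "indicator {0<..} (0 + norm y * \<rho>) = (indicator {0<..} \<rho> :: ennreal)"
        using y by (simp add: indicator_def zero_less_mult_iff)
      have 3: "norm y * (0 + norm y * \<rho>)\<^sup>2 = norm y ^ 3 * \<rho>\<^sup>2"
        by (simp add: power_mult_distrib power_numeral_reduce)
      have "ennreal \<bar>norm y\<bar> * (i * (ennreal ((0 + norm y * \<rho>)\<^sup>2) * z)) = i * (ennreal (norm y * (0 + norm y * \<rho>)\<^sup>2) * z)" for i z :: ennreal
        by (simp add: ennreal_mult ac_simps)
      then show "ennreal \<bar>norm y\<bar> * (indicator {0<..} (0 + norm y * \<rho>) * (ennreal ((0 + norm y * \<rho>)\<^sup>2) * F ((0 + norm y * \<rho>) *\<^sub>R sgn y))) =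
         indicator {0<..} \<rho> * (ennreal (norm y ^ 3 * \<rho>\<^sup>2) * F (\<rho> *\<^sub>R y))"
        unfolding 1 2 3[symmetric] .
    qed
    finally show ?thesis by (simp add: H_def nn_integral_cmult)
  qed
  have "(\<integral>\<^sup>+\<phi>. G \<phi> \<partial>sph) = (\<integral>\<^sup>+y. indicator (ball 0 1) y * G (sgn y) \<partial>lborel)" by (rule nn_integral_sph[OF Gm])
  also have "\<dots> = (\<integral>\<^sup>+y. (\<integral>\<^sup>+\<rho>. H y \<rho> \<partial>lborel) \<partial>lborel)"
    using AE_lborel_neq[of "0 :: real^3"] G by (intro nn_integral_cong_AE) auto
  also have "\<dots> = (\<integral>\<^sup>+\<rho>. (\<integral>\<^sup>+y. H y \<rho> \<partial>lborel) \<partial>lborel)" by (rule nn_integral_swap[OF Hm])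
  also have "\<dots> = (\<integral>\<^sup>+\<rho>. (\<integral>\<^sup>+x. ennreal (norm x ^ 3 / \<rho> ^ 4) * indicator {norm x<..} \<rho> * F x \<partial>lborel) \<partial>lborel)"
  proof (rule nn_integral_cong)
    fix \<rho> :: real
    show "(\<integral>\<^sup>+y. H y \<rho> \<partial>lborel) = (\<integral>\<^sup>+x. ennreal (norm x ^ 3 / \<rho> ^ 4) * indicator {norm x<..} \<rho> * F x \<partial>lborel)"
    proof (cases "\<rho> > 0")
      case False
      then have "H y \<rho> = 0" and "indicator {norm x<..} \<rho> = (0 :: ennreal)" for x y :: "real^3"
        using norm_ge_zero[of x] by (auto simp: H_def indicator_def simp del: norm_ge_zero)
      then show ?thesis by simp
    next
      case True
      define K where "K x = ennreal (norm x ^ 3 / \<rho> ^ 4) * indicator {norm x<..} \<rho> * F x" for x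
      have Km: "K \<in> borel_measurable borel" unfolding K_def indicator_def greaterThan_iff by measurable
      have "ennreal (\<rho> ^ 3) * K (\<rho> *\<^sub>R y) = H y \<rho>" for y
      proof -
        have "\<rho> ^ 3 * (norm (\<rho> *\<^sub>R y) ^ 3 / \<rho> ^ 4) = norm y ^ 3 * \<rho>\<^sup>2"
          using True by (simp add: power_mult_distrib field_simps power_numeral_reduce)
        moreover have "indicator {norm (\<rho> *\<^sub>R y)<..} \<rho> = (indicator (ball 0 1) y :: ennreal)"
          using True by (auto simp: indicator_def)
        moreover have "ennreal (\<rho> ^ 3) * (ennreal (norm (\<rho> *\<^sub>R y) ^ 3 / \<rho> ^ 4) * i * f) =
            i * (ennreal (\<rho> ^ 3 * (norm (\<rho> *\<^sub>R y) ^ 3 / \<rho> ^ 4)) * f)" for i f :: ennreal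
          using True by (subst ennreal_mult) (auto simp: ac_simps)
        ultimately show ?thesis using True by (simp add: K_def H_def)
      qed
      then have "(\<integral>\<^sup>+y. H y \<rho> \<partial>lborel) = ennreal (\<bar>\<rho>\<bar> ^ DIM(real^3)) * (\<integral>\<^sup>+y. K (0 + \<rho> *\<^sub>R y) \<partial>lborel)"
        using True Km by (subst nn_integral_cmult[symmetric]) auto
      also have "\<dots> = (\<integral>\<^sup>+x. K x \<partial>lborel)"
        by (rule nn_integral_lborel_affine[symmetric]) (use True Km in auto)
      finally show ?thesis by (simp add: K_def)
    qed
  qed
  also have "\<dots> = (\<integral>\<^sup>+x. (\<integral>\<^sup>+\<rho>. ennreal (norm x ^ 3 / \<rho> ^ 4) * indicator {norm x<..} \<rho> * F x \<partial>lborel) \<partial>lborel)"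
    unfolding indicator_def greaterThan_iff by (rule nn_integral_swap) measurable
  also have "\<dots> = (\<integral>\<^sup>+x. ennreal (1 / 3) * F x \<partial>lborel)"
  proof (rule nn_integral_cong_AE, use AE_lborel_neq[of "0 :: real^3"] in eventually_elim)
    case (elim x)
    then show ?case using nn_integral_power_tail[of "norm x"] by (simp add: nn_integral_multc)
  qed
  also have "\<dots> = ennreal (1 / 3) * (\<integral>\<^sup>+x. F x \<partial>lborel)" by (rule nn_integral_cmult) simp
  finally have "3 * (\<integral>\<^sup>+\<phi>. G \<phi> \<partial>sph) = ennreal 3 * ennreal (1 / 3) * (\<integral>\<^sup>+x. F x \<partial>lborel)"
    by (simp add: mult.assoc)
  also have "ennreal 3 * ennreal (1 / 3) = 1" by (subst ennreal_mult[symmetric]) auto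
  finally show ?thesis by (simp add: G_def)
qed

lemma nn_integral_sph_uminus:
  assumes [measurable]: "F \<in> borel_measurable borel"
  shows "(\<integral>\<^sup>+\<phi>. F (- \<phi>) \<partial>sph) = (\<integral>\<^sup>+\<phi>. F \<phi> \<partial>sph)"
proof -
  have "(\<integral>\<^sup>+\<phi>. F (- \<phi>) \<partial>sph) = (\<integral>\<^sup>+y. indicator (ball 0 1) y * F (- sgn y) \<partial>lborel)"
    by (rule nn_integral_sph) measurable
  also have "\<dots> = (\<integral>\<^sup>+y. indicator (ball 0 1) (- y) * F (sgn (- y)) \<partial>lborel)"
    by (intro nn_integral_cong) (auto simp: sgn_minus indicator_def)
  also have "\<dots> = (\<integral>\<^sup>+y. indicator (ball 0 1) y * F (sgn y) \<partial>lborel)"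
    by (rule nn_integral_lborel_uminus) measurable
  also have "\<dots> = (\<integral>\<^sup>+\<phi>. F \<phi> \<partial>sph)" by (rule nn_integral_sph[symmetric]) simp
  finally show ?thesis .
qed

text \<open>Here r runs over the whole line, so every point is reached from \<phi> and from -\<phi>;
  the two half-lines give the factor 2. The factor 3 of polar coordinates is given away.\<close>

lemma nn_integral_radial_le:
  fixes F :: "real^3 \<Rightarrow> ennreal"
  assumes [measurable]: "F \<in> borel_measurable borel"
  shows "(\<integral>\<^sup>+\<phi>. (\<integral>\<^sup>+r. ennreal (r\<^sup>2) * F (r *\<^sub>R \<phi>) \<partial>lborel) \<partial>sph) \<le> 2 * (\<integral>\<^sup>+x. F x \<partial>lborel)"
proof -
  define X where "X F = (\<integral>\<^sup>+\<phi>. (\<integral>\<^sup>+r. indicator {0<..} r * (ennreal (r\<^sup>2) * F (r *\<^sub>R \<phi>)) \<partial>lborel) \<partial>sph)" for F :: "real^3 \<Rightarrow> ennreal"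
  have X: "X F \<le> (\<integral>\<^sup>+x. F x \<partial>lborel)" if "F \<in> borel_measurable borel" for F
  proof -
    have "1 * X F \<le> 3 * X F" by (rule mult_right_mono) auto
    then show ?thesis using nn_integral_polar[OF that] by (simp add: X_def)
  qed
  have "(\<integral>\<^sup>+r. ennreal (r\<^sup>2) * F (r *\<^sub>R \<phi>) \<partial>lborel) =
     (\<integral>\<^sup>+r. indicator {0<..} r * (ennreal (r\<^sup>2) * F (r *\<^sub>R \<phi>)) \<partial>lborel) +
     (\<integral>\<^sup>+r. indicator {0<..} r * (ennreal (r\<^sup>2) * F (- (r *\<^sub>R \<phi>))) \<partial>lborel)" for \<phi>
  proof -
    have "(\<integral>\<^sup>+r. ennreal (r\<^sup>2) * F (r *\<^sub>R \<phi>) \<partial>lborel) =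
       (\<integral>\<^sup>+r. indicator {0<..} r * (ennreal (r\<^sup>2) * F (r *\<^sub>R \<phi>)) + indicator {0<..} (- r) * (ennreal (r\<^sup>2) * F (r *\<^sub>R \<phi>)) \<partial>lborel)"
      using AE_lborel_neq[of "0 :: real"] by (intro nn_integral_cong_AE) (auto simp: indicator_def)
    also have "\<dots> = (\<integral>\<^sup>+r. indicator {0<..} r * (ennreal (r\<^sup>2) * F (r *\<^sub>R \<phi>)) \<partial>lborel) +
       (\<integral>\<^sup>+r. indicator {0<..} (- r) * (ennreal (r\<^sup>2) * F (r *\<^sub>R \<phi>)) \<partial>lborel)"
      by (rule nn_integral_add) measurable
    also have "(\<integral>\<^sup>+r. indicator {0<..} (- r) * (ennreal (r\<^sup>2) * F (r *\<^sub>R \<phi>)) \<partial>lborel) =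
       (\<integral>\<^sup>+r. indicator {0<..} r * (ennreal (r\<^sup>2) * F (- (r *\<^sub>R \<phi>))) \<partial>lborel)"
      using nn_integral_lborel_uminus[of "\<lambda>r. indicator {0<..} r * (ennreal (r\<^sup>2) * F (- (r *\<^sub>R \<phi>)))"] by simp
    finally show ?thesis .
  qed
  then have "(\<integral>\<^sup>+\<phi>. (\<integral>\<^sup>+r. ennreal (r\<^sup>2) * F (r *\<^sub>R \<phi>) \<partial>lborel) \<partial>sph) = X F + X (\<lambda>x. F (- x))"
    unfolding X_def by (simp add: nn_integral_add)
  also have "\<dots> \<le> (\<integral>\<^sup>+x. F x \<partial>lborel) + (\<integral>\<^sup>+x. F (- x) \<partial>lborel)" by (intro add_mono X) measurable
  finally show ?thesis by (simp add: nn_integral_lborel_uminus mult_2)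
qed

text \<open>Fubini's theorem in the direction \<open>e\<close> without a choice of coordinates:
  every line parallel to \<open>e\<close> meets the slab 0 \<le> x \<bullet> e \<le> 1 in a segment
  of length 1, so integrating the line integrals over the slab counts each line once.\<close>

lemma nn_integral_split_line:
  fixes F :: "real^3 \<Rightarrow> ennreal"
  assumes [measurable]: "F \<in> borel_measurable borel" and e: "norm e = 1"
  shows "(\<integral>\<^sup>+x. F x \<partial>lborel) =
    (\<integral>\<^sup>+x. indicator {0..1} (x \<bullet> e) * (\<integral>\<^sup>+t. F (x + (t - x \<bullet> e) *\<^sub>R e) \<partial>lborel) \<partial>lborel)"
proof -
  have ee: "e \<bullet> e = 1" using e by (simp add: dot_square_norm)
  have "(\<integral>\<^sup>+x. indicator {0..1} (x \<bullet> e) * (\<integral>\<^sup>+t. F (x + (t - x \<bullet> e) *\<^sub>R e) \<partial>lborel) \<partial>lborel) =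
     (\<integral>\<^sup>+x. (\<integral>\<^sup>+t. indicator {0..1} (x \<bullet> e) * F (x + t *\<^sub>R e) \<partial>lborel) \<partial>lborel)"
  proof (rule nn_integral_cong)
    fix x
    show "indicator {0..1} (x \<bullet> e) * (\<integral>\<^sup>+t. F (x + (t - x \<bullet> e) *\<^sub>R e) \<partial>lborel) =
       (\<integral>\<^sup>+t. indicator {0..1} (x \<bullet> e) * F (x + t *\<^sub>R e) \<partial>lborel)"
      using nn_integral_lborel_shift[of "\<lambda>t. F (x + t *\<^sub>R e)" "- (x \<bullet> e)"] by (simp add: nn_integral_cmult)
  qed
  also have "\<dots> = (\<integral>\<^sup>+t. (\<integral>\<^sup>+x. indicator {0..1} (x \<bullet> e) * F (x + t *\<^sub>R e) \<partial>lborel) \<partial>lborel)"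
    by (rule nn_integral_swap) measurable
  also have "\<dots> = (\<integral>\<^sup>+t. (\<integral>\<^sup>+x. indicator {0..1} (x \<bullet> e - t) * F x \<partial>lborel) \<partial>lborel)"
  proof (rule nn_integral_cong)
    fix t :: real
    show "(\<integral>\<^sup>+x. indicator {0..1} (x \<bullet> e) * F (x + t *\<^sub>R e) \<partial>lborel) = (\<integral>\<^sup>+x. indicator {0..1} (x \<bullet> e - t) * F x \<partial>lborel)"
      using nn_integral_lborel_shift[of "\<lambda>x. indicator {0..1} (x \<bullet> e - t) * F x" "t *\<^sub>R e"]
      by (simp add: inner_add_left ee add.commute)
  qed
  also have "\<dots> = (\<integral>\<^sup>+x. (\<integral>\<^sup>+t. indicator {0..1} (x \<bullet> e - t) * F x \<partial>lborel) \<partial>lborel)"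
    by (rule nn_integral_swap) measurable
  also have "\<dots> = (\<integral>\<^sup>+x. F x \<partial>lborel)"
  proof (rule nn_integral_cong)
    fix x
    have "(\<integral>\<^sup>+t. indicator {0..1} (x \<bullet> e - t) \<partial>lborel) = (\<integral>\<^sup>+t. indicator {x \<bullet> e - 1..x \<bullet> e} t \<partial>lborel)"
      by (intro nn_integral_cong) (auto simp: indicator_def)
    then show "(\<integral>\<^sup>+t. indicator {0..1} (x \<bullet> e - t) * F x \<partial>lborel) = F x"
      by (simp add: nn_integral_multc)
  qed
  finally show ?thesis by simp
qed

text \<open>The frame is the image of the standard basis under a rotation taking the first basis
  vector to \<open>e\<close>.\<close>

lemma orthonormal_frame:
  fixes e :: "real^3"
  assumes "norm e = 1"
  obtains e2 e3 where "norm e2 = 1" "norm e3 = 1" "e \<bullet> e2 = 0" "e \<bullet> e3 = 0" "e2 \<bullet> e3 = 0"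
    "\<And>x. x = (x \<bullet> e) *\<^sub>R e + (x \<bullet> e2) *\<^sub>R e2 + (x \<bullet> e3) *\<^sub>R e3"
proof -
  obtain f :: "real^3 \<Rightarrow> real^3" where f: "orthogonal_transformation f" "f (axis 1 1) = e"
    using orthogonal_transformation_exists[of "axis 1 1 :: real^3" e] assms by auto
  have lin: "linear f" using f(1) by (rule orthogonal_transformation_linear)
  have inn: "f x \<bullet> f y = x \<bullet> y" for x y using f(1) by (simp add: orthogonal_transformation_def)
  have n: "norm (f y) = norm y" for y using f(1) by (rule orthogonal_transformation_norm)
  have surj: "surj f" using f(1) by (rule orthogonal_transformation_surj)
  have ex: "x = (x \<bullet> f (axis 1 1)) *\<^sub>R f (axis 1 1) + (x \<bullet> f (axis 2 1)) *\<^sub>R f (axis 2 1) + (x \<bullet> f (axis 3 1)) *\<^sub>R f (axis 3 1)" for x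
  proof -
    obtain y where y: "x = f y" using surj by (rule surjE)
    have "y = (y \<bullet> axis 1 1) *\<^sub>R axis 1 1 + (y \<bullet> axis 2 1) *\<^sub>R axis 2 1 + (y \<bullet> axis 3 1) *\<^sub>R axis 3 1"
      unfolding inner_axis by (simp add: vec_eq_iff forall_3 axis_def)
    then have "f y = f ((y \<bullet> axis 1 1) *\<^sub>R axis 1 1 + (y \<bullet> axis 2 1) *\<^sub>R axis 2 1 + (y \<bullet> axis 3 1) *\<^sub>R axis 3 1)"
      by (rule arg_cong)
    then show ?thesis unfolding y inn by (simp only: linear_add[OF lin] linear_cmul[OF lin])
  qed
  show thesis
    by (rule that[of "f (axis 2 1)" "f (axis 3 1)"])
      (use ex in \<open>auto simp: n inn inner_axis_axis simp flip: f(2)\<close>)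
qed

text \<open>The radius 2 is taken because points whose coordinates in an orthonormal frame lie in
  [0, 1] have norm at most sqrt 3.\<close>

definition ball_vol :: ennreal where "ball_vol = emeasure lborel (cball (0 :: real^3) 2)"

lemma ball_vol_finite: "ball_vol < \<infinity>"
  using emeasure_bounded_finite[of "cball (0 :: real^3) 2"] by (simp add: ball_vol_def less_top)

text \<open>Splitting along \<open>e2\<close> and \<open>e3\<close> as well leaves the planar
  integral times the volume of a unit cube, which is bounded by \<open>ball_vol\<close>.\<close>

lemma nn_integral_plane_le:
  fixes K :: "real^3 \<Rightarrow> ennreal"
  assumes [measurable]: "K \<in> borel_measurable borel"
    and n: "norm e = 1" "norm e2 = 1" "norm e3 = 1" and o: "e \<bullet> e2 = 0" "e \<bullet> e3 = 0" "e2 \<bullet> e3 = 0"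
    and ex: "\<And>x. x = (x \<bullet> e) *\<^sub>R e + (x \<bullet> e2) *\<^sub>R e2 + (x \<bullet> e3) *\<^sub>R e3"
  shows "(\<integral>\<^sup>+x. indicator {0..1} (x \<bullet> e) * K (x - (x \<bullet> e) *\<^sub>R e) \<partial>lborel) \<le>
    ball_vol * (\<integral>\<^sup>+\<gamma>. (\<integral>\<^sup>+\<beta>. K (\<beta> *\<^sub>R e2 + \<gamma> *\<^sub>R e3) \<partial>lborel) \<partial>lborel)"
proof -
  have sq: "e2 \<bullet> e2 = 1" "e3 \<bullet> e3 = 1" "e \<bullet> e = 1" using n by (simp_all add: dot_square_norm)
  have o': "e2 \<bullet> e = 0" "e3 \<bullet> e = 0" "e3 \<bullet> e2 = 0" using o by (simp_all add: inner_commute)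
  define F where "F x = indicator {0..1} (x \<bullet> e) * K (x - (x \<bullet> e) *\<^sub>R e)" for x
  have [measurable]: "F \<in> borel_measurable borel" unfolding F_def by measurable
  define G where "G x = indicator {0..1} (x \<bullet> e2) * (indicator {0..1} (x \<bullet> e) *
     (\<integral>\<^sup>+\<beta>. K (x - (x \<bullet> e) *\<^sub>R e + (\<beta> - x \<bullet> e2) *\<^sub>R e2) \<partial>lborel))" for x
  have [measurable]: "G \<in> borel_measurable borel" unfolding G_def by measurable
  define Z where "Z = (\<integral>\<^sup>+\<gamma>. (\<integral>\<^sup>+\<beta>. K (\<beta> *\<^sub>R e2 + \<gamma> *\<^sub>R e3) \<partial>lborel) \<partial>lborel)"
  have "(\<integral>\<^sup>+x. F x \<partial>lborel) = (\<integral>\<^sup>+x. indicator {0..1} (x \<bullet> e2) * (\<integral>\<^sup>+\<beta>. F (x + (\<beta> - x \<bullet> e2) *\<^sub>R e2) \<partial>lborel) \<partial>lborel)"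
    by (rule nn_integral_split_line) (use n in auto)
  also have "\<dots> = (\<integral>\<^sup>+x. G x \<partial>lborel)"
    by (simp add: F_def G_def inner_add_left o' nn_integral_cmult algebra_simps)
  also have "\<dots> = (\<integral>\<^sup>+x. indicator {0..1} (x \<bullet> e3) * (\<integral>\<^sup>+\<gamma>. G (x + (\<gamma> - x \<bullet> e3) *\<^sub>R e3) \<partial>lborel) \<partial>lborel)"
    by (rule nn_integral_split_line) (use n in auto)
  also have "\<dots> = (\<integral>\<^sup>+x. indicator {0..1} (x \<bullet> e3) * (indicator {0..1} (x \<bullet> e2) * (indicator {0..1} (x \<bullet> e) * Z)) \<partial>lborel)"
  proof (intro nn_integral_cong arg_cong2[where f="(*)"] refl)
    fix x
    have "x + (\<gamma> - x \<bullet> e3) *\<^sub>R e3 - (x \<bullet> e) *\<^sub>R e + (\<beta> - x \<bullet> e2) *\<^sub>R e2 = \<beta> *\<^sub>R e2 + \<gamma> *\<^sub>R e3" for \<beta> \<gamma>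
      using ex[of x] by (simp add: algebra_simps)
    then have "G (x + (\<gamma> - x \<bullet> e3) *\<^sub>R e3) = indicator {0..1} (x \<bullet> e2) * (indicator {0..1} (x \<bullet> e) *
       (\<integral>\<^sup>+\<beta>. K (\<beta> *\<^sub>R e2 + \<gamma> *\<^sub>R e3) \<partial>lborel))" for \<gamma>
      by (simp add: G_def inner_add_left o' sq)
    then show "(\<integral>\<^sup>+\<gamma>. G (x + (\<gamma> - x \<bullet> e3) *\<^sub>R e3) \<partial>lborel) = indicator {0..1} (x \<bullet> e2) * (indicator {0..1} (x \<bullet> e) * Z)"
      by (simp add: nn_integral_cmult Z_def)
  qed
  also have "\<dots> \<le> (\<integral>\<^sup>+x. indicator (cball 0 2) x * Z \<partial>(lborel :: (real^3) measure))"
  proof (rule nn_integral_mono)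
    fix x :: "real^3"
    have "norm x \<le> 2" if "x \<bullet> e3 \<in> {0..1}" "x \<bullet> e2 \<in> {0..1}" "x \<bullet> e \<in> {0..1}"
    proof -
      have "x \<bullet> x = ((x \<bullet> e) *\<^sub>R e + (x \<bullet> e2) *\<^sub>R e2 + (x \<bullet> e3) *\<^sub>R e3) \<bullet> x" using ex[of x] by simp
      also have "\<dots> = (x \<bullet> e)\<^sup>2 + (x \<bullet> e2)\<^sup>2 + (x \<bullet> e3)\<^sup>2"
        by (simp add: inner_add_left inner_commute[of e x] inner_commute[of e2 x] inner_commute[of e3 x] power2_eq_square)
      also have "\<dots> \<le> 1 + 1 + 1" using that by (intro add_mono power_le_one) auto
      finally have "(norm x)\<^sup>2 \<le> 2\<^sup>2" by (simp add: dot_square_norm)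
      then show ?thesis by (rule power2_le_imp_le) simp
    qed
    then show "indicator {0..1} (x \<bullet> e3) * (indicator {0..1} (x \<bullet> e2) * (indicator {0..1} (x \<bullet> e) * Z)) \<le> indicator (cball 0 2) x * Z"
      by (auto simp: indicator_def)
  qed
  also have "\<dots> = ball_vol * Z" unfolding ball_vol_def
    by (subst nn_integral_multc) (auto intro!: borel_measurable_indicator borel_closed)
  finally show ?thesis by (simp add: F_def Z_def)
qed

text \<open>If r is the component of w along \<psi>, then r^2 dr d\<psi> is the volume element for H
  in polar coordinates, and A controls the transversal integral of k. The factor 2 comes from r
  running over both half-lines.\<close>

lemma nn_integral_line_plane:
  fixes k :: "real^3 \<Rightarrow> real^3 \<Rightarrow> ennreal" and H :: "real^3 \<Rightarrow> ennreal"
  assumes [measurable]: "H \<in> borel_measurable borel" "(\<lambda>(\<psi>, w). k \<psi> w) \<in> borel_measurable (borel \<Otimes>\<^sub>M borel)"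
    and A: "\<And>\<psi> r. norm \<psi> = 1 \<Longrightarrow> (\<integral>\<^sup>+x. indicator {0..1} (x \<bullet> \<psi>) * k \<psi> (x + (r - x \<bullet> \<psi>) *\<^sub>R \<psi>) \<partial>lborel) \<le> A"
  shows "(\<integral>\<^sup>+\<psi>. (\<integral>\<^sup>+w. ennreal ((w \<bullet> \<psi>)\<^sup>2) * H ((w \<bullet> \<psi>) *\<^sub>R \<psi>) * k \<psi> w \<partial>lborel) \<partial>sph) \<le> 2 * A * (\<integral>\<^sup>+x. H x \<partial>lborel)"
proof -
  have "(\<integral>\<^sup>+w. ennreal ((w \<bullet> \<psi>)\<^sup>2) * H ((w \<bullet> \<psi>) *\<^sub>R \<psi>) * k \<psi> w \<partial>lborel) \<le> A * (\<integral>\<^sup>+r. ennreal (r\<^sup>2) * H (r *\<^sub>R \<psi>) \<partial>lborel)"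
    if psi: "norm \<psi> = 1" for \<psi>
  proof -
    have [measurable]: "k \<psi> \<in> borel_measurable borel" by measurable
    have pp: "\<psi> \<bullet> \<psi> = 1" using psi by (simp add: dot_square_norm)
    have "(\<integral>\<^sup>+w. ennreal ((w \<bullet> \<psi>)\<^sup>2) * H ((w \<bullet> \<psi>) *\<^sub>R \<psi>) * k \<psi> w \<partial>lborel) =
      (\<integral>\<^sup>+x. indicator {0..1} (x \<bullet> \<psi>) * (\<integral>\<^sup>+t. ennreal (((x + (t - x \<bullet> \<psi>) *\<^sub>R \<psi>) \<bullet> \<psi>)\<^sup>2) *
         H (((x + (t - x \<bullet> \<psi>) *\<^sub>R \<psi>) \<bullet> \<psi>) *\<^sub>R \<psi>) * k \<psi> (x + (t - x \<bullet> \<psi>) *\<^sub>R \<psi>) \<partial>lborel) \<partial>lborel)"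
      by (rule nn_integral_split_line) (use psi in auto)
    also have "\<dots> = (\<integral>\<^sup>+x. (\<integral>\<^sup>+t. ennreal (t\<^sup>2) * H (t *\<^sub>R \<psi>) * (indicator {0..1} (x \<bullet> \<psi>) * k \<psi> (x + (t - x \<bullet> \<psi>) *\<^sub>R \<psi>)) \<partial>lborel) \<partial>lborel)"
      by (subst nn_integral_cmult[symmetric]) (auto simp: inner_add_left pp ac_simps)
    also have "\<dots> = (\<integral>\<^sup>+t. (\<integral>\<^sup>+x. ennreal (t\<^sup>2) * H (t *\<^sub>R \<psi>) * (indicator {0..1} (x \<bullet> \<psi>) * k \<psi> (x + (t - x \<bullet> \<psi>) *\<^sub>R \<psi>)) \<partial>lborel) \<partial>lborel)"
      by (rule nn_integral_swap) measurable
    also have "\<dots> = (\<integral>\<^sup>+t. ennreal (t\<^sup>2) * H (t *\<^sub>R \<psi>) * (\<integral>\<^sup>+x. indicator {0..1} (x \<bullet> \<psi>) * k \<psi> (x + (t - x \<bullet> \<psi>) *\<^sub>R \<psi>) \<partial>lborel) \<partial>lborel)"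
      by (intro nn_integral_cong nn_integral_cmult) measurable
    also have "\<dots> \<le> (\<integral>\<^sup>+t. ennreal (t\<^sup>2) * H (t *\<^sub>R \<psi>) * A \<partial>lborel)"
      by (intro nn_integral_mono mult_left_mono A psi) auto
    also have "\<dots> = A * (\<integral>\<^sup>+r. ennreal (r\<^sup>2) * H (r *\<^sub>R \<psi>) \<partial>lborel)"
      by (subst nn_integral_multc) (auto simp: mult.commute)
    finally show ?thesis .
  qed
  then have "(\<integral>\<^sup>+\<psi>. (\<integral>\<^sup>+w. ennreal ((w \<bullet> \<psi>)\<^sup>2) * H ((w \<bullet> \<psi>) *\<^sub>R \<psi>) * k \<psi> w \<partial>lborel) \<partial>sph) \<le>
     (\<integral>\<^sup>+\<psi>. A * (\<integral>\<^sup>+r. ennreal (r\<^sup>2) * H (r *\<^sub>R \<psi>) \<partial>lborel) \<partial>sph)"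
    using AE_sph_norm by (intro nn_integral_mono_AE) auto
  also have "\<dots> = A * (\<integral>\<^sup>+\<psi>. (\<integral>\<^sup>+r. ennreal (r\<^sup>2) * H (r *\<^sub>R \<psi>) \<partial>lborel) \<partial>sph)"
    by (rule nn_integral_cmult) measurable
  also have "\<dots> \<le> A * (2 * (\<integral>\<^sup>+x. H x \<partial>lborel))" by (intro mult_left_mono nn_integral_radial_le) auto
  finally show ?thesis by (simp add: ac_simps)
qed

section \<open>Inscribed angles\<close>

text \<open>The inverse substitution is u = t + sqrt(t^2 + n^2), an increasing bijection of the line
  onto the half-line. It is the action of y \<mapsto> y + |y| e on a line parallel to e at distance
  n from the axis. The substitution is made on the compact intervals [1 / (k + 2), k + 2], whose
  union is the half-line.\<close>

lemma nn_integral_hyperbola: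
  fixes f :: "real \<Rightarrow> ennreal"
  assumes n: "n > 0" and [measurable]: "f \<in> borel_measurable borel"
  shows "(\<integral>\<^sup>+t. f t \<partial>lborel) =
    (\<integral>\<^sup>+u. indicator {0<..} u * (f ((u\<^sup>2 - n\<^sup>2) / (2 * u)) * ennreal ((u\<^sup>2 + n\<^sup>2) / (2 * u\<^sup>2))) \<partial>lborel)"
proof -
  define g where "g u = (u\<^sup>2 - n\<^sup>2) / (2 * u)" for u
  define g' where "g' u = (u\<^sup>2 + n\<^sup>2) / (2 * u\<^sup>2)" for u
  have [measurable]: "g \<in> borel_measurable borel" "g' \<in> borel_measurable borel"
    unfolding g_def g'_def by measurable
  have dg: "(g has_real_derivative g' u) (at u)" if "u > 0" for u
    unfolding g_def g'_def using that
    by (auto intro!: derivative_eq_intros simp: field_simps power2_eq_square)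
  have mono: "g u \<le> g v" if "0 < u" "u \<le> v" for u v
  proof (rule DERIV_nonneg_imp_nondecreasing[OF that(2)])
    fix x assume "u \<le> x"
    then have "(g has_real_derivative g' x) (at x)" "0 \<le> g' x" using that(1) dg by (auto simp: g'_def)
    then show "\<exists>y. (g has_real_derivative y) (at x) \<and> 0 \<le> y" by blast
  qed
  define a where "a k = 1 / (real k + 2)" for k
  define b where "b k = real k + 2" for k
  have ab: "0 < a k" "a k < b k" for k
  proof -
    show "0 < a k" by (simp add: a_def)
    have "a k \<le> 1" by (simp add: a_def)
    then show "a k < b k" by (simp add: b_def)
  qed
  have a_mono: "a l \<le> a k" "b k \<le> b l" if "k \<le> l" for k l
    using that by (auto simp: a_def b_def field_simps)
  have ex: "\<exists>k. a k \<le> u \<and> u \<le> b k" if u: "u > 0" for u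
  proof -
    obtain k :: nat where k: "max u (1 / u) \<le> real k" using real_arch_simple by blast
    then have "1 / u \<le> real k + 2" "u \<le> real k + 2" by auto
    then have "a k \<le> u" "u \<le> b k" using u by (auto simp: a_def b_def field_simps)
    then show ?thesis by blast
  qed
  have UA: "(\<Union>k. {g (a k)..g (b k)}) = UNIV"
  proof (intro equalityI subsetI UNIV_I)
    fix t :: real
    define u where "u = t + sqrt (t\<^sup>2 + n\<^sup>2)"
    have "\<bar>t\<bar> < sqrt (t\<^sup>2 + n\<^sup>2)" using n by (intro real_less_rsqrt) auto
    then have u: "u > 0" by (auto simp: u_def)
    have "(u - t)\<^sup>2 = t\<^sup>2 + n\<^sup>2" by (simp add: u_def)
    then have "u\<^sup>2 - n\<^sup>2 = 2 * u * t" by (simp add: power2_diff algebra_simps)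
    then have "g u = t" using u by (simp add: g_def)
    moreover obtain k where "a k \<le> u" "u \<le> b k" using ex[OF u] by blast
    ultimately have "t \<in> {g (a k)..g (b k)}" using mono[of "a k" u] mono[of u "b k"] ab[of k] u by auto
    then show "t \<in> (\<Union>k. {g (a k)..g (b k)})" by blast
  qed
  have UB: "(\<Union>k. {a k..b k}) = {0<..}"
  proof (intro equalityI subsetI)
    fix u assume "u \<in> (\<Union>k. {a k..b k})"
    then obtain k where "a k \<le> u" by auto
    then show "u \<in> {0<..}" using ab(1)[of k] by auto
  qed (use ex in auto)
  have incA: "incseq (\<lambda>k. {g (a k)..g (b k)})"
  proof (rule monoI)
    fix k l :: nat assume kl: "k \<le> l"
    have "g (a l) \<le> g (a k)" "g (b k) \<le> g (b l)"
      using a_mono[OF kl] ab[of k] ab[of l] by (auto intro!: mono)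
    then show "{g (a k)..g (b k)} \<le> {g (a l)..g (b l)}" by auto
  qed
  have incB: "incseq (\<lambda>k. {a k..b k})" by (rule monoI) (use a_mono in force)
  define h where "h u = f (g u) * ennreal (g' u)" for u
  have [measurable]: "h \<in> borel_measurable borel" unfolding h_def by measurable
  have "(\<integral>\<^sup>+t. f t \<partial>lborel) = emeasure (density lborel f) (\<Union>k. {g (a k)..g (b k)})"
    unfolding UA by (subst emeasure_density) auto
  also have "\<dots> = (SUP k. emeasure (density lborel f) {g (a k)..g (b k)})"
    by (rule SUP_emeasure_incseq[symmetric]) (use incA in auto)
  also have "\<dots> = (SUP k. emeasure (density lborel h) {a k..b k})"
  proof (rule SUP_cong[OF refl])
    fix k
    have "(\<integral>\<^sup>+x. f x * indicator {g (a k)..g (b k)} x \<partial>lborel) =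
             (\<integral>\<^sup>+x. f (g x) * g' x * indicator {a k..b k} x \<partial>lborel)"
    proof (rule nn_integral_substitution_aux)
      show "(g has_real_derivative g' x) (at x)" if "x \<in> {a k..b k}" for x
        using that ab(1)[of k] by (intro dg) auto
      show "continuous_on {a k..b k} g'" unfolding g'_def
        using ab(1)[of k] by (intro continuous_intros) auto
    qed (use ab in \<open>auto simp: g'_def\<close>)
    then show "emeasure (density lborel f) {g (a k)..g (b k)} = emeasure (density lborel h) {a k..b k}"
      by (simp add: emeasure_density h_def)
  qed
  also have "\<dots> = emeasure (density lborel h) (\<Union>k. {a k..b k})"
    by (rule SUP_emeasure_incseq) (use incB in auto)
  also have "\<dots> = (\<integral>\<^sup>+u. h u * indicator {0<..} u \<partial>lborel)"
    unfolding UB by (subst emeasure_density) auto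
  finally show ?thesis by (simp add: h_def g_def g'_def mult.commute)
qed

lemma AE_inner_neq:
  fixes e :: "'a::euclidean_space"
  assumes "e \<noteq> 0"
  shows "AE x in lborel. e \<bullet> x \<noteq> c"
proof -
  have "{x. e \<bullet> x = c} \<in> null_sets lebesgue"
    using negligible_hyperplane[of e c] assms by (auto simp: negligible_iff_null_sets)
  then have "{x. e \<bullet> x = c} \<in> null_sets lborel"
    by (subst (asm) null_sets_completion_iff) (auto intro!: borel_closed closed_hyperplane)
  then show ?thesis by (rule AE_I') auto
qed

lemma AE_not_on_line:
  fixes e :: "real^3"
  assumes "norm e = 1"
  shows "AE x in lborel. x - (x \<bullet> e) *\<^sub>R e \<noteq> 0"
proof -
  obtain e2 e3 where e2: "norm e2 = 1" "e \<bullet> e2 = 0" using orthonormal_frame[OF assms] by metis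
  then have "e2 \<noteq> 0" by auto
  from AE_inner_neq[OF this, of 0] show ?thesis
  proof eventually_elim
    case (elim x)
    have "e2 \<bullet> (x - (x \<bullet> e) *\<^sub>R e) = e2 \<bullet> x" using e2 by (simp add: inner_diff_right inner_commute[of e2 e])
    then show ?case using elim by auto
  qed
qed

text \<open>Inscribed angles: a sphere through the origin with diameter \<open>w\<close> is parametrised by the direction \<open>\<psi>\<close> of its
  points seen from the origin. In terms of homogeneous functions this is the substitution
  \<open>y \<mapsto> y + |y| e\<close> with \<open>e = w / |w|\<close>, which shears along the lines in direction \<open>e\<close>.\<close>

lemma nn_integral_inscribed_le:
  fixes w :: "real^3" and G :: "real^3 \<Rightarrow> ennreal"
  assumes [measurable]: "G \<in> borel_measurable borel"
  shows "(\<integral>\<^sup>+\<phi>. ennreal (norm w) * G (w /\<^sub>R 2 + (norm w / 2) *\<^sub>R \<phi>) \<partial>sph) \<le>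
    12 * (\<integral>\<^sup>+\<psi>. ennreal \<bar>w \<bullet> \<psi>\<bar> * G ((w \<bullet> \<psi>) *\<^sub>R \<psi>) \<partial>sph)"
proof (cases "w = 0")
  case False
  define e where "e = w /\<^sub>R norm w"
  have e: "norm e = 1" using False by (simp add: e_def)
  have ee: "e \<bullet> e = 1" using e by (simp add: dot_square_norm)
  have we: "w = norm w *\<^sub>R e" using False by (simp add: e_def)
  have nw: "norm w > 0" using False by simp
  define H where "H \<psi> = G ((w \<bullet> \<psi>) *\<^sub>R \<psi>)" for \<psi>
  have [measurable]: "H \<in> borel_measurable borel" unfolding H_def by measurable
  define \<Phi> where "\<Phi> y = indicator (ball 0 1) y * H (sgn (y + norm y *\<^sub>R e))" for y
  have [measurable]: "\<Phi> \<in> borel_measurable borel" unfolding \<Phi>_def by measurable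
  \<comment> \<open>The transformed integrand: |a|^2 < 2 (a \<bullet> e) describes the image of the
    unit ball under the shear, and |a|^2 / (2 (a \<bullet> e)^2) is the Jacobian of
    \<open>nn_integral_hyperbola\<close>.\<close>
  define \<Psi> where "\<Psi> a = (if a \<bullet> e > 0 \<and> (norm a)\<^sup>2 < 2 * (a \<bullet> e) then ennreal ((norm a)\<^sup>2 / (2 * (a \<bullet> e)\<^sup>2)) else 0) * H (sgn a)" for a
  have [measurable]: "\<Psi> \<in> borel_measurable borel" unfolding \<Psi>_def by measurable
  have "(\<integral>\<^sup>+\<phi>. G (w /\<^sub>R 2 + (norm w / 2) *\<^sub>R \<phi>) \<partial>sph) = (\<integral>\<^sup>+y. indicator (ball 0 1) y * G (w /\<^sub>R 2 + (norm w / 2) *\<^sub>R sgn y) \<partial>lborel)"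
    by (rule nn_integral_sph) measurable
  also have "\<dots> = (\<integral>\<^sup>+y. \<Phi> y \<partial>lborel)"
  proof (rule nn_integral_cong_AE, use AE_lborel_neq[of "0 :: real^3"] in eventually_elim)
    case (elim y)
    \<comment> \<open>The inscribed angle: as z is a sum of two unit vectors, |z|^2 = 2 (e \<bullet>
      z), so the point (|w| / 2) z of the sphere is the projection of w onto its own
      direction.\<close>
    define z where "z = sgn y + e"
    have sy: "sgn y \<bullet> sgn y = 1" using elim by (simp add: dot_square_norm norm_sgn)
    have yz: "y + norm y *\<^sub>R e = norm y *\<^sub>R z" using elim by (simp add: z_def scaleR_add_right sgn_div_norm)
    have zz: "z \<bullet> z = 2 * (e \<bullet> z)"
      by (simp add: z_def inner_add_left inner_add_right sy ee inner_commute)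
    have "(w \<bullet> sgn z) *\<^sub>R sgn z = (norm w / 2) *\<^sub>R z"
    proof (cases "z = 0")
      case False
      have "(w \<bullet> sgn z) *\<^sub>R sgn z = (norm w * ((e \<bullet> z) / (norm z)\<^sup>2)) *\<^sub>R z"
        by (subst we) (simp add: sgn_div_norm power2_eq_square divide_inverse ac_simps)
      also have "(norm z)\<^sup>2 = 2 * (e \<bullet> z)" using zz by (simp add: dot_square_norm)
      also have "e \<bullet> z / (2 * (e \<bullet> z)) = 1 / 2" using zz False by auto
      finally show ?thesis by simp
    qed simp
    moreover have "sgn (y + norm y *\<^sub>R e) = sgn z"
      unfolding yz using elim by (simp add: sgn_scaleR)
    moreover have "(norm w / 2) *\<^sub>R z = w /\<^sub>R 2 + (norm w / 2) *\<^sub>R sgn y"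
    proof -
      have "w /\<^sub>R 2 = (norm w *\<^sub>R e) /\<^sub>R 2" using we by (rule arg_cong)
      then show ?thesis by (simp add: z_def scaleR_add_right)
    qed
    ultimately show ?case by (simp add: \<Phi>_def H_def)
  qed
  also have "\<dots> = (\<integral>\<^sup>+x. indicator {0..1} (x \<bullet> e) * (\<integral>\<^sup>+t. \<Phi> (x + (t - x \<bullet> e) *\<^sub>R e) \<partial>lborel) \<partial>lborel)"
    by (rule nn_integral_split_line[OF _ e]) measurable
  also have "\<dots> = (\<integral>\<^sup>+x. indicator {0..1} (x \<bullet> e) * (\<integral>\<^sup>+u. \<Psi> (x + (u - x \<bullet> e) *\<^sub>R e) \<partial>lborel) \<partial>lborel)"
  proof (rule nn_integral_cong_AE, use AE_not_on_line[OF e] in eventually_elim)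
    case (elim x)
    define b where "b = x - (x \<bullet> e) *\<^sub>R e"
    define n where "n = norm b"
    have n: "n > 0" using elim by (simp add: n_def b_def)
    have be: "b \<bullet> e = 0" by (simp add: b_def inner_diff_left ee)
    have xb: "x + (t - x \<bullet> e) *\<^sub>R e = b + t *\<^sub>R e" for t by (simp add: b_def algebra_simps)
    have nbt: "(norm (b + t *\<^sub>R e))\<^sup>2 = n\<^sup>2 + t\<^sup>2" for t
      unfolding n_def power2_norm_eq_inner
      by (simp add: inner_add_left inner_add_right be ee inner_commute[of e b] power2_eq_square)
    have "(\<integral>\<^sup>+t. \<Phi> (b + t *\<^sub>R e) \<partial>lborel) =
       (\<integral>\<^sup>+u. indicator {0<..} u * (\<Phi> (b + ((u\<^sup>2 - n\<^sup>2) / (2 * u)) *\<^sub>R e) * ennreal ((u\<^sup>2 + n\<^sup>2) / (2 * u\<^sup>2))) \<partial>lborel)"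
      by (rule nn_integral_hyperbola[OF n]) measurable
    also have "\<dots> = (\<integral>\<^sup>+u. \<Psi> (b + u *\<^sub>R e) \<partial>lborel)"
    proof (rule nn_integral_cong)
      fix u :: real
      have ue: "(b + u *\<^sub>R e) \<bullet> e = u" using be by (simp add: inner_add_left ee)
      show "indicator {0<..} u * (\<Phi> (b + ((u\<^sup>2 - n\<^sup>2) / (2 * u)) *\<^sub>R e) * ennreal ((u\<^sup>2 + n\<^sup>2) / (2 * u\<^sup>2))) = \<Psi> (b + u *\<^sub>R e)"
      proof (cases "u > 0")
        case True
        define t where "t = (u\<^sup>2 - n\<^sup>2) / (2 * u)"
        define m where "m = (u\<^sup>2 + n\<^sup>2) / (2 * u)"
        have m0: "m \<ge> 0" using True by (simp add: m_def)
        have mt: "t + m = u" using True by (simp add: t_def m_def field_simps power2_eq_square)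
        have "m - t = n\<^sup>2 / u" using True by (simp add: t_def m_def field_simps)
        then have "(m - t) * (t + m) = n\<^sup>2" using True mt by simp
        then have "m\<^sup>2 = n\<^sup>2 + t\<^sup>2" by (simp add: algebra_simps power2_eq_square)
        then have "(norm (b + t *\<^sub>R e))\<^sup>2 = m\<^sup>2" using nbt by simp
        then have nm: "norm (b + t *\<^sub>R e) = m" using m0 by (simp add: power2_eq_iff_nonneg)
        have eq: "b + t *\<^sub>R e + m *\<^sub>R e = b + u *\<^sub>R e" using mt by (metis add.assoc scaleR_add_left)
        then have "\<Phi> (b + t *\<^sub>R e) = (if m < 1 then H (sgn (b + u *\<^sub>R e)) else 0)"
          unfolding \<Phi>_def nm eq by (auto simp: indicator_def nm)
        moreover have "m < 1 \<longleftrightarrow> n\<^sup>2 + u\<^sup>2 < 2 * u" using True by (simp add: m_def field_simps)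
        ultimately have P: "\<Phi> (b + t *\<^sub>R e) = (if n\<^sup>2 + u\<^sup>2 < 2 * u then H (sgn (b + u *\<^sub>R e)) else 0)" by simp
        show ?thesis
          using True unfolding t_def[symmetric] P \<Psi>_def ue nbt by (simp add: add.commute mult.commute)
      next
        case False
        then show ?thesis by (simp add: \<Psi>_def ue)
      qed
    qed
    finally show ?case unfolding xb by simp
  qed
  also have "\<dots> = (\<integral>\<^sup>+a. \<Psi> a \<partial>lborel)"
    by (rule nn_integral_split_line[OF _ e, symmetric]) measurable
  also have "\<dots> = 3 * (\<integral>\<^sup>+\<psi>. (\<integral>\<^sup>+r. indicator {0<..} r * (ennreal (r\<^sup>2) * \<Psi> (r *\<^sub>R \<psi>)) \<partial>lborel) \<partial>sph)"
    by (rule nn_integral_polar) measurable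
  \<comment> \<open>In the direction \<psi> with c = \<psi> \<bullet> e > 0 the constraint reads r <
    2 c; there r^2 times the Jacobian is at most 2, so the radial integral is at most 4 c times H.
    With the 3 of polar coordinates this makes 12.\<close>
  also have "\<dots> \<le> 3 * (\<integral>\<^sup>+\<psi>. 4 * (ennreal \<bar>e \<bullet> \<psi>\<bar> * H \<psi>) \<partial>sph)"
  proof (rule mult_left_mono[OF nn_integral_mono_AE], use AE_sph_norm in eventually_elim)
    case (elim \<psi>)
    define c where "c = \<psi> \<bullet> e"
    have "(\<integral>\<^sup>+r. indicator {0<..} r * (ennreal (r\<^sup>2) * \<Psi> (r *\<^sub>R \<psi>)) \<partial>lborel) \<le>
      (\<integral>\<^sup>+r. (2 * H \<psi>) * indicator {0..2 * \<bar>c\<bar>} r \<partial>lborel)"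
    proof (rule nn_integral_mono)
      fix r :: real
      show "indicator {0<..} r * (ennreal (r\<^sup>2) * \<Psi> (r *\<^sub>R \<psi>)) \<le> (2 * H \<psi>) * indicator {0..2 * \<bar>c\<bar>} r"
      proof (cases "r > 0 \<and> c > 0 \<and> r < 2 * c")
        case True
        have "r\<^sup>2 * (r\<^sup>2 / (2 * (r * c)\<^sup>2)) = r\<^sup>2 / (2 * c\<^sup>2)" using True by (simp add: power_mult_distrib)
        also have "\<dots> \<le> (2 * c)\<^sup>2 / (2 * c\<^sup>2)" using True by (intro divide_right_mono power_mono) auto
        also have "\<dots> = 2" using True by (simp add: power_mult_distrib)
        finally have "ennreal (r\<^sup>2) * ennreal (r\<^sup>2 / (2 * (r * c)\<^sup>2)) \<le> 2"
          by (subst ennreal_mult[symmetric]) (auto intro!: ennreal_leI[where y=2, simplified])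
        then have "ennreal (r\<^sup>2) * ennreal (r\<^sup>2 / (2 * (r * c)\<^sup>2)) * H \<psi> \<le> 2 * H \<psi>" by (rule mult_right_mono) simp
        moreover have "sgn (r *\<^sub>R \<psi>) = \<psi>" using True elim by (simp add: sgn_scaleR sgn_div_norm)
        moreover have "r * r < 2 * (r * c)" using True by simp
        ultimately show ?thesis
          using True elim by (simp add: \<Psi>_def c_def[symmetric] power2_eq_square mult.assoc)
      next
        case False
        have "\<Psi> (r *\<^sub>R \<psi>) = 0" if r: "r > 0"
        proof (cases "c > 0")
          case True
          then have "\<not> r < 2 * c" using False r by simp
          then have "\<not> r * r < 2 * (r * c)" using r by (simp add: not_less)
          then show ?thesis using r elim by (simp add: \<Psi>_def c_def[symmetric] power2_eq_square)
        next
          case False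
          then show ?thesis using r by (simp add: \<Psi>_def c_def[symmetric] zero_less_mult_iff)
        qed
        then show ?thesis by (auto simp: indicator_def)
      qed
    qed
    also have "\<dots> = 2 * H \<psi> * ennreal (2 * \<bar>c\<bar>)" by (simp add: nn_integral_cmult_indicator)
    also have "\<dots> = 4 * (ennreal \<bar>e \<bullet> \<psi>\<bar> * H \<psi>)"
      by (simp add: c_def inner_commute[of \<psi> e] ennreal_mult ac_simps)
    finally show ?case .
  qed simp
  also have "\<dots> = 12 * (\<integral>\<^sup>+\<psi>. ennreal \<bar>e \<bullet> \<psi>\<bar> * H \<psi> \<partial>sph)"
  proof -
    have "(\<integral>\<^sup>+\<psi>. 4 * (ennreal \<bar>e \<bullet> \<psi>\<bar> * H \<psi>) \<partial>sph) = 4 * (\<integral>\<^sup>+\<psi>. ennreal \<bar>e \<bullet> \<psi>\<bar> * H \<psi> \<partial>sph)"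
      by (rule nn_integral_cmult) measurable
    then show ?thesis by (simp add: mult.assoc[symmetric])
  qed
  finally have "ennreal (norm w) * (\<integral>\<^sup>+\<phi>. G (w /\<^sub>R 2 + (norm w / 2) *\<^sub>R \<phi>) \<partial>sph) \<le>
     ennreal (norm w) * (12 * (\<integral>\<^sup>+\<psi>. ennreal \<bar>e \<bullet> \<psi>\<bar> * H \<psi> \<partial>sph))"
    by (rule mult_left_mono) simp
  also have "\<dots> = 12 * (\<integral>\<^sup>+\<psi>. ennreal (norm w) * (ennreal \<bar>e \<bullet> \<psi>\<bar> * H \<psi>) \<partial>sph)"
  proof -
    have "(\<integral>\<^sup>+\<psi>. ennreal (norm w) * (ennreal \<bar>e \<bullet> \<psi>\<bar> * H \<psi>) \<partial>sph) =
        ennreal (norm w) * (\<integral>\<^sup>+\<psi>. ennreal \<bar>e \<bullet> \<psi>\<bar> * H \<psi> \<partial>sph)"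
      by (rule nn_integral_cmult) measurable
    then show ?thesis by (simp add: mult.left_commute)
  qed
  also have "\<dots> = 12 * (\<integral>\<^sup>+\<psi>. ennreal \<bar>w \<bullet> \<psi>\<bar> * G ((w \<bullet> \<psi>) *\<^sub>R \<psi>) \<partial>sph)"
  proof -
    have "ennreal (norm w) * ennreal \<bar>e \<bullet> \<psi>\<bar> = ennreal \<bar>w \<bullet> \<psi>\<bar>" for \<psi>
      by (subst (2) we) (simp add: abs_mult ennreal_mult)
    then show ?thesis by (simp add: H_def flip: mult.assoc)
  qed
  also have "ennreal (norm w) * (\<integral>\<^sup>+\<phi>. G (w /\<^sub>R 2 + (norm w / 2) *\<^sub>R \<phi>) \<partial>sph) =
      (\<integral>\<^sup>+\<phi>. ennreal (norm w) * G (w /\<^sub>R 2 + (norm w / 2) *\<^sub>R \<phi>) \<partial>sph)"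
    by (rule nn_integral_cmult[symmetric]) measurable
  finally show ?thesis .
qed simp

section \<open>Integrals of the weights\<close>

lemma power2_powr: "(x\<^sup>2) powr a = \<bar>x\<bar> powr (2 * a)" for x a :: real
proof (cases "x = 0")
  case False
  then have "x\<^sup>2 = \<bar>x\<bar> powr 2" by (simp add: powr_numeral)
  then show ?thesis by (simp only: powr_powr)
qed simp

lemma nn_integral_two_powers_finite:
  fixes a b :: real
  assumes "a < 1" "1 < b"
  shows "(\<integral>\<^sup>+x. ennreal (if \<bar>x\<bar> \<le> 1 then \<bar>x\<bar> powr - a else \<bar>x\<bar> powr - b) \<partial>(lborel :: real measure)) < \<infinity>"
proof -
  define P where "P x = ennreal (x powr - a) * indicator {0..1} x" for x :: real
  define Q where "Q x = ennreal (x powr - b) * indicator {1..} x" for x :: real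
  have [measurable]: "P \<in> borel_measurable borel" "Q \<in> borel_measurable borel"
    unfolding P_def Q_def by measurable
  have "(\<integral>\<^sup>+x. P x \<partial>lborel) = ennreal (1 powr (- a + 1) / (- a + 1))"
    unfolding P_def by (rule nn_integral_has_integral_lebesgue'[OF _ has_integral_powr_from_0]) (use assms in auto)
  then have P: "(\<integral>\<^sup>+x. P x \<partial>lborel) < \<infinity>" by simp
  have "(\<integral>\<^sup>+x. Q x \<partial>lborel) = ennreal (- (1 powr (- b + 1)) / (- b + 1))"
    unfolding Q_def by (rule nn_integral_has_integral_lebesgue'[OF _ has_integral_powr_to_inf]) (use assms in auto)
  then have Q: "(\<integral>\<^sup>+x. Q x \<partial>lborel) < \<infinity>" by simp
  have "(\<integral>\<^sup>+x. ennreal (if \<bar>x\<bar> \<le> 1 then \<bar>x\<bar> powr - a else \<bar>x\<bar> powr - b) \<partial>lborel) \<le>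
     (\<integral>\<^sup>+x. (P x + Q x) + (P (- x) + Q (- x)) \<partial>lborel)"
    by (intro nn_integral_mono) (auto simp: P_def Q_def indicator_def abs_if)
  also have "\<dots> = ((\<integral>\<^sup>+x. P x \<partial>lborel) + (\<integral>\<^sup>+x. Q x \<partial>lborel)) + ((\<integral>\<^sup>+x. P (- x) \<partial>lborel) + (\<integral>\<^sup>+x. Q (- x) \<partial>lborel))"
    by (simp add: nn_integral_add)
  also have "\<dots> < \<infinity>" using P Q by (simp add: nn_integral_lborel_uminus)
  finally show ?thesis .
qed

lemma nn_integral_finite_by_powers:
  fixes f :: "real \<Rightarrow> real"
  assumes "a < 1" "1 < b"
    and "\<And>x. x \<noteq> 0 \<Longrightarrow> \<bar>x\<bar> \<le> 1 \<Longrightarrow> f x \<le> \<bar>x\<bar> powr - a"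
    and "\<And>x. 1 < \<bar>x\<bar> \<Longrightarrow> f x \<le> \<bar>x\<bar> powr - b"
  shows "(\<integral>\<^sup>+x. ennreal (f x) \<partial>lborel) < \<infinity>"
proof -
  have "(\<integral>\<^sup>+x. ennreal (f x) \<partial>lborel) \<le>
     (\<integral>\<^sup>+x. ennreal (if \<bar>x\<bar> \<le> 1 then \<bar>x\<bar> powr - a else \<bar>x\<bar> powr - b) \<partial>lborel)"
    using AE_lborel_neq[of "0 :: real"] assms(3,4) by (intro nn_integral_mono_AE) (auto intro!: ennreal_leI)
  then show ?thesis using nn_integral_two_powers_finite[OF assms(1,2)] by (rule le_less_trans)
qed

definition japanese_const :: "real \<Rightarrow> ennreal" where
  "japanese_const q = (\<integral>\<^sup>+x. ennreal ((1 + x\<^sup>2) powr - q) \<partial>lborel)"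

lemma japanese_const_finite:
  assumes "q > 1 / 2"
  shows "japanese_const q < \<infinity>"
  unfolding japanese_const_def
proof (rule nn_integral_finite_by_powers)
  show "1 / 2 < (1 :: real)" "1 < 2 * q" using assms by auto
  show "(1 + x\<^sup>2) powr - q \<le> \<bar>x\<bar> powr - (1 / 2)" if "x \<noteq> 0" "\<bar>x\<bar> \<le> 1" for x
  proof -
    have "(1 + x\<^sup>2) powr - q \<le> 1 powr - q" using assms by (intro powr_mono2') auto
    also have "\<dots> = 1 powr - (1 / 2)" by simp
    also have "\<dots> \<le> \<bar>x\<bar> powr - (1 / 2)" using that by (intro powr_mono2') auto
    finally show ?thesis .
  qed
  show "(1 + x\<^sup>2) powr - q \<le> \<bar>x\<bar> powr - (2 * q)" if "1 < \<bar>x\<bar>" for x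
  proof -
    have "(1 + x\<^sup>2) powr - q \<le> (x\<^sup>2) powr - q" using assms that by (intro powr_mono2') auto
    then show ?thesis by (simp add: power2_powr)
  qed
qed

text \<open>Uniformity in the shift q is the point. For |\<beta>| \<le> 1 the weight is at most 1
  and the singularity is integrable. Otherwise both factors are, up to a constant, powers of
  brackets whose exponents add up to r = s / 2 + 1 / 4 > 1 / 2; replacing both bases by the smaller
  one bounds the product by two translates of one integrable function.\<close>

lemma nn_integral_shifted_kernel_le:
  fixes s :: real
  assumes s: "s > 1 / 2"
  obtains C where "C < \<infinity>"
    "\<And>q. (\<integral>\<^sup>+\<beta>. ennreal ((1 + (\<beta> + q)\<^sup>2) powr - (s / 2) * \<bar>\<beta>\<bar> powr - (1 / 2)) \<partial>lborel) \<le> C"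
proof -
  define r where "r = s / 2 + 1 / 4"
  have r: "r > 1 / 2" using s by (simp add: r_def)
  define K where "K = (\<integral>\<^sup>+x. ennreal (if \<bar>x\<bar> \<le> 1 then \<bar>x\<bar> powr - (1 / 2) else \<bar>x\<bar> powr - 2) \<partial>(lborel :: real measure))"
  define C where "C = K + 2 * (japanese_const r + japanese_const r)"
  have "K < \<infinity>" unfolding K_def by (rule nn_integral_two_powers_finite) auto
  then have "C < \<infinity>" using japanese_const_finite[OF r] by (simp add: C_def ennreal_mult_less_top)
  moreover have "(\<integral>\<^sup>+\<beta>. ennreal ((1 + (\<beta> + q)\<^sup>2) powr - (s / 2) * \<bar>\<beta>\<bar> powr - (1 / 2)) \<partial>lborel) \<le> C" for q
  proof -
    have pt: "(1 + (\<beta> + q)\<^sup>2) powr - (s / 2) * \<bar>\<beta>\<bar> powr - (1 / 2) \<le>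
       (if \<bar>\<beta>\<bar> \<le> 1 then \<bar>\<beta>\<bar> powr - (1 / 2) else \<bar>\<beta>\<bar> powr - 2) + 2 * ((1 + (q + \<beta>)\<^sup>2) powr - r + (1 + \<beta>\<^sup>2) powr - r)" for \<beta>
    proof (cases "\<bar>\<beta>\<bar> \<le> 1")
      case True
      have "(1 + (\<beta> + q)\<^sup>2) powr - (s / 2) \<le> 1 powr - (s / 2)" using s by (intro powr_mono2') auto
      then have "(1 + (\<beta> + q)\<^sup>2) powr - (s / 2) * \<bar>\<beta>\<bar> powr - (1 / 2) \<le> 1 * \<bar>\<beta>\<bar> powr - (1 / 2)"
        by (intro mult_right_mono) auto
      then show ?thesis using True by (simp add: add_increasing2)
    next
      case False
      define A where "A = 1 + (\<beta> + q)\<^sup>2"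
      define B where "B = 1 + \<beta>\<^sup>2"
      have A: "A \<ge> 1" and B: "B \<ge> 1" by (simp_all add: A_def B_def)
      have "1 < \<beta>\<^sup>2" using False by (simp add: abs_le_square_iff[of \<beta> 1, simplified] not_le)
      then have "B / 2 \<le> \<beta>\<^sup>2" by (simp add: B_def)
      then have "(\<beta>\<^sup>2) powr - (1 / 4) \<le> (B / 2) powr - (1 / 4)" using B by (intro powr_mono2') auto
      also have "\<dots> = 2 powr (1 / 4) * B powr - (1 / 4)" using B by (simp add: powr_divide powr_minus field_simps)
      also have "\<dots> \<le> 2 * B powr - (1 / 4)"
      proof (rule mult_right_mono)
        have "2 powr (1 / 4) \<le> (2 :: real) powr 1" by (rule powr_mono) auto
        then show "2 powr (1 / 4) \<le> (2 :: real)" by simp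
      qed simp
      also have "(\<beta>\<^sup>2) powr - (1 / 4) = \<bar>\<beta>\<bar> powr - (1 / 2)"
        by (simp add: power2_powr)
      finally have "A powr - (s / 2) * \<bar>\<beta>\<bar> powr - (1 / 2) \<le> A powr - (s / 2) * (2 * B powr - (1 / 4))"
        by (intro mult_left_mono) auto
      also have "\<dots> = 2 * (A powr - (s / 2) * B powr - (1 / 4))" by simp
      also have "A powr - (s / 2) * B powr - (1 / 4) \<le> min A B powr - (s / 2) * min A B powr - (1 / 4)"
        using A B s by (intro mult_mono powr_mono2') auto
      also have "\<dots> = min A B powr - r" by (simp add: r_def flip: powr_add)
      also have "\<dots> \<le> A powr - r + B powr - r" by (simp add: min_def)
      finally have "A powr - (s / 2) * \<bar>\<beta>\<bar> powr - (1 / 2) \<le> 2 * (A powr - r + B powr - r)" by simp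
      moreover have "1 + (q + \<beta>)\<^sup>2 = A" by (simp add: A_def add.commute)
      moreover have "0 \<le> (if \<bar>\<beta>\<bar> \<le> 1 then \<bar>\<beta>\<bar> powr - (1 / 2) else \<bar>\<beta>\<bar> powr - 2)" by simp
      ultimately show ?thesis unfolding A_def[symmetric] B_def[symmetric] by simp
    qed
    have "(\<integral>\<^sup>+\<beta>. ennreal ((1 + (\<beta> + q)\<^sup>2) powr - (s / 2) * \<bar>\<beta>\<bar> powr - (1 / 2)) \<partial>lborel) \<le>
       (\<integral>\<^sup>+\<beta>. ennreal (if \<bar>\<beta>\<bar> \<le> 1 then \<bar>\<beta>\<bar> powr - (1 / 2) else \<bar>\<beta>\<bar> powr - 2) +
          2 * (ennreal ((1 + (q + \<beta>)\<^sup>2) powr - r) + ennreal ((1 + \<beta>\<^sup>2) powr - r)) \<partial>lborel)"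
    proof (rule nn_integral_mono)
      fix \<beta>
      have "ennreal ((if \<bar>\<beta>\<bar> \<le> 1 then \<bar>\<beta>\<bar> powr - (1 / 2) else \<bar>\<beta>\<bar> powr - 2) + 2 * ((1 + (q + \<beta>)\<^sup>2) powr - r + (1 + \<beta>\<^sup>2) powr - r)) =
        ennreal (if \<bar>\<beta>\<bar> \<le> 1 then \<bar>\<beta>\<bar> powr - (1 / 2) else \<bar>\<beta>\<bar> powr - 2) +
          2 * (ennreal ((1 + (q + \<beta>)\<^sup>2) powr - r) + ennreal ((1 + \<beta>\<^sup>2) powr - r))"
        by (simp add: ennreal_mult)
      then show "ennreal ((1 + (\<beta> + q)\<^sup>2) powr - (s / 2) * \<bar>\<beta>\<bar> powr - (1 / 2)) \<le>
         ennreal (if \<bar>\<beta>\<bar> \<le> 1 then \<bar>\<beta>\<bar> powr - (1 / 2) else \<bar>\<beta>\<bar> powr - 2) +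
          2 * (ennreal ((1 + (q + \<beta>)\<^sup>2) powr - r) + ennreal ((1 + \<beta>\<^sup>2) powr - r))"
        using ennreal_leI[OF pt[of \<beta>]] by simp
    qed
    also have "\<dots> = K + 2 * ((\<integral>\<^sup>+\<beta>. ennreal ((1 + (q + \<beta>)\<^sup>2) powr - r) \<partial>lborel) + japanese_const r)"
      by (simp add: nn_integral_add nn_integral_cmult K_def japanese_const_def)
    also have "(\<integral>\<^sup>+\<beta>. ennreal ((1 + (q + \<beta>)\<^sup>2) powr - r) \<partial>lborel) = japanese_const r"
      unfolding japanese_const_def by (rule nn_integral_lborel_shift[of "\<lambda>\<beta>. ennreal ((1 + \<beta>\<^sup>2) powr - r)" q]) measurable
    finally show ?thesis by (simp add: C_def)
  qed
  ultimately show thesis using that by blast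
qed

text \<open>D dominates the geometric mean of A and B. This splits powers of sums of squares into
  factors depending on one variable each.\<close>

lemma powr_sum_le_mult:
  fixes A B D q :: real
  assumes "A > 0" "B > 0" "A \<le> D" "B \<le> D" "q \<ge> 0"
  shows "D powr - q \<le> A powr - (q / 2) * B powr - (q / 2)"
proof -
  have "D powr - q = D powr - (q / 2) * D powr - (q / 2)" by (simp flip: powr_add)
  also have "\<dots> \<le> A powr - (q / 2) * B powr - (q / 2)"
    using assms by (intro mult_mono powr_mono2') auto
  finally show ?thesis .
qed

lemma nn_integral_product:
  fixes f g :: "real \<Rightarrow> ennreal"
  assumes [measurable]: "f \<in> borel_measurable borel" "g \<in> borel_measurable borel"
  shows "(\<integral>\<^sup>+\<gamma>. (\<integral>\<^sup>+\<beta>. f \<beta> * g \<gamma> \<partial>lborel) \<partial>lborel) = (\<integral>\<^sup>+\<beta>. f \<beta> \<partial>lborel) * (\<integral>\<^sup>+\<gamma>. g \<gamma> \<partial>lborel)"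
  by (simp add: nn_integral_multc nn_integral_cmult)

text \<open>Junk value: for \<open>\<beta> = 0\<close> or \<open>\<gamma> = 0\<close> the right-hand side is \<open>0\<close>, as \<open>0 powr a = 0\<close>.\<close>

lemma inverse_sqrt_sum_le:
  fixes \<beta> \<gamma> :: real
  assumes "\<beta> \<noteq> 0" "\<gamma> \<noteq> 0"
  shows "1 / sqrt (\<beta>\<^sup>2 + \<gamma>\<^sup>2) \<le> \<bar>\<beta>\<bar> powr - (1 / 2) * \<bar>\<gamma>\<bar> powr - (1 / 2)"
proof -
  have "\<bar>\<beta>\<bar> \<le> sqrt (\<beta>\<^sup>2 + \<gamma>\<^sup>2)" "\<bar>\<gamma>\<bar> \<le> sqrt (\<beta>\<^sup>2 + \<gamma>\<^sup>2)" by (auto intro!: real_le_rsqrt)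
  then have "sqrt (\<beta>\<^sup>2 + \<gamma>\<^sup>2) powr - 1 \<le> \<bar>\<beta>\<bar> powr - (1 / 2) * \<bar>\<gamma>\<bar> powr - (1 / 2)"
    using assms by (intro powr_sum_le_mult) auto
  then show ?thesis using assms by (simp add: powr_minus_divide)
qed

text \<open>The weight and the singularity are both distributed evenly over the two coordinates,
  which reduces the bound to the square of the one-dimensional one.\<close>

lemma planar_kernel_le:
  fixes s :: real
  assumes s: "s > 1 / 2"
  obtains C where "C < \<infinity>"
    "\<And>q q'. (\<integral>\<^sup>+\<gamma>. (\<integral>\<^sup>+\<beta>. ennreal ((1 + (\<beta> + q)\<^sup>2 + (\<gamma> + q')\<^sup>2) powr - s) / ennreal (sqrt (\<beta>\<^sup>2 + \<gamma>\<^sup>2)) \<partial>lborel) \<partial>lborel) \<le> C"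
proof -
  obtain C where C: "C < \<infinity>"
    "\<And>q. (\<integral>\<^sup>+\<beta>. ennreal ((1 + (\<beta> + q)\<^sup>2) powr - (s / 2) * \<bar>\<beta>\<bar> powr - (1 / 2)) \<partial>lborel) \<le> C"
    using nn_integral_shifted_kernel_le[OF s] by blast
  define f where "f q \<beta> = ennreal ((1 + (\<beta> + q)\<^sup>2) powr - (s / 2) * \<bar>\<beta>\<bar> powr - (1 / 2))" for q \<beta> :: real
  have [measurable]: "f q \<in> borel_measurable borel" for q unfolding f_def by measurable
  have "(\<integral>\<^sup>+\<gamma>. (\<integral>\<^sup>+\<beta>. ennreal ((1 + (\<beta> + q)\<^sup>2 + (\<gamma> + q')\<^sup>2) powr - s) / ennreal (sqrt (\<beta>\<^sup>2 + \<gamma>\<^sup>2)) \<partial>lborel) \<partial>lborel) \<le> C * C" for q q'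
  proof -
    have pt: "ennreal ((1 + (\<beta> + q)\<^sup>2 + (\<gamma> + q')\<^sup>2) powr - s) / ennreal (sqrt (\<beta>\<^sup>2 + \<gamma>\<^sup>2)) \<le> f q \<beta> * f q' \<gamma>"
      if nz: "\<beta> \<noteq> 0" "\<gamma> \<noteq> 0" for \<beta> \<gamma>
    proof -
      have "(1 + (\<beta> + q)\<^sup>2 + (\<gamma> + q')\<^sup>2) powr - s \<le> (1 + (\<beta> + q)\<^sup>2) powr - (s / 2) * (1 + (\<gamma> + q')\<^sup>2) powr - (s / 2)"
        using s by (intro powr_sum_le_mult) (auto intro!: add_pos_nonneg)
      then have "(1 + (\<beta> + q)\<^sup>2 + (\<gamma> + q')\<^sup>2) powr - s * (1 / sqrt (\<beta>\<^sup>2 + \<gamma>\<^sup>2)) \<le>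
         ((1 + (\<beta> + q)\<^sup>2) powr - (s / 2) * (1 + (\<gamma> + q')\<^sup>2) powr - (s / 2)) * (\<bar>\<beta>\<bar> powr - (1 / 2) * \<bar>\<gamma>\<bar> powr - (1 / 2))"
        using inverse_sqrt_sum_le[OF nz] by (intro mult_mono) auto
      then have "ennreal ((1 + (\<beta> + q)\<^sup>2 + (\<gamma> + q')\<^sup>2) powr - s / sqrt (\<beta>\<^sup>2 + \<gamma>\<^sup>2)) \<le>
         ennreal (((1 + (\<beta> + q)\<^sup>2) powr - (s / 2) * \<bar>\<beta>\<bar> powr - (1 / 2)) * ((1 + (\<gamma> + q')\<^sup>2) powr - (s / 2) * \<bar>\<gamma>\<bar> powr - (1 / 2)))"
        by (intro ennreal_leI) (simp add: ac_simps)
      moreover have "sqrt (\<beta>\<^sup>2 + \<gamma>\<^sup>2) > 0" using nz by (simp add: add_pos_pos)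
      ultimately show ?thesis by (simp add: f_def divide_ennreal ennreal_mult)
    qed
    have "(\<integral>\<^sup>+\<gamma>. (\<integral>\<^sup>+\<beta>. ennreal ((1 + (\<beta> + q)\<^sup>2 + (\<gamma> + q')\<^sup>2) powr - s) / ennreal (sqrt (\<beta>\<^sup>2 + \<gamma>\<^sup>2)) \<partial>lborel) \<partial>lborel) \<le>
      (\<integral>\<^sup>+\<gamma>. (\<integral>\<^sup>+\<beta>. f q \<beta> * f q' \<gamma> \<partial>lborel) \<partial>lborel)"
    proof (rule nn_integral_mono_AE, use AE_lborel_neq[of "0 :: real"] in eventually_elim)
      case (elim \<gamma>)
      then show ?case
        using AE_lborel_neq[of "0 :: real"] pt by (intro nn_integral_mono_AE) auto
    qed
    also have "\<dots> = (\<integral>\<^sup>+\<beta>. f q \<beta> \<partial>lborel) * (\<integral>\<^sup>+\<gamma>. f q' \<gamma> \<partial>lborel)" by (rule nn_integral_product) measurable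
    also have "\<dots> \<le> C * C" unfolding f_def by (intro mult_mono C) auto
    finally show ?thesis .
  qed
  moreover have "C * C < \<infinity>" using C(1) by (simp add: ennreal_mult_less_top)
  ultimately show thesis using that by blast
qed

text \<open>By scaling, the integral of (t^2 + |b|^2)^(-(s + 1/2)) over a plane is proportional to
  |t|^(1 - 2s), which the prefactor compensates; hence the bound does not depend on t. Each
  coordinate takes half of both powers.\<close>

lemma planar_power_kernel_le:
  fixes s t :: real
  assumes s: "s > 1 / 2" and t: "t \<noteq> 0"
  shows "(\<integral>\<^sup>+\<gamma>. (\<integral>\<^sup>+\<beta>. ennreal (\<bar>t\<bar> powr (2 * s - 1) * (t\<^sup>2 + (\<beta> + q)\<^sup>2 + (\<gamma> + q')\<^sup>2) powr - (s + 1 / 2)) \<partial>lborel) \<partial>lborel)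
    \<le> japanese_const ((s + 1 / 2) / 2) * japanese_const ((s + 1 / 2) / 2)"
proof -
  define r where "r = (s + 1 / 2) / 2"
  define f where "f q \<beta> = ennreal (\<bar>t\<bar> powr (s - 1 / 2) * (t\<^sup>2 + (q + \<beta>)\<^sup>2) powr - r)" for q \<beta> :: real
  have [measurable]: "f q \<in> borel_measurable borel" for q unfolding f_def by measurable
  have f: "(\<integral>\<^sup>+\<beta>. f q \<beta> \<partial>lborel) = japanese_const r" for q
  proof -
    have "(\<integral>\<^sup>+\<beta>. f q \<beta> \<partial>lborel) = (\<integral>\<^sup>+\<beta>. f 0 (q + \<beta>) \<partial>lborel)" by (simp add: f_def)
    also have "\<dots> = (\<integral>\<^sup>+\<beta>. f 0 \<beta> \<partial>lborel)" by (rule nn_integral_lborel_shift) measurable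
    also have "\<dots> = ennreal \<bar>t\<bar> * (\<integral>\<^sup>+\<beta>. f 0 (0 + t * \<beta>) \<partial>lborel)"
      by (rule nn_integral_real_affine) (use t in auto)
    also have "\<dots> = (\<integral>\<^sup>+\<beta>. ennreal \<bar>t\<bar> * f 0 (0 + t * \<beta>) \<partial>lborel)" by (rule nn_integral_cmult[symmetric]) measurable
    also have "\<dots> = japanese_const r" unfolding japanese_const_def
    proof (rule nn_integral_cong)
      fix \<beta> :: real
      have "t\<^sup>2 + (0 + (0 + t * \<beta>))\<^sup>2 = t\<^sup>2 * (1 + \<beta>\<^sup>2)" by (simp add: power_mult_distrib algebra_simps)
      moreover have "(t\<^sup>2 * (1 + \<beta>\<^sup>2)) powr - r = (t\<^sup>2) powr - r * (1 + \<beta>\<^sup>2) powr - r" by (rule powr_mult)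
      moreover have "(t\<^sup>2) powr - r = \<bar>t\<bar> powr - (s + 1 / 2)"
        unfolding power2_powr by (rule arg_cong[where f="\<lambda>z. \<bar>t\<bar> powr z"]) (simp add: r_def field_simps)
      moreover have "\<bar>t\<bar> * (\<bar>t\<bar> powr (s - 1 / 2) * \<bar>t\<bar> powr - (s + 1 / 2)) = 1"
      proof -
        have "\<bar>t\<bar> powr (s - 1 / 2) * \<bar>t\<bar> powr - (s + 1 / 2) = \<bar>t\<bar> powr - 1" by (simp flip: powr_add)
        then show ?thesis using t by (simp add: powr_minus_divide)
      qed
      ultimately have "\<bar>t\<bar> * (\<bar>t\<bar> powr (s - 1 / 2) * (t\<^sup>2 + (0 + (0 + t * \<beta>))\<^sup>2) powr - r) = (1 + \<beta>\<^sup>2) powr - r"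
        by (metis mult.assoc mult_1)
      then show "ennreal \<bar>t\<bar> * f 0 (0 + t * \<beta>) = ennreal ((1 + \<beta>\<^sup>2) powr - r)"
        unfolding f_def by (subst ennreal_mult[symmetric]) auto
    qed
    finally show ?thesis .
  qed
  have "(\<integral>\<^sup>+\<gamma>. (\<integral>\<^sup>+\<beta>. ennreal (\<bar>t\<bar> powr (2 * s - 1) * (t\<^sup>2 + (\<beta> + q)\<^sup>2 + (\<gamma> + q')\<^sup>2) powr - (s + 1 / 2)) \<partial>lborel) \<partial>lborel) \<le>
     (\<integral>\<^sup>+\<gamma>. (\<integral>\<^sup>+\<beta>. f q \<beta> * f q' \<gamma> \<partial>lborel) \<partial>lborel)"
  proof (intro nn_integral_mono)
    fix \<beta> \<gamma> :: real
    have "(t\<^sup>2 + (\<beta> + q)\<^sup>2 + (\<gamma> + q')\<^sup>2) powr - (s + 1 / 2) \<le> (t\<^sup>2 + (q + \<beta>)\<^sup>2) powr - r * (t\<^sup>2 + (q' + \<gamma>)\<^sup>2) powr - r"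
      unfolding r_def using s t by (intro powr_sum_le_mult) (auto intro!: add_pos_nonneg simp: add.commute)
    moreover have "\<bar>t\<bar> powr (2 * s - 1) = \<bar>t\<bar> powr (s - 1 / 2) * \<bar>t\<bar> powr (s - 1 / 2)" by (simp flip: powr_add)
    ultimately have "\<bar>t\<bar> powr (2 * s - 1) * (t\<^sup>2 + (\<beta> + q)\<^sup>2 + (\<gamma> + q')\<^sup>2) powr - (s + 1 / 2) \<le>
       (\<bar>t\<bar> powr (s - 1 / 2) * \<bar>t\<bar> powr (s - 1 / 2)) * ((t\<^sup>2 + (q + \<beta>)\<^sup>2) powr - r * (t\<^sup>2 + (q' + \<gamma>)\<^sup>2) powr - r)"
      by (metis mult_left_mono powr_ge_zero mult_nonneg_nonneg)
    then show "ennreal (\<bar>t\<bar> powr (2 * s - 1) * (t\<^sup>2 + (\<beta> + q)\<^sup>2 + (\<gamma> + q')\<^sup>2) powr - (s + 1 / 2)) \<le> f q \<beta> * f q' \<gamma>"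
      unfolding f_def by (subst ennreal_mult[symmetric]) (auto intro!: ennreal_leI simp: ac_simps)
  qed
  also have "\<dots> = (\<integral>\<^sup>+\<beta>. f q \<beta> \<partial>lborel) * (\<integral>\<^sup>+\<gamma>. f q' \<gamma> \<partial>lborel)" by (rule nn_integral_product) measurable
  finally show ?thesis by (simp add: f r_def)
qed

text \<open>The exponent 2 s - 1 at the origin requires s < 1, the exponent 4 s - 1 at infinity
  requires s > 1/2.\<close>

lemma nn_integral_directional_kernel_finite:
  fixes s :: real
  assumes "1 / 2 < s" "s < 1"
  shows "(\<integral>\<^sup>+x. ennreal (\<bar>x\<bar> powr (1 - 2 * s) * (1 + x\<^sup>2) powr - s) \<partial>lborel) < \<infinity>"
proof (rule nn_integral_finite_by_powers)
  show "2 * s - 1 < 1" "1 < 4 * s - 1" using assms by auto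
  show "\<bar>x\<bar> powr (1 - 2 * s) * (1 + x\<^sup>2) powr - s \<le> \<bar>x\<bar> powr - (2 * s - 1)" for x
  proof -
    have "(1 + x\<^sup>2) powr - s \<le> 1 powr - s" using assms by (intro powr_mono2') auto
    then have "\<bar>x\<bar> powr (1 - 2 * s) * (1 + x\<^sup>2) powr - s \<le> \<bar>x\<bar> powr (1 - 2 * s) * 1" by (intro mult_left_mono) auto
    then show ?thesis by simp
  qed
  show "\<bar>x\<bar> powr (1 - 2 * s) * (1 + x\<^sup>2) powr - s \<le> \<bar>x\<bar> powr - (4 * s - 1)" if "1 < \<bar>x\<bar>" for x
  proof -
    have "(1 + x\<^sup>2) powr - s \<le> (x\<^sup>2) powr - s" using assms that by (intro powr_mono2') auto
    then have "\<bar>x\<bar> powr (1 - 2 * s) * (1 + x\<^sup>2) powr - s \<le> \<bar>x\<bar> powr (1 - 2 * s) * \<bar>x\<bar> powr (- 2 * s)"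
      by (intro mult_left_mono) (auto simp: power2_powr)
    also have "\<dots> = \<bar>x\<bar> powr - (4 * s - 1)" by (simp flip: powr_add)
    finally show ?thesis .
  qed
qed

section \<open>Bounds for the collision integral of non-negative functions\<close>

lemma bracket_ge_1: "bracket x \<ge> 1"
  by (simp add: bracket_def)

lemma bracket_pos [simp]: "bracket x > 0" "bracket x \<noteq> 0" "bracket x \<ge> 0"
  using bracket_ge_1[of x] by auto

lemma bracket_measurable [measurable]: "bracket \<in> borel_measurable borel"
  unfolding bracket_def[abs_def] by measurable

lemma bracket_powr: "bracket x powr a = (1 + (norm x)\<^sup>2) powr (a / 2)"
proof -
  have "(1 + (norm x)\<^sup>2) powr (a / 2) = ((bracket x)\<^sup>2) powr (a / 2)" by (simp add: bracket_def)
  then show ?thesis by (simp add: power2_powr)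
qed

lemma norm_le_bracket: "norm x \<le> bracket x"
  unfolding bracket_def by (rule real_le_rsqrt) simp

lemma p2_of_measurable [measurable (raw)]:
  assumes [measurable]: "f \<in> borel_measurable M" "g \<in> borel_measurable M" "h \<in> borel_measurable M"
  shows "(\<lambda>x. p2_of (f x) (g x) (h x)) \<in> borel_measurable M"
    and "(\<lambda>x. p3_of (f x) (g x) (h x)) \<in> borel_measurable M"
  unfolding p2_of_def p3_of_def by measurable

section \<open>The collision integral with values in [0, \<infinity>]\<close>

lemma nn_integral_swap_sph:
  fixes F :: "'a::euclidean_space \<Rightarrow> real^3 \<Rightarrow> ennreal"
  assumes "(\<lambda>(x, y). F x y) \<in> borel_measurable (borel \<Otimes>\<^sub>M borel)"
  shows "(\<integral>\<^sup>+x. (\<integral>\<^sup>+y. F x y \<partial>sph) \<partial>lborel) = (\<integral>\<^sup>+y. (\<integral>\<^sup>+x. F x y \<partial>lborel) \<partial>sph)"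
proof -
  interpret pair_sigma_finite "lborel :: 'a measure" sph ..
  show ?thesis
  proof (rule Fubini'[symmetric])
    show "(\<lambda>(x, y). F x y) \<in> borel_measurable (lborel \<Otimes>\<^sub>M sph)" using assms by measurable
  qed
qed

text \<open>Declared for the measurability prover, this inserts measurable arguments into an
  abstract integrand of three momenta.\<close>

lemma measurable_triple:
  assumes [measurable]: "(\<lambda>(a, b, c). \<Phi> a b c) \<in> borel_measurable (A \<Otimes>\<^sub>M B \<Otimes>\<^sub>M C)"
    "f \<in> measurable M A" "g \<in> measurable M B" "h \<in> measurable M C"
  shows "(\<lambda>x. \<Phi> (f x) (g x) (h x)) \<in> borel_measurable M"
  using measurable_compose[of "\<lambda>x. (f x, g x, h x)" M "A \<Otimes>\<^sub>M B \<Otimes>\<^sub>M C" "\<lambda>(a, b, c). \<Phi> a b c" borel] by simp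

text \<open>The \<nu>-integral in the coordinates (p1, \<phi>) without the factor
  \<open>sph_const / 8\<close>, taken in \<open>ennreal\<close> so that it is meaningful before
  integrability is known.\<close>

definition coll :: "real^3 \<Rightarrow> (real^3 \<Rightarrow> real^3 \<Rightarrow> real^3 \<Rightarrow> ennreal) \<Rightarrow> ennreal" where
  "coll p \<Phi> = (\<integral>\<^sup>+p1. (\<integral>\<^sup>+\<phi>. ennreal (norm (p - p1)) * \<Phi> p1 (p2_of p p1 \<phi>) (p3_of p p1 \<phi>) \<partial>sph) \<partial>lborel)"

lemma coll_mono: "(\<And>a b c. \<Phi> a b c \<le> \<Psi> a b c) \<Longrightarrow> coll p \<Phi> \<le> coll p \<Psi>"
  unfolding coll_def by (intro nn_integral_mono mult_left_mono) auto

lemma coll_add: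
  assumes "(\<lambda>(a, b, c). \<Phi> a b c) \<in> borel_measurable (borel \<Otimes>\<^sub>M borel \<Otimes>\<^sub>M borel)"
    "(\<lambda>(a, b, c). \<Psi> a b c) \<in> borel_measurable (borel \<Otimes>\<^sub>M borel \<Otimes>\<^sub>M borel)"
  shows "coll p (\<lambda>a b c. \<Phi> a b c + \<Psi> a b c) = coll p \<Phi> + coll p \<Psi>"
  supply measurable_triple[OF assms(1), measurable (raw)] measurable_triple[OF assms(2), measurable (raw)]
  unfolding coll_def by (simp add: distrib_left nn_integral_add)

lemma coll_cmult:
  assumes "(\<lambda>(a, b, c). \<Phi> a b c) \<in> borel_measurable (borel \<Otimes>\<^sub>M borel \<Otimes>\<^sub>M borel)"
  shows "coll p (\<lambda>a b c. C * \<Phi> a b c) = C * coll p \<Phi>"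
proof -
  note [measurable (raw)] = measurable_triple[OF assms]
  have "ennreal (norm (p - p1)) * (C * \<Phi> a b c) = C * (ennreal (norm (p - p1)) * \<Phi> a b c)" for p1 a b c
    by (rule mult.left_commute)
  then show ?thesis unfolding coll_def by (simp add: nn_integral_cmult)
qed

lemma coll_shift:
  assumes "(\<lambda>(a, b, c). \<Phi> a b c) \<in> borel_measurable (borel \<Otimes>\<^sub>M borel \<Otimes>\<^sub>M borel)"
  shows "coll p \<Phi> = (\<integral>\<^sup>+w. (\<integral>\<^sup>+\<phi>. ennreal (norm w) * \<Phi> (p + w) (p + (w /\<^sub>R 2 + (norm w / 2) *\<^sub>R \<phi>))
     (p + (w /\<^sub>R 2 - (norm w / 2) *\<^sub>R \<phi>)) \<partial>sph) \<partial>lborel)"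
proof -
  note [measurable (raw)] = measurable_triple[OF assms]
  define F where "F p1 = (\<integral>\<^sup>+\<phi>. ennreal (norm (p - p1)) * \<Phi> p1 (p2_of p p1 \<phi>) (p3_of p p1 \<phi>) \<partial>sph)" for p1
  have [measurable]: "F \<in> borel_measurable borel" unfolding F_def by measurable
  have half: "(p + (p + w)) /\<^sub>R 2 = p + w /\<^sub>R 2" for w by (simp add: vec_eq_iff field_simps)
  have "coll p \<Phi> = (\<integral>\<^sup>+w. F (p + w) \<partial>lborel)"
    unfolding coll_def F_def[symmetric] by (rule nn_integral_lborel_shift[symmetric]) measurable
  moreover have "norm (p - (p + w)) = norm w" for w by simp
  moreover have "p2_of p (p + w) \<phi> = p + (w /\<^sub>R 2 + (norm w / 2) *\<^sub>R \<phi>)" "p3_of p (p + w) \<phi> = p + (w /\<^sub>R 2 - (norm w / 2) *\<^sub>R \<phi>)" for w \<phi>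
    unfolding p2_of_def p3_of_def half by (simp_all only: \<open>\<And>w. norm (p - (p + w)) = norm w\<close> add.assoc add_diff_eq)
  ultimately show ?thesis unfolding F_def by (simp only:)
qed

text \<open>Replacing \<phi> by -\<phi> exchanges the antipodal points p2 and p3.\<close>

lemma coll_swap23:
  assumes "(\<lambda>(a, b, c). \<Phi> a b c) \<in> borel_measurable (borel \<Otimes>\<^sub>M borel \<Otimes>\<^sub>M borel)"
  shows "coll p (\<lambda>a b c. \<Phi> a c b) = coll p \<Phi>"
  supply measurable_triple[OF assms, measurable (raw)]
  unfolding coll_def
proof (rule nn_integral_cong)
  fix p1
  have "p2_of p p1 (- \<phi>) = p3_of p p1 \<phi>" "p3_of p p1 (- \<phi>) = p2_of p p1 \<phi>" for \<phi>
    by (simp_all add: p2_of_def p3_of_def)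
  then show "(\<integral>\<^sup>+\<phi>. ennreal (norm (p - p1)) * \<Phi> p1 (p3_of p p1 \<phi>) (p2_of p p1 \<phi>) \<partial>sph) =
    (\<integral>\<^sup>+\<phi>. ennreal (norm (p - p1)) * \<Phi> p1 (p2_of p p1 \<phi>) (p3_of p p1 \<phi>) \<partial>sph)"
    using nn_integral_sph_uminus[of "\<lambda>\<phi>. ennreal (norm (p - p1)) * \<Phi> p1 (p2_of p p1 \<phi>) (p3_of p p1 \<phi>)"] by simp
qed

lemma coll_le_directions:
  assumes "(\<lambda>(a, b, c). \<Phi> a b c) \<in> borel_measurable (borel \<Otimes>\<^sub>M borel \<Otimes>\<^sub>M borel)"
  shows "coll p \<Phi> \<le> 12 * (\<integral>\<^sup>+\<psi>. (\<integral>\<^sup>+w. ennreal \<bar>w \<bullet> \<psi>\<bar> *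
     \<Phi> (p + w) (p + (w \<bullet> \<psi>) *\<^sub>R \<psi>) (p + (w - (w \<bullet> \<psi>) *\<^sub>R \<psi>)) \<partial>lborel) \<partial>sph)"
proof -
  note [measurable (raw)] = measurable_triple[OF assms]
  have half: "w - (w /\<^sub>R 2 + x) = w /\<^sub>R 2 - x" for w x :: "real^3" by (simp add: vec_eq_iff field_simps)
  have "coll p \<Phi> \<le> (\<integral>\<^sup>+w. 12 * (\<integral>\<^sup>+\<psi>. ennreal \<bar>w \<bullet> \<psi>\<bar> *
     \<Phi> (p + w) (p + (w \<bullet> \<psi>) *\<^sub>R \<psi>) (p + (w - (w \<bullet> \<psi>) *\<^sub>R \<psi>)) \<partial>sph) \<partial>lborel)"
    unfolding coll_shift[OF assms]
  proof (rule nn_integral_mono)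
    fix w
    have "(\<lambda>a. \<Phi> (p + w) (p + a) (p + (w - a))) \<in> borel_measurable borel" by measurable
    from nn_integral_inscribed_le[OF this, of w]
    show "(\<integral>\<^sup>+\<phi>. ennreal (norm w) * \<Phi> (p + w) (p + (w /\<^sub>R 2 + (norm w / 2) *\<^sub>R \<phi>)) (p + (w /\<^sub>R 2 - (norm w / 2) *\<^sub>R \<phi>)) \<partial>sph)
      \<le> 12 * (\<integral>\<^sup>+\<psi>. ennreal \<bar>w \<bullet> \<psi>\<bar> * \<Phi> (p + w) (p + (w \<bullet> \<psi>) *\<^sub>R \<psi>) (p + (w - (w \<bullet> \<psi>) *\<^sub>R \<psi>)) \<partial>sph)"
      by (simp only: half)
  qed
  also have "\<dots> = 12 * (\<integral>\<^sup>+w. (\<integral>\<^sup>+\<psi>. ennreal \<bar>w \<bullet> \<psi>\<bar> *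
     \<Phi> (p + w) (p + (w \<bullet> \<psi>) *\<^sub>R \<psi>) (p + (w - (w \<bullet> \<psi>) *\<^sub>R \<psi>)) \<partial>sph) \<partial>lborel)"
    by (rule nn_integral_cmult) measurable
  also have "(\<integral>\<^sup>+w. (\<integral>\<^sup>+\<psi>. ennreal \<bar>w \<bullet> \<psi>\<bar> * \<Phi> (p + w) (p + (w \<bullet> \<psi>) *\<^sub>R \<psi>) (p + (w - (w \<bullet> \<psi>) *\<^sub>R \<psi>)) \<partial>sph) \<partial>lborel) =
     (\<integral>\<^sup>+\<psi>. (\<integral>\<^sup>+w. ennreal \<bar>w \<bullet> \<psi>\<bar> * \<Phi> (p + w) (p + (w \<bullet> \<psi>) *\<^sub>R \<psi>) (p + (w - (w \<bullet> \<psi>) *\<^sub>R \<psi>)) \<partial>lborel) \<partial>sph)"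
    by (rule nn_integral_swap_sph) measurable
  finally show ?thesis .
qed

text \<open>A weighted arithmetic-geometric mean inequality. The parameter \<open>l\<close> is optimised after integration,
  which replaces the Cauchy--Schwarz inequality.\<close>

lemma weighted_amgm_ennreal:
  fixes g h k l :: real
  assumes nn: "g \<ge> 0" "h \<ge> 0" "k \<ge> 0" and l: "l > 0"
    and XY: "X = \<infinity> \<or> Y = \<infinity> \<or> X * Y \<ge> ennreal (k\<^sup>2)"
  shows "ennreal (g * h * k) \<le> ennreal l * (ennreal (g\<^sup>2) * X) + ennreal (1 / l) * (ennreal (h\<^sup>2) * Y)"
proof (cases "g = 0 \<or> h = 0")
  case True
  then show ?thesis by auto
next
  case False
  then have gh: "g > 0" "h > 0" using nn by auto
  consider "X = \<infinity>" | "Y = \<infinity>" | "X \<noteq> \<infinity>" "Y \<noteq> \<infinity>" "X * Y \<ge> ennreal (k\<^sup>2)" using XY by blast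
  then show ?thesis
  proof cases
    case 1
    then show ?thesis using gh l by (simp add: ennreal_mult_top)
  next
    case 2
    then show ?thesis using gh l by (simp add: ennreal_mult_top)
  next
    case 3
    then obtain x y where x: "X = ennreal x" "x \<ge> 0" and y: "Y = ennreal y" "y \<ge> 0"
      by (cases X; cases Y) auto
    have "k\<^sup>2 \<le> x * y" using 3(3) x y by (simp add: ennreal_mult[symmetric])
    define u where "u = l * (g\<^sup>2 * x)"
    define v where "v = 1 / l * (h\<^sup>2 * y)"
    have uv: "u \<ge> 0" "v \<ge> 0" using x y l by (simp_all add: u_def v_def)
    have "(g * h * k)\<^sup>2 = (g\<^sup>2 * h\<^sup>2) * k\<^sup>2" by (simp add: power_mult_distrib)
    also have "\<dots> \<le> (g\<^sup>2 * h\<^sup>2) * (x * y)" using \<open>k\<^sup>2 \<le> x * y\<close> by (intro mult_left_mono) auto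
    also have "\<dots> = u * v" using l by (simp add: u_def v_def)
    also have "\<dots> \<le> (u + v)\<^sup>2" using uv by (simp add: power2_sum)
    finally have "g * h * k \<le> u + v" by (rule power2_le_imp_le) (use uv in simp)
    then have "ennreal (g * h * k) \<le> ennreal u + ennreal v" using uv by (simp add: ennreal_leI flip: ennreal_plus)
    also have "ennreal u + ennreal v = ennreal l * (ennreal (g\<^sup>2) * X) + ennreal (1 / l) * (ennreal (h\<^sup>2) * Y)"
      unfolding u_def v_def x(1) y(1) using x(2) y(2) l
      by (intro arg_cong2[where f="(+)"]) (subst ennreal_mult, simp, simp, subst ennreal_mult, simp, simp, rule refl)+
    finally show ?thesis .
  qed
qed

text \<open>The minimum of l a + b / l is at l = sqrt(b / a). If only one of a and b is 0, the
  infimum is approached but not attained, hence the \<epsilon> of room.\<close>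

lemma ennreal_optimize:
  fixes a b :: real
  assumes ab: "a \<ge> 0" "b \<ge> 0" and I: "\<And>l. l > 0 \<Longrightarrow> I \<le> ennreal l * ennreal a + ennreal (1 / l) * ennreal b"
  shows "I \<le> ennreal (2 * sqrt (a * b))"
proof (rule ennreal_le_epsilon)
  fix e :: real assume e: "e > 0"
  have "I \<le> ennreal (l * a + b / l)" if "l > 0" for l
    using I[OF that] ab that by (simp add: ennreal_mult[symmetric] flip: ennreal_plus)
  moreover have "\<exists>l>0. l * a + b / l \<le> 2 * sqrt (a * b) + e"
  proof (cases "a = 0")
    case True
    define l where "l = (b + 1) / e"
    have "b / l \<le> e" using ab e by (simp add: l_def field_simps)
    then show ?thesis using True ab e by (intro exI[of _ l]) (auto simp: l_def)
  next
    case False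
    show ?thesis
    proof (cases "b = 0")
      case True
      then show ?thesis using False ab e by (intro exI[of _ "e / a"]) auto
    next
      case b0: False
      then have p: "a > 0" "b > 0" using ab False by auto
      define l where "l = sqrt b / sqrt a"
      have "l * a = sqrt (a * b)" "b / l = sqrt (a * b)"
        using p by (simp_all add: l_def real_sqrt_mult field_simps)
      then show ?thesis using p e by (intro exI[of _ l]) (auto simp: l_def)
    qed
  qed
  ultimately obtain l where "I \<le> ennreal (l * a + b / l)" "l * a + b / l \<le> 2 * sqrt (a * b) + e" by blast
  then have "I \<le> ennreal (2 * sqrt (a * b) + e)" by (meson ennreal_leI order_trans)
  then show "I \<le> ennreal (2 * sqrt (a * b)) + ennreal e" using e ab by simp
qed

definition wnorm2 :: "real \<Rightarrow> (real^3 \<Rightarrow> real) \<Rightarrow> ennreal" where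
  "wnorm2 s f = (\<integral>\<^sup>+x. ennreal ((bracket x powr s * f x)\<^sup>2) \<partial>lborel)"

lemma wnorm2_mono:
  assumes "s \<le> s'"
  shows "wnorm2 s f \<le> wnorm2 s' f"
  unfolding wnorm2_def
proof (intro nn_integral_mono ennreal_leI)
  fix x
  have "bracket x powr s \<le> bracket x powr s'" using assms bracket_ge_1 by (intro powr_mono) auto
  then have "(bracket x powr s)\<^sup>2 \<le> (bracket x powr s')\<^sup>2" by (intro power_mono) auto
  then show "(bracket x powr s * f x)\<^sup>2 \<le> (bracket x powr s' * f x)\<^sup>2"
    unfolding power_mult_distrib by (rule mult_right_mono) simp
qed

section \<open>The integral of g(p2) h(p3)\<close>

lemma bracket_planar_le:
  fixes p :: "real^3"
  assumes n: "norm e2 = 1" "norm e3 = 1" and o: "e2 \<bullet> e3 = 0" "e \<bullet> e2 = 0" "e \<bullet> e3 = 0" "norm e = 1"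
    and ex: "\<And>x. x = (x \<bullet> e) *\<^sub>R e + (x \<bullet> e2) *\<^sub>R e2 + (x \<bullet> e3) *\<^sub>R e3"
  shows "(norm (p + (\<beta> *\<^sub>R e2 + \<gamma> *\<^sub>R e3) + r *\<^sub>R e))\<^sup>2 = (p \<bullet> e + r)\<^sup>2 + (\<beta> + p \<bullet> e2)\<^sup>2 + (\<gamma> + p \<bullet> e3)\<^sup>2"
proof -
  have sq: "e2 \<bullet> e2 = 1" "e3 \<bullet> e3 = 1" "e \<bullet> e = 1" using n o by (simp_all add: dot_square_norm)
  have o': "e2 \<bullet> e = 0" "e3 \<bullet> e = 0" "e3 \<bullet> e2 = 0" using o by (simp_all add: inner_commute)
  define a b c where "a = p \<bullet> e + r" and "b = \<beta> + p \<bullet> e2" and "c = \<gamma> + p \<bullet> e3"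
  have 1: "p + (\<beta> *\<^sub>R e2 + \<gamma> *\<^sub>R e3) + r *\<^sub>R e = a *\<^sub>R e + b *\<^sub>R e2 + c *\<^sub>R e3"
    by (subst ex[of p]) (simp add: a_def b_def c_def algebra_simps)
  have 2: "(a *\<^sub>R e + b *\<^sub>R e2 + c *\<^sub>R e3) \<bullet> (a *\<^sub>R e + b *\<^sub>R e2 + c *\<^sub>R e3) = a * a + b * b + c * c"
    by (simp add: inner_add_left inner_add_right sq o o')
  show ?thesis unfolding power2_norm_eq_inner 1 2 by (simp add: a_def b_def c_def power2_eq_square)
qed

lemma norm_planar:
  fixes e2 :: "real^3"
  assumes n: "norm e2 = 1" "norm e3 = 1" and o: "e2 \<bullet> e3 = 0"
  shows "norm (\<beta> *\<^sub>R e2 + \<gamma> *\<^sub>R e3) = sqrt (\<beta>\<^sup>2 + \<gamma>\<^sup>2)"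
proof -
  have sq: "e2 \<bullet> e2 = 1" "e3 \<bullet> e3 = 1" using n by (simp_all add: dot_square_norm)
  have "(\<beta> *\<^sub>R e2 + \<gamma> *\<^sub>R e3) \<bullet> (\<beta> *\<^sub>R e2 + \<gamma> *\<^sub>R e3) = \<beta>\<^sup>2 + \<gamma>\<^sup>2"
    using o by (simp add: inner_add_left inner_add_right sq inner_commute[of e3 e2] power2_eq_square)
  then show ?thesis by (simp add: norm_eq_sqrt_inner)
qed

lemma plane_integral_kernel_le:
  fixes s :: real
  assumes s: "s > 1 / 2"
  obtains A where "A < \<infinity>"
    "\<And>(p :: real^3) \<psi>. norm \<psi> = 1 \<Longrightarrow> (\<integral>\<^sup>+x. indicator {0..1} (x \<bullet> \<psi>) *
       (ennreal (bracket (p + (x - (x \<bullet> \<psi>) *\<^sub>R \<psi>)) powr (- 2 * s)) / ennreal (norm (x - (x \<bullet> \<psi>) *\<^sub>R \<psi>))) \<partial>lborel) \<le> A"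
proof -
  obtain C where C: "C < \<infinity>"
    "\<And>q q'. (\<integral>\<^sup>+\<gamma>. (\<integral>\<^sup>+\<beta>. ennreal ((1 + (\<beta> + q)\<^sup>2 + (\<gamma> + q')\<^sup>2) powr - s) / ennreal (sqrt (\<beta>\<^sup>2 + \<gamma>\<^sup>2)) \<partial>lborel) \<partial>lborel) \<le> C"
    using planar_kernel_le[OF s] by blast
  have "(\<integral>\<^sup>+x. indicator {0..1} (x \<bullet> \<psi>) *
       (ennreal (bracket (p + (x - (x \<bullet> \<psi>) *\<^sub>R \<psi>)) powr (- 2 * s)) / ennreal (norm (x - (x \<bullet> \<psi>) *\<^sub>R \<psi>))) \<partial>lborel) \<le> ball_vol * C"
    if psi: "norm \<psi> = 1" for p \<psi> :: "real^3"
  proof -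
    obtain e2 e3 where fr: "norm e2 = 1" "norm e3 = 1" "\<psi> \<bullet> e2 = 0" "\<psi> \<bullet> e3 = 0" "e2 \<bullet> e3 = 0"
      "\<And>x. x = (x \<bullet> \<psi>) *\<^sub>R \<psi> + (x \<bullet> e2) *\<^sub>R e2 + (x \<bullet> e3) *\<^sub>R e3" using orthonormal_frame[OF psi] by metis
    define K where "K b = ennreal (bracket (p + b) powr (- 2 * s)) / ennreal (norm b)" for b
    have "(\<integral>\<^sup>+x. indicator {0..1} (x \<bullet> \<psi>) * K (x - (x \<bullet> \<psi>) *\<^sub>R \<psi>) \<partial>lborel) \<le>
       ball_vol * (\<integral>\<^sup>+\<gamma>. (\<integral>\<^sup>+\<beta>. K (\<beta> *\<^sub>R e2 + \<gamma> *\<^sub>R e3) \<partial>lborel) \<partial>lborel)"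
      by (rule nn_integral_plane_le[OF _ psi fr]) (simp add: K_def)
    also have "(\<integral>\<^sup>+\<gamma>. (\<integral>\<^sup>+\<beta>. K (\<beta> *\<^sub>R e2 + \<gamma> *\<^sub>R e3) \<partial>lborel) \<partial>lborel) \<le>
       (\<integral>\<^sup>+\<gamma>. (\<integral>\<^sup>+\<beta>. ennreal ((1 + (\<beta> + p \<bullet> e2)\<^sup>2 + (\<gamma> + p \<bullet> e3)\<^sup>2) powr - s) / ennreal (sqrt (\<beta>\<^sup>2 + \<gamma>\<^sup>2)) \<partial>lborel) \<partial>lborel)"
    proof (intro nn_integral_mono)
      fix \<beta> \<gamma>
      have "(norm (p + (\<beta> *\<^sub>R e2 + \<gamma> *\<^sub>R e3)))\<^sup>2 = (p \<bullet> \<psi>)\<^sup>2 + (\<beta> + p \<bullet> e2)\<^sup>2 + (\<gamma> + p \<bullet> e3)\<^sup>2"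
        using bracket_planar_le[of e2 e3 \<psi> p \<beta> \<gamma> 0] fr psi by simp
      then have "bracket (p + (\<beta> *\<^sub>R e2 + \<gamma> *\<^sub>R e3)) powr (- 2 * s) \<le> (1 + (\<beta> + p \<bullet> e2)\<^sup>2 + (\<gamma> + p \<bullet> e3)\<^sup>2) powr - s"
        unfolding bracket_powr using s by (auto intro!: powr_mono2' add_pos_nonneg)
      then show "K (\<beta> *\<^sub>R e2 + \<gamma> *\<^sub>R e3) \<le> ennreal ((1 + (\<beta> + p \<bullet> e2)\<^sup>2 + (\<gamma> + p \<bullet> e3)\<^sup>2) powr - s) / ennreal (sqrt (\<beta>\<^sup>2 + \<gamma>\<^sup>2))"
        unfolding K_def norm_planar[OF fr(1,2,5)] by (intro divide_right_mono_ennreal ennreal_leI)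
    qed
    also have "\<dots> \<le> C" by (rule C)
    finally show ?thesis by (simp add: K_def mult_left_mono)
  qed
  moreover have "ball_vol * C < \<infinity>" using C(1) ball_vol_finite by (simp add: ennreal_mult_less_top)
  ultimately show thesis using that by blast
qed

text \<open>The quotient |p2 - p| / |p3 - p| is made for polar coordinates: |p2 - p| = |w \<bullet>
  \<psi>| completes the Jacobian |w \<bullet> \<psi>| to the radial density (w \<bullet> \<psi>)^2
  for H, and 1 / |p3 - p| together with the weight is integrable over the plane orthogonal to
  \<psi>.\<close>

lemma coll_23_kernel_le:
  fixes s :: real
  assumes s: "s > 1 / 2"
  obtains C where "C < \<infinity>"
    "\<And>p H. H \<in> borel_measurable borel \<Longrightarrow>
      coll p (\<lambda>a b c. H b * (ennreal (bracket c powr (- 2 * s)) * (ennreal (norm (b - p)) / ennreal (norm (c - p))))) \<le>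
      C * (\<integral>\<^sup>+x. H x \<partial>lborel)"
proof -
  obtain A where A: "A < \<infinity>"
    "\<And>(p :: real^3) \<psi>. norm \<psi> = 1 \<Longrightarrow> (\<integral>\<^sup>+x. indicator {0..1} (x \<bullet> \<psi>) *
       (ennreal (bracket (p + (x - (x \<bullet> \<psi>) *\<^sub>R \<psi>)) powr (- 2 * s)) / ennreal (norm (x - (x \<bullet> \<psi>) *\<^sub>R \<psi>))) \<partial>lborel) \<le> A"
    using plane_integral_kernel_le[OF s] by blast
  have "coll p (\<lambda>a b c. H b * (ennreal (bracket c powr (- 2 * s)) * (ennreal (norm (b - p)) / ennreal (norm (c - p))))) \<le>
      12 * (2 * A) * (\<integral>\<^sup>+x. H x \<partial>lborel)" if [measurable]: "H \<in> borel_measurable borel" for p H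
  proof -
    define H' where "H' x = H (p + x)" for x
    have [measurable]: "H' \<in> borel_measurable borel" unfolding H'_def by measurable
    define k where "k \<psi> w = ennreal (bracket (p + (w - (w \<bullet> \<psi>) *\<^sub>R \<psi>)) powr (- 2 * s)) / ennreal (norm (w - (w \<bullet> \<psi>) *\<^sub>R \<psi>))" for \<psi> w
    have [measurable]: "(\<lambda>(\<psi>, w). k \<psi> w) \<in> borel_measurable (borel \<Otimes>\<^sub>M borel)" unfolding k_def by measurable
    have "coll p (\<lambda>a b c. H b * (ennreal (bracket c powr (- 2 * s)) * (ennreal (norm (b - p)) / ennreal (norm (c - p))))) \<le>
       12 * (\<integral>\<^sup>+\<psi>. (\<integral>\<^sup>+w. ennreal \<bar>w \<bullet> \<psi>\<bar> * (H (p + (w \<bullet> \<psi>) *\<^sub>R \<psi>) * (ennreal (bracket (p + (w - (w \<bullet> \<psi>) *\<^sub>R \<psi>)) powr (- 2 * s)) *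
         (ennreal (norm (p + (w \<bullet> \<psi>) *\<^sub>R \<psi> - p)) / ennreal (norm (p + (w - (w \<bullet> \<psi>) *\<^sub>R \<psi>) - p))))) \<partial>lborel) \<partial>sph)"
      by (rule coll_le_directions) measurable
    also have "\<dots> = 12 * (\<integral>\<^sup>+\<psi>. (\<integral>\<^sup>+w. ennreal ((w \<bullet> \<psi>)\<^sup>2) * H' ((w \<bullet> \<psi>) *\<^sub>R \<psi>) * k \<psi> w \<partial>lborel) \<partial>sph)"
    proof (intro arg_cong2[where f="(*)"] refl nn_integral_cong_AE, use AE_sph_norm in eventually_elim)
      case (elim \<psi>)
      show ?case
      proof (rule nn_integral_cong)
        fix w
        have "norm (p + (w \<bullet> \<psi>) *\<^sub>R \<psi> - p) = \<bar>w \<bullet> \<psi>\<bar>" using elim by simp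
        moreover have "p + (w - (w \<bullet> \<psi>) *\<^sub>R \<psi>) - p = w - (w \<bullet> \<psi>) *\<^sub>R \<psi>" by simp
        moreover have "ennreal ((w \<bullet> \<psi>)\<^sup>2) = ennreal \<bar>w \<bullet> \<psi>\<bar> * ennreal \<bar>w \<bullet> \<psi>\<bar>"
          by (simp add: ennreal_mult[symmetric] power2_eq_square flip: abs_mult)
        ultimately show "ennreal \<bar>w \<bullet> \<psi>\<bar> * (H (p + (w \<bullet> \<psi>) *\<^sub>R \<psi>) * (ennreal (bracket (p + (w - (w \<bullet> \<psi>) *\<^sub>R \<psi>)) powr (- 2 * s)) *
         (ennreal (norm (p + (w \<bullet> \<psi>) *\<^sub>R \<psi> - p)) / ennreal (norm (p + (w - (w \<bullet> \<psi>) *\<^sub>R \<psi>) - p))))) =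
          ennreal ((w \<bullet> \<psi>)\<^sup>2) * H' ((w \<bullet> \<psi>) *\<^sub>R \<psi>) * k \<psi> w"
          by (simp only: H'_def k_def ennreal_times_divide) (simp only: ennreal_times_divide ac_simps)
      qed
    qed
    also have "\<dots> \<le> 12 * (2 * A * (\<integral>\<^sup>+x. H' x \<partial>lborel))"
    proof (intro mult_left_mono nn_integral_line_plane)
      fix \<psi> :: "real^3" and r assume psi: "norm \<psi> = 1"
      have pp: "\<psi> \<bullet> \<psi> = 1" using psi by (simp add: dot_square_norm)
      have eq: "x + (r - x \<bullet> \<psi>) *\<^sub>R \<psi> - ((x + (r - x \<bullet> \<psi>) *\<^sub>R \<psi>) \<bullet> \<psi>) *\<^sub>R \<psi> = x - (x \<bullet> \<psi>) *\<^sub>R \<psi>" for x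
        by (simp add: inner_add_left pp algebra_simps)
      show "(\<integral>\<^sup>+x. indicator {0..1} (x \<bullet> \<psi>) * k \<psi> (x + (r - x \<bullet> \<psi>) *\<^sub>R \<psi>) \<partial>lborel) \<le> A"
        using A(2)[OF psi, of p] unfolding k_def eq .
    qed (simp_all, measurable)
    also have "(\<integral>\<^sup>+x. H' x \<partial>lborel) = (\<integral>\<^sup>+x. H x \<partial>lborel)" unfolding H'_def by (rule nn_integral_lborel_shift) simp
    finally show ?thesis by (simp add: mult.assoc)
  qed
  moreover have "12 * (2 * A) < \<infinity>" using A(1) by (simp add: ennreal_mult_less_top)
  ultimately show thesis using that by blast
qed

text \<open>Cauchy-Schwarz with the weight |p2 - p| / |p3 - p| on g and its reciprocal on h; the two
  halves are mirror images under p2 \<leftrightarrow> p3, so one kernel bound serves both.\<close>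

lemma coll_p2_p3_le:
  fixes s :: real
  assumes s: "s > 1 / 2"
  obtains C where "C < \<infinity>"
    "\<And>p l g h. l > 0 \<Longrightarrow> g \<in> borel_measurable borel \<Longrightarrow> h \<in> borel_measurable borel \<Longrightarrow>
      coll p (\<lambda>a b c. ennreal (\<bar>g b\<bar> * \<bar>h c\<bar>)) \<le> ennreal l * (C * wnorm2 s g) + ennreal (1 / l) * (C * wnorm2 s h)"
proof -
  obtain C where C: "C < \<infinity>"
    "\<And>p H. H \<in> borel_measurable borel \<Longrightarrow>
      coll p (\<lambda>a b c. H b * (ennreal (bracket c powr (- 2 * s)) * (ennreal (norm (b - p)) / ennreal (norm (c - p))))) \<le>
      C * (\<integral>\<^sup>+x. H x \<partial>lborel)"
    using coll_23_kernel_le[OF s] by blast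
  have "coll p (\<lambda>a b c. ennreal (\<bar>g b\<bar> * \<bar>h c\<bar>)) \<le> ennreal l * (C * wnorm2 s g) + ennreal (1 / l) * (C * wnorm2 s h)"
    if l: "l > 0" and [measurable]: "g \<in> borel_measurable borel" "h \<in> borel_measurable borel" for p l g h
  proof -
    define X where "X f a b c = ennreal ((bracket b powr s * f b)\<^sup>2) *
       (ennreal (bracket c powr (- 2 * s)) * (ennreal (norm (b - p)) / ennreal (norm (c - p))))" for f :: "real^3 \<Rightarrow> real" and a b c :: "real^3"
    \<comment> \<open>If exactly one of b and c equals p, one of the two quotients has denominator 0
      and is infinite, so the bound is trivial. If both equalled p, both quotients would be 0 / 0 =
      0 and the bound could fail.\<close>
    have pt: "ennreal (\<bar>g b\<bar> * \<bar>h c\<bar>) \<le> ennreal l * X g a b c + ennreal (1 / l) * X h a c b" if "b \<noteq> p \<or> c \<noteq> p" for a b c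
    proof -
      define k where "k = bracket b powr - s * bracket c powr - s"
      have eq: "\<bar>g b\<bar> * \<bar>h c\<bar> = (bracket b powr s * \<bar>g b\<bar>) * (bracket c powr s * \<bar>h c\<bar>) * k"
        by (simp add: k_def powr_minus field_simps)
      have sq: "(bracket x powr s * \<bar>f x\<bar>)\<^sup>2 = (bracket x powr s * f x)\<^sup>2" for f x
        by (simp add: power_mult_distrib)
      have "ennreal ((bracket b powr s * \<bar>g b\<bar>) * (bracket c powr s * \<bar>h c\<bar>) * k) \<le>
         ennreal l * (ennreal ((bracket b powr s * \<bar>g b\<bar>)\<^sup>2) * (ennreal (bracket c powr (- 2 * s)) * (ennreal (norm (b - p)) / ennreal (norm (c - p))))) +
         ennreal (1 / l) * (ennreal ((bracket c powr s * \<bar>h c\<bar>)\<^sup>2) * (ennreal (bracket b powr (- 2 * s)) * (ennreal (norm (c - p)) / ennreal (norm (b - p)))))"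
      proof (rule weighted_amgm_ennreal[OF _ _ _ l])
        let ?X = "ennreal (bracket c powr (- 2 * s)) * (ennreal (norm (b - p)) / ennreal (norm (c - p)))"
        let ?Y = "ennreal (bracket b powr (- 2 * s)) * (ennreal (norm (c - p)) / ennreal (norm (b - p)))"
        show "?X = \<infinity> \<or> ?Y = \<infinity> \<or> ?X * ?Y \<ge> ennreal (k\<^sup>2)"
        proof (cases "b = p \<or> c = p")
          case True
          then show ?thesis using that by (auto simp: ennreal_divide_zero ennreal_mult_top)
        next
          case False
          have "(bracket b powr - s)\<^sup>2 = bracket b powr (- 2 * s)" "(bracket c powr - s)\<^sup>2 = bracket c powr (- 2 * s)"
            by (simp_all add: power2_eq_square flip: powr_add)
          then have "k\<^sup>2 = bracket c powr (- 2 * s) * (norm (b - p) / norm (c - p)) * (bracket b powr (- 2 * s) * (norm (c - p) / norm (b - p)))"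
            using False by (simp add: k_def power_mult_distrib)
          moreover have "?X = ennreal (bracket c powr (- 2 * s) * (norm (b - p) / norm (c - p)))"
            by (subst ennreal_mult) (use False in \<open>auto simp: divide_ennreal\<close>)
          moreover have "?Y = ennreal (bracket b powr (- 2 * s) * (norm (c - p) / norm (b - p)))"
            by (subst ennreal_mult) (use False in \<open>auto simp: divide_ennreal\<close>)
          ultimately have "?X * ?Y = ennreal (k\<^sup>2)" by (simp only: ennreal_mult[symmetric] mult_nonneg_nonneg divide_nonneg_nonneg powr_ge_zero norm_ge_zero)
          then show ?thesis by simp
        qed
      qed (auto simp: k_def)
      then show ?thesis unfolding eq X_def sq .
    qed
    have "coll p (\<lambda>a b c. ennreal (\<bar>g b\<bar> * \<bar>h c\<bar>)) \<le> coll p (\<lambda>a b c. ennreal l * X g a b c + ennreal (1 / l) * X h a c b)"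
      unfolding coll_def
    proof (intro nn_integral_mono)
      fix p1 \<phi>
      \<comment> \<open>As p2 + p3 = p + p1, both points coincide with p only if p1 = p, where the
        factor |p - p1| vanishes.\<close>
      show "ennreal (norm (p - p1)) * ennreal (\<bar>g (p2_of p p1 \<phi>)\<bar> * \<bar>h (p3_of p p1 \<phi>)\<bar>) \<le>
        ennreal (norm (p - p1)) * (ennreal l * X g p1 (p2_of p p1 \<phi>) (p3_of p p1 \<phi>) + ennreal (1 / l) * X h p1 (p3_of p p1 \<phi>) (p2_of p p1 \<phi>))"
      proof (cases "p = p1")
        case False
        have "p2_of p p1 \<phi> + p3_of p p1 \<phi> = p + p1" by (simp add: p2_of_def p3_of_def vec_eq_iff field_simps)
        then have "p2_of p p1 \<phi> \<noteq> p \<or> p3_of p p1 \<phi> \<noteq> p" using False by auto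
        then show ?thesis by (intro mult_left_mono pt) auto
      qed simp
    qed
    also have "\<dots> = ennreal l * coll p (X g) + ennreal (1 / l) * coll p (\<lambda>a b c. X h a c b)"
    proof -
      have "coll p (\<lambda>a b c. ennreal l * X g a b c + ennreal (1 / l) * X h a c b) =
          coll p (\<lambda>a b c. ennreal l * X g a b c) + coll p (\<lambda>a b c. ennreal (1 / l) * X h a c b)"
        unfolding X_def by (rule coll_add) measurable
      moreover have "coll p (\<lambda>a b c. ennreal l * X g a b c) = ennreal l * coll p (X g)"
        unfolding X_def by (rule coll_cmult) measurable
      moreover have "coll p (\<lambda>a b c. ennreal (1 / l) * X h a c b) = ennreal (1 / l) * coll p (\<lambda>a b c. X h a c b)"
        unfolding X_def by (rule coll_cmult) measurable
      ultimately show ?thesis by simp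
    qed
    also have "coll p (\<lambda>a b c. X h a c b) = coll p (X h)" unfolding X_def by (rule coll_swap23) measurable
    also have "ennreal l * coll p (X g) + ennreal (1 / l) * coll p (X h) \<le> ennreal l * (C * wnorm2 s g) + ennreal (1 / l) * (C * wnorm2 s h)"
      unfolding X_def wnorm2_def by (intro add_mono mult_left_mono C) auto
    finally show ?thesis .
  qed
  then show thesis using that C(1) by blast
qed

text \<open>The integrand grows as |x \<bullet> \<psi>| decreases to 0, so the integral over
  directions is bounded by one over the ball, where the component along x is a Cartesian coordinate;
  rescaling this coordinate by |x| gains the factor 1 / |x|.\<close>

lemma directional_integral_le:
  fixes s :: real
  assumes s: "1 / 2 < s" "s < 1"
  obtains C where "C < \<infinity>"
    "\<And>x :: real^3. ennreal (norm x powr (2 * s + 1)) * (\<integral>\<^sup>+\<psi>. ennreal (\<bar>x \<bullet> \<psi>\<bar> powr (1 - 2 * s) * (1 + (x \<bullet> \<psi>)\<^sup>2) powr - s) \<partial>sph)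
       \<le> C * ennreal (norm x powr (2 * s))"
proof -
  define F where "F u = ennreal (\<bar>u\<bar> powr (1 - 2 * s) * (1 + u\<^sup>2) powr - s)" for u :: real
  have [measurable]: "F \<in> borel_measurable borel" unfolding F_def by measurable
  define J where "J = (\<integral>\<^sup>+u. F u \<partial>lborel)"
  have J: "J < \<infinity>" unfolding J_def F_def by (rule nn_integral_directional_kernel_finite[OF s])
  \<comment> \<open>The point v = 0 is excluded because \<open>0 powr a = 0\<close> makes F vanish
    there.\<close>
  have F_mono: "F u \<le> F v" if "\<bar>v\<bar> \<le> \<bar>u\<bar>" "v \<noteq> 0" for u v
  proof -
    have "v\<^sup>2 \<le> u\<^sup>2" using that(1) by (simp add: abs_le_square_iff)
    then have "(1 + u\<^sup>2) powr - s \<le> (1 + v\<^sup>2) powr - s" using s by (intro powr_mono2') (auto intro: add_pos_nonneg)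
    moreover have "\<bar>u\<bar> powr (1 - 2 * s) \<le> \<bar>v\<bar> powr (1 - 2 * s)" using s that by (intro powr_mono2') auto
    ultimately show ?thesis unfolding F_def by (intro ennreal_leI mult_mono) auto
  qed
  have "ennreal (norm x powr (2 * s + 1)) * (\<integral>\<^sup>+\<psi>. F (x \<bullet> \<psi>) \<partial>sph) \<le> ball_vol * J * ennreal (norm x powr (2 * s))" for x :: "real^3"
  proof (cases "x = 0")
    case False
    define e where "e = x /\<^sub>R norm x"
    have e: "norm e = 1" using False by (simp add: e_def)
    have ee: "e \<bullet> e = 1" using e by (simp add: dot_square_norm)
    have xe: "x = norm x *\<^sub>R e" using False by (simp add: e_def)
    have "(\<integral>\<^sup>+\<psi>. F (x \<bullet> \<psi>) \<partial>sph) = (\<integral>\<^sup>+y. indicator (ball 0 1) y * F (x \<bullet> sgn y) \<partial>lborel)"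
      by (rule nn_integral_sph) measurable
    also have "\<dots> \<le> (\<integral>\<^sup>+y. indicator (ball 0 1) y * F (x \<bullet> y) \<partial>lborel)"
    proof (rule nn_integral_mono_AE, use AE_inner_neq[OF False, of 0] in eventually_elim)
      case (elim y)
      then have y: "y \<noteq> 0" by auto
      have "F (x \<bullet> sgn y) \<le> F (x \<bullet> y)" if "norm y < 1"
      proof (rule F_mono)
        have "\<bar>x \<bullet> y\<bar> = norm y * \<bar>x \<bullet> sgn y\<bar>" using y by (simp add: sgn_div_norm abs_mult)
        also have "\<dots> \<le> 1 * \<bar>x \<bullet> sgn y\<bar>" using that by (intro mult_right_mono) auto
        finally show "\<bar>x \<bullet> y\<bar> \<le> \<bar>x \<bullet> sgn y\<bar>" by simp
      qed (use elim in simp)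
      then show ?case by (auto simp: indicator_def)
    qed
    also have "\<dots> = (\<integral>\<^sup>+z. indicator {0..1} (z \<bullet> e) * (\<integral>\<^sup>+t. indicator (ball 0 1) (z + (t - z \<bullet> e) *\<^sub>R e) * F (x \<bullet> (z + (t - z \<bullet> e) *\<^sub>R e)) \<partial>lborel) \<partial>lborel)"
      by (rule nn_integral_split_line[OF _ e]) measurable
    also have "\<dots> \<le> (\<integral>\<^sup>+z. indicator (cball 0 2) z * (\<integral>\<^sup>+t. F (0 + norm x * t) \<partial>lborel) \<partial>(lborel :: (real^3) measure))"
    proof (rule nn_integral_mono)
      fix z :: "real^3"
      have xz: "x \<bullet> (z + (t - z \<bullet> e) *\<^sub>R e) = 0 + norm x * t" for t
        by (subst xe) (simp add: inner_add_right ee inner_commute[of e z] algebra_simps)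
      show "indicator {0..1} (z \<bullet> e) * (\<integral>\<^sup>+t. indicator (ball 0 1) (z + (t - z \<bullet> e) *\<^sub>R e) * F (x \<bullet> (z + (t - z \<bullet> e) *\<^sub>R e)) \<partial>lborel)
        \<le> indicator (cball 0 2) z * (\<integral>\<^sup>+t. F (0 + norm x * t) \<partial>lborel)"
      proof (cases "z \<in> cball 0 2")
        case True
        have "(\<integral>\<^sup>+t. indicator (ball 0 1) (z + (t - z \<bullet> e) *\<^sub>R e) * F (x \<bullet> (z + (t - z \<bullet> e) *\<^sub>R e)) \<partial>lborel) \<le> (\<integral>\<^sup>+t. F (0 + norm x * t) \<partial>lborel)"
          unfolding xz by (intro nn_integral_mono) (auto simp: indicator_def)
        then show ?thesis using True by (auto simp: indicator_def)
      next
        case False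
        \<comment> \<open>A line in direction e that meets the unit ball is at distance less than 1
          from the origin, so its part in the slab stays within radius 2.\<close>
        have zero: "indicator {0..1} (z \<bullet> e) * (indicator (ball 0 1) (z + (t - z \<bullet> e) *\<^sub>R e) * c) = 0" for t and c :: ennreal
        proof (rule ccontr)
          assume "\<not> ?thesis"
          then have a: "0 \<le> z \<bullet> e" "z \<bullet> e \<le> 1" "norm (z + (t - z \<bullet> e) *\<^sub>R e) < 1" by (auto simp: indicator_def split: if_splits)
          define b where "b = z - (z \<bullet> e) *\<^sub>R e"
          have be: "b \<bullet> e = 0" by (simp add: b_def inner_diff_left ee)
          have zt: "z + (t - z \<bullet> e) *\<^sub>R e = b + t *\<^sub>R e" by (simp add: b_def algebra_simps)
          have "(norm (b + t *\<^sub>R e))\<^sup>2 = (norm b)\<^sup>2 + t\<^sup>2"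
            unfolding power2_norm_eq_inner
            by (simp add: inner_add_left inner_add_right be ee inner_commute[of e b] power2_eq_square)
          then have "(norm b)\<^sup>2 \<le> (norm (b + t *\<^sub>R e))\<^sup>2" by simp
          then have "norm b \<le> norm (b + t *\<^sub>R e)" by (rule power2_le_imp_le) simp
          moreover have "norm z \<le> norm b + norm ((z \<bullet> e) *\<^sub>R e)"
            using norm_triangle_ineq[of b "(z \<bullet> e) *\<^sub>R e"] by (simp add: b_def)
          ultimately have "norm z \<le> 2" using a e by (simp add: zt)
          then show False using False by simp
        qed
        then have "indicator {0..1} (z \<bullet> e) * (\<integral>\<^sup>+t. indicator (ball 0 1) (z + (t - z \<bullet> e) *\<^sub>R e) * F (x \<bullet> (z + (t - z \<bullet> e) *\<^sub>R e)) \<partial>lborel) = 0"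
        proof -
          have "indicator {0..1} (z \<bullet> e) * (\<integral>\<^sup>+t. indicator (ball 0 1) (z + (t - z \<bullet> e) *\<^sub>R e) * F (x \<bullet> (z + (t - z \<bullet> e) *\<^sub>R e)) \<partial>lborel) =
              (\<integral>\<^sup>+t. indicator {0..1} (z \<bullet> e) * (indicator (ball 0 1) (z + (t - z \<bullet> e) *\<^sub>R e) * F (x \<bullet> (z + (t - z \<bullet> e) *\<^sub>R e))) \<partial>lborel)"
            by (rule nn_integral_cmult[symmetric]) measurable
          also have "\<dots> = (\<integral>\<^sup>+(t :: real). 0 \<partial>lborel)" by (intro nn_integral_cong zero)
          finally show ?thesis by simp
        qed
        then show ?thesis by (simp only: zero_le)
      qed
    qed
    also have "\<dots> = ball_vol * (\<integral>\<^sup>+t. F (0 + norm x * t) \<partial>lborel)"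
      unfolding ball_vol_def by (subst nn_integral_multc) (auto intro!: borel_measurable_indicator borel_closed)
    finally have "ennreal \<bar>norm x\<bar> * (\<integral>\<^sup>+\<psi>. F (x \<bullet> \<psi>) \<partial>sph) \<le> ennreal \<bar>norm x\<bar> * (ball_vol * (\<integral>\<^sup>+t. F (0 + norm x * t) \<partial>lborel))"
      by (rule mult_left_mono) simp
    also have "\<dots> = ball_vol * (ennreal \<bar>norm x\<bar> * (\<integral>\<^sup>+t. F (0 + norm x * t) \<partial>lborel))" by (rule mult.left_commute)
    also have "ennreal \<bar>norm x\<bar> * (\<integral>\<^sup>+t. F (0 + norm x * t) \<partial>lborel) = J"
      unfolding J_def by (rule nn_integral_real_affine[symmetric]) (use False in auto)
    finally have *: "ennreal (norm x) * (\<integral>\<^sup>+\<psi>. F (x \<bullet> \<psi>) \<partial>sph) \<le> ball_vol * J" by simp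
    have "norm x powr (2 * s + 1) = norm x powr (2 * s) * norm x" using False by (simp add: powr_add)
    then have "ennreal (norm x powr (2 * s + 1)) * (\<integral>\<^sup>+\<psi>. F (x \<bullet> \<psi>) \<partial>sph) =
       ennreal (norm x powr (2 * s)) * (ennreal (norm x) * (\<integral>\<^sup>+\<psi>. F (x \<bullet> \<psi>) \<partial>sph))"
      by (simp add: ennreal_mult mult.assoc)
    also have "\<dots> \<le> ennreal (norm x powr (2 * s)) * (ball_vol * J)" by (rule mult_left_mono[OF *]) simp
    finally show ?thesis by (simp add: mult.commute)
  qed simp
  moreover have "ball_vol * J < \<infinity>" using J ball_vol_finite by (simp add: ennreal_mult_less_top)
  ultimately show thesis using that unfolding F_def by blast
qed

text \<open>This is the transversal bound for the kernel that multiplies h in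
  \<open>coll_p1_p2_le\<close>. On a plane orthogonal to \<psi> the inner product with \<psi> is
  constant; where the constant is 0 the integrand vanishes by the convention for
  \<open>powr\<close>.\<close>

lemma plane_integral_power_kernel_le:
  fixes s :: real
  assumes s: "s > 1 / 2"
  obtains A where "A < \<infinity>"
    "\<And>(p :: real^3) \<psi> r. norm \<psi> = 1 \<Longrightarrow> (\<integral>\<^sup>+x. indicator {0..1} (x \<bullet> \<psi>) *
       ennreal (\<bar>(p + (x + (r - x \<bullet> \<psi>) *\<^sub>R \<psi>)) \<bullet> \<psi>\<bar> powr (2 * s - 1) * norm (p + (x + (r - x \<bullet> \<psi>) *\<^sub>R \<psi>)) powr - (2 * s + 1)) \<partial>lborel) \<le> A"
proof -
  define J where "J = japanese_const ((s + 1 / 2) / 2)"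
  have J: "J < \<infinity>" unfolding J_def by (rule japanese_const_finite) (use s in auto)
  have "(\<integral>\<^sup>+x. indicator {0..1} (x \<bullet> \<psi>) *
       ennreal (\<bar>(p + (x + (r - x \<bullet> \<psi>) *\<^sub>R \<psi>)) \<bullet> \<psi>\<bar> powr (2 * s - 1) * norm (p + (x + (r - x \<bullet> \<psi>) *\<^sub>R \<psi>)) powr - (2 * s + 1)) \<partial>lborel) \<le> ball_vol * (J * J)"
    if psi: "norm \<psi> = 1" for p \<psi> :: "real^3" and r
  proof -
    have pp: "\<psi> \<bullet> \<psi> = 1" using psi by (simp add: dot_square_norm)
    obtain e2 e3 where fr: "norm e2 = 1" "norm e3 = 1" "\<psi> \<bullet> e2 = 0" "\<psi> \<bullet> e3 = 0" "e2 \<bullet> e3 = 0"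
      "\<And>x. x = (x \<bullet> \<psi>) *\<^sub>R \<psi> + (x \<bullet> e2) *\<^sub>R e2 + (x \<bullet> e3) *\<^sub>R e3" using orthonormal_frame[OF psi] by metis
    define t where "t = p \<bullet> \<psi> + r"
    define K where "K b = ennreal (\<bar>t\<bar> powr (2 * s - 1) * norm (p + b + r *\<^sub>R \<psi>) powr - (2 * s + 1))" for b
    have eq: "(p + (x + (r - x \<bullet> \<psi>) *\<^sub>R \<psi>)) \<bullet> \<psi> = t" "p + (x + (r - x \<bullet> \<psi>) *\<^sub>R \<psi>) = p + (x - (x \<bullet> \<psi>) *\<^sub>R \<psi>) + r *\<^sub>R \<psi>" for x
      by (simp_all add: t_def inner_add_left pp algebra_simps)
    have "(\<integral>\<^sup>+x. indicator {0..1} (x \<bullet> \<psi>) * K (x - (x \<bullet> \<psi>) *\<^sub>R \<psi>) \<partial>lborel) \<le>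
       ball_vol * (\<integral>\<^sup>+\<gamma>. (\<integral>\<^sup>+\<beta>. K (\<beta> *\<^sub>R e2 + \<gamma> *\<^sub>R e3) \<partial>lborel) \<partial>lborel)"
      by (rule nn_integral_plane_le[OF _ psi fr]) (simp add: K_def)
    also have "(\<integral>\<^sup>+\<gamma>. (\<integral>\<^sup>+\<beta>. K (\<beta> *\<^sub>R e2 + \<gamma> *\<^sub>R e3) \<partial>lborel) \<partial>lborel) =
       (\<integral>\<^sup>+\<gamma>. (\<integral>\<^sup>+\<beta>. ennreal (\<bar>t\<bar> powr (2 * s - 1) * (t\<^sup>2 + (\<beta> + p \<bullet> e2)\<^sup>2 + (\<gamma> + p \<bullet> e3)\<^sup>2) powr - (s + 1 / 2)) \<partial>lborel) \<partial>lborel)"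
    proof (intro nn_integral_cong)
      fix \<beta> \<gamma>
      have n2: "(norm (p + (\<beta> *\<^sub>R e2 + \<gamma> *\<^sub>R e3) + r *\<^sub>R \<psi>))\<^sup>2 = t\<^sup>2 + (\<beta> + p \<bullet> e2)\<^sup>2 + (\<gamma> + p \<bullet> e3)\<^sup>2"
        unfolding t_def by (rule bracket_planar_le) (use fr psi in auto)
      have "(t\<^sup>2 + (\<beta> + p \<bullet> e2)\<^sup>2 + (\<gamma> + p \<bullet> e3)\<^sup>2) powr - (s + 1 / 2) = norm (p + (\<beta> *\<^sub>R e2 + \<gamma> *\<^sub>R e3) + r *\<^sub>R \<psi>) powr (2 * - (s + 1 / 2))"
        unfolding n2[symmetric] power2_powr by simp
      moreover have "2 * - (s + 1 / 2) = - (2 * s + 1)" by simp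
      ultimately show "K (\<beta> *\<^sub>R e2 + \<gamma> *\<^sub>R e3) = ennreal (\<bar>t\<bar> powr (2 * s - 1) * (t\<^sup>2 + (\<beta> + p \<bullet> e2)\<^sup>2 + (\<gamma> + p \<bullet> e3)\<^sup>2) powr - (s + 1 / 2))"
        unfolding K_def by (simp only:)
    qed
    also have "\<dots> \<le> J * J"
    proof (cases "t = 0")
      case False
      then show ?thesis unfolding J_def by (rule planar_power_kernel_le[OF s])
    qed simp
    finally show ?thesis unfolding eq(1) unfolding eq(2) K_def by (simp add: mult_left_mono)
  qed
  moreover have "ball_vol * (J * J) < \<infinity>" using J ball_vol_finite by (simp add: ennreal_mult_less_top)
  ultimately show thesis using that by blast
qed

text \<open>As p1 = p + w is not split by \<psi>, the Cauchy-Schwarz weights are taken relative to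
  the origin instead of p. The weight on h is homogeneous of degree -2 in p1, so its integrals over
  planes are bounded independently of their distance from 0. Its reciprocal, damped by <p1 \<bullet>
  \<psi>>^(-2s), falls to g and is integrated over \<psi>. The damping is available because p1
  \<bullet> \<psi> = p2 \<bullet> \<psi> is at most |p2|.\<close>

lemma coll_p1_p2_le:
  fixes s :: real
  assumes s: "1 / 2 < s" "s < 1"
  obtains C where "C < \<infinity>"
    "\<And>p l g h. l > 0 \<Longrightarrow> g \<in> borel_measurable borel \<Longrightarrow> h \<in> borel_measurable borel \<Longrightarrow>
      coll p (\<lambda>a b c. ennreal (\<bar>g a\<bar> * \<bar>h b\<bar>)) \<le> ennreal l * (C * wnorm2 s h) + ennreal (1 / l) * (C * wnorm2 s g)"
proof -
  obtain C where C: "C < \<infinity>"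
    "\<And>x :: real^3. ennreal (norm x powr (2 * s + 1)) * (\<integral>\<^sup>+\<psi>. ennreal (\<bar>x \<bullet> \<psi>\<bar> powr (1 - 2 * s) * (1 + (x \<bullet> \<psi>)\<^sup>2) powr - s) \<partial>sph)
       \<le> C * ennreal (norm x powr (2 * s))"
    using directional_integral_le[OF s] by blast
  obtain A where A: "A < \<infinity>"
    "\<And>(p :: real^3) \<psi> r. norm \<psi> = 1 \<Longrightarrow> (\<integral>\<^sup>+x. indicator {0..1} (x \<bullet> \<psi>) *
       ennreal (\<bar>(p + (x + (r - x \<bullet> \<psi>) *\<^sub>R \<psi>)) \<bullet> \<psi>\<bar> powr (2 * s - 1) * norm (p + (x + (r - x \<bullet> \<psi>) *\<^sub>R \<psi>)) powr - (2 * s + 1)) \<partial>lborel) \<le> A"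
    using plane_integral_power_kernel_le[OF s(1)] by blast
  define D where "D = 12 * (2 * A + C)"
  have D: "D < \<infinity>" using A(1) C(1) by (simp add: D_def ennreal_mult_less_top)
  have "coll p (\<lambda>a b c. ennreal (\<bar>g a\<bar> * \<bar>h b\<bar>)) \<le> ennreal l * (D * wnorm2 s h) + ennreal (1 / l) * (D * wnorm2 s g)"
    if l: "l > 0" and [measurable]: "g \<in> borel_measurable borel" "h \<in> borel_measurable borel" for p l g h
  proof -
    define H where "H x = ennreal ((bracket (p + x) powr s * h (p + x))\<^sup>2)" for x
    have Hm [measurable]: "H \<in> borel_measurable borel" unfolding H_def by measurable
    define k where "k \<psi> w = ennreal (\<bar>(p + w) \<bullet> \<psi>\<bar> powr (2 * s - 1) * norm (p + w) powr - (2 * s + 1))" for \<psi> w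
    have km [measurable]: "(\<lambda>(\<psi>, w). k \<psi> w) \<in> borel_measurable (borel \<Otimes>\<^sub>M borel)" unfolding k_def by measurable
    define Z where "Z \<psi> x = ennreal ((g x)\<^sup>2) * (ennreal (norm x powr (2 * s + 1)) * ennreal (\<bar>x \<bullet> \<psi>\<bar> powr (1 - 2 * s) * (1 + (x \<bullet> \<psi>)\<^sup>2) powr - s))" for \<psi> x
    have Zm [measurable]: "(\<lambda>(\<psi>, x). Z \<psi> x) \<in> borel_measurable (borel \<Otimes>\<^sub>M borel)" unfolding Z_def by measurable
    have pt: "ennreal \<bar>w \<bullet> \<psi>\<bar> * ennreal (\<bar>g (p + w)\<bar> * \<bar>h (p + (w \<bullet> \<psi>) *\<^sub>R \<psi>)\<bar>) \<le>
       ennreal l * (ennreal ((w \<bullet> \<psi>)\<^sup>2) * H ((w \<bullet> \<psi>) *\<^sub>R \<psi>) * k \<psi> w) + ennreal (1 / l) * Z \<psi> (p + w)"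
      if psi: "norm \<psi> = 1" and nz: "\<psi> \<bullet> w \<noteq> - (\<psi> \<bullet> p)" for \<psi> w
    proof -
      define x where "x = p + w"
      define z where "z = p + (w \<bullet> \<psi>) *\<^sub>R \<psi>"
      have pp: "\<psi> \<bullet> \<psi> = 1" using psi by (simp add: dot_square_norm)
      have "x \<bullet> \<psi> = \<psi> \<bullet> w + \<psi> \<bullet> p" by (simp add: x_def inner_add_right inner_commute[of _ \<psi>])
      then have xp: "x \<bullet> \<psi> \<noteq> 0" using nz by linarith
      then have x0: "x \<noteq> 0" by auto
      have "z \<bullet> \<psi> = x \<bullet> \<psi>" by (simp add: z_def x_def inner_add_left pp)
      then have xz: "\<bar>x \<bullet> \<psi>\<bar> \<le> norm z" using Cauchy_Schwarz_ineq2[of z \<psi>] psi by simp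
      define kk where "kk = bracket z powr - s"
      \<comment> \<open>The choice gives X Y = <x \<bullet> \<psi>>^(-2s), which dominates kk^2 =
        <z>^(-2s). The Jacobian |w \<bullet> \<psi>| goes entirely to the factor with h, where its
        square is the polar density.\<close>
      define Y where "Y = norm x powr (2 * s + 1) * (\<bar>x \<bullet> \<psi>\<bar> powr (1 - 2 * s) * (1 + (x \<bullet> \<psi>)\<^sup>2) powr - s)"
      define X where "X = \<bar>x \<bullet> \<psi>\<bar> powr (2 * s - 1) * norm x powr - (2 * s + 1)"
      have XY: "X * Y = (1 + (x \<bullet> \<psi>)\<^sup>2) powr - s"
      proof -
        have "X * Y = (\<bar>x \<bullet> \<psi>\<bar> powr (2 * s - 1) * \<bar>x \<bullet> \<psi>\<bar> powr (1 - 2 * s)) * (norm x powr - (2 * s + 1) * norm x powr (2 * s + 1)) * (1 + (x \<bullet> \<psi>)\<^sup>2) powr - s"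
          by (simp add: X_def Y_def)
        also have "\<bar>x \<bullet> \<psi>\<bar> powr (2 * s - 1) * \<bar>x \<bullet> \<psi>\<bar> powr (1 - 2 * s) = 1" using xp by (simp flip: powr_add)
        also have "norm x powr - (2 * s + 1) * norm x powr (2 * s + 1) = 1" using x0 by (simp flip: powr_add)
        finally show ?thesis by simp
      qed
      have "kk\<^sup>2 = (1 + (norm z)\<^sup>2) powr - s"
        by (simp add: kk_def bracket_powr power2_eq_square flip: powr_add)
      also have "\<dots> \<le> (1 + (x \<bullet> \<psi>)\<^sup>2) powr - s"
      proof -
        have "(x \<bullet> \<psi>)\<^sup>2 \<le> (norm z)\<^sup>2" using power_mono[OF xz, of 2] by simp
        then show ?thesis using s by (intro powr_mono2') (auto intro: add_pos_nonneg)
      qed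
      finally have "ennreal (kk\<^sup>2) \<le> ennreal X * ennreal Y" unfolding XY[symmetric]
        by (subst ennreal_mult[symmetric]) (auto simp: X_def Y_def intro: ennreal_leI)
      then have "ennreal ((\<bar>w \<bullet> \<psi>\<bar> * (bracket z powr s * \<bar>h z\<bar>)) * \<bar>g x\<bar> * kk) \<le>
        ennreal l * (ennreal ((\<bar>w \<bullet> \<psi>\<bar> * (bracket z powr s * \<bar>h z\<bar>))\<^sup>2) * ennreal X) + ennreal (1 / l) * (ennreal (\<bar>g x\<bar>\<^sup>2) * ennreal Y)"
        using l by (intro weighted_amgm_ennreal) (auto simp: kk_def)
      also have "(\<bar>w \<bullet> \<psi>\<bar> * (bracket z powr s * \<bar>h z\<bar>)) * \<bar>g x\<bar> * kk = \<bar>w \<bullet> \<psi>\<bar> * (\<bar>g x\<bar> * \<bar>h z\<bar>)"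
        by (simp add: kk_def powr_minus field_simps)
      also have "ennreal (\<bar>w \<bullet> \<psi>\<bar> * (\<bar>g x\<bar> * \<bar>h z\<bar>)) = ennreal \<bar>w \<bullet> \<psi>\<bar> * ennreal (\<bar>g x\<bar> * \<bar>h z\<bar>)"
        by (rule ennreal_mult) auto
      also have "ennreal ((\<bar>w \<bullet> \<psi>\<bar> * (bracket z powr s * \<bar>h z\<bar>))\<^sup>2) * ennreal X = ennreal ((w \<bullet> \<psi>)\<^sup>2) * H ((w \<bullet> \<psi>) *\<^sub>R \<psi>) * k \<psi> w"
        by (simp add: H_def k_def X_def z_def x_def power_mult_distrib ennreal_mult)
      also have "ennreal (\<bar>g x\<bar>\<^sup>2) * ennreal Y = Z \<psi> (p + w)"
        by (simp add: Z_def Y_def x_def ennreal_mult)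
      finally show ?thesis by (simp add: x_def z_def)
    qed
    have "coll p (\<lambda>a b c. ennreal (\<bar>g a\<bar> * \<bar>h b\<bar>)) \<le>
      12 * (\<integral>\<^sup>+\<psi>. (\<integral>\<^sup>+w. ennreal \<bar>w \<bullet> \<psi>\<bar> * ennreal (\<bar>g (p + w)\<bar> * \<bar>h (p + (w \<bullet> \<psi>) *\<^sub>R \<psi>)\<bar>) \<partial>lborel) \<partial>sph)"
      by (rule coll_le_directions) measurable
    also have "\<dots> \<le> 12 * (\<integral>\<^sup>+\<psi>. (\<integral>\<^sup>+w. ennreal l * (ennreal ((w \<bullet> \<psi>)\<^sup>2) * H ((w \<bullet> \<psi>) *\<^sub>R \<psi>) * k \<psi> w) + ennreal (1 / l) * Z \<psi> (p + w) \<partial>lborel) \<partial>sph)"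
    proof (rule mult_left_mono[OF nn_integral_mono_AE], use AE_sph_norm in eventually_elim)
      case (elim \<psi>)
      then have "\<psi> \<noteq> 0" by auto
      from AE_inner_neq[OF this, of "- (\<psi> \<bullet> p)"] show ?case
        using pt[OF elim] by (intro nn_integral_mono_AE) auto
    qed simp
    also have "\<dots> = 12 * (ennreal l * (\<integral>\<^sup>+\<psi>. (\<integral>\<^sup>+w. ennreal ((w \<bullet> \<psi>)\<^sup>2) * H ((w \<bullet> \<psi>) *\<^sub>R \<psi>) * k \<psi> w \<partial>lborel) \<partial>sph) +
       ennreal (1 / l) * (\<integral>\<^sup>+\<psi>. (\<integral>\<^sup>+w. Z \<psi> (p + w) \<partial>lborel) \<partial>sph))"
      by (simp add: nn_integral_add nn_integral_cmult)
    also have "\<dots> \<le> 12 * (ennreal l * (2 * A * wnorm2 s h) + ennreal (1 / l) * (C * wnorm2 s g))"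
    proof (intro mult_left_mono add_mono)
      have "(\<integral>\<^sup>+x. H x \<partial>lborel) = wnorm2 s h"
        unfolding H_def wnorm2_def
        by (rule nn_integral_lborel_shift[of "\<lambda>x. ennreal ((bracket x powr s * h x)\<^sup>2)" p]) measurable
      moreover have "(\<integral>\<^sup>+\<psi>. (\<integral>\<^sup>+w. ennreal ((w \<bullet> \<psi>)\<^sup>2) * H ((w \<bullet> \<psi>) *\<^sub>R \<psi>) * k \<psi> w \<partial>lborel) \<partial>sph) \<le> 2 * A * (\<integral>\<^sup>+x. H x \<partial>lborel)"
        by (rule nn_integral_line_plane[OF Hm km]) (use A(2) in \<open>simp add: k_def\<close>)
      ultimately show "(\<integral>\<^sup>+\<psi>. (\<integral>\<^sup>+w. ennreal ((w \<bullet> \<psi>)\<^sup>2) * H ((w \<bullet> \<psi>) *\<^sub>R \<psi>) * k \<psi> w \<partial>lborel) \<partial>sph) \<le> 2 * A * wnorm2 s h" by simp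
      have "(\<integral>\<^sup>+\<psi>. (\<integral>\<^sup>+w. Z \<psi> (p + w) \<partial>lborel) \<partial>sph) = (\<integral>\<^sup>+\<psi>. (\<integral>\<^sup>+x. Z \<psi> x \<partial>lborel) \<partial>sph)"
        by (intro nn_integral_cong nn_integral_lborel_shift) measurable
      also have "\<dots> = (\<integral>\<^sup>+x. (\<integral>\<^sup>+\<psi>. Z \<psi> x \<partial>sph) \<partial>lborel)"
        by (rule nn_integral_swap_sph[symmetric]) measurable
      also have "\<dots> \<le> (\<integral>\<^sup>+x. C * ennreal ((bracket x powr s * g x)\<^sup>2) \<partial>lborel)"
      proof (rule nn_integral_mono)
        fix x
        have "(\<integral>\<^sup>+\<psi>. Z \<psi> x \<partial>sph) = ennreal ((g x)\<^sup>2) * (ennreal (norm x powr (2 * s + 1)) *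
           (\<integral>\<^sup>+\<psi>. ennreal (\<bar>x \<bullet> \<psi>\<bar> powr (1 - 2 * s) * (1 + (x \<bullet> \<psi>)\<^sup>2) powr - s) \<partial>sph))"
          unfolding Z_def by (subst nn_integral_cmult, measurable, subst nn_integral_cmult, measurable)
        also have "\<dots> \<le> ennreal ((g x)\<^sup>2) * (C * ennreal (norm x powr (2 * s)))" by (intro mult_left_mono C) simp
        also have "\<dots> = C * ennreal (norm x powr (2 * s) * (g x)\<^sup>2)" by (simp add: ennreal_mult ac_simps)
        also have "\<dots> \<le> C * ennreal ((bracket x powr s * g x)\<^sup>2)"
        proof (intro mult_left_mono ennreal_leI)
          have "norm x powr (2 * s) \<le> bracket x powr (2 * s)" using s norm_le_bracket by (intro powr_mono2) auto
          also have "\<dots> = (bracket x powr s)\<^sup>2" by (simp add: power2_eq_square flip: powr_add)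
          finally show "norm x powr (2 * s) * (g x)\<^sup>2 \<le> (bracket x powr s * g x)\<^sup>2"
            unfolding power_mult_distrib by (rule mult_right_mono) simp
        qed simp
        finally show "(\<integral>\<^sup>+\<psi>. Z \<psi> x \<partial>sph) \<le> C * ennreal ((bracket x powr s * g x)\<^sup>2)" .
      qed
      also have "\<dots> = C * wnorm2 s g" unfolding wnorm2_def by (rule nn_integral_cmult) measurable
      finally show "(\<integral>\<^sup>+\<psi>. (\<integral>\<^sup>+w. Z \<psi> (p + w) \<partial>lborel) \<partial>sph) \<le> C * wnorm2 s g" .
    qed auto
    also have "\<dots> \<le> ennreal l * (D * wnorm2 s h) + ennreal (1 / l) * (D * wnorm2 s g)"
    proof -
      have "12 * (2 * A) \<le> D" "12 * C \<le> D" unfolding D_def by (auto intro!: mult_left_mono)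
      then have "ennreal l * (12 * (2 * A) * wnorm2 s h) + ennreal (1 / l) * (12 * C * wnorm2 s g) \<le>
         ennreal l * (D * wnorm2 s h) + ennreal (1 / l) * (D * wnorm2 s g)"
        by (intro add_mono mult_left_mono mult_right_mono) auto
      moreover have "12 * (ennreal l * (2 * A * wnorm2 s h) + ennreal (1 / l) * (C * wnorm2 s g)) =
          ennreal l * (12 * (2 * A) * wnorm2 s h) + ennreal (1 / l) * (12 * C * wnorm2 s g)"
        by (simp only: distrib_left mult_ac)
      ultimately show ?thesis by (simp only:)
    qed
    finally show ?thesis .
  qed
  then show thesis using that D by blast
qed

text \<open>The distance of \<open>c - \<rho> \<phi>\<close> to the line through \<open>c\<close> bounds \<open>|c - \<rho> \<phi>|\<close> from below by
  \<open>\<rho>\<close> times a function of \<open>\<phi>\<close> whose inverse is integrable on the sphere.\<close>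

lemma newton_potential_le:
  obtains C where "C < \<infinity>"
    "\<And>(c :: real^3) \<rho>. \<rho> \<ge> 0 \<Longrightarrow> ennreal \<rho> * (\<integral>\<^sup>+\<phi>. ennreal (1 / bracket (c - \<rho> *\<^sub>R \<phi>)) \<partial>sph) \<le> C"
proof -
  obtain A where A: "A < \<infinity>"
    "\<And>(p :: real^3) \<psi>. norm \<psi> = 1 \<Longrightarrow> (\<integral>\<^sup>+x. indicator {0..1} (x \<bullet> \<psi>) *
       (ennreal (bracket (p + (x - (x \<bullet> \<psi>) *\<^sub>R \<psi>)) powr (- 2 * 1)) / ennreal (norm (x - (x \<bullet> \<psi>) *\<^sub>R \<psi>))) \<partial>lborel) \<le> A"
    using plane_integral_kernel_le[of 1] by auto
  have "ennreal \<rho> * (\<integral>\<^sup>+\<phi>. ennreal (1 / bracket (c - \<rho> *\<^sub>R \<phi>)) \<partial>sph) \<le> 4 * A" if rho: "\<rho> \<ge> 0" for c :: "real^3" and \<rho>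
  proof -
    obtain e :: "real^3" where e: "norm e = 1" "c = norm c *\<^sub>R e"
    proof (cases "c = 0")
      case True
      then show thesis using that[of "axis 1 1"] by simp
    next
      case False
      then show thesis using that[of "c /\<^sub>R norm c"] by simp
    qed
    have ee: "e \<bullet> e = 1" using e by (simp add: dot_square_norm)
    define P where "P x = x - (x \<bullet> e) *\<^sub>R e" for x
    have [measurable]: "P \<in> borel_measurable borel" unfolding P_def by measurable
    have P_le: "norm (P x) \<le> norm x" for x
    proof -
      have "x \<bullet> x = P x \<bullet> P x + (x \<bullet> e)\<^sup>2"
        by (simp add: P_def inner_diff_left inner_diff_right ee inner_commute[of e x] power2_eq_square)
      then have "(norm (P x))\<^sup>2 \<le> (norm x)\<^sup>2" by (simp add: power2_norm_eq_inner)
      then show ?thesis by (rule power2_le_imp_le) simp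
    qed
    have P_scale: "P (r *\<^sub>R x) = r *\<^sub>R P x" for r x by (simp add: P_def algebra_simps)
    have Pc: "P (c - \<rho> *\<^sub>R \<phi>) = - (\<rho> *\<^sub>R P \<phi>)" for \<phi>
      by (subst e(2)) (simp add: P_def inner_diff_left ee algebra_simps)
    have "ennreal \<rho> * (\<integral>\<^sup>+\<phi>. ennreal (1 / bracket (c - \<rho> *\<^sub>R \<phi>)) \<partial>sph) = (\<integral>\<^sup>+\<phi>. ennreal \<rho> * ennreal (1 / bracket (c - \<rho> *\<^sub>R \<phi>)) \<partial>sph)"
      by (rule nn_integral_cmult[symmetric]) measurable
    also have "\<dots> \<le> (\<integral>\<^sup>+\<phi>. 1 / ennreal (norm (P \<phi>)) \<partial>sph)"
    proof (rule nn_integral_mono)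
      fix \<phi>
      show "ennreal \<rho> * ennreal (1 / bracket (c - \<rho> *\<^sub>R \<phi>)) \<le> 1 / ennreal (norm (P \<phi>))"
      proof (cases "P \<phi> = 0")
        case False
        have "\<rho> * norm (P \<phi>) \<le> bracket (c - \<rho> *\<^sub>R \<phi>)"
          using order_trans[OF P_le norm_le_bracket, of "c - \<rho> *\<^sub>R \<phi>"] rho by (simp add: Pc)
        then have "\<rho> * (1 / bracket (c - \<rho> *\<^sub>R \<phi>)) \<le> 1 / norm (P \<phi>)" using False by (simp add: field_simps)
        moreover have "1 / ennreal (norm (P \<phi>)) = ennreal (1 / norm (P \<phi>))"
          using False divide_ennreal[of 1 "norm (P \<phi>)"] by simp
        ultimately show ?thesis using rho by (simp add: ennreal_leI flip: ennreal_mult)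
      qed (simp add: ennreal_divide_zero)
    qed
    also have "\<dots> = (\<integral>\<^sup>+y. indicator (ball 0 1) y * (1 / ennreal (norm (P (sgn y)))) \<partial>lborel)"
      by (rule nn_integral_sph) measurable
    also have "\<dots> \<le> (\<integral>\<^sup>+y. indicator (ball 0 1) y * (1 / ennreal (norm (P y))) \<partial>lborel)"
    proof (rule nn_integral_mono_AE, use AE_lborel_neq[of "0 :: real^3"] in eventually_elim)
      case (elim y)
      have "1 / ennreal (norm (P (sgn y))) \<le> 1 / ennreal (norm (P y))" if "norm y < 1"
      proof -
        have "norm (P y) = norm y * norm (P (sgn y))" using elim by (simp add: sgn_div_norm P_scale)
        also have "\<dots> \<le> 1 * norm (P (sgn y))" using that by (intro mult_right_mono) auto
        finally have le: "norm (P y) \<le> norm (P (sgn y))" by simp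
        show ?thesis
        proof (cases "P y = 0")
          case False
          then have "norm (P y) > 0" by simp
          moreover then have "norm (P (sgn y)) > 0" using le by linarith
          ultimately have "1 / ennreal (norm (P (sgn y))) = ennreal (1 / norm (P (sgn y)))" "1 / ennreal (norm (P y)) = ennreal (1 / norm (P y))"
            using le divide_ennreal[of 1 "norm (P (sgn y))"] divide_ennreal[of 1 "norm (P y)"] by simp_all
          moreover have "1 / norm (P (sgn y)) \<le> 1 / norm (P y)" using le \<open>norm (P y) > 0\<close> by (intro frac_le) auto
          ultimately show ?thesis by (simp add: ennreal_leI)
        qed (simp add: ennreal_divide_zero)
      qed
      then show ?case by (auto simp: indicator_def)
    qed
    also have "\<dots> = (\<integral>\<^sup>+x. indicator {0..1} (x \<bullet> e) * (\<integral>\<^sup>+t. indicator (ball 0 1) (x + (t - x \<bullet> e) *\<^sub>R e) * (1 / ennreal (norm (P (x + (t - x \<bullet> e) *\<^sub>R e)))) \<partial>lborel) \<partial>lborel)"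
      by (rule nn_integral_split_line[OF _ e(1)]) measurable
    \<comment> \<open>On the unit ball <b>^(-2) is at least 1/2, so this weight can be inserted at
      the cost of a factor 2 to match \<open>plane_integral_kernel_le\<close> with exponent 1; the
      other factor 2 is the length of the range of t.\<close>
    also have "\<dots> \<le> (\<integral>\<^sup>+x. 4 * (indicator {0..1} (x \<bullet> e) * (ennreal (bracket (0 + (x - (x \<bullet> e) *\<^sub>R e)) powr (- 2 * 1)) / ennreal (norm (x - (x \<bullet> e) *\<^sub>R e)))) \<partial>lborel)"
    proof (rule nn_integral_mono)
      fix x
      define b where "b = x - (x \<bullet> e) *\<^sub>R e"
      have xb: "x + (t - x \<bullet> e) *\<^sub>R e = b + t *\<^sub>R e" for t by (simp add: b_def algebra_simps)
      have be: "b \<bullet> e = 0" by (simp add: b_def inner_diff_left ee)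
      have Pb: "P (b + t *\<^sub>R e) = b" for t by (simp add: P_def inner_add_left be ee)
      have "(\<integral>\<^sup>+t. indicator (ball 0 1) (b + t *\<^sub>R e) * (1 / ennreal (norm b)) \<partial>lborel) \<le>
         (\<integral>\<^sup>+t. 2 * (ennreal (bracket b powr - 2) / ennreal (norm b)) * indicator {-1..1} t \<partial>(lborel :: real measure))"
      proof (rule nn_integral_mono)
        fix t :: real
        have "norm (b + t *\<^sub>R e) < 1 \<Longrightarrow> norm b \<le> 1 \<and> \<bar>t\<bar> \<le> 1"
        proof
          assume a: "norm (b + t *\<^sub>R e) < 1"
          show "norm b \<le> 1" using P_le[of "b + t *\<^sub>R e"] a by (simp add: Pb)
          have "\<bar>(b + t *\<^sub>R e) \<bullet> e\<bar> \<le> norm (b + t *\<^sub>R e) * norm e" by (rule Cauchy_Schwarz_ineq2)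
          then show "\<bar>t\<bar> \<le> 1" using a e(1) by (simp add: inner_add_left be ee)
        qed
        moreover have "1 / ennreal (norm b) \<le> 2 * (ennreal (bracket b powr - 2) / ennreal (norm b))" if "norm b \<le> 1"
        proof -
          have "bracket b powr - 2 = 1 / (1 + (norm b)\<^sup>2)"
            by (simp add: bracket_powr powr_minus_divide add_pos_nonneg)
          moreover have "1 + (norm b)\<^sup>2 \<le> 2" using that by (simp add: power_le_one)
          ultimately have "1 \<le> 2 * bracket b powr - 2" by (simp add: field_simps add_pos_nonneg)
          then have "1 \<le> 2 * ennreal (bracket b powr - 2)"
            using ennreal_leI[of 1 "2 * bracket b powr - 2"] by (simp add: ennreal_mult)
          then have "1 / ennreal (norm b) \<le> 2 * ennreal (bracket b powr - 2) / ennreal (norm b)"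
            by (rule divide_right_mono_ennreal)
          then show ?thesis by (simp add: ennreal_times_divide)
        qed
        ultimately show "indicator (ball 0 1) (b + t *\<^sub>R e) * (1 / ennreal (norm b)) \<le>
          2 * (ennreal (bracket b powr - 2) / ennreal (norm b)) * indicator {-1..1} t"
          by (cases "norm (b + t *\<^sub>R e) < 1") (auto simp: indicator_def)
      qed
      also have "\<dots> = 2 * (ennreal (bracket b powr - 2) / ennreal (norm b)) * ennreal 2"
        by (subst nn_integral_cmult_indicator) auto
      also have "\<dots> = 4 * (ennreal (bracket b powr - 2) / ennreal (norm b))"
      proof -
        have "2 * X * 2 = (2 * 2) * X" for X :: ennreal by (simp only: mult_ac)
        then show ?thesis by simp
      qed
      finally have "indicator {0..1} (x \<bullet> e) * (\<integral>\<^sup>+t. indicator (ball 0 1) (b + t *\<^sub>R e) * (1 / ennreal (norm b)) \<partial>lborel) \<le>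
          indicator {0..1} (x \<bullet> e) * (4 * (ennreal (bracket b powr - 2) / ennreal (norm b)))"
        by (rule mult_left_mono) simp
      then show "indicator {0..1} (x \<bullet> e) * (\<integral>\<^sup>+t. indicator (ball 0 1) (x + (t - x \<bullet> e) *\<^sub>R e) * (1 / ennreal (norm (P (x + (t - x \<bullet> e) *\<^sub>R e)))) \<partial>lborel)
        \<le> 4 * (indicator {0..1} (x \<bullet> e) * (ennreal (bracket (0 + (x - (x \<bullet> e) *\<^sub>R e)) powr (- 2 * 1)) / ennreal (norm (x - (x \<bullet> e) *\<^sub>R e))))"
        unfolding xb Pb b_def[symmetric] by (simp add: mult.left_commute)
    qed
    also have "\<dots> = 4 * (\<integral>\<^sup>+x. indicator {0..1} (x \<bullet> e) * (ennreal (bracket (0 + (x - (x \<bullet> e) *\<^sub>R e)) powr (- 2 * 1)) / ennreal (norm (x - (x \<bullet> e) *\<^sub>R e))) \<partial>lborel)"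
      by (rule nn_integral_cmult) measurable
    also have "\<dots> \<le> 4 * A" by (rule mult_left_mono[OF A(2)[OF e(1)]]) simp
    finally show ?thesis .
  qed
  moreover have "4 * A < \<infinity>" using A(1) by (simp add: ennreal_mult_less_top)
  ultimately show thesis using that by blast
qed

section \<open>Exchange of incoming and outgoing momenta, and the gain term\<close>

lemma measurable_quadruple:
  assumes [measurable]: "(\<lambda>(a, b, c, d). F a b c d) \<in> borel_measurable (A \<Otimes>\<^sub>M B \<Otimes>\<^sub>M C \<Otimes>\<^sub>M D)"
    "f \<in> measurable M A" "g \<in> measurable M B" "h \<in> measurable M C" "k \<in> measurable M D"
  shows "(\<lambda>x. F (f x) (g x) (h x) (k x)) \<in> borel_measurable M"
  using measurable_compose[of "\<lambda>x. (f x, g x, h x, k x)" M "A \<Otimes>\<^sub>M B \<Otimes>\<^sub>M C \<Otimes>\<^sub>M D" "\<lambda>(a, b, c, d). F a b c d" borel] by simp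

text \<open>The factor 48 is 8 times 2 times 3: the Jacobian of p1 = p - 2 d, the relation |p - p1|
  = 2 |d|, and the 3 of polar coordinates for d.\<close>

lemma coll_integral_radial:
  fixes F :: "real^3 \<Rightarrow> real^3 \<Rightarrow> real^3 \<Rightarrow> real^3 \<Rightarrow> ennreal"
  assumes m: "(\<lambda>(a, b, c, d). F a b c d) \<in> borel_measurable (borel \<Otimes>\<^sub>M borel \<Otimes>\<^sub>M borel \<Otimes>\<^sub>M borel)"
  shows "(\<integral>\<^sup>+p. coll p (F p) \<partial>lborel) = 48 * (\<integral>\<^sup>+c. (\<integral>\<^sup>+\<theta>. (\<integral>\<^sup>+\<phi>. (\<integral>\<^sup>+r. indicator {0<..} r *
     (ennreal (r\<^sup>2) * (ennreal r * F (c + r *\<^sub>R \<theta>) (c - r *\<^sub>R \<theta>) (c + r *\<^sub>R \<phi>) (c - r *\<^sub>R \<phi>))) \<partial>lborel) \<partial>sph) \<partial>sph) \<partial>lborel)"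
proof -
  note [measurable (raw)] = measurable_quadruple[OF m]
  define V where "V c d = (\<integral>\<^sup>+\<phi>. ennreal (norm d) * F (c + d) (c - d) (c + norm d *\<^sub>R \<phi>) (c - norm d *\<^sub>R \<phi>) \<partial>sph)" for c d
  have Vm: "(\<lambda>(c, d). V c d) \<in> borel_measurable (borel \<Otimes>\<^sub>M borel)" unfolding V_def by measurable
  note [measurable] = Vm
  have "coll p (F p) = 8 * (\<integral>\<^sup>+d. 2 * V (p - d) d \<partial>lborel)" for p
  proof -
    define G where "G p1 = (\<integral>\<^sup>+\<phi>. ennreal (norm (p - p1)) * F p p1 (p2_of p p1 \<phi>) (p3_of p p1 \<phi>) \<partial>sph)" for p1
    have [measurable]: "G \<in> borel_measurable borel" unfolding G_def by measurable
    have "coll p (F p) = ennreal (\<bar>-2\<bar> ^ DIM(real^3)) * (\<integral>\<^sup>+d. G (p + (-2) *\<^sub>R d) \<partial>lborel)"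
      unfolding coll_def G_def[symmetric] by (rule nn_integral_lborel_affine) auto
    moreover have "G (p + (-2) *\<^sub>R d) = 2 * V (p - d) d" for d
    proof -
      have n: "norm (p - (p + (-2) *\<^sub>R d)) = 2 * norm d" by simp
      have h: "(p + (p + (-2) *\<^sub>R d)) /\<^sub>R 2 = p - d" by (simp add: vec_eq_iff field_simps)
      have "p - d + d = p" "p - d - d = p + (-2) *\<^sub>R d" by (simp_all add: vec_eq_iff)
      then have "2 * V (p - d) d = (\<integral>\<^sup>+\<phi>. 2 * (ennreal (norm d) * F p (p + (-2) *\<^sub>R d) (p - d + norm d *\<^sub>R \<phi>) (p - d - norm d *\<^sub>R \<phi>)) \<partial>sph)"
        unfolding V_def by (simp only:) (rule nn_integral_cmult[symmetric], measurable)
      then show ?thesis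
        unfolding G_def p2_of_def p3_of_def n h by (simp add: ennreal_mult mult.assoc)
    qed
    ultimately show ?thesis by simp
  qed
  then have "(\<integral>\<^sup>+p. coll p (F p) \<partial>lborel) = (\<integral>\<^sup>+p. 8 * (\<integral>\<^sup>+d. 2 * V (p - d) d \<partial>lborel) \<partial>lborel)" by simp
  also have "\<dots> = 16 * (\<integral>\<^sup>+p. (\<integral>\<^sup>+d. V (p - d) d \<partial>lborel) \<partial>lborel)"
  proof -
    have "(\<integral>\<^sup>+d. 2 * V (p - d) d \<partial>lborel) = 2 * (\<integral>\<^sup>+d. V (p - d) d \<partial>lborel)" for p
      by (rule nn_integral_cmult) measurable
    moreover have "(\<integral>\<^sup>+p. 16 * (\<integral>\<^sup>+d. V (p - d) d \<partial>lborel) \<partial>lborel) = 16 * (\<integral>\<^sup>+p. (\<integral>\<^sup>+d. V (p - d) d \<partial>lborel) \<partial>lborel)"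
      by (rule nn_integral_cmult) measurable
    ultimately show ?thesis by (simp add: mult.assoc[symmetric])
  qed
  also have "(\<integral>\<^sup>+p. (\<integral>\<^sup>+d. V (p - d) d \<partial>lborel) \<partial>lborel) = (\<integral>\<^sup>+d. (\<integral>\<^sup>+p. V (p - d) d \<partial>lborel) \<partial>lborel)"
    by (rule nn_integral_swap) measurable
  also have "\<dots> = (\<integral>\<^sup>+d. (\<integral>\<^sup>+c. V c d \<partial>lborel) \<partial>lborel)"
  proof (rule nn_integral_cong)
    fix d
    show "(\<integral>\<^sup>+p. V (p - d) d \<partial>lborel) = (\<integral>\<^sup>+c. V c d \<partial>lborel)"
      using nn_integral_lborel_shift[of "\<lambda>c. V c d" "- d"] by simp
  qed
  also have "\<dots> = (\<integral>\<^sup>+c. (\<integral>\<^sup>+d. V c d \<partial>lborel) \<partial>lborel)" by (rule nn_integral_swap) measurable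
  also have "\<dots> = (\<integral>\<^sup>+c. 3 * (\<integral>\<^sup>+\<theta>. (\<integral>\<^sup>+r. indicator {0<..} r * (ennreal (r\<^sup>2) * V c (r *\<^sub>R \<theta>)) \<partial>lborel) \<partial>sph) \<partial>lborel)"
    by (intro nn_integral_cong nn_integral_polar) measurable
  also have "\<dots> = 3 * (\<integral>\<^sup>+c. (\<integral>\<^sup>+\<theta>. (\<integral>\<^sup>+r. indicator {0<..} r * (ennreal (r\<^sup>2) * V c (r *\<^sub>R \<theta>)) \<partial>lborel) \<partial>sph) \<partial>lborel)"
    by (rule nn_integral_cmult) measurable
  also have "(\<integral>\<^sup>+c. (\<integral>\<^sup>+\<theta>. (\<integral>\<^sup>+r. indicator {0<..} r * (ennreal (r\<^sup>2) * V c (r *\<^sub>R \<theta>)) \<partial>lborel) \<partial>sph) \<partial>lborel) =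
     (\<integral>\<^sup>+c. (\<integral>\<^sup>+\<theta>. (\<integral>\<^sup>+\<phi>. (\<integral>\<^sup>+r. indicator {0<..} r *
     (ennreal (r\<^sup>2) * (ennreal r * F (c + r *\<^sub>R \<theta>) (c - r *\<^sub>R \<theta>) (c + r *\<^sub>R \<phi>) (c - r *\<^sub>R \<phi>))) \<partial>lborel) \<partial>sph) \<partial>sph) \<partial>lborel)"
  proof (rule nn_integral_cong, rule nn_integral_cong_AE, use AE_sph_norm in eventually_elim)
    fix c \<theta> :: "real^3" assume th: "norm \<theta> = 1"
    have "(\<integral>\<^sup>+r. indicator {0<..} r * (ennreal (r\<^sup>2) * V c (r *\<^sub>R \<theta>)) \<partial>lborel) =
       (\<integral>\<^sup>+r. (\<integral>\<^sup>+\<phi>. indicator {0<..} r * (ennreal (r\<^sup>2) * (ennreal r * F (c + r *\<^sub>R \<theta>) (c - r *\<^sub>R \<theta>) (c + r *\<^sub>R \<phi>) (c - r *\<^sub>R \<phi>))) \<partial>sph) \<partial>lborel)"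
    proof (rule nn_integral_cong)
      fix r :: real
      show "indicator {0<..} r * (ennreal (r\<^sup>2) * V c (r *\<^sub>R \<theta>)) =
        (\<integral>\<^sup>+\<phi>. indicator {0<..} r * (ennreal (r\<^sup>2) * (ennreal r * F (c + r *\<^sub>R \<theta>) (c - r *\<^sub>R \<theta>) (c + r *\<^sub>R \<phi>) (c - r *\<^sub>R \<phi>))) \<partial>sph)"
      proof (cases "r > 0")
        case True
        then have "norm (r *\<^sub>R \<theta>) = r" using th by simp
        then have "V c (r *\<^sub>R \<theta>) = (\<integral>\<^sup>+\<phi>. ennreal r * F (c + r *\<^sub>R \<theta>) (c - r *\<^sub>R \<theta>) (c + r *\<^sub>R \<phi>) (c - r *\<^sub>R \<phi>) \<partial>sph)"
          unfolding V_def by (simp only:)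
        moreover have "(\<integral>\<^sup>+\<phi>. indicator {0<..} r * (ennreal (r\<^sup>2) * X \<phi>) \<partial>sph) = indicator {0<..} r * (ennreal (r\<^sup>2) * (\<integral>\<^sup>+\<phi>. X \<phi> \<partial>sph))"
          if [measurable]: "X \<in> borel_measurable borel" for X
          using True by (simp add: nn_integral_cmult)
        ultimately show ?thesis by simp
      qed simp
    qed
    also have "\<dots> = (\<integral>\<^sup>+\<phi>. (\<integral>\<^sup>+r. indicator {0<..} r *
     (ennreal (r\<^sup>2) * (ennreal r * F (c + r *\<^sub>R \<theta>) (c - r *\<^sub>R \<theta>) (c + r *\<^sub>R \<phi>) (c - r *\<^sub>R \<phi>))) \<partial>lborel) \<partial>sph)"
      by (rule nn_integral_swap_sph) measurable
    finally show "(\<integral>\<^sup>+r. indicator {0<..} r * (ennreal (r\<^sup>2) * V c (r *\<^sub>R \<theta>)) \<partial>lborel) =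
       (\<integral>\<^sup>+\<phi>. (\<integral>\<^sup>+r. indicator {0<..} r *
     (ennreal (r\<^sup>2) * (ennreal r * F (c + r *\<^sub>R \<theta>) (c - r *\<^sub>R \<theta>) (c + r *\<^sub>R \<phi>) (c - r *\<^sub>R \<phi>))) \<partial>lborel) \<partial>sph)" .
  qed
  finally show ?thesis by (simp flip: mult.assoc)
qed

text \<open>Exchanging the incoming pair \<open>(p, p1)\<close> and the outgoing pair \<open>(p2, p3)\<close>: with
  \<open>p = c + d\<close>, \<open>p1 = c - d\<close> and polar coordinates \<open>d = r \<theta>\<close> both pairs are antipodal on the sphere of
  centre \<open>c\<close> and radius \<open>r\<close>, and the exchange is \<open>\<theta> \<leftrightarrow> \<phi>\<close>.\<close>

lemma coll_exchange:
  fixes F :: "real^3 \<Rightarrow> real^3 \<Rightarrow> real^3 \<Rightarrow> real^3 \<Rightarrow> ennreal"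
  assumes m: "(\<lambda>(a, b, c, d). F a b c d) \<in> borel_measurable (borel \<Otimes>\<^sub>M borel \<Otimes>\<^sub>M borel \<Otimes>\<^sub>M borel)"
  shows "(\<integral>\<^sup>+p. coll p (F p) \<partial>lborel) = (\<integral>\<^sup>+p. coll p (\<lambda>p1 p2 p3. F p2 p3 p p1) \<partial>lborel)"
proof -
  note [measurable (raw)] = measurable_quadruple[OF m]
  have m': "(\<lambda>(a, b, c, d). F c d a b) \<in> borel_measurable (borel \<Otimes>\<^sub>M borel \<Otimes>\<^sub>M borel \<Otimes>\<^sub>M borel)" by measurable
  interpret pair_sigma_finite sph sph ..
  have "(\<integral>\<^sup>+\<theta>. (\<integral>\<^sup>+\<phi>. (\<integral>\<^sup>+r. indicator {0<..} r *
     (ennreal (r\<^sup>2) * (ennreal r * F (c + r *\<^sub>R \<theta>) (c - r *\<^sub>R \<theta>) (c + r *\<^sub>R \<phi>) (c - r *\<^sub>R \<phi>))) \<partial>lborel) \<partial>sph) \<partial>sph) =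
    (\<integral>\<^sup>+\<phi>. (\<integral>\<^sup>+\<theta>. (\<integral>\<^sup>+r. indicator {0<..} r *
     (ennreal (r\<^sup>2) * (ennreal r * F (c + r *\<^sub>R \<theta>) (c - r *\<^sub>R \<theta>) (c + r *\<^sub>R \<phi>) (c - r *\<^sub>R \<phi>))) \<partial>lborel) \<partial>sph) \<partial>sph)" for c
    by (rule Fubini'[symmetric]) measurable
  then show ?thesis unfolding coll_integral_radial[OF m] coll_integral_radial[OF m'] by simp
qed

text \<open>Cauchy-Schwarz sets <p1> f(p1)^2 / <p3> against g(p2)^2 <p3> h(p3)^2 / <p1>. In the
  first factor only 1 / <p3> depends on \<phi>, so the potential bound makes it uniform in p. The
  second is integrated over p after the exchange of pairs, when again only 1 / <p3> depends on
  \<phi>.\<close>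

lemma coll_p1_p2_p3_le:
  obtains C where "C < \<infinity>"
    "\<And>f g h. f \<in> borel_measurable borel \<Longrightarrow> g \<in> borel_measurable borel \<Longrightarrow> h \<in> borel_measurable borel \<Longrightarrow>
       wnorm2 (1 / 2) f < \<infinity> \<Longrightarrow> wnorm2 0 g < \<infinity> \<Longrightarrow> wnorm2 (1 / 2) h < \<infinity> \<Longrightarrow>
       (\<integral>\<^sup>+p. (coll p (\<lambda>a b c. ennreal (\<bar>f a\<bar> * (\<bar>g b\<bar> * \<bar>h c\<bar>))))\<^sup>2 \<partial>lborel) \<le>
       C * (wnorm2 (1 / 2) f * (wnorm2 0 g * wnorm2 (1 / 2) h))"
proof -
  obtain C0 where C0: "C0 < \<infinity>"
    "\<And>(c :: real^3) \<rho>. \<rho> \<ge> 0 \<Longrightarrow> ennreal \<rho> * (\<integral>\<^sup>+\<phi>. ennreal (1 / bracket (c - \<rho> *\<^sub>R \<phi>)) \<partial>sph) \<le> C0"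
    using newton_potential_le by blast
  \<comment> \<open>The potential bound carries the radius, which is half of |p - p1|.\<close>
  define N where "N = 2 * C0"
  have N: "N < \<infinity>" using C0(1) by (simp add: N_def ennreal_mult_less_top)
  have N3: "ennreal (norm (p - p1)) * (\<integral>\<^sup>+\<phi>. ennreal (1 / bracket (p3_of p p1 \<phi>)) \<partial>sph) \<le> N" for p p1
  proof -
    have "ennreal (norm (p - p1)) = 2 * ennreal (norm (p - p1) / 2)"
      using ennreal_mult[of 2 "norm (p - p1) / 2"] by simp
    then show ?thesis
      using mult_left_mono[OF C0(2)[of "norm (p - p1) / 2" "(p + p1) /\<^sub>R 2"], of 2]
      by (simp add: N_def p3_of_def mult.assoc)
  qed
  have "(\<integral>\<^sup>+p. (coll p (\<lambda>a b c. ennreal (\<bar>f a\<bar> * (\<bar>g b\<bar> * \<bar>h c\<bar>))))\<^sup>2 \<partial>lborel) \<le>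
       (4 * (N * N)) * (wnorm2 (1 / 2) f * (wnorm2 0 g * wnorm2 (1 / 2) h))"
    if [measurable]: "f \<in> borel_measurable borel" "g \<in> borel_measurable borel" "h \<in> borel_measurable borel"
      and fin: "wnorm2 (1 / 2) f < \<infinity>" "wnorm2 0 g < \<infinity>" "wnorm2 (1 / 2) h < \<infinity>" for f g h
  proof -
    define Fa where "Fa a = ennreal ((bracket a powr (1 / 2) * f a)\<^sup>2)" for a
    define Gb where "Gb b = ennreal ((bracket b powr 0 * g b)\<^sup>2)" for b
    define Hc where "Hc c = ennreal ((bracket c powr (1 / 2) * h c)\<^sup>2)" for c
    have [measurable]: "Fa \<in> borel_measurable borel" "Gb \<in> borel_measurable borel" "Hc \<in> borel_measurable borel"
      unfolding Fa_def Gb_def Hc_def by measurable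
    have W: "wnorm2 (1 / 2) f = (\<integral>\<^sup>+x. Fa x \<partial>lborel)" "wnorm2 0 g = (\<integral>\<^sup>+x. Gb x \<partial>lborel)" "wnorm2 (1 / 2) h = (\<integral>\<^sup>+x. Hc x \<partial>lborel)"
      by (simp_all only: wnorm2_def Fa_def Gb_def Hc_def)
    define A where "A p = coll p (\<lambda>a b c. Fa a * ennreal (1 / bracket c))" for p
    define B where "B p = coll p (\<lambda>a b c. Gb b * Hc c * ennreal (1 / bracket a))" for p
    have Bm [measurable]: "B \<in> borel_measurable borel" unfolding B_def coll_def by measurable
    have A_le: "A p \<le> N * wnorm2 (1 / 2) f" for p
    proof -
      have "A p = (\<integral>\<^sup>+p1. Fa p1 * (ennreal (norm (p - p1)) * (\<integral>\<^sup>+\<phi>. ennreal (1 / bracket (p3_of p p1 \<phi>)) \<partial>sph)) \<partial>lborel)"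
        unfolding A_def coll_def
        by (subst nn_integral_cmult[symmetric], measurable, subst nn_integral_cmult[symmetric], measurable) (simp add: ac_simps)
      also have "\<dots> \<le> (\<integral>\<^sup>+p1. Fa p1 * N \<partial>lborel)" by (intro nn_integral_mono mult_left_mono N3) auto
      also have "\<dots> = N * wnorm2 (1 / 2) f" unfolding W by (subst nn_integral_multc) (auto simp: mult.commute)
      finally show ?thesis .
    qed
    have B_int: "(\<integral>\<^sup>+p. B p \<partial>lborel) \<le> N * (wnorm2 0 g * wnorm2 (1 / 2) h)"
    proof -
      have "(\<integral>\<^sup>+p. B p \<partial>lborel) = (\<integral>\<^sup>+p. coll p (\<lambda>p1 p2 p3. Gb p * Hc p1 * ennreal (1 / bracket p3)) \<partial>lborel)"
        unfolding B_def by (rule coll_exchange[of "\<lambda>p p1 p2 p3. Gb p2 * Hc p3 * ennreal (1 / bracket p1)"]) measurable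
      also have "\<dots> = (\<integral>\<^sup>+p. (\<integral>\<^sup>+p1. Gb p * Hc p1 * (ennreal (norm (p - p1)) * (\<integral>\<^sup>+\<phi>. ennreal (1 / bracket (p3_of p p1 \<phi>)) \<partial>sph)) \<partial>lborel) \<partial>lborel)"
        unfolding coll_def
        by (subst nn_integral_cmult[symmetric], measurable, subst nn_integral_cmult[symmetric], measurable) (simp add: ac_simps)
      also have "\<dots> \<le> (\<integral>\<^sup>+p. (\<integral>\<^sup>+p1. Gb p * Hc p1 * N \<partial>lborel) \<partial>lborel)"
        by (intro nn_integral_mono mult_left_mono N3) auto
      also have "\<dots> = N * (wnorm2 0 g * wnorm2 (1 / 2) h)"
        unfolding W by (simp add: nn_integral_multc nn_integral_cmult ac_simps)
      finally show ?thesis .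
    qed
    have "N * (wnorm2 0 g * wnorm2 (1 / 2) h) < \<infinity>" using N fin by (simp add: ennreal_mult_less_top)
    with B_int have "(\<integral>\<^sup>+p. B p \<partial>lborel) \<noteq> \<infinity>" by (auto simp: top_unique)
    then have B_fin: "AE p in lborel. B p \<noteq> \<infinity>" by (rule nn_integral_PInf_AE[rotated]) measurable
    have Nf: "N * wnorm2 (1 / 2) f < \<infinity>" using N fin by (simp add: ennreal_mult_less_top)
    have "coll p (\<lambda>a b c. ennreal (\<bar>f a\<bar> * (\<bar>g b\<bar> * \<bar>h c\<bar>))) \<le> ennreal l * (N * wnorm2 (1 / 2) f) + ennreal (1 / l) * B p"
      if l: "l > 0" for l p
    proof -
      have pt: "ennreal (\<bar>f a\<bar> * (\<bar>g b\<bar> * \<bar>h c\<bar>)) \<le> ennreal l * (Fa a * ennreal (1 / bracket c)) + ennreal (1 / l) * (Gb b * Hc c * ennreal (1 / bracket a))" for a b c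
      proof -
        define k where "k = bracket a powr - (1 / 2) * bracket c powr - (1 / 2)"
        have eq: "\<bar>f a\<bar> * (\<bar>g b\<bar> * \<bar>h c\<bar>) = (bracket a powr (1 / 2) * \<bar>f a\<bar>) * (\<bar>g b\<bar> * (bracket c powr (1 / 2) * \<bar>h c\<bar>)) * k"
          by (simp add: k_def powr_minus field_simps)
        have half: "(bracket x powr - (1 / 2))\<^sup>2 = 1 / bracket x" for x
          by (simp add: power2_eq_square powr_minus_divide flip: powr_add)
        have "k\<^sup>2 = 1 / bracket c * (1 / bracket a)" unfolding k_def power_mult_distrib half by simp
        then have "ennreal (k\<^sup>2) = ennreal (1 / bracket c) * ennreal (1 / bracket a)" by (simp only:) (rule ennreal_mult, auto)
        then have "ennreal ((bracket a powr (1 / 2) * \<bar>f a\<bar>) * (\<bar>g b\<bar> * (bracket c powr (1 / 2) * \<bar>h c\<bar>)) * k) \<le>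
          ennreal l * (ennreal ((bracket a powr (1 / 2) * \<bar>f a\<bar>)\<^sup>2) * ennreal (1 / bracket c)) +
          ennreal (1 / l) * (ennreal ((\<bar>g b\<bar> * (bracket c powr (1 / 2) * \<bar>h c\<bar>))\<^sup>2) * ennreal (1 / bracket a))"
          by (intro weighted_amgm_ennreal[OF _ _ _ l]) (auto simp: k_def)
        moreover have "ennreal ((bracket a powr (1 / 2) * \<bar>f a\<bar>)\<^sup>2) = Fa a" by (simp add: Fa_def power_mult_distrib)
        moreover have "ennreal ((\<bar>g b\<bar> * (bracket c powr (1 / 2) * \<bar>h c\<bar>))\<^sup>2) = Gb b * Hc c"
          by (simp add: Gb_def Hc_def power_mult_distrib ennreal_mult)
        ultimately show ?thesis unfolding eq by simp
      qed
      have "coll p (\<lambda>a b c. ennreal (\<bar>f a\<bar> * (\<bar>g b\<bar> * \<bar>h c\<bar>))) \<le>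
        coll p (\<lambda>a b c. ennreal l * (Fa a * ennreal (1 / bracket c)) + ennreal (1 / l) * (Gb b * Hc c * ennreal (1 / bracket a)))"
        by (rule coll_mono[OF pt])
      also have "\<dots> = coll p (\<lambda>a b c. ennreal l * (Fa a * ennreal (1 / bracket c))) + coll p (\<lambda>a b c. ennreal (1 / l) * (Gb b * Hc c * ennreal (1 / bracket a)))"
        by (rule coll_add) measurable
      also have "coll p (\<lambda>a b c. ennreal l * (Fa a * ennreal (1 / bracket c))) = ennreal l * A p"
        unfolding A_def by (rule coll_cmult) measurable
      also have "coll p (\<lambda>a b c. ennreal (1 / l) * (Gb b * Hc c * ennreal (1 / bracket a))) = ennreal (1 / l) * B p"
        unfolding B_def by (rule coll_cmult) measurable
      also have "ennreal l * A p + ennreal (1 / l) * B p \<le> ennreal l * (N * wnorm2 (1 / 2) f) + ennreal (1 / l) * B p"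
        by (intro add_mono mult_left_mono A_le) auto
      finally show ?thesis .
    qed
    note coll_le = this
    \<comment> \<open>The parameter l is optimised separately at every p with finite
      \<open>B p\<close>, that is, almost everywhere; the square of the optimum is 4 times the
      product of the two bounds.\<close>
    have "(\<integral>\<^sup>+p. (coll p (\<lambda>a b c. ennreal (\<bar>f a\<bar> * (\<bar>g b\<bar> * \<bar>h c\<bar>))))\<^sup>2 \<partial>lborel) \<le>
       (\<integral>\<^sup>+p. 4 * (N * wnorm2 (1 / 2) f) * B p \<partial>lborel)"
    proof (rule nn_integral_mono_AE, use B_fin in eventually_elim)
      case (elim p)
      obtain b where b: "B p = ennreal b" "b \<ge> 0" using elim by (cases "B p") auto
      obtain a where a: "N * wnorm2 (1 / 2) f = ennreal a" "a \<ge> 0" using Nf by (cases "N * wnorm2 (1 / 2) f") auto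
      have "coll p (\<lambda>a b c. ennreal (\<bar>f a\<bar> * (\<bar>g b\<bar> * \<bar>h c\<bar>))) \<le> ennreal (2 * sqrt (a * b))"
        by (rule ennreal_optimize) (use coll_le[of _ p] a b in auto)
      then have "(coll p (\<lambda>a b c. ennreal (\<bar>f a\<bar> * (\<bar>g b\<bar> * \<bar>h c\<bar>))))\<^sup>2 \<le> (ennreal (2 * sqrt (a * b)))\<^sup>2"
        by (rule power_mono) simp
      also have "\<dots> = ennreal ((2 * sqrt (a * b))\<^sup>2)" using a b by (simp add: ennreal_power)
      also have "(2 * sqrt (a * b))\<^sup>2 = 4 * (a * b)" using a b by (simp add: power_mult_distrib)
      also have "ennreal (4 * (a * b)) = 4 * (N * wnorm2 (1 / 2) f) * B p"
        unfolding a b using a(2) b(2) by (simp add: ennreal_mult mult.assoc)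
      finally show ?case .
    qed
    also have "\<dots> = 4 * (N * wnorm2 (1 / 2) f) * (\<integral>\<^sup>+p. B p \<partial>lborel)" by (rule nn_integral_cmult) measurable
    also have "\<dots> \<le> 4 * (N * wnorm2 (1 / 2) f) * (N * (wnorm2 0 g * wnorm2 (1 / 2) h))" by (intro mult_left_mono B_int) simp
    also have "\<dots> = (4 * (N * N)) * (wnorm2 (1 / 2) f * (wnorm2 0 g * wnorm2 (1 / 2) h))" by (simp add: ac_simps)
    finally show ?thesis .
  qed
  moreover have "4 * (N * N) < \<infinity>" using N by (simp add: ennreal_mult_less_top)
  ultimately show thesis using that by blast
qed

section \<open>The Hilbert space of square-integrable functions\<close>

definition square_integrable :: "(real^3 \<Rightarrow> real) set" where
  "square_integrable = {f \<in> borel_measurable borel. integrable lborel (\<lambda>x. (f x)\<^sup>2)}"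

lemma square_integrable_measurable: "f \<in> square_integrable \<Longrightarrow> f \<in> borel_measurable borel"
  by (simp add: square_integrable_def)

lemma square_integrable_mult:
  assumes "f \<in> square_integrable" "g \<in> square_integrable"
  shows "integrable lborel (\<lambda>x. f x * g x)"
proof (rule Bochner_Integration.integrable_bound)
  show "integrable lborel (\<lambda>x. (f x)\<^sup>2 + (g x)\<^sup>2)" using assms by (simp add: square_integrable_def)
  show "(\<lambda>x. f x * g x) \<in> borel_measurable lborel" using assms by (auto simp: square_integrable_def)
  have "\<bar>a * b\<bar> \<le> a\<^sup>2 + b\<^sup>2" for a b :: real
  proof -
    have "0 \<le> \<bar>a\<bar> * \<bar>b\<bar>" by simp
    then show ?thesis using sum_squares_bound[of "\<bar>a\<bar>" "\<bar>b\<bar>"] unfolding abs_mult power2_abs by linarith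
  qed
  then show "AE x in lborel. norm (f x * g x) \<le> norm ((f x)\<^sup>2 + (g x)\<^sup>2)" by simp
qed

lemma square_integrable_add:
  assumes "f \<in> square_integrable" "g \<in> square_integrable"
  shows "(\<lambda>x. f x + g x) \<in> square_integrable"
  using assms square_integrable_mult[OF assms]
  by (auto simp: square_integrable_def power2_sum mult.assoc intro!: Bochner_Integration.integrable_add)

lemma square_integrable_scale:
  assumes "f \<in> square_integrable"
  shows "(\<lambda>x. c * f x) \<in> square_integrable"
  using assms by (auto simp: square_integrable_def power_mult_distrib)

lemma square_integrable_diff:
  assumes "f \<in> square_integrable" "g \<in> square_integrable"
  shows "(\<lambda>x. f x - g x) \<in> square_integrable"
  using square_integrable_add[OF assms(1) square_integrable_scale[OF assms(2), of "-1"]] by simp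

lemma square_integrable_minus: "f \<in> square_integrable \<Longrightarrow> (\<lambda>x. - f x) \<in> square_integrable"
  using square_integrable_scale[of f "-1"] by simp

lemma square_integrable_0: "(\<lambda>x. 0) \<in> square_integrable"
  by (simp add: square_integrable_def)

definition L2_eq :: "(real^3 \<Rightarrow> real) \<Rightarrow> (real^3 \<Rightarrow> real) \<Rightarrow> bool" where
  "L2_eq f g \<longleftrightarrow> f \<in> square_integrable \<and> g \<in> square_integrable \<and> (AE x in lborel. f x = g x)"

\<comment> \<open>Classes modulo null sets form a type of their own, so that the classes
  \<open>real_inner\<close> and \<open>banach\<close> and the calculus based on them apply. The
  relation is partial, as a function that is not square integrable is not related to itself.\<close>
quotient_type l2 = "real^3 \<Rightarrow> real" / partial: L2_eq
proof (rule part_equivpI)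
  show "\<exists>x. L2_eq x x" using square_integrable_0 by (auto simp: L2_eq_def)
  show "symp L2_eq" by (rule sympI) (auto simp: L2_eq_def)
  show "transp L2_eq" by (rule transpI) (auto simp: L2_eq_def)
qed

instantiation l2 :: real_inner
begin

lift_definition zero_l2 :: l2 is "\<lambda>x. 0" by (simp add: L2_eq_def square_integrable_0)

lift_definition plus_l2 :: "l2 \<Rightarrow> l2 \<Rightarrow> l2" is "\<lambda>f g x. f x + g x"
  by (auto simp: L2_eq_def square_integrable_add)

lift_definition scaleR_l2 :: "real \<Rightarrow> l2 \<Rightarrow> l2" is "\<lambda>c f x. c * f x"
  by (auto simp: L2_eq_def square_integrable_scale)

lift_definition uminus_l2 :: "l2 \<Rightarrow> l2" is "\<lambda>f x. - f x"
  by (auto simp: L2_eq_def square_integrable_minus)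

lift_definition minus_l2 :: "l2 \<Rightarrow> l2 \<Rightarrow> l2" is "\<lambda>f g x. f x - g x"
  by (auto simp: L2_eq_def square_integrable_diff)

lift_definition inner_l2 :: "l2 \<Rightarrow> l2 \<Rightarrow> real" is "\<lambda>f g. LINT x|lborel. f x * g x"
  by (auto simp: L2_eq_def square_integrable_def intro!: integral_cong_AE)

definition norm_l2 :: "l2 \<Rightarrow> real" where "norm_l2 x = sqrt (inner x x)"
definition sgn_l2 :: "l2 \<Rightarrow> l2" where "sgn_l2 x = scaleR (inverse (norm x)) x"
definition dist_l2 :: "l2 \<Rightarrow> l2 \<Rightarrow> real" where "dist_l2 x y = norm (x - y)"
definition uniformity_l2 :: "(l2 \<times> l2) filter" where
  "uniformity_l2 = (INF e\<in>{0<..}. principal {(x, y). dist x y < e})"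
definition open_l2 :: "l2 set \<Rightarrow> bool" where
  "open_l2 S = (\<forall>x\<in>S. \<forall>\<^sub>F (x', y) in uniformity. x' = x \<longrightarrow> y \<in> S)"

instance
proof
  fix x y z :: l2 and a b :: real
  show "x + y + z = x + (y + z)" by transfer (auto simp: L2_eq_def square_integrable_add add.assoc)
  show "x + y = y + x" by transfer (auto simp: L2_eq_def square_integrable_add add.commute)
  show "0 + x = x" by transfer (auto simp: L2_eq_def)
  show "- x + x = 0" by transfer (auto simp: L2_eq_def square_integrable_0)
  show "x - y = x + - y"
    by transfer (auto simp: L2_eq_def square_integrable_diff)
  show "a *\<^sub>R (x + y) = a *\<^sub>R x + a *\<^sub>R y"
    by transfer (auto simp: L2_eq_def square_integrable_add square_integrable_scale distrib_left)
  show "(a + b) *\<^sub>R x = a *\<^sub>R x + b *\<^sub>R x"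
    by transfer (auto simp: L2_eq_def square_integrable_add square_integrable_scale distrib_right)
  show "a *\<^sub>R b *\<^sub>R x = (a * b) *\<^sub>R x"
    by transfer (auto simp: L2_eq_def square_integrable_scale mult.assoc)
  show "1 *\<^sub>R x = x" by transfer (auto simp: L2_eq_def)
  show "inner x y = inner y x" by transfer (simp add: mult.commute)
  show "inner (x + y) z = inner x z + inner y z"
  proof transfer
    fix f g h assume "L2_eq f f" "L2_eq g g" "L2_eq h h"
    then show "(LINT x|lborel. (f x + g x) * h x) = (LINT x|lborel. f x * h x) + (LINT x|lborel. g x * h x)"
      by (simp add: distrib_right L2_eq_def square_integrable_mult)
  qed
  show "inner (a *\<^sub>R x) y = a * inner x y" by transfer (simp add: mult.assoc)
  show "0 \<le> inner x x" by transfer (simp add: integral_nonneg_AE)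
  show "inner x x = 0 \<longleftrightarrow> x = 0"
  proof transfer
    fix f assume "L2_eq f f"
    then have f: "f \<in> square_integrable" by (simp add: L2_eq_def)
    have "(LINT x|lborel. f x * f x) = 0 \<longleftrightarrow> (AE x in lborel. f x * f x = 0)"
      by (rule integral_nonneg_eq_0_iff_AE) (use square_integrable_mult[OF f f] in auto)
    then show "((LINT x|lborel. f x * f x) = 0) = L2_eq f (\<lambda>x. 0)"
      using f square_integrable_0 by (simp add: L2_eq_def)
  qed
qed (simp_all add: norm_l2_def sgn_l2_def dist_l2_def uniformity_l2_def open_l2_def)

end

lemma norm_l2_abs:
  assumes "f \<in> square_integrable"
  shows "norm (abs_l2 f) = sqrt (LINT x|lborel. (f x)\<^sup>2)"
  using assms by (simp add: norm_l2_def inner_l2.abs_eq L2_eq_def power2_eq_square)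

lemma nn_integral_square_l2:
  assumes "f \<in> square_integrable"
  shows "(\<integral>\<^sup>+x. ennreal ((f x)\<^sup>2) \<partial>lborel) = ennreal ((norm (abs_l2 f))\<^sup>2)"
  using assms by (subst nn_integral_eq_integral) (auto simp: norm_l2_abs square_integrable_def)

lemma rep_l2_square_integrable: "rep_l2 x \<in> square_integrable"
  using Quotient3_rep_reflp[OF Quotient3_l2, of x] by (simp add: L2_eq_def)

lemma abs_rep_l2: "abs_l2 (rep_l2 x) = x"
  by (rule Quotient3_abs_rep[OF Quotient3_l2])

lemma abs_l2_eq_iff:
  assumes "f \<in> square_integrable" "g \<in> square_integrable"
  shows "abs_l2 f = abs_l2 g \<longleftrightarrow> (AE x in lborel. f x = g x)"
  using Quotient3_rel[OF Quotient3_l2, of f g] assms by (auto simp: L2_eq_def)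

lemma abs_l2_add:
  assumes "f \<in> square_integrable" "g \<in> square_integrable"
  shows "abs_l2 f + abs_l2 g = abs_l2 (\<lambda>x. f x + g x)"
  using assms by (simp add: plus_l2.abs_eq L2_eq_def)

lemma abs_l2_diff:
  assumes "f \<in> square_integrable" "g \<in> square_integrable"
  shows "abs_l2 f - abs_l2 g = abs_l2 (\<lambda>x. f x - g x)"
  using assms by (simp add: minus_l2.abs_eq L2_eq_def)

lemma abs_l2_scaleR:
  assumes "f \<in> square_integrable"
  shows "c *\<^sub>R abs_l2 f = abs_l2 (\<lambda>x. c * f x)"
  using assms by (simp add: scaleR_l2.abs_eq L2_eq_def)

lemma inner_abs_l2:
  assumes "f \<in> square_integrable" "g \<in> square_integrable"
  shows "inner (abs_l2 f) (abs_l2 g) = (LINT x|lborel. f x * g x)"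
  using assms by (simp add: inner_l2.abs_eq L2_eq_def)

lemma square_integrableI_nn:
  assumes "f \<in> borel_measurable borel" "(\<integral>\<^sup>+x. ennreal ((f x)\<^sup>2) \<partial>lborel) < \<infinity>"
  shows "f \<in> square_integrable"
  using assms by (auto simp: square_integrable_def intro!: integrableI_bounded)

lemma square_integrable_abs:
  "f \<in> square_integrable \<Longrightarrow> (\<lambda>x. \<bar>f x\<bar>) \<in> square_integrable"
  by (auto simp: square_integrable_def)

lemma square_integrable_sum:
  assumes "\<And>i. i \<in> I \<Longrightarrow> f i \<in> square_integrable"
  shows "(\<lambda>x. \<Sum>i\<in>I. f i x) \<in> square_integrable"
  using assms by (induction I rule: infinite_finite_induct) (auto simp: square_integrable_0 square_integrable_add)

lemma norm_abs_l2_sum_le: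
  fixes n :: nat
  assumes f: "\<And>i. f i \<in> square_integrable"
  shows "norm (abs_l2 (\<lambda>x. \<Sum>i<n. \<bar>f i x\<bar>)) \<le> (\<Sum>i<n. norm (abs_l2 (f i)))"
proof (induction n)
  case 0
  then show ?case by (simp add: norm_l2_abs square_integrable_0)
next
  case (Suc n)
  have "abs_l2 (\<lambda>x. \<Sum>i<Suc n. \<bar>f i x\<bar>) = abs_l2 (\<lambda>x. \<Sum>i<n. \<bar>f i x\<bar>) + abs_l2 (\<lambda>x. \<bar>f n x\<bar>)"
    using f by (subst abs_l2_add) (auto intro!: square_integrable_sum square_integrable_abs)
  moreover have "norm (abs_l2 (\<lambda>x. \<bar>f n x\<bar>)) = norm (abs_l2 (f n))"
    using f by (simp add: norm_l2_abs square_integrable_abs)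
  ultimately show ?case using Suc norm_triangle_ineq[of "abs_l2 (\<lambda>x. \<Sum>i<n. \<bar>f i x\<bar>)" "abs_l2 (\<lambda>x. \<bar>f n x\<bar>)"] by simp
qed

text \<open>Riesz--Fischer: a rapidly convergent subsequence converges almost everywhere.\<close>

instance l2 :: banach
proof
  fix X :: "nat \<Rightarrow> l2" assume X: "Cauchy X"
  have "\<exists>r. strict_mono r \<and> (\<forall>k. \<forall>m\<ge>r k. dist (X m) (X (r k)) < (1/2) ^ k)"
  proof -
    have "\<exists>N. \<forall>m\<ge>N. \<forall>n\<ge>N. dist (X m) (X n) < (1/2) ^ k" for k
      using X by (intro metric_CauchyD) auto
    then obtain N where N: "\<And>k m n. m \<ge> N k \<Longrightarrow> n \<ge> N k \<Longrightarrow> dist (X m) (X n) < (1/2) ^ k" by metis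
    \<comment> \<open>The sum dominates N k, and the added k makes r strictly increasing.\<close>
    define r where "r k = (\<Sum>i\<le>k. N i) + k" for k
    have "strict_mono r" by (rule strict_monoI_Suc) (simp add: r_def)
    moreover have "r k \<ge> N k" for k using member_le_sum[of k "{..k}" N] by (simp add: r_def)
    moreover have "dist (X m) (X (r k)) < (1/2) ^ k" if "m \<ge> r k" for k m
      using N[of k m "r k"] \<open>\<And>k. r k \<ge> N k\<close>[of k] that by simp
    ultimately show ?thesis by blast
  qed
  then obtain r where r: "strict_mono r" "\<And>k m. m \<ge> r k \<Longrightarrow> dist (X m) (X (r k)) < (1/2) ^ k" by blast
  define f where "f k = rep_l2 (X (r k))" for k
  have f: "f k \<in> square_integrable" for k by (simp add: f_def rep_l2_square_integrable)
  have fm [measurable]: "f k \<in> borel_measurable borel" for k using f by (rule square_integrable_measurable)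
  have Xf: "X (r k) = abs_l2 (f k)" for k by (simp add: f_def abs_rep_l2)
  define d where "d k x = f (Suc k) x - f k x" for k x
  have d: "d k \<in> square_integrable" for k unfolding d_def by (intro square_integrable_diff f)
  have dm [measurable]: "d k \<in> borel_measurable borel" for k using d by (rule square_integrable_measurable)
  have nd: "norm (abs_l2 (d k)) \<le> (1/2) ^ k" for k
  proof -
    have "abs_l2 (d k) = X (r (Suc k)) - X (r k)" unfolding d_def Xf by (rule abs_l2_diff[symmetric]) (use f in auto)
    then show ?thesis using r(2)[of k "r (Suc k)"] r(1) by (simp add: dist_norm strict_mono_less_eq)
  qed
  have sum_half: "(\<Sum>i<n. (1/2 :: real) ^ i) \<le> 2" for n
    by (subst geometric_sum) auto
  define g where "g n x = (\<Sum>i<n. \<bar>d i x\<bar>)" for n x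
  have gm [measurable]: "g n \<in> borel_measurable borel" for n unfolding g_def by measurable
  have "(\<integral>\<^sup>+x. ennreal ((g n x)\<^sup>2) \<partial>lborel) \<le> 4" for n
  proof -
    have "norm (abs_l2 (g n)) \<le> 2"
    proof -
      have "norm (abs_l2 (g n)) \<le> (\<Sum>i<n. norm (abs_l2 (d i)))"
        unfolding g_def by (rule norm_abs_l2_sum_le[OF d])
      also have "\<dots> \<le> (\<Sum>i<n. (1/2) ^ i)" by (intro sum_mono nd)
      finally show ?thesis using sum_half[of n] by linarith
    qed
    then have "(norm (abs_l2 (g n)))\<^sup>2 \<le> 2\<^sup>2" by (intro power_mono) auto
    then have "ennreal ((norm (abs_l2 (g n)))\<^sup>2) \<le> 4" using ennreal_leI[of "(norm (abs_l2 (g n)))\<^sup>2" 4] by simp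
    moreover have "g n \<in> square_integrable"
      unfolding g_def by (intro square_integrable_sum square_integrable_abs d)
    ultimately show ?thesis by (simp add: nn_integral_square_l2)
  qed
  \<comment> \<open>The norms are bounded uniformly in n, so by monotone convergence the sum of all
    |d i| is square integrable and finite almost everywhere; there the telescoping sums
    converge.\<close>
  then have "(\<integral>\<^sup>+x. (SUP n. ennreal ((g n x)\<^sup>2)) \<partial>lborel) \<le> 4"
    by (subst nn_integral_monotone_convergence_SUP)
       (auto intro!: SUP_least incseq_SucI le_funI ennreal_leI power_mono sum_nonneg simp: g_def)
  then have "(\<integral>\<^sup>+x. (SUP n. ennreal ((g n x)\<^sup>2)) \<partial>lborel) \<noteq> \<infinity>" by (auto simp: top_unique)
  then have "AE x in lborel. (SUP n. ennreal ((g n x)\<^sup>2)) \<noteq> \<infinity>"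
    by (rule nn_integral_PInf_AE[rotated]) measurable
  then have conv: "AE x in lborel. convergent (\<lambda>k. f k x)"
  proof eventually_elim
    case (elim x)
    then obtain C where C: "(SUP n. ennreal ((g n x)\<^sup>2)) = ennreal C" "C \<ge> 0"
      by (cases "SUP n. ennreal ((g n x)\<^sup>2)") auto
    have "(g n x)\<^sup>2 \<le> C" for n
    proof -
      have "ennreal ((g n x)\<^sup>2) \<le> ennreal C" unfolding C(1)[symmetric] by (rule SUP_upper) simp
      then show ?thesis using C(2) by simp
    qed
    then have "(\<Sum>i<n. \<bar>d i x\<bar>) \<le> sqrt C" for n
      by (metis g_def real_le_rsqrt)
    then have "summable (\<lambda>i. \<bar>d i x\<bar>)" by (intro summableI_nonneg_bounded) auto
    then have "summable (\<lambda>i. d i x)" by (rule summable_rabs_cancel)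
    then have "convergent (\<lambda>n. \<Sum>i<n. d i x)" by (simp add: summable_iff_convergent)
    moreover have "(\<Sum>i<n. d i x) = f n x - f 0 x" for n
      unfolding d_def by (rule sum_lessThan_telescope)
    ultimately show ?case by (simp add: convergent_diff_const_right_iff)
  qed
  define F where "F x = lim (\<lambda>k. f k x)" for x
  have Fm [measurable]: "F \<in> borel_measurable borel" unfolding F_def by measurable
  have lim: "AE x in lborel. (\<lambda>k. f k x) \<longlonglongrightarrow> F x"
    using conv by eventually_elim (simp add: F_def convergent_LIMSEQ_iff)
  \<comment> \<open>Fatou's lemma passes the Cauchy estimate for f m - f k to the limit in
    m.\<close>
  have close: "(\<integral>\<^sup>+x. ennreal ((F x - f k x)\<^sup>2) \<partial>lborel) \<le> ennreal (((1/2) ^ k)\<^sup>2)" for k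
  proof -
    have "(\<integral>\<^sup>+x. ennreal ((F x - f k x)\<^sup>2) \<partial>lborel) = (\<integral>\<^sup>+x. liminf (\<lambda>m. ennreal ((f m x - f k x)\<^sup>2)) \<partial>lborel)"
    proof (rule nn_integral_cong_AE, use lim in eventually_elim)
      case (elim x)
      then have "(\<lambda>m. ennreal ((f m x - f k x)\<^sup>2)) \<longlonglongrightarrow> ennreal ((F x - f k x)\<^sup>2)"
        by (intro tendsto_intros)
      then show ?case by (rule lim_imp_Liminf[OF trivial_limit_sequentially, symmetric])
    qed
    also have "\<dots> \<le> liminf (\<lambda>m. \<integral>\<^sup>+x. ennreal ((f m x - f k x)\<^sup>2) \<partial>lborel)"
      by (rule nn_integral_liminf) measurable
    also have "\<dots> \<le> limsup (\<lambda>m. \<integral>\<^sup>+x. ennreal ((f m x - f k x)\<^sup>2) \<partial>lborel)"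
      by (rule Liminf_le_Limsup) simp
    also have "\<dots> \<le> ennreal (((1/2) ^ k)\<^sup>2)"
    proof (rule Limsup_bounded, rule eventually_sequentiallyI)
      fix m assume "m \<ge> k"
      have "(\<integral>\<^sup>+x. ennreal ((f m x - f k x)\<^sup>2) \<partial>lborel) = ennreal ((norm (X (r m) - X (r k)))\<^sup>2)"
        unfolding Xf using f by (simp add: nn_integral_square_l2 abs_l2_diff square_integrable_diff)
      also have "\<dots> \<le> ennreal (((1/2) ^ k)\<^sup>2)"
        using r(2)[of k "r m"] r(1) \<open>m \<ge> k\<close>
        by (intro ennreal_leI power_mono) (auto simp: dist_norm strict_mono_less_eq)
      finally show "(\<integral>\<^sup>+x. ennreal ((f m x - f k x)\<^sup>2) \<partial>lborel) \<le> ennreal (((1/2) ^ k)\<^sup>2)" .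
    qed
    finally show ?thesis .
  qed
  have Fd: "(\<lambda>x. F x - f k x) \<in> square_integrable" for k
    by (rule square_integrableI_nn) (measurable, use close[of k] in \<open>auto simp: less_top[symmetric] top_unique\<close>)
  have F: "F \<in> square_integrable" using square_integrable_add[OF Fd[of 0] f[of 0]] by simp
  have "norm (abs_l2 F - X (r k)) \<le> (1/2) ^ k" for k
  proof -
    have "ennreal ((norm (abs_l2 F - X (r k)))\<^sup>2) \<le> ennreal (((1/2) ^ k)\<^sup>2)"
      using close[of k] F f Fd[of k] by (simp add: nn_integral_square_l2 Xf abs_l2_diff)
    then have "(norm (abs_l2 F - X (r k)))\<^sup>2 \<le> ((1/2) ^ k)\<^sup>2" by simp
    then show ?thesis by (rule power2_le_imp_le) simp
  qed
  then have "(\<lambda>k. X (r k)) \<longlonglongrightarrow> abs_l2 F"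
    by (intro metric_tendsto_imp_tendsto[OF LIMSEQ_realpow_zero[of "1/2"]])
       (auto simp: dist_norm norm_minus_commute)
  then have "(X \<circ> r) \<longlonglongrightarrow> abs_l2 F" by (simp add: comp_def)
  from Cauchy_converges_subseq[OF X r(1) this] show "convergent X"
    by (rule convergentI)
qed

section \<open>Cubic vector fields in a Hilbert space\<close>

text \<open>In an inner product space the squared norm is differentiable, so exp(-2 L t) |x - y|^2
  is seen to be nonincreasing from its derivative.\<close>

lemma hilbert_gronwall:
  fixes x y :: "real \<Rightarrow> 'a::real_inner"
  assumes dx: "\<And>t. t \<in> {0..T} \<Longrightarrow> (x has_vector_derivative x' t) (at t within {0..T})"
    and dy: "\<And>t. t \<in> {0..T} \<Longrightarrow> (y has_vector_derivative y' t) (at t within {0..T})"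
    and L: "\<And>t. t \<in> {0..T} \<Longrightarrow> norm (x' t - y' t) \<le> L * norm (x t - y t)"
    and t: "t \<in> {0..T}"
  shows "norm (x t - y t) \<le> exp (L * t) * norm (x 0 - y 0)"
proof -
  define u where "u t = x t - y t" for t
  define u' where "u' t = x' t - y' t" for t
  define g where "g t = exp (-2 * L * t) * (u t \<bullet> u t)" for t
  define g' where "g' t = exp (-2 * L * t) * (2 * (u t \<bullet> u' t)) - 2 * L * exp (-2 * L * t) * (u t \<bullet> u t)" for t
  have du: "(u has_vector_derivative u' t) (at t within {0..T})" if "t \<in> {0..T}" for t
    unfolding u_def u'_def using dx[OF that] dy[OF that] by (intro derivative_intros)
  have dg: "(g has_real_derivative g' t) (at t within {0..T})" if "t \<in> {0..T}" for t
  proof -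
    have "((\<lambda>t. u t \<bullet> u t) has_derivative (\<lambda>h. u t \<bullet> (h *\<^sub>R u' t) + (h *\<^sub>R u' t) \<bullet> u t)) (at t within {0..T})"
      using du[OF that] unfolding has_vector_derivative_def by (intro derivative_intros)
    then have "((\<lambda>t. u t \<bullet> u t) has_real_derivative (2 * (u t \<bullet> u' t))) (at t within {0..T})"
      unfolding has_field_derivative_def
      by (rule has_derivative_eq_rhs) (auto simp: inner_commute)
    then show ?thesis unfolding g_def g'_def
      by (auto intro!: derivative_eq_intros)
  qed
  have neg: "g' t \<le> 0" if "t \<in> {0..T}" for t
  proof -
    have "u t \<bullet> u' t \<le> norm (u t) * norm (u' t)" by (rule norm_cauchy_schwarz)
    also have "\<dots> \<le> norm (u t) * (L * norm (u t))"
      using L[OF that] by (intro mult_left_mono) (auto simp: u_def u'_def)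
    also have "\<dots> = L * (u t \<bullet> u t)" by (simp add: dot_square_norm power2_eq_square)
    finally have "exp (-2 * L * t) * (2 * (u t \<bullet> u' t)) \<le> exp (-2 * L * t) * (2 * (L * (u t \<bullet> u t)))"
      by (intro mult_left_mono) auto
    then show ?thesis by (simp add: g'_def algebra_simps)
  qed
  have "g t \<le> g 0"
  proof (rule DERIV_nonpos_imp_decreasing_open[of 0 t g])
    show "0 \<le> t" using t by simp
    show "\<exists>y. (g has_real_derivative y) (at s) \<and> y \<le> 0" if "0 < s" "s < t" for s
    proof -
      have "(g has_real_derivative g' s) (at s)"
        using dg[of s] that t at_within_Icc_at[of 0 s T] by auto
      then show ?thesis using neg[of s] that t by auto
    qed
    have "continuous_on {0..T} g"
      using dg by (meson DERIV_continuous continuous_on_eq_continuous_within)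
    then show "continuous_on {0..t} g" by (rule continuous_on_subset) (use t in auto)
  qed
  then have "(norm (u t))\<^sup>2 \<le> exp (2 * L * t) * (norm (u 0))\<^sup>2"
    by (simp add: g_def dot_square_norm exp_minus field_simps)
  also have "\<dots> = (exp (L * t) * norm (u 0))\<^sup>2"
    by (simp add: power_mult_distrib mult.assoc flip: exp_of_nat_mult[of 2])
  finally show ?thesis
    unfolding u_def by (rule power2_le_imp_le) simp
qed

text \<open>\<open>D\<close> describes a cone by the conditions inner x d \<ge> 0, which are closed
  and commute with integration, as the Picard iteration demands. One constant serves both the
  Lipschitz and the cone condition, since each survives when \<open>C\<close> grows.\<close>

locale cubic_vector_field =
  fixes N :: "'a::{real_inner,banach} \<Rightarrow> 'a" and C :: real and D :: "'a set"
  assumes Cpos: "C > 0"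
    and N0: "N 0 = 0"
    and N_lip: "norm (N x - N y) \<le> C * ((norm x)\<^sup>2 + (norm y)\<^sup>2) * norm (x - y)"
    and N_cone: "(\<forall>d\<in>D. inner x d \<ge> 0) \<Longrightarrow> norm x \<le> M \<Longrightarrow>
                 (\<forall>d\<in>D. inner (N x + (C * M\<^sup>2) *\<^sub>R x) d \<ge> 0)"
begin

lemma N_bound: "norm (N x) \<le> C * norm x ^ 3"
  using N_lip[of x 0] N0 by (simp add: power_numeral_reduce algebra_simps)

lemma N_lip_ball:
  assumes "norm x \<le> M" "norm y \<le> M"
  shows "norm (N x - N y) \<le> 2 * C * M\<^sup>2 * norm (x - y)"
proof -
  have "(norm x)\<^sup>2 \<le> M\<^sup>2" "(norm y)\<^sup>2 \<le> M\<^sup>2" using assms by (auto intro!: power_mono)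
  then have "C * ((norm x)\<^sup>2 + (norm y)\<^sup>2) * norm (x - y) \<le> C * (2 * M\<^sup>2) * norm (x - y)"
    using Cpos by (intro mult_right_mono mult_left_mono) auto
  then show ?thesis using N_lip[of x y] by (simp add: algebra_simps)
qed

lemma continuous_on_N: "continuous_on S N"
proof (rule continuous_on_subset)
  have "isCont N x" for x
  proof -
    have "((\<lambda>y. C * ((norm y)\<^sup>2 + (norm x)\<^sup>2) * norm (y - x)) \<longlongrightarrow>
            C * ((norm x)\<^sup>2 + (norm x)\<^sup>2) * norm (x - x)) (at x)"
      by (intro tendsto_intros)
    then have "((\<lambda>y. C * ((norm y)\<^sup>2 + (norm x)\<^sup>2) * norm (y - x)) \<longlongrightarrow> 0) (at x)" by simp
    then have "((\<lambda>y. N y - N x) \<longlongrightarrow> 0) (at x)"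
      by (rule Lim_null_comparison[rotated]) (auto intro!: always_eventually N_lip)
    then show ?thesis unfolding isCont_def by (simp add: LIM_zero_iff)
  qed
  then show "continuous_on UNIV N" by (simp add: continuous_on_eq_continuous_at)
qed simp

lemma local_solution:
  assumes R: "R > 0" and x0: "norm x0 \<le> R" and T: "T = 1 / (24 * C * R\<^sup>2)"
  obtains x where "x 0 = x0"
    "\<And>t. t \<in> {0..T} \<Longrightarrow> (x has_vector_derivative N (x t)) (at t within {0..T})"
    "\<And>t. t \<in> {0..T} \<Longrightarrow> norm (x t) \<le> 2 * R"
    "\<And>t. (\<forall>d\<in>D. inner x0 d \<ge> 0) \<Longrightarrow> t \<in> {0..T} \<Longrightarrow> \<forall>d\<in>D. inner (x t) d \<ge> 0"
proof -
  have Tpos: "T > 0" using R Cpos T by simp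
  \<comment> \<open>The shift by \<open>l\<close> puts \<open>N x + l x\<close> into the cone dual to \<open>D\<close> as long as \<open>x\<close> lies in it and \<open>norm x \<le> 2 * R\<close>,
    so that the Picard iteration \<open>P\<close> of the equation with integrating factor \<open>exp (l t)\<close> preserves that cone.\<close>
  define l where "l = C * (2 * R)\<^sup>2"
  have l0: "l \<ge> 0" using Cpos by (simp add: l_def)
  \<comment> \<open>The cone condition is conditional on \<open>x0\<close>, so that one fixed point
    argument covers data inside and outside the cone.\<close>
  define K where "K = {x. norm x \<le> 2 * R \<and> ((\<forall>d\<in>D. inner x0 d \<ge> 0) \<longrightarrow> (\<forall>d\<in>D. inner x d \<ge> 0))}"
  \<comment> \<open>Curves on [0, T] are continued constantly beyond the ends, because the fixed
    point is sought among bounded continuous functions on the whole line.\<close>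
  define cl where "cl t = max 0 (min t T)" for t
  have cl: "cl t \<in> {0..T}" for t using Tpos by (auto simp: cl_def)
  have cl_id: "cl t = t" if "t \<in> {0..T}" for t using that by (auto simp: cl_def)
  have cl_cont: "continuous_on S cl" for S unfolding cl_def by (intro continuous_intros)
  define G where "G x t = exp (l * t) *\<^sub>R (N (x t) + l *\<^sub>R x t)" for x :: "real \<Rightarrow> 'a" and t
  define P where "P x t = exp (- l * t) *\<^sub>R (x0 + integral {0..t} (G x))" for x :: "real \<Rightarrow> 'a" and t
  have G_cont: "continuous_on S (G x)" if "continuous_on S x" for x S
    unfolding G_def using that
    by (intro continuous_intros continuous_on_compose2[OF continuous_on_N[of UNIV] that]) auto
  have P_deriv: "(P x has_vector_derivative (N (x t) + l *\<^sub>R x t - l *\<^sub>R P x t)) (at t within {0..T})"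
    if c: "continuous_on {0..T} x" and t: "t \<in> {0..T}" for x t
  proof -
    have "((\<lambda>u. integral {0..u} (G x)) has_vector_derivative G x t) (at t within {0..T})"
      by (rule integral_has_vector_derivative[OF G_cont[OF c] t])
    then have "((\<lambda>u. x0 + integral {0..u} (G x)) has_vector_derivative 0 + G x t) (at t within {0..T})"
      by (intro derivative_intros)
    moreover have "((\<lambda>u. exp (- l * u)) has_real_derivative - l * exp (- l * t)) (at t within {0..T})"
      by (auto intro!: derivative_eq_intros)
    ultimately have "(P x has_vector_derivative
       (exp (- l * t) *\<^sub>R (0 + G x t) + (- l * exp (- l * t)) *\<^sub>R (x0 + integral {0..t} (G x)))) (at t within {0..T})"
      unfolding P_def by (rule has_vector_derivative_scaleR[rotated])
    moreover have "exp (- l * t) *\<^sub>R (0 + G x t) + (- l * exp (- l * t)) *\<^sub>R (x0 + integral {0..t} (G x))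
        = N (x t) + l *\<^sub>R x t - l *\<^sub>R P x t"
      by (simp add: G_def P_def flip: exp_add)
    ultimately show ?thesis by simp
  qed
  have P_cont: "continuous_on {0..T} (P x)" if "continuous_on {0..T} x" for x
    using P_deriv[OF that] by (meson continuous_on_eq_continuous_within has_vector_derivative_continuous)
  \<comment> \<open>The integrand grows at most like exp(l u), which exp(-l t) cancels; the shift by
    l thus costs no exponential factor.\<close>
  have P_diff: "norm (exp (- l * t) *\<^sub>R integral {0..t} H) \<le> B * T"
    if t: "t \<in> {0..T}" and c: "continuous_on {0..T} H"
      and b: "\<And>u. u \<in> {0..T} \<Longrightarrow> norm (H u) \<le> exp (l * u) * B" and B: "B \<ge> 0" for t B and H :: "real \<Rightarrow> 'a"
  proof -
    have "norm (integral {0..t} H) \<le> (exp (l * t) * B) * (t - 0)"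
    proof (rule integral_bound)
      show "continuous_on {0..t} H" by (rule continuous_on_subset[OF c]) (use t in auto)
      show "norm (H u) \<le> exp (l * t) * B" if "u \<in> {0..t}" for u
        by (rule order_trans[OF b]) (use that t l0 B in \<open>auto intro!: mult_right_mono mult_left_mono\<close>)
    qed (use t in auto)
    also have "\<dots> \<le> (exp (l * t) * B) * T" using t B by (intro mult_left_mono) auto
    finally have "exp (- l * t) * norm (integral {0..t} H) \<le> exp (- l * t) * ((exp (l * t) * B) * T)"
      by (intro mult_left_mono) auto
    also have "\<dots> = B * T" by (simp add: exp_minus)
    finally show ?thesis by simp
  qed
  \<comment> \<open>The 24 is twice the 12 of the contraction estimate, which asks for 12 C R^2 T
    \<le> 1/2. The other demand, 16 C R^3 T \<le> R for staying in the ball of radius 2 R, is then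
    met with 2 R / 3.\<close>
  have TC: "C * R\<^sup>2 * T = 1 / 24" using T R Cpos by simp
  have P_K: "P x t \<in> K" if c: "continuous_on {0..T} x" and K: "\<And>u. u \<in> {0..T} \<Longrightarrow> x u \<in> K" and t: "t \<in> {0..T}" for x t
  proof -
    have nx: "norm (x u) \<le> 2 * R" if "u \<in> {0..T}" for u using K[OF that] by (simp add: K_def)
    have "norm (P x t) \<le> norm (exp (- l * t) *\<^sub>R x0) + norm (exp (- l * t) *\<^sub>R integral {0..t} (G x))"
      unfolding P_def scaleR_add_right by (rule norm_triangle_ineq)
    also have "norm (exp (- l * t) *\<^sub>R x0) \<le> 1 * R"
      unfolding norm_scaleR using x0 l0 t by (intro mult_mono) auto
    also have "norm (exp (- l * t) *\<^sub>R integral {0..t} (G x)) \<le> (16 * C * R ^ 3) * T"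
    proof (rule P_diff[OF t G_cont[OF c]])
      fix u assume u: "u \<in> {0..T}"
      have "norm (N (x u) + l *\<^sub>R x u) \<le> norm (N (x u)) + norm (l *\<^sub>R x u)" by (rule norm_triangle_ineq)
      also have "\<dots> \<le> C * (2 * R) ^ 3 + l * (2 * R)"
      proof (intro add_mono)
        show "norm (N (x u)) \<le> C * (2 * R) ^ 3"
          using Cpos nx[OF u] by (intro order_trans[OF N_bound] mult_left_mono power_mono) auto
        show "norm (l *\<^sub>R x u) \<le> l * (2 * R)"
          using nx[OF u] l0 by (auto intro!: mult_left_mono)
      qed
      also have "\<dots> = 16 * C * R ^ 3" by (simp add: l_def power_numeral_reduce)
      finally show "norm (G x u) \<le> exp (l * u) * (16 * C * R ^ 3)"
        by (simp add: G_def)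
    qed (use Cpos R in simp)
    also have "(16 * C * R ^ 3) * T = 16 * R * (C * R\<^sup>2 * T)" by (simp add: power_numeral_reduce)
    finally have "norm (P x t) \<le> R + 16 * R / 24" by (simp add: TC)
    then have n: "norm (P x t) \<le> 2 * R" using R by simp
    have "inner (P x t) d \<ge> 0" if pos: "\<forall>d\<in>D. inner x0 d \<ge> 0" and d: "d \<in> D" for d
    proof -
      have "inner (G x u) d \<ge> 0" if "u \<in> {0..T}" for u
        unfolding G_def inner_scaleR_left
      proof (intro mult_nonneg_nonneg)
        show "0 \<le> (N (x u) + l *\<^sub>R x u) \<bullet> d"
          using N_cone[of "x u" "2 * R"] K[OF that] pos d by (auto simp: K_def l_def)
      qed simp
      then have "integral {0..t} (\<lambda>u. inner (G x u) d) \<ge> 0"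
        using t by (intro integral_nonneg integrable_continuous_real continuous_intros
            continuous_on_subset[OF G_cont[OF c]]) auto
      moreover have "integral {0..t} (\<lambda>u. inner (G x u) d) = inner (integral {0..t} (G x)) d"
        using integral_linear[OF integrable_continuous_real[OF continuous_on_subset[OF G_cont[OF c]]]
          bounded_linear_inner_left[of d], of 0 t] t by (auto simp: o_def)
      ultimately show ?thesis using pos d by (auto simp: P_def inner_add_left)
    qed
    then show ?thesis using n by (simp add: K_def)
  qed
  define s where "s = {f :: real \<Rightarrow>\<^sub>C 'a. \<forall>t. apply_bcontfun f t \<in> K}"
  \<comment> \<open>\<open>Bcontfun\<close> yields the intended function only for bounded continuous
    arguments, which is established for f in \<open>s\<close>.\<close>
  define F where "F f = Bcontfun (\<lambda>t. P (apply_bcontfun f) (cl t))" for f :: "real \<Rightarrow>\<^sub>C 'a"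
  have F: "apply_bcontfun (F f) t = P (apply_bcontfun f) (cl t)" if "f \<in> s" for f t
  proof -
    have "(\<lambda>t. P (apply_bcontfun f) (cl t)) \<in> bcontfun"
    proof (rule bcontfun_normI)
      show "continuous_on UNIV (\<lambda>t. P (apply_bcontfun f) (cl t))"
        by (rule continuous_on_compose2[OF P_cont cl_cont]) (use cl in auto)
      show "norm (P (apply_bcontfun f) (cl t)) \<le> 2 * R" for t
        using P_K[of "apply_bcontfun f" "cl t"] cl[of t] that by (auto simp: s_def K_def)
    qed
    then show ?thesis unfolding F_def by (simp add: Bcontfun_inverse)
  qed
  have "\<exists>!f\<in>s. F f = f"
  proof (rule Banach_fix)
    have K_closed: "closed K"
    proof -
      have "K = cball 0 (2 * R) \<inter> {x. (\<forall>d\<in>D. inner x0 d \<ge> 0) \<longrightarrow> (\<forall>d\<in>D. inner x d \<ge> 0)}" by (auto simp: K_def)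
      moreover have "closed {x. (\<forall>d\<in>D. inner x0 d \<ge> 0) \<longrightarrow> (\<forall>d\<in>D. inner x d \<ge> 0)}"
      proof (cases "\<forall>d\<in>D. inner x0 d \<ge> 0")
        case True
        have "{x. \<forall>d\<in>D. inner x d \<ge> 0} = (\<Inter>d\<in>D. {x. inner x d \<ge> 0})" by auto
        also have "closed \<dots>" by (intro closed_INT ballI closed_Collect_le continuous_intros)
        finally show ?thesis using True by simp
      next
        case False
        then have "{x. (\<forall>d\<in>D. inner x0 d \<ge> 0) \<longrightarrow> (\<forall>d\<in>D. inner x d \<ge> 0)} = UNIV" by blast
        then show ?thesis by simp
      qed
      ultimately show ?thesis by (auto intro!: closed_Int)
    qed
    have "closed s"
      unfolding closed_sequential_limits
    proof (intro allI impI, elim conjE)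
      fix X :: "nat \<Rightarrow> real \<Rightarrow>\<^sub>C 'a" and f assume X: "\<forall>n. X n \<in> s" "X \<longlonglongrightarrow> f"
      have "apply_bcontfun f t \<in> K" for t
      proof (rule closed_sequentially[OF K_closed])
        show "\<And>n. apply_bcontfun (X n) t \<in> K" using X(1) by (auto simp: s_def)
        show "(\<lambda>n. apply_bcontfun (X n) t) \<longlonglongrightarrow> apply_bcontfun f t"
          using tendsto_bcontfun_uniform_limit[OF X(2)] by (auto intro: tendsto_uniform_limitI)
      qed
      then show "f \<in> s" by (simp add: s_def)
    qed
    then show "complete s" by (simp add: complete_eq_closed)
    have "const_bcontfun x0 \<in> s" using x0 R by (auto simp: s_def K_def const_bcontfun.rep_eq)
    then show "s \<noteq> {}" by auto
    show "F ` s \<subseteq> s"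
    proof (safe)
      fix f assume f: "f \<in> s"
      show "F f \<in> s" unfolding s_def
        using F[OF f] P_K[of "apply_bcontfun f"] cl f by (auto simp: s_def)
    qed
    show "dist (F f) (F g) \<le> 1 / 2 * dist f g" if f: "f \<in> s" and g: "g \<in> s" for f g
    proof (rule dist_bound)
      fix t
      let ?f = "apply_bcontfun f" and ?g = "apply_bcontfun g"
      have nf: "norm (?f u) \<le> 2 * R" "norm (?g u) \<le> 2 * R" for u using f g by (auto simp: s_def K_def)
      have d: "norm (?f u - ?g u) \<le> dist f g" for u using dist_bounded[of f u g] by (simp add: dist_norm)
      have "P ?f (cl t) - P ?g (cl t) = exp (- l * cl t) *\<^sub>R (integral {0..cl t} (G ?f) - integral {0..cl t} (G ?g))"
        unfolding P_def by (simp add: algebra_simps)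
      also have "integral {0..cl t} (G ?f) - integral {0..cl t} (G ?g) = integral {0..cl t} (\<lambda>u. G ?f u - G ?g u)"
        by (rule integral_diff[symmetric]) (auto intro!: integrable_continuous_real G_cont)
      also have "norm (exp (- l * cl t) *\<^sub>R integral {0..cl t} (\<lambda>u. G ?f u - G ?g u)) \<le> (12 * C * R\<^sup>2 * dist f g) * T"
      proof (rule P_diff[OF cl])
        show "continuous_on {0..T} (\<lambda>u. G ?f u - G ?g u)" by (intro continuous_intros G_cont) auto
        fix u
        have eq: "G ?f u - G ?g u = exp (l * u) *\<^sub>R ((N (?f u) - N (?g u)) + l *\<^sub>R (?f u - ?g u))"
          by (simp add: G_def algebra_simps)
        have "norm ((N (?f u) - N (?g u)) + l *\<^sub>R (?f u - ?g u)) \<le>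
            2 * C * (2 * R)\<^sup>2 * norm (?f u - ?g u) + l * norm (?f u - ?g u)"
          using N_lip_ball[OF nf] l0 by (intro norm_triangle_le add_mono) auto
        also have "\<dots> \<le> 2 * C * (2 * R)\<^sup>2 * dist f g + l * dist f g"
          using d l0 Cpos by (intro add_mono mult_left_mono) auto
        also have "\<dots> = 12 * C * R\<^sup>2 * dist f g"
          by (simp add: l_def power_mult_distrib)
        finally show "norm (G ?f u - G ?g u) \<le> exp (l * u) * (12 * C * R\<^sup>2 * dist f g)"
          unfolding eq by simp
      qed (use Cpos in simp)
      also have "(12 * C * R\<^sup>2 * dist f g) * T = 12 * (C * R\<^sup>2 * T) * dist f g" by simp
      finally show "dist (apply_bcontfun (F f) t) (apply_bcontfun (F g) t) \<le> 1 / 2 * dist f g"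
        using F[OF f] F[OF g] by (simp add: dist_norm TC)
    qed
  qed auto
  then obtain f where f: "f \<in> s" "F f = f" by auto
  let ?x = "apply_bcontfun f"
  have fix1: "?x t = P ?x t" if "t \<in> {0..T}" for t
    using F[OF f(1), of t] f(2) cl_id[OF that] by simp
  show thesis
  proof
    show "?x 0 = x0" using fix1[of 0] Tpos by (simp add: P_def)
    show "(?x has_vector_derivative N (?x t)) (at t within {0..T})" if t: "t \<in> {0..T}" for t
    proof (rule has_vector_derivative_transform[OF t])
      show "(P ?x has_vector_derivative N (?x t)) (at t within {0..T})"
        using P_deriv[OF continuous_on_apply_bcontfun t, of f] fix1[OF t] by simp
    qed (use fix1 in auto)
    show "norm (?x t) \<le> 2 * R" for t using f(1) by (auto simp: s_def K_def)
    show "\<forall>d\<in>D. inner x0 d \<ge> 0 \<Longrightarrow> \<forall>d\<in>D. inner (?x t) d \<ge> 0" for t using f(1) by (auto simp: s_def K_def)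
  qed
qed

text \<open>A competing solution comes without a norm bound, but it is continuous on a compact
  interval, hence confined to some ball, on which the field is Lipschitz.\<close>

lemma solution_unique:
  assumes T: "T \<ge> 0"
    and x: "\<And>t. t \<in> {0..T} \<Longrightarrow> (x has_vector_derivative N (x t)) (at t within {0..T})"
    and y: "\<And>t. t \<in> {0..T} \<Longrightarrow> (y has_vector_derivative N (y t)) (at t within {0..T})"
    and "x 0 = y 0" "t \<in> {0..T}"
  shows "x t = y t"
proof -
  have "continuous_on {0..T} x" "continuous_on {0..T} y"
    using x y by (meson continuous_on_eq_continuous_within has_vector_derivative_continuous)+
  then have "bounded (x ` {0..T})" "bounded (y ` {0..T})"
    by (auto intro!: compact_imp_bounded compact_continuous_image)
  then have "bounded (x ` {0..T} \<union> y ` {0..T})" by simp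
  then obtain M where M: "\<And>z. z \<in> x ` {0..T} \<union> y ` {0..T} \<Longrightarrow> norm z \<le> M" unfolding bounded_iff by blast
  have "norm (x t - y t) \<le> exp (2 * C * M\<^sup>2 * t) * norm (x 0 - y 0)"
    by (rule hilbert_gronwall[OF x y N_lip_ball]) (use M assms in auto)
  then show ?thesis using assms by simp
qed

lemma solution_dependence:
  assumes x: "\<And>t. t \<in> {0..T} \<Longrightarrow> (x has_vector_derivative N (x t)) (at t within {0..T})"
    and y: "\<And>t. t \<in> {0..T} \<Longrightarrow> (y has_vector_derivative N (y t)) (at t within {0..T})"
    and "\<And>t. t \<in> {0..T} \<Longrightarrow> norm (x t) \<le> M" "\<And>t. t \<in> {0..T} \<Longrightarrow> norm (y t) \<le> M"
    and "t \<in> {0..T}"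
  shows "norm (x t - y t) \<le> exp (2 * C * M\<^sup>2 * T) * norm (x 0 - y 0)"
proof -
  have "norm (x t - y t) \<le> exp (2 * C * M\<^sup>2 * t) * norm (x 0 - y 0)"
    by (rule hilbert_gronwall[OF x y N_lip_ball]) (use assms in auto)
  also have "\<dots> \<le> exp (2 * C * M\<^sup>2 * T) * norm (x 0 - y 0)"
    using assms Cpos by (intro mult_right_mono) (auto intro!: mult_left_mono)
  finally show ?thesis .
qed

end

section \<open>Trilinear estimates in weighted spaces\<close>

lemma square_integrable_wnorm2_iff:
  "(\<lambda>x. bracket x powr s * f x) \<in> square_integrable \<longleftrightarrow> f \<in> L2w s"
proof -
  have "(\<lambda>x. bracket x powr s * f x) \<in> borel_measurable borel \<longleftrightarrow> f \<in> borel_measurable borel"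
  proof
    assume [measurable]: "(\<lambda>x. bracket x powr s * f x) \<in> borel_measurable borel"
    have "(\<lambda>x. bracket x powr - s * (bracket x powr s * f x)) \<in> borel_measurable borel" by measurable
    moreover have "(\<lambda>x. bracket x powr - s * (bracket x powr s * f x)) = f" by (simp add: fun_eq_iff powr_minus)
    ultimately show "f \<in> borel_measurable borel" by (simp only:)
  next
    assume [measurable]: "f \<in> borel_measurable borel"
    show "(\<lambda>x. bracket x powr s * f x) \<in> borel_measurable borel" by measurable
  qed
  then show ?thesis unfolding square_integrable_def L2w_def measurable_lborel2 mem_Collect_eq by (simp only:)
qed

text \<open>Multiplication by the weight is an isometry onto the unweighted space, so one type of
  classes serves every exponent \<open>s\<close>.\<close>

definition wl2 :: "real \<Rightarrow> (real^3 \<Rightarrow> real) \<Rightarrow> l2" where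
  "wl2 s f = abs_l2 (\<lambda>x. bracket x powr s * f x)"

definition unwl2 :: "real \<Rightarrow> l2 \<Rightarrow> real^3 \<Rightarrow> real" where
  "unwl2 s u x = bracket x powr - s * rep_l2 u x"

lemma L2w_measurable: "f \<in> L2w s \<Longrightarrow> f \<in> borel_measurable borel"
  by (simp add: L2w_def)

lemma norm_wl2: "f \<in> L2w s \<Longrightarrow> norm (wl2 s f) = L2w_norm s f"
  unfolding wl2_def L2w_norm_def square_integrable_wnorm2_iff[symmetric] by (rule norm_l2_abs)

lemma L2w_norm_nonneg [simp]: "L2w_norm s f \<ge> 0"
  by (simp add: L2w_norm_def integral_nonneg_AE)

lemma wnorm2_L2w: "f \<in> L2w s \<Longrightarrow> wnorm2 s f = ennreal ((L2w_norm s f)\<^sup>2)"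
  using nn_integral_square_l2[of "\<lambda>x. bracket x powr s * f x"] norm_wl2[of f s]
  unfolding wnorm2_def wl2_def square_integrable_wnorm2_iff by simp

lemma L2wI:
  assumes "f \<in> borel_measurable borel" "wnorm2 s f < \<infinity>"
  shows "f \<in> L2w s"
proof -
  note [measurable] = assms(1)
  have "(\<lambda>x. bracket x powr s * f x) \<in> borel_measurable borel" by measurable
  from square_integrableI_nn[OF this assms(2)[unfolded wnorm2_def]] show ?thesis
    unfolding square_integrable_wnorm2_iff .
qed

lemma wl2_eq_iff: "f \<in> L2w s \<Longrightarrow> g \<in> L2w s \<Longrightarrow> wl2 s f = wl2 s g \<longleftrightarrow> (AE x in lborel. f x = g x)"
  unfolding wl2_def by (subst abs_l2_eq_iff) (auto simp: square_integrable_wnorm2_iff)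

lemma wl2_add:
  assumes "f \<in> L2w s" "g \<in> L2w s"
  shows "(\<lambda>x. f x + g x) \<in> L2w s" "wl2 s (\<lambda>x. f x + g x) = wl2 s f + wl2 s g"
  unfolding wl2_def square_integrable_wnorm2_iff[symmetric] distrib_left
  using assms[folded square_integrable_wnorm2_iff] by (rule square_integrable_add abs_l2_add[symmetric])+

lemma wl2_diff:
  assumes "f \<in> L2w s" "g \<in> L2w s"
  shows "(\<lambda>x. f x - g x) \<in> L2w s" "wl2 s (\<lambda>x. f x - g x) = wl2 s f - wl2 s g"
  unfolding wl2_def square_integrable_wnorm2_iff[symmetric] right_diff_distrib
  using assms[folded square_integrable_wnorm2_iff] by (rule square_integrable_diff abs_l2_diff[symmetric])+

lemma wl2_scale:
  assumes "f \<in> L2w s"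
  shows "(\<lambda>x. r * f x) \<in> L2w s" "wl2 s (\<lambda>x. r * f x) = r *\<^sub>R wl2 s f"
proof -
  have eq: "(\<lambda>x. bracket x powr s * (r * f x)) = (\<lambda>x. r * (bracket x powr s * f x))"
    by (simp add: fun_eq_iff)
  note sq = assms[folded square_integrable_wnorm2_iff]
  show "(\<lambda>x. r * f x) \<in> L2w s"
    unfolding square_integrable_wnorm2_iff[symmetric] eq by (rule square_integrable_scale[OF sq])
  show "wl2 s (\<lambda>x. r * f x) = r *\<^sub>R wl2 s f"
    unfolding wl2_def eq by (rule abs_l2_scaleR[OF sq, symmetric])
qed

lemma unwl2_L2w: "unwl2 s u \<in> L2w s" and wl2_unwl2: "wl2 s (unwl2 s u) = u"
proof -
  have "(\<lambda>x. bracket x powr s * unwl2 s u x) = rep_l2 u"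
    by (simp add: unwl2_def fun_eq_iff powr_minus)
  then show "unwl2 s u \<in> L2w s" "wl2 s (unwl2 s u) = u"
    using rep_l2_square_integrable[of u] square_integrable_wnorm2_iff[of s "unwl2 s u"]
    by (simp_all add: wl2_def abs_rep_l2)
qed

lemma L2w_norm_diff: "f \<in> L2w s \<Longrightarrow> g \<in> L2w s \<Longrightarrow> L2w_norm s (\<lambda>x. f x - g x) = norm (wl2 s f - wl2 s g)"
  by (simp add: norm_wl2[symmetric] wl2_diff)

lemma L2w_norm_cong_AE:
  assumes "f \<in> L2w s" "g \<in> L2w s" "AE x in lborel. f x = g x"
  shows "L2w_norm s f = L2w_norm s g"
  using assms wl2_eq_iff[of f s g] by (simp flip: norm_wl2)

lemma L2w_norm_triangle:
  assumes "f \<in> L2w s" "g \<in> L2w s"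
  shows "L2w_norm s (\<lambda>x. f x + g x) \<le> L2w_norm s f + L2w_norm s g"
  using assms norm_triangle_ineq[of "wl2 s f" "wl2 s g"] wl2_add[OF assms] by (simp flip: norm_wl2)

section \<open>The trilinear operators as Bochner integrals\<close>

abbreviation \<omega>2 :: "real^3 \<Rightarrow> real" where "\<omega>2 \<equiv> \<lambda>p. (norm p)\<^sup>2"

text \<open>An iterated Bochner integral takes a default value where integrability fails and is then
  not linear. Finiteness of \<open>coll\<close> turns it into one integral over the product space,
  to which linearity and the norm bound apply.\<close>

lemma nu_integral_finite:
  fixes \<Phi> :: "real^3 \<Rightarrow> real^3 \<Rightarrow> real^3 \<Rightarrow> real"
  assumes m: "(\<lambda>(a, b, c). \<Phi> a b c) \<in> borel_measurable (borel \<Otimes>\<^sub>M borel \<Otimes>\<^sub>M borel)"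
    and fin: "coll p (\<lambda>a b c. ennreal \<bar>\<Phi> a b c\<bar>) < \<infinity>"
  defines "J \<equiv> \<lambda>z. sph_const / 8 * norm (p - fst z) * \<Phi> (fst z) (p2_of p (fst z) (snd z)) (p3_of p (fst z) (snd z))"
  shows "integrable (lborel \<Otimes>\<^sub>M sph) J"
    and "nu_integral \<omega>2 p \<Phi> = (LINT z|(lborel \<Otimes>\<^sub>M sph). J z)"
    and "ennreal \<bar>nu_integral \<omega>2 p \<Phi>\<bar> \<le> ennreal (sph_const / 8) * coll p (\<lambda>a b c. ennreal \<bar>\<Phi> a b c\<bar>)"
proof -
  note [measurable (raw)] = measurable_triple[OF m]
  interpret pair_sigma_finite "lborel :: (real^3) measure" sph ..
  have [measurable]: "J \<in> borel_measurable (borel \<Otimes>\<^sub>M borel)" unfolding J_def by measurable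
  have Jm: "J \<in> borel_measurable (lborel \<Otimes>\<^sub>M sph)" by measurable
  have k: "sph_const / 8 \<ge> 0" using sph_const_nonneg by simp
  have "(\<integral>\<^sup>+z. ennreal (norm (J z)) \<partial>(lborel \<Otimes>\<^sub>M sph)) = (\<integral>\<^sup>+p1. (\<integral>\<^sup>+\<phi>. ennreal (norm (J (p1, \<phi>))) \<partial>sph) \<partial>lborel)"
    by (rule sph.nn_integral_fst[symmetric]) (use Jm in measurable)
  also have "\<dots> = (\<integral>\<^sup>+p1. (\<integral>\<^sup>+\<phi>. ennreal (sph_const / 8) * (ennreal (norm (p - p1)) * ennreal \<bar>\<Phi> p1 (p2_of p p1 \<phi>) (p3_of p p1 \<phi>)\<bar>) \<partial>sph) \<partial>lborel)"
  proof (intro nn_integral_cong)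
    fix p1 \<phi>
    have "norm (J (p1, \<phi>)) = sph_const / 8 * (norm (p - p1) * \<bar>\<Phi> p1 (p2_of p p1 \<phi>) (p3_of p p1 \<phi>)\<bar>)"
      using k by (simp add: J_def abs_mult)
    then show "ennreal (norm (J (p1, \<phi>))) = ennreal (sph_const / 8) * (ennreal (norm (p - p1)) * ennreal \<bar>\<Phi> p1 (p2_of p p1 \<phi>) (p3_of p p1 \<phi>)\<bar>)"
      by (simp only: ennreal_mult[OF k] ennreal_mult[OF norm_ge_zero abs_ge_zero] mult_nonneg_nonneg norm_ge_zero abs_ge_zero)
  qed
  also have "\<dots> = ennreal (sph_const / 8) * coll p (\<lambda>a b c. ennreal \<bar>\<Phi> a b c\<bar>)"
  proof -
    have "(\<integral>\<^sup>+\<phi>. ennreal (sph_const / 8) * (ennreal (norm (p - p1)) * ennreal \<bar>\<Phi> p1 (p2_of p p1 \<phi>) (p3_of p p1 \<phi>)\<bar>) \<partial>sph) =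
      ennreal (sph_const / 8) * (\<integral>\<^sup>+\<phi>. (ennreal (norm (p - p1)) * ennreal \<bar>\<Phi> p1 (p2_of p p1 \<phi>) (p3_of p p1 \<phi>)\<bar>) \<partial>sph)" for p1
      by (rule nn_integral_cmult) measurable
    then show ?thesis unfolding coll_def by (simp only:) (rule nn_integral_cmult, measurable)
  qed
  finally have nn: "(\<integral>\<^sup>+z. ennreal (norm (J z)) \<partial>(lborel \<Otimes>\<^sub>M sph)) = ennreal (sph_const / 8) * coll p (\<lambda>a b c. ennreal \<bar>\<Phi> a b c\<bar>)" .
  show int: "integrable (lborel \<Otimes>\<^sub>M sph) J"
    by (rule integrableI_bounded[OF Jm]) (use nn fin in \<open>simp add: ennreal_mult_less_top\<close>)
  have "nu_integral \<omega>2 p \<Phi> = (LINT p1|lborel. LINT \<phi>|sph. J (p1, \<phi>))"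
    unfolding J_def fst_conv snd_conv by (rule nu_integral_eq) measurable
  also have "\<dots> = (LINT z|(lborel \<Otimes>\<^sub>M sph). J z)" by (rule integral_fst'[OF int])
  finally show nu: "nu_integral \<omega>2 p \<Phi> = (LINT z|(lborel \<Otimes>\<^sub>M sph). J z)" .
  have "ennreal (norm (LINT z|(lborel \<Otimes>\<^sub>M sph). J z)) \<le> (\<integral>\<^sup>+z. ennreal (norm (J z)) \<partial>(lborel \<Otimes>\<^sub>M sph))"
    by (rule integral_norm_bound_ennreal[OF int])
  then show "ennreal \<bar>nu_integral \<omega>2 p \<Phi>\<bar> \<le> ennreal (sph_const / 8) * coll p (\<lambda>a b c. ennreal \<bar>\<Phi> a b c\<bar>)"
    unfolding nn nu by simp
qed

lemma nu_integral_diff: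
  fixes \<Phi> \<Psi> :: "real^3 \<Rightarrow> real^3 \<Rightarrow> real^3 \<Rightarrow> real"
  assumes m: "(\<lambda>(a, b, c). \<Phi> a b c) \<in> borel_measurable (borel \<Otimes>\<^sub>M borel \<Otimes>\<^sub>M borel)"
    "(\<lambda>(a, b, c). \<Psi> a b c) \<in> borel_measurable (borel \<Otimes>\<^sub>M borel \<Otimes>\<^sub>M borel)"
    and fin: "coll p (\<lambda>a b c. ennreal \<bar>\<Phi> a b c\<bar>) < \<infinity>" "coll p (\<lambda>a b c. ennreal \<bar>\<Psi> a b c\<bar>) < \<infinity>"
    and fin': "coll p (\<lambda>a b c. ennreal \<bar>\<Phi> a b c - \<Psi> a b c\<bar>) < \<infinity>"
  shows "nu_integral \<omega>2 p (\<lambda>a b c. \<Phi> a b c - \<Psi> a b c) = nu_integral \<omega>2 p \<Phi> - nu_integral \<omega>2 p \<Psi>"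
proof -
  have m': "(\<lambda>(a, b, c). \<Phi> a b c - \<Psi> a b c) \<in> borel_measurable (borel \<Otimes>\<^sub>M borel \<Otimes>\<^sub>M borel)"
    using borel_measurable_diff[OF m] by (simp add: split_def)
  show ?thesis
    unfolding nu_integral_finite(2)[OF m(1) fin(1)] nu_integral_finite(2)[OF m(2) fin(2)] nu_integral_finite(2)[OF m' fin']
    by (subst Bochner_Integration.integral_diff[symmetric])
       (use nu_integral_finite(1)[OF m(1) fin(1)] nu_integral_finite(1)[OF m(2) fin(2)] in \<open>simp_all add: right_diff_distrib\<close>)
qed

lemma nu_integral_measurable:
  fixes F :: "real^3 \<Rightarrow> real^3 \<Rightarrow> real^3 \<Rightarrow> real^3 \<Rightarrow> real"
  assumes m: "(\<lambda>(p, a, b, c). F p a b c) \<in> borel_measurable (borel \<Otimes>\<^sub>M borel \<Otimes>\<^sub>M borel \<Otimes>\<^sub>M borel)"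
  shows "(\<lambda>p. nu_integral \<omega>2 p (F p)) \<in> borel_measurable borel"
proof -
  note [measurable (raw)] = measurable_quadruple[OF m]
  have "nu_integral \<omega>2 p (F p) = (LINT p1|lborel. LINT \<phi>|sph. sph_const / 8 * norm (p - p1) * F p p1 (p2_of p p1 \<phi>) (p3_of p p1 \<phi>))" for p
    by (rule nu_integral_eq) measurable
  moreover have "(\<lambda>p. LINT p1|lborel. LINT \<phi>|sph. sph_const / 8 * norm (p - p1) * F p p1 (p2_of p p1 \<phi>) (p3_of p p1 \<phi>)) \<in> borel_measurable borel"
    by measurable
  ultimately show ?thesis by (simp only:)
qed

text \<open>The selectors \<open>a\<close>, \<open>b\<close>, \<open>c\<close> pick the three momenta among \<open>p, p1, p2, p3\<close> at which the
  arguments of the trilinear operator are evaluated.\<close>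

locale collision_term =
  fixes a b c :: "real^3 \<Rightarrow> real^3 \<Rightarrow> real^3 \<Rightarrow> real^3 \<Rightarrow> real^3" and s K :: real
  assumes sel_measurable:
      "(\<lambda>(p, p1, p2, p3). a p p1 p2 p3) \<in> borel_measurable (borel \<Otimes>\<^sub>M borel \<Otimes>\<^sub>M borel \<Otimes>\<^sub>M borel)"
      "(\<lambda>(p, p1, p2, p3). b p p1 p2 p3) \<in> borel_measurable (borel \<Otimes>\<^sub>M borel \<Otimes>\<^sub>M borel \<Otimes>\<^sub>M borel)"
      "(\<lambda>(p, p1, p2, p3). c p p1 p2 p3) \<in> borel_measurable (borel \<Otimes>\<^sub>M borel \<Otimes>\<^sub>M borel \<Otimes>\<^sub>M borel)"
    and K_nonneg: "K \<ge> 0"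
    and bound: "f \<in> L2w s \<Longrightarrow> g \<in> L2w s \<Longrightarrow> h \<in> L2w s \<Longrightarrow>
      (\<integral>\<^sup>+p. ennreal ((bracket p powr s)\<^sup>2) * (coll p (\<lambda>p1 p2 p3.
         ennreal (\<bar>f (a p p1 p2 p3)\<bar> * (\<bar>g (b p p1 p2 p3)\<bar> * \<bar>h (c p p1 p2 p3)\<bar>))))\<^sup>2 \<partial>lborel)
      \<le> ennreal ((K * L2w_norm s f * L2w_norm s g * L2w_norm s h)\<^sup>2)"
begin

definition integrand :: "(real^3 \<Rightarrow> real) \<Rightarrow> (real^3 \<Rightarrow> real) \<Rightarrow> (real^3 \<Rightarrow> real) \<Rightarrow> real^3 \<Rightarrow> real^3 \<Rightarrow> real^3 \<Rightarrow> real^3 \<Rightarrow> real" where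
  "integrand f g h p p1 p2 p3 = f (a p p1 p2 p3) * g (b p p1 p2 p3) * h (c p p1 p2 p3)"

definition T :: "(real^3 \<Rightarrow> real) \<Rightarrow> (real^3 \<Rightarrow> real) \<Rightarrow> (real^3 \<Rightarrow> real) \<Rightarrow> real^3 \<Rightarrow> real" where
  "T f g h p = nu_integral \<omega>2 p (integrand f g h p)"

lemmas sel_measurable' [measurable (raw)] = sel_measurable[THEN measurable_quadruple]

lemma integrand_measurable:
  assumes [measurable]: "f \<in> borel_measurable borel" "g \<in> borel_measurable borel" "h \<in> borel_measurable borel"
  shows "(\<lambda>(p, p1, p2, p3). integrand f g h p p1 p2 p3) \<in> borel_measurable (borel \<Otimes>\<^sub>M borel \<Otimes>\<^sub>M borel \<Otimes>\<^sub>M borel)"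
    and "(\<lambda>(p1, p2, p3). integrand f g h p p1 p2 p3) \<in> borel_measurable (borel \<Otimes>\<^sub>M borel \<Otimes>\<^sub>M borel)"
  unfolding integrand_def by measurable

definition mass :: "(real^3 \<Rightarrow> real) \<Rightarrow> (real^3 \<Rightarrow> real) \<Rightarrow> (real^3 \<Rightarrow> real) \<Rightarrow> real^3 \<Rightarrow> ennreal" where
  "mass f g h p = coll p (\<lambda>p1 p2 p3. ennreal \<bar>integrand f g h p p1 p2 p3\<bar>)"

lemma bound':
  assumes "f \<in> L2w s" "g \<in> L2w s" "h \<in> L2w s"
  shows "(\<integral>\<^sup>+p. ennreal ((bracket p powr s)\<^sup>2) * (mass f g h p)\<^sup>2 \<partial>lborel)
      \<le> ennreal ((K * L2w_norm s f * L2w_norm s g * L2w_norm s h)\<^sup>2)"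
  using bound[OF assms] by (simp add: mass_def integrand_def abs_mult mult.assoc)

lemma mass_finite:
  assumes "f \<in> L2w s" "g \<in> L2w s" "h \<in> L2w s"
  shows "AE p in lborel. mass f g h p < \<infinity>"
proof -
  note [measurable] = assms[THEN L2w_measurable]
  note [measurable (raw)] = measurable_quadruple[OF integrand_measurable(1)]
  have [measurable]: "(\<lambda>p. mass f g h p) \<in> borel_measurable borel"
    unfolding mass_def coll_def by measurable
  have "(\<integral>\<^sup>+p. ennreal ((bracket p powr s)\<^sup>2) * (mass f g h p)\<^sup>2 \<partial>lborel) \<noteq> \<infinity>"
    using bound'[OF assms] by (auto simp: top_unique)
  then have "AE p in lborel. ennreal ((bracket p powr s)\<^sup>2) * (mass f g h p)\<^sup>2 \<noteq> \<infinity>"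
    by (rule nn_integral_PInf_AE[rotated]) measurable
  then show ?thesis
  proof eventually_elim
    case (elim p)
    have "mass f g h p \<noteq> \<infinity>"
    proof
      assume "mass f g h p = \<infinity>"
      then have "ennreal ((bracket p powr s)\<^sup>2) * (mass f g h p)\<^sup>2 = \<infinity>"
        by (simp add: ennreal_mult_top power2_eq_square)
      then show False using elim by simp
    qed
    then show ?case by (simp add: less_top)
  qed
qed

lemma T_L2w:
  assumes fgh: "f \<in> L2w s" "g \<in> L2w s" "h \<in> L2w s"
  shows "T f g h \<in> L2w s"
    and "L2w_norm s (T f g h) \<le> sph_const / 8 * K * L2w_norm s f * L2w_norm s g * L2w_norm s h"
proof -
  note m = fgh[THEN L2w_measurable]
  have Tm [measurable]: "T f g h \<in> borel_measurable borel"
    unfolding T_def[abs_def] by (rule nu_integral_measurable[OF integrand_measurable(1)[OF m]])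
  note [measurable] = m
  note [measurable (raw)] = measurable_quadruple[OF integrand_measurable(1)]
  have [measurable]: "(\<lambda>p. mass f g h p) \<in> borel_measurable borel"
    unfolding mass_def coll_def by measurable
  have k: "sph_const / 8 \<ge> 0" using sph_const_nonneg by simp
  define B where "B = sph_const / 8 * K * L2w_norm s f * L2w_norm s g * L2w_norm s h"
  have B: "B \<ge> 0" unfolding B_def using k K_nonneg by (intro mult_nonneg_nonneg) auto
  have "wnorm2 s (T f g h) \<le> (\<integral>\<^sup>+p. ennreal ((sph_const / 8)\<^sup>2) * (ennreal ((bracket p powr s)\<^sup>2) * (mass f g h p)\<^sup>2) \<partial>lborel)"
    unfolding wnorm2_def
  proof (rule nn_integral_mono_AE, use mass_finite[OF fgh] in eventually_elim)
    case (elim p)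
    have "ennreal \<bar>T f g h p\<bar> \<le> ennreal (sph_const / 8) * mass f g h p"
      unfolding T_def mass_def by (rule nu_integral_finite(3)[OF integrand_measurable(2)[OF m]]) (use elim in \<open>simp add: mass_def\<close>)
    then have "(ennreal \<bar>T f g h p\<bar>)\<^sup>2 \<le> (ennreal (sph_const / 8) * mass f g h p)\<^sup>2" by (rule power_mono) simp
    then have "ennreal ((T f g h p)\<^sup>2) \<le> ennreal ((sph_const / 8)\<^sup>2) * (mass f g h p)\<^sup>2"
      using k by (simp add: ennreal_power power_mult_distrib)
    then have "ennreal ((bracket p powr s)\<^sup>2) * ennreal ((T f g h p)\<^sup>2) \<le> ennreal ((bracket p powr s)\<^sup>2) * (ennreal ((sph_const / 8)\<^sup>2) * (mass f g h p)\<^sup>2)"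
      by (rule mult_left_mono) simp
    then show ?case by (simp add: power_mult_distrib ennreal_mult mult.left_commute)
  qed
  also have "\<dots> = ennreal ((sph_const / 8)\<^sup>2) * (\<integral>\<^sup>+p. ennreal ((bracket p powr s)\<^sup>2) * (mass f g h p)\<^sup>2 \<partial>lborel)"
    by (rule nn_integral_cmult) measurable
  also have "\<dots> \<le> ennreal ((sph_const / 8)\<^sup>2) * ennreal ((K * L2w_norm s f * L2w_norm s g * L2w_norm s h)\<^sup>2)"
    by (intro mult_left_mono bound' fgh) simp
  also have "\<dots> = ennreal (B\<^sup>2)" by (simp add: B_def power_mult_distrib power_divide mult.assoc flip: ennreal_mult)
  finally have le: "wnorm2 s (T f g h) \<le> ennreal (B\<^sup>2)" .
  show T: "T f g h \<in> L2w s" by (rule L2wI[OF Tm]) (use le in \<open>auto intro: le_less_trans\<close>)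
  have "(L2w_norm s (T f g h))\<^sup>2 \<le> B\<^sup>2" using le unfolding wnorm2_L2w[OF T] by simp
  then have "L2w_norm s (T f g h) \<le> B" by (rule power2_le_imp_le[OF _ B])
  then show "L2w_norm s (T f g h) \<le> sph_const / 8 * K * L2w_norm s f * L2w_norm s g * L2w_norm s h" by (simp add: B_def)
qed

text \<open>Additivity of \<open>nu_integral\<close> is available at points where the masses of both
  terms and of the difference are finite, hence the statements almost everywhere.\<close>

lemma T_diff:
  assumes "f \<in> L2w s" "g \<in> L2w s" "h \<in> L2w s" "k \<in> L2w s"
  shows "AE p in lborel. T (\<lambda>x. f x - k x) g h p = T f g h p - T k g h p"
    and "AE p in lborel. T g (\<lambda>x. f x - k x) h p = T g f h p - T g k h p"
    and "AE p in lborel. T g h (\<lambda>x. f x - k x) p = T g h f p - T g h k p"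
proof -
  note m = assms[THEN L2w_measurable]
  note d = wl2_diff(1)[OF assms(1,4)]
  note i2 = integrand_measurable(2)
  have 1: "integrand (\<lambda>x. f x - k x) g h p = (\<lambda>p1 p2 p3. integrand f g h p p1 p2 p3 - integrand k g h p p1 p2 p3)" for p
    by (simp add: integrand_def fun_eq_iff algebra_simps)
  have 2: "integrand g (\<lambda>x. f x - k x) h p = (\<lambda>p1 p2 p3. integrand g f h p p1 p2 p3 - integrand g k h p p1 p2 p3)" for p
    by (simp add: integrand_def fun_eq_iff algebra_simps)
  have 3: "integrand g h (\<lambda>x. f x - k x) p = (\<lambda>p1 p2 p3. integrand g h f p p1 p2 p3 - integrand g h k p p1 p2 p3)" for p
    by (simp add: integrand_def fun_eq_iff algebra_simps)
  show "AE p in lborel. T (\<lambda>x. f x - k x) g h p = T f g h p - T k g h p"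
    using mass_finite[OF assms(1-3)] mass_finite[OF assms(4,2,3)] mass_finite[OF d assms(2,3)]
    by eventually_elim (simp only: T_def mass_def 1, intro nu_integral_diff i2 m, assumption+)
  show "AE p in lborel. T g (\<lambda>x. f x - k x) h p = T g f h p - T g k h p"
    using mass_finite[OF assms(2,1,3)] mass_finite[OF assms(2,4,3)] mass_finite[OF assms(2) d assms(3)]
    by eventually_elim (simp only: T_def mass_def 2, intro nu_integral_diff i2 m, assumption+)
  show "AE p in lborel. T g h (\<lambda>x. f x - k x) p = T g h f p - T g h k p"
    using mass_finite[OF assms(2,3,1)] mass_finite[OF assms(2,3,4)] mass_finite[OF assms(2,3) d]
    by eventually_elim (simp only: T_def mass_def 3, intro nu_integral_diff i2 m, assumption+)
qed

lemma T_cube_lipschitz: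
  assumes f: "f \<in> L2w s" and g: "g \<in> L2w s"
  shows "L2w_norm s (\<lambda>p. T f f f p - T g g g p) \<le>
    sph_const / 4 * K * ((L2w_norm s f)\<^sup>2 + (L2w_norm s g)\<^sup>2) * L2w_norm s (\<lambda>p. f p - g p)"
proof -
  define d where "d = (\<lambda>p. f p - g p)"
  have d: "d \<in> L2w s" unfolding d_def by (rule wl2_diff[OF f g])
  define A where "A = sph_const / 8 * K"
  have A: "A \<ge> 0" using sph_const_nonneg K_nonneg by (simp add: A_def)
  define u v n where "u = L2w_norm s f" and "v = L2w_norm s g" and "n = L2w_norm s d"
  have uvn: "u \<ge> 0" "v \<ge> 0" "n \<ge> 0" by (simp_all add: u_def v_def n_def)
  \<comment> \<open>The telescoping fff - ggg = dff + gdf + ggd with d = f - g.\<close>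
  define S where "S = (\<lambda>p. (T d f f p + T g d f p) + T g g d p)"
  have S1: "(\<lambda>p. T d f f p + T g d f p) \<in> L2w s" by (intro wl2_add T_L2w d f g)
  have S: "S \<in> L2w s" unfolding S_def by (intro wl2_add[OF S1] T_L2w d f g)
  have "AE p in lborel. T f f f p - T g g g p = S p"
    using T_diff(1)[OF f f f g] T_diff(2)[OF f g f g] T_diff(3)[OF f g g g]
    by eventually_elim (simp add: S_def d_def)
  then have "L2w_norm s (\<lambda>p. T f f f p - T g g g p) = L2w_norm s S"
    by (intro L2w_norm_cong_AE wl2_diff T_L2w f g S)
  also have "\<dots> \<le> L2w_norm s (\<lambda>p. T d f f p + T g d f p) + L2w_norm s (T g g d)"
    unfolding S_def by (intro L2w_norm_triangle S1 T_L2w d g)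
  also have "L2w_norm s (\<lambda>p. T d f f p + T g d f p) \<le> L2w_norm s (T d f f) + L2w_norm s (T g d f)"
    by (intro L2w_norm_triangle T_L2w d f g)
  also have "L2w_norm s (T d f f) \<le> A * n * u * u"
    unfolding A_def n_def u_def by (rule T_L2w(2)[OF d f f])
  also have "L2w_norm s (T g d f) \<le> A * v * n * u"
    unfolding A_def n_def u_def v_def by (rule T_L2w(2)[OF g d f])
  also have "L2w_norm s (T g g d) \<le> A * v * v * n"
    unfolding A_def n_def v_def by (rule T_L2w(2)[OF g g d])
  also have "A * n * u * u + A * v * n * u + A * v * v * n = A * (u * u + u * v + v * v) * n"
    by (simp add: algebra_simps)
  also have "\<dots> \<le> A * (2 * (u\<^sup>2 + v\<^sup>2)) * n"
  proof (intro mult_right_mono mult_left_mono A uvn)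
    have "2 * u * v \<le> u\<^sup>2 + v\<^sup>2" by (rule sum_squares_bound)
    moreover have "0 \<le> u * v" using uvn by simp
    ultimately show "u * u + u * v + v * v \<le> 2 * (u\<^sup>2 + v\<^sup>2)" by (simp add: power2_eq_square)
  qed
  also have "\<dots> = sph_const / 4 * K * (u\<^sup>2 + v\<^sup>2) * n" by (simp add: A_def)
  finally show ?thesis by (simp only: u_def v_def n_def d_def)
qed

end

section \<open>The three bounds in terms of the norms\<close>

lemma optimize_product:
  assumes "C < \<infinity>" "x \<ge> 0" "y \<ge> 0"
    and I: "\<And>l. l > 0 \<Longrightarrow> I \<le> ennreal l * (C * ennreal (x\<^sup>2)) + ennreal (1 / l) * (C * ennreal (y\<^sup>2))"
  shows "I \<le> ennreal (2 * enn2real C * x * y)"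
proof -
  obtain k where k: "C = ennreal k" "k \<ge> 0" using assms(1) by (cases C) auto
  have "I \<le> ennreal (2 * sqrt ((k * x\<^sup>2) * (k * y\<^sup>2)))"
    by (rule ennreal_optimize) (use I k in \<open>simp_all add: ennreal_mult\<close>)
  also have "(k * x\<^sup>2) * (k * y\<^sup>2) = (k * x * y)\<^sup>2" by (simp add: power2_eq_square)
  also have "sqrt ((k * x * y)\<^sup>2) = k * x * y" using k assms by simp
  finally show ?thesis using k by (simp add: mult.assoc)
qed

lemma coll_p2_p3_bound:
  assumes s: "s > 1 / 2"
  obtains K :: real where "K \<ge> 0" "\<And>p g h. g \<in> L2w s \<Longrightarrow> h \<in> L2w s \<Longrightarrow>
    coll p (\<lambda>a b c. ennreal (\<bar>g b\<bar> * \<bar>h c\<bar>)) \<le> ennreal (K * L2w_norm s g * L2w_norm s h)"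
proof -
  obtain C where C: "C < \<infinity>"
    "\<And>p l g h. l > 0 \<Longrightarrow> g \<in> borel_measurable borel \<Longrightarrow> h \<in> borel_measurable borel \<Longrightarrow>
      coll p (\<lambda>a b c. ennreal (\<bar>g b\<bar> * \<bar>h c\<bar>)) \<le> ennreal l * (C * wnorm2 s g) + ennreal (1 / l) * (C * wnorm2 s h)"
    using coll_p2_p3_le[OF s] by blast
  show thesis
  proof
    show "0 \<le> 2 * enn2real C" by simp
    fix p g h assume g: "g \<in> L2w s" and h: "h \<in> L2w s"
    show "coll p (\<lambda>a b c. ennreal (\<bar>g b\<bar> * \<bar>h c\<bar>)) \<le> ennreal (2 * enn2real C * L2w_norm s g * L2w_norm s h)"
      by (rule optimize_product[OF C(1)])
         (use C(2)[OF _ L2w_measurable[OF g] L2w_measurable[OF h]] wnorm2_L2w[OF g] wnorm2_L2w[OF h] in auto)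
  qed
qed

lemma coll_p1_p2_bound:
  assumes s: "s > 1 / 2"
  obtains K :: real where "K \<ge> 0" "\<And>p g h. g \<in> L2w s \<Longrightarrow> h \<in> L2w s \<Longrightarrow>
    coll p (\<lambda>a b c. ennreal (\<bar>g a\<bar> * \<bar>h b\<bar>)) \<le> ennreal (K * L2w_norm s g * L2w_norm s h)"
proof -
  \<comment> \<open>\<open>coll_p1_p2_le\<close> requires an exponent below 1; beyond 3/4 the bound
    for 3/4 is used, as the norms increase with the exponent.\<close>
  define s' where "s' = min s (3 / 4)"
  have s': "1 / 2 < s'" "s' < 1" "s' \<le> s" using s by (auto simp: s'_def)
  obtain C where C: "C < \<infinity>"
    "\<And>p l g h. l > 0 \<Longrightarrow> g \<in> borel_measurable borel \<Longrightarrow> h \<in> borel_measurable borel \<Longrightarrow>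
      coll p (\<lambda>a b c. ennreal (\<bar>g a\<bar> * \<bar>h b\<bar>)) \<le> ennreal l * (C * wnorm2 s' h) + ennreal (1 / l) * (C * wnorm2 s' g)"
    using coll_p1_p2_le[OF s'(1,2)] by blast
  show thesis
  proof
    show "0 \<le> 2 * enn2real C" by simp
    fix p g h assume g: "g \<in> L2w s" and h: "h \<in> L2w s"
    have "coll p (\<lambda>a b c. ennreal (\<bar>g a\<bar> * \<bar>h b\<bar>)) \<le> ennreal (2 * enn2real C * L2w_norm s h * L2w_norm s g)"
    proof (rule optimize_product[OF C(1)])
      fix l :: real assume l: "l > 0"
      have "coll p (\<lambda>a b c. ennreal (\<bar>g a\<bar> * \<bar>h b\<bar>)) \<le> ennreal l * (C * wnorm2 s' h) + ennreal (1 / l) * (C * wnorm2 s' g)"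
        by (rule C(2)[OF l L2w_measurable[OF g] L2w_measurable[OF h]])
      also have "\<dots> \<le> ennreal l * (C * wnorm2 s h) + ennreal (1 / l) * (C * wnorm2 s g)"
        by (intro add_mono mult_left_mono wnorm2_mono s') auto
      finally show "coll p (\<lambda>a b c. ennreal (\<bar>g a\<bar> * \<bar>h b\<bar>)) \<le>
          ennreal l * (C * ennreal ((L2w_norm s h)\<^sup>2)) + ennreal (1 / l) * (C * ennreal ((L2w_norm s g)\<^sup>2))"
        unfolding wnorm2_L2w[OF g] wnorm2_L2w[OF h] .
    qed auto
    also have "2 * enn2real C * L2w_norm s h * L2w_norm s g = 2 * enn2real C * L2w_norm s g * L2w_norm s h" by simp
    finally show "coll p (\<lambda>a b c. ennreal (\<bar>g a\<bar> * \<bar>h b\<bar>)) \<le> ennreal (2 * enn2real C * L2w_norm s g * L2w_norm s h)" .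
  qed
qed

text \<open>Conservation of energy: (p, p1) and (p2, p3) are antipodal pairs on one sphere, and the
  parallelogram law gives both sums the same value.\<close>

lemma norm_p2_p3_sum:
  assumes "norm \<phi> = 1"
  shows "(norm (p2_of p p1 \<phi>))\<^sup>2 + (norm (p3_of p p1 \<phi>))\<^sup>2 = (norm p)\<^sup>2 + (norm p1)\<^sup>2"
proof -
  define c d e where "c = (p + p1) /\<^sub>R 2" and "d = (p - p1) /\<^sub>R 2" and "e = (norm (p - p1) / 2) *\<^sub>R \<phi>"
  have par: "(norm (c + u))\<^sup>2 + (norm (c - u))\<^sup>2 = 2 * (norm c)\<^sup>2 + 2 * (norm u)\<^sup>2" for u
    unfolding power2_norm_eq_inner
    by (simp add: inner_add_left inner_add_right inner_diff_left inner_diff_right)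
  have "p = c + d" "p1 = c - d" by (simp_all add: c_def d_def vec_eq_iff field_simps)
  moreover have "norm d = norm e" using assms by (simp add: d_def e_def)
  moreover have "p2_of p p1 \<phi> = c + e" "p3_of p p1 \<phi> = c - e" by (simp_all add: p2_of_def p3_of_def c_def e_def)
  ultimately show ?thesis using par[of d] par[of e] by simp
qed

lemma bracket_powr_le_sum:
  assumes "norm \<phi> = 1" "s \<ge> 0"
  shows "bracket p powr s \<le> 2 powr s * (bracket (p2_of p p1 \<phi>) powr s + bracket (p3_of p p1 \<phi>) powr s)"
proof -
  let ?a = "bracket (p2_of p p1 \<phi>)" and ?b = "bracket (p3_of p p1 \<phi>)"
  have sq: "(bracket x)\<^sup>2 = 1 + (norm x)\<^sup>2" for x by (simp add: bracket_def)
  have "(bracket p)\<^sup>2 \<le> ?a\<^sup>2 + ?b\<^sup>2"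
    unfolding sq using norm_p2_p3_sum[OF assms(1), of p p1] by simp
  also have "\<dots> \<le> (max ?a ?b)\<^sup>2 + (max ?a ?b)\<^sup>2" by (intro add_mono power_mono) auto
  also have "\<dots> \<le> (2 * max ?a ?b)\<^sup>2" by (simp add: power_mult_distrib)
  finally have "bracket p \<le> 2 * max ?a ?b" by (rule power2_le_imp_le) (simp add: le_max_iff_disj)
  then have "bracket p powr s \<le> (2 * max ?a ?b) powr s" using assms by (intro powr_mono2) auto
  also have "\<dots> = 2 powr s * max ?a ?b powr s" by (rule powr_mult)
  also have "\<dots> \<le> 2 powr s * (?a powr s + ?b powr s)"
    by (intro mult_left_mono) (auto simp: max_def)
  finally show ?thesis .
qed

lemma ennreal_power2_sum_le: "(x + y)\<^sup>2 \<le> 2 * (x\<^sup>2 + y\<^sup>2)" for x y :: ennreal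
proof (cases "x = \<infinity> \<or> y = \<infinity>")
  case True
  then have eq: "2 * (x\<^sup>2 + y\<^sup>2) = \<infinity>" by (auto simp: power2_eq_square ennreal_mult_top ennreal_top_mult)
  show ?thesis unfolding eq by simp
next
  case False
  then obtain a b where ab: "x = ennreal a" "a \<ge> 0" "y = ennreal b" "b \<ge> 0" by (cases x; cases y) auto
  have "(a + b)\<^sup>2 \<le> 2 * (a\<^sup>2 + b\<^sup>2)" using sum_squares_bound[of a b] by (simp add: power2_sum)
  then have "ennreal ((a + b)\<^sup>2) \<le> ennreal (2 * (a\<^sup>2 + b\<^sup>2))" by (rule ennreal_leI)
  moreover have "(x + y)\<^sup>2 = ennreal ((a + b)\<^sup>2)"
    using ab by (simp add: ennreal_power ennreal_plus[symmetric] del: ennreal_plus)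
  moreover have "2 * (x\<^sup>2 + y\<^sup>2) = ennreal (2 * (a\<^sup>2 + b\<^sup>2))"
    using ab by (simp add: ennreal_power ennreal_mult)
  ultimately show ?thesis by simp
qed

text \<open>Whichever of g and h receives the weight <p>^s takes the unweighted middle place in
  \<open>coll_p1_p2_p3_le\<close>, and the other two functions are measured with the exponent 1/2
  \<le> s. For h this uses the symmetry p2 \<leftrightarrow> p3.\<close>

lemma coll_p1_p2_p3_bound:
  assumes s: "s > 1 / 2"
  obtains K :: real where "K \<ge> 0" "\<And>f g h. f \<in> L2w s \<Longrightarrow> g \<in> L2w s \<Longrightarrow> h \<in> L2w s \<Longrightarrow>
    (\<integral>\<^sup>+p. ennreal ((bracket p powr s)\<^sup>2) * (coll p (\<lambda>a b c. ennreal (\<bar>f a\<bar> * (\<bar>g b\<bar> * \<bar>h c\<bar>))))\<^sup>2 \<partial>lborel)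
      \<le> ennreal ((K * L2w_norm s f * L2w_norm s g * L2w_norm s h)\<^sup>2)"
proof -
  obtain C where C: "C < \<infinity>"
    "\<And>f g h. f \<in> borel_measurable borel \<Longrightarrow> g \<in> borel_measurable borel \<Longrightarrow> h \<in> borel_measurable borel \<Longrightarrow>
       wnorm2 (1 / 2) f < \<infinity> \<Longrightarrow> wnorm2 0 g < \<infinity> \<Longrightarrow> wnorm2 (1 / 2) h < \<infinity> \<Longrightarrow>
       (\<integral>\<^sup>+p. (coll p (\<lambda>a b c. ennreal (\<bar>f a\<bar> * (\<bar>g b\<bar> * \<bar>h c\<bar>))))\<^sup>2 \<partial>lborel) \<le>
       C * (wnorm2 (1 / 2) f * (wnorm2 0 g * wnorm2 (1 / 2) h))"
    using coll_p1_p2_p3_le by blast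
  obtain k where k: "C = ennreal k" "k \<ge> 0" using C(1) by (cases C) auto
  \<comment> \<open>The 4 in K^2 collects the 2 of (x + y)^2 \<le> 2 (x^2 + y^2) and the two equal
    bounds \<open>U1\<close> and \<open>U2\<close>.\<close>
  define K where "K = 2 * 2 powr s * sqrt k"
  have K2: "K\<^sup>2 = 4 * (2 powr s)\<^sup>2 * k" using k by (simp add: K_def power_mult_distrib)
  show thesis
  proof
    show "K \<ge> 0" using k by (simp add: K_def)
    fix f g h assume fgh: "f \<in> L2w s" "g \<in> L2w s" "h \<in> L2w s"
    note [measurable] = fgh[THEN L2w_measurable]
    define G where "G x = bracket x powr s * g x" for x
    define H where "H x = bracket x powr s * h x" for x
    have [measurable]: "G \<in> borel_measurable borel" "H \<in> borel_measurable borel" unfolding G_def H_def by measurable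
    define U where "U g h p = coll p (\<lambda>a b c. ennreal (\<bar>f a\<bar> * (\<bar>g b\<bar> * \<bar>h c\<bar>)))" for g h p
    have Um [measurable]: "U u v \<in> borel_measurable borel"
      if [measurable]: "u \<in> borel_measurable borel" "v \<in> borel_measurable borel" for u v
      unfolding U_def[abs_def] coll_def by measurable
    have W: "wnorm2 0 G = wnorm2 s g" "wnorm2 0 H = wnorm2 s h" by (simp_all add: wnorm2_def G_def H_def)
    have half: "wnorm2 (1 / 2) u \<le> ennreal ((L2w_norm s u)\<^sup>2)" if "u \<in> L2w s" for u
      using wnorm2_mono[of "1 / 2" s u] s wnorm2_L2w[OF that] by simp
    have half_fin: "wnorm2 (1 / 2) u < \<infinity>" if "u \<in> L2w s" for u
      using half[OF that] by (rule le_less_trans) simp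
    have U1: "(\<integral>\<^sup>+p. (U G h p)\<^sup>2 \<partial>lborel) \<le> ennreal (k * ((L2w_norm s f)\<^sup>2 * ((L2w_norm s g)\<^sup>2 * (L2w_norm s h)\<^sup>2)))"
    proof -
      have "(\<integral>\<^sup>+p. (U G h p)\<^sup>2 \<partial>lborel) \<le> C * (wnorm2 (1 / 2) f * (wnorm2 0 G * wnorm2 (1 / 2) h))"
        unfolding U_def by (rule C(2)) (measurable, use half_fin fgh wnorm2_L2w in \<open>auto simp: W\<close>)
      also have "\<dots> \<le> C * (ennreal ((L2w_norm s f)\<^sup>2) * (ennreal ((L2w_norm s g)\<^sup>2) * ennreal ((L2w_norm s h)\<^sup>2)))"
        unfolding W wnorm2_L2w[OF fgh(2)] by (intro mult_mono half fgh) auto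
      finally show ?thesis using k by (simp add: ennreal_mult)
    qed
    have U2: "(\<integral>\<^sup>+p. (U H g p)\<^sup>2 \<partial>lborel) \<le> ennreal (k * ((L2w_norm s f)\<^sup>2 * ((L2w_norm s g)\<^sup>2 * (L2w_norm s h)\<^sup>2)))"
    proof -
      have "(\<integral>\<^sup>+p. (U H g p)\<^sup>2 \<partial>lborel) \<le> C * (wnorm2 (1 / 2) f * (wnorm2 0 H * wnorm2 (1 / 2) g))"
        unfolding U_def by (rule C(2)) (measurable, use half_fin fgh wnorm2_L2w in \<open>auto simp: W\<close>)
      also have "\<dots> \<le> C * (ennreal ((L2w_norm s f)\<^sup>2) * (ennreal ((L2w_norm s h)\<^sup>2) * ennreal ((L2w_norm s g)\<^sup>2)))"
        unfolding W wnorm2_L2w[OF fgh(3)] by (intro mult_mono half fgh) auto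
      finally show ?thesis using k by (simp add: ennreal_mult mult.commute[of "ennreal ((L2w_norm s h)\<^sup>2)"] mult.commute[of "(L2w_norm s h)\<^sup>2"])
    qed
    have pt: "ennreal (bracket p powr s) * U g h p \<le> ennreal (2 powr s) * (U G h p + U H g p)" for p
    proof -
      have "ennreal (bracket p powr s) * U g h p = coll p (\<lambda>a b c. ennreal (bracket p powr s) * ennreal (\<bar>f a\<bar> * (\<bar>g b\<bar> * \<bar>h c\<bar>)))"
        unfolding U_def by (rule coll_cmult[symmetric]) measurable
      also have "\<dots> \<le> coll p (\<lambda>a b c. ennreal (2 powr s) * (ennreal (\<bar>f a\<bar> * (\<bar>G b\<bar> * \<bar>h c\<bar>)) + ennreal (\<bar>f a\<bar> * (\<bar>H c\<bar> * \<bar>g b\<bar>))))"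
        unfolding coll_def
      proof (rule nn_integral_mono, rule nn_integral_mono_AE, use AE_sph_norm in eventually_elim)
        fix p1 \<phi> :: "real^3" assume phi: "norm \<phi> = 1"
        let ?b = "p2_of p p1 \<phi>" and ?c = "p3_of p p1 \<phi>"
        have "bracket p powr s * (\<bar>f p1\<bar> * (\<bar>g ?b\<bar> * \<bar>h ?c\<bar>)) \<le>
          2 powr s * (bracket ?b powr s + bracket ?c powr s) * (\<bar>f p1\<bar> * (\<bar>g ?b\<bar> * \<bar>h ?c\<bar>))"
          using s by (intro mult_right_mono bracket_powr_le_sum[OF phi]) auto
        also have "\<dots> = 2 powr s * (\<bar>f p1\<bar> * (\<bar>G ?b\<bar> * \<bar>h ?c\<bar>) + \<bar>f p1\<bar> * (\<bar>H ?c\<bar> * \<bar>g ?b\<bar>))"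
          by (simp add: G_def H_def abs_mult algebra_simps)
        finally have "ennreal (bracket p powr s * (\<bar>f p1\<bar> * (\<bar>g ?b\<bar> * \<bar>h ?c\<bar>))) \<le>
          ennreal (2 powr s * (\<bar>f p1\<bar> * (\<bar>G ?b\<bar> * \<bar>h ?c\<bar>) + \<bar>f p1\<bar> * (\<bar>H ?c\<bar> * \<bar>g ?b\<bar>)))" by (rule ennreal_leI)
        then have "ennreal (bracket p powr s) * ennreal (\<bar>f p1\<bar> * (\<bar>g ?b\<bar> * \<bar>h ?c\<bar>)) \<le>
          ennreal (2 powr s) * (ennreal (\<bar>f p1\<bar> * (\<bar>G ?b\<bar> * \<bar>h ?c\<bar>)) + ennreal (\<bar>f p1\<bar> * (\<bar>H ?c\<bar> * \<bar>g ?b\<bar>)))"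
          by (simp only: ennreal_mult[OF powr_ge_zero] ennreal_plus mult_nonneg_nonneg add_nonneg_nonneg abs_ge_zero)
        then show "ennreal (norm (p - p1)) * (ennreal (bracket p powr s) * ennreal (\<bar>f p1\<bar> * (\<bar>g ?b\<bar> * \<bar>h ?c\<bar>))) \<le>
          ennreal (norm (p - p1)) * (ennreal (2 powr s) * (ennreal (\<bar>f p1\<bar> * (\<bar>G ?b\<bar> * \<bar>h ?c\<bar>)) + ennreal (\<bar>f p1\<bar> * (\<bar>H ?c\<bar> * \<bar>g ?b\<bar>))))"
          by (rule mult_left_mono) simp
      qed
      also have "\<dots> = ennreal (2 powr s) * coll p (\<lambda>a b c. ennreal (\<bar>f a\<bar> * (\<bar>G b\<bar> * \<bar>h c\<bar>)) + ennreal (\<bar>f a\<bar> * (\<bar>H c\<bar> * \<bar>g b\<bar>)))"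
        by (rule coll_cmult) measurable
      also have "coll p (\<lambda>a b c. ennreal (\<bar>f a\<bar> * (\<bar>G b\<bar> * \<bar>h c\<bar>)) + ennreal (\<bar>f a\<bar> * (\<bar>H c\<bar> * \<bar>g b\<bar>))) =
         U G h p + coll p (\<lambda>a b c. ennreal (\<bar>f a\<bar> * (\<bar>H c\<bar> * \<bar>g b\<bar>)))"
        unfolding U_def by (rule coll_add) measurable
      also have "coll p (\<lambda>a b c. ennreal (\<bar>f a\<bar> * (\<bar>H c\<bar> * \<bar>g b\<bar>))) = U H g p"
        unfolding U_def by (rule coll_swap23[of "\<lambda>a b c. ennreal (\<bar>f a\<bar> * (\<bar>H b\<bar> * \<bar>g c\<bar>))"]) measurable
      finally show ?thesis .
    qed
    have "(\<integral>\<^sup>+p. ennreal ((bracket p powr s)\<^sup>2) * (U g h p)\<^sup>2 \<partial>lborel) \<le>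
       (\<integral>\<^sup>+p. ennreal ((2 powr s)\<^sup>2 * 2) * ((U G h p)\<^sup>2 + (U H g p)\<^sup>2) \<partial>lborel)"
    proof (rule nn_integral_mono)
      fix p
      have "ennreal ((bracket p powr s)\<^sup>2) * (U g h p)\<^sup>2 = (ennreal (bracket p powr s) * U g h p)\<^sup>2"
        by (simp add: power_mult_distrib ennreal_power)
      also have "\<dots> \<le> (ennreal (2 powr s) * (U G h p + U H g p))\<^sup>2" by (rule power_mono[OF pt]) simp
      also have "\<dots> = ennreal ((2 powr s)\<^sup>2) * (U G h p + U H g p)\<^sup>2" by (simp add: power_mult_distrib ennreal_power)
      also have "\<dots> \<le> ennreal ((2 powr s)\<^sup>2) * (2 * ((U G h p)\<^sup>2 + (U H g p)\<^sup>2))" by (intro mult_left_mono ennreal_power2_sum_le) simp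
      also have "\<dots> = ennreal ((2 powr s)\<^sup>2 * 2) * ((U G h p)\<^sup>2 + (U H g p)\<^sup>2)" by (simp add: ennreal_mult mult.assoc)
      finally show "ennreal ((bracket p powr s)\<^sup>2) * (U g h p)\<^sup>2 \<le> ennreal ((2 powr s)\<^sup>2 * 2) * ((U G h p)\<^sup>2 + (U H g p)\<^sup>2)" .
    qed
    also have "\<dots> = ennreal ((2 powr s)\<^sup>2 * 2) * ((\<integral>\<^sup>+p. (U G h p)\<^sup>2 \<partial>lborel) + (\<integral>\<^sup>+p. (U H g p)\<^sup>2 \<partial>lborel))"
      by (subst nn_integral_cmult, measurable, subst nn_integral_add, measurable)
    also have "\<dots> \<le> ennreal ((2 powr s)\<^sup>2 * 2) *
       (ennreal (k * ((L2w_norm s f)\<^sup>2 * ((L2w_norm s g)\<^sup>2 * (L2w_norm s h)\<^sup>2))) + ennreal (k * ((L2w_norm s f)\<^sup>2 * ((L2w_norm s g)\<^sup>2 * (L2w_norm s h)\<^sup>2))))"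
      by (intro mult_left_mono add_mono U1 U2) simp
    also have "\<dots> = ennreal ((2 powr s)\<^sup>2 * 2 * (2 * (k * ((L2w_norm s f)\<^sup>2 * ((L2w_norm s g)\<^sup>2 * (L2w_norm s h)\<^sup>2)))))"
    proof -
      have "ennreal x * (ennreal y + ennreal y) = ennreal (x * (2 * y))" if "x \<ge> 0" "y \<ge> 0" for x y
      proof -
        have "ennreal y + ennreal y = ennreal (2 * y)" using that by (metis ennreal_plus mult_2)
        then show ?thesis using that by (simp only: ennreal_mult[symmetric] mult_nonneg_nonneg zero_le_numeral)
      qed
      then show ?thesis using k(2) by simp
    qed
    also have "(2 powr s)\<^sup>2 * 2 * (2 * (k * ((L2w_norm s f)\<^sup>2 * ((L2w_norm s g)\<^sup>2 * (L2w_norm s h)\<^sup>2)))) = (K * L2w_norm s f * L2w_norm s g * L2w_norm s h)\<^sup>2"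
      by (simp add: power_mult_distrib K2)
    finally show "(\<integral>\<^sup>+p. ennreal ((bracket p powr s)\<^sup>2) * (coll p (\<lambda>a b c. ennreal (\<bar>f a\<bar> * (\<bar>g b\<bar> * \<bar>h c\<bar>))))\<^sup>2 \<partial>lborel)
      \<le> ennreal ((K * L2w_norm s f * L2w_norm s g * L2w_norm s h)\<^sup>2)" unfolding U_def .
  qed
qed

text \<open>The factor f(p) leaves the integral and the rest is bounded uniformly in p, so the
  weight meets f alone.\<close>

lemma pointwise_term_bound:
  assumes f: "f \<in> L2w s" and K: "K \<ge> 0" "x \<ge> 0" "y \<ge> 0"
    and m: "\<And>p. (\<lambda>(p1, p2, p3). \<Phi> p p1 p2 p3) \<in> borel_measurable (borel \<Otimes>\<^sub>M borel \<Otimes>\<^sub>M borel)"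
    and nn: "\<And>p p1 p2 p3. \<Phi> p p1 p2 p3 \<ge> (0 :: real)"
    and le: "\<And>p. coll p (\<lambda>p1 p2 p3. ennreal (\<Phi> p p1 p2 p3)) \<le> ennreal (K * x * y)"
  shows "(\<integral>\<^sup>+p. ennreal ((bracket p powr s)\<^sup>2) * (coll p (\<lambda>p1 p2 p3. ennreal (\<bar>f p\<bar> * \<Phi> p p1 p2 p3)))\<^sup>2 \<partial>lborel)
      \<le> ennreal ((K * L2w_norm s f * x * y)\<^sup>2)"
proof -
  note [measurable] = L2w_measurable[OF f]
  have Kxy: "K * x * y \<ge> 0" using K by simp
  have "(\<integral>\<^sup>+p. ennreal ((bracket p powr s)\<^sup>2) * (coll p (\<lambda>p1 p2 p3. ennreal (\<bar>f p\<bar> * \<Phi> p p1 p2 p3)))\<^sup>2 \<partial>lborel) \<le>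
     (\<integral>\<^sup>+p. ennreal ((K * x * y)\<^sup>2) * ennreal ((bracket p powr s * f p)\<^sup>2) \<partial>lborel)"
  proof (rule nn_integral_mono)
    fix p
    have "(\<lambda>(p1, p2, p3). ennreal (\<Phi> p p1 p2 p3)) \<in> borel_measurable (borel \<Otimes>\<^sub>M borel \<Otimes>\<^sub>M borel)"
      using measurable_compose[OF m[of p] measurable_ennreal] by (simp add: split_def)
    then have "coll p (\<lambda>p1 p2 p3. ennreal (\<bar>f p\<bar> * \<Phi> p p1 p2 p3)) = ennreal \<bar>f p\<bar> * coll p (\<lambda>p1 p2 p3. ennreal (\<Phi> p p1 p2 p3))"
      by (subst coll_cmult[symmetric]) (auto simp: ennreal_mult nn)
    also have "\<dots> \<le> ennreal \<bar>f p\<bar> * ennreal (K * x * y)" by (rule mult_left_mono[OF le]) simp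
    also have "\<dots> = ennreal (\<bar>f p\<bar> * (K * x * y))" by (rule ennreal_mult[symmetric]) (use Kxy in auto)
    finally have "(coll p (\<lambda>p1 p2 p3. ennreal (\<bar>f p\<bar> * \<Phi> p p1 p2 p3)))\<^sup>2 \<le> (ennreal (\<bar>f p\<bar> * (K * x * y)))\<^sup>2"
      by (rule power_mono) simp
    also have "\<dots> = ennreal ((\<bar>f p\<bar> * (K * x * y))\<^sup>2)" by (rule ennreal_power) (use Kxy in auto)
    finally have "ennreal ((bracket p powr s)\<^sup>2) * (coll p (\<lambda>p1 p2 p3. ennreal (\<bar>f p\<bar> * \<Phi> p p1 p2 p3)))\<^sup>2 \<le>
      ennreal ((bracket p powr s)\<^sup>2) * ennreal ((\<bar>f p\<bar> * (K * x * y))\<^sup>2)" by (rule mult_left_mono) simp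
    also have "\<dots> = ennreal ((bracket p powr s)\<^sup>2 * (\<bar>f p\<bar> * (K * x * y))\<^sup>2)" by (rule ennreal_mult[symmetric]) auto
    also have "(bracket p powr s)\<^sup>2 * (\<bar>f p\<bar> * (K * x * y))\<^sup>2 = (K * x * y)\<^sup>2 * (bracket p powr s * f p)\<^sup>2"
      by (simp add: power_mult_distrib)
    also have "ennreal \<dots> = ennreal ((K * x * y)\<^sup>2) * ennreal ((bracket p powr s * f p)\<^sup>2)" by (rule ennreal_mult) auto
    finally show "ennreal ((bracket p powr s)\<^sup>2) * (coll p (\<lambda>p1 p2 p3. ennreal (\<bar>f p\<bar> * \<Phi> p p1 p2 p3)))\<^sup>2 \<le>
      ennreal ((K * x * y)\<^sup>2) * ennreal ((bracket p powr s * f p)\<^sup>2)" .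
  qed
  also have "\<dots> = ennreal ((K * x * y)\<^sup>2) * wnorm2 s f" unfolding wnorm2_def by (rule nn_integral_cmult) measurable
  also have "\<dots> = ennreal ((K * L2w_norm s f * x * y)\<^sup>2)"
    unfolding wnorm2_L2w[OF f] by (subst ennreal_mult[symmetric]) (auto simp: power_mult_distrib)
  finally show ?thesis .
qed

section \<open>Assembling the collision operator\<close>

lemma momentum_measurable:
  "(\<lambda>(p :: real^3, p1 :: real^3, p2 :: real^3, p3 :: real^3). p) \<in> borel_measurable (borel \<Otimes>\<^sub>M borel \<Otimes>\<^sub>M borel \<Otimes>\<^sub>M borel)"
  "(\<lambda>(p :: real^3, p1 :: real^3, p2 :: real^3, p3 :: real^3). p1) \<in> borel_measurable (borel \<Otimes>\<^sub>M borel \<Otimes>\<^sub>M borel \<Otimes>\<^sub>M borel)"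
  "(\<lambda>(p :: real^3, p1 :: real^3, p2 :: real^3, p3 :: real^3). p2) \<in> borel_measurable (borel \<Otimes>\<^sub>M borel \<Otimes>\<^sub>M borel \<Otimes>\<^sub>M borel)"
  "(\<lambda>(p :: real^3, p1 :: real^3, p2 :: real^3, p3 :: real^3). p3) \<in> borel_measurable (borel \<Otimes>\<^sub>M borel \<Otimes>\<^sub>M borel \<Otimes>\<^sub>M borel)"
  by (auto intro!: measurable_fst'' measurable_snd'' measurable_ident_sets simp: split_def)

lemma collision_term_p:
  assumes K: "K \<ge> 0"
  shows "(\<And>p g h. g \<in> L2w s \<Longrightarrow> h \<in> L2w s \<Longrightarrow>
      coll p (\<lambda>a b c. ennreal (\<bar>g b\<bar> * \<bar>h c\<bar>)) \<le> ennreal (K * L2w_norm s g * L2w_norm s h)) \<Longrightarrow>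
    collision_term (\<lambda>p p1 p2 p3. p) (\<lambda>p p1 p2 p3. p2) (\<lambda>p p1 p2 p3. p3) s K"
    and "(\<And>p g h. g \<in> L2w s \<Longrightarrow> h \<in> L2w s \<Longrightarrow>
      coll p (\<lambda>a b c. ennreal (\<bar>g a\<bar> * \<bar>h b\<bar>)) \<le> ennreal (K * L2w_norm s g * L2w_norm s h)) \<Longrightarrow>
    collision_term (\<lambda>p p1 p2 p3. p) (\<lambda>p p1 p2 p3. p1) (\<lambda>p p1 p2 p3. p2) s K"
proof -
  have m: "(\<lambda>(p1 :: real^3, p2 :: real^3, p3 :: real^3). \<bar>g p2\<bar> * \<bar>h p3\<bar>) \<in> borel_measurable (borel \<Otimes>\<^sub>M borel \<Otimes>\<^sub>M borel)"
    "(\<lambda>(p1 :: real^3, p2 :: real^3, p3 :: real^3). \<bar>g p1\<bar> * \<bar>h p2\<bar>) \<in> borel_measurable (borel \<Otimes>\<^sub>M borel \<Otimes>\<^sub>M borel)"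
    if "g \<in> L2w s" "h \<in> L2w s" for g h
  proof -
    note [measurable] = that[THEN L2w_measurable]
    show "(\<lambda>(p1 :: real^3, p2 :: real^3, p3 :: real^3). \<bar>g p2\<bar> * \<bar>h p3\<bar>) \<in> borel_measurable (borel \<Otimes>\<^sub>M borel \<Otimes>\<^sub>M borel)"
      "(\<lambda>(p1 :: real^3, p2 :: real^3, p3 :: real^3). \<bar>g p1\<bar> * \<bar>h p2\<bar>) \<in> borel_measurable (borel \<Otimes>\<^sub>M borel \<Otimes>\<^sub>M borel)"
      by measurable
  qed
  show "collision_term (\<lambda>p p1 p2 p3. p) (\<lambda>p p1 p2 p3. p2) (\<lambda>p p1 p2 p3. p3) s K"
    if le: "\<And>p g h. g \<in> L2w s \<Longrightarrow> h \<in> L2w s \<Longrightarrow>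
      coll p (\<lambda>a b c. ennreal (\<bar>g b\<bar> * \<bar>h c\<bar>)) \<le> ennreal (K * L2w_norm s g * L2w_norm s h)"
    by (rule collision_term.intro[OF momentum_measurable(1,3,4) K],
        rule pointwise_term_bound[OF _ K L2w_norm_nonneg L2w_norm_nonneg m(1) _ le]) (assumption | simp)+
  show "collision_term (\<lambda>p p1 p2 p3. p) (\<lambda>p p1 p2 p3. p1) (\<lambda>p p1 p2 p3. p2) s K"
    if le: "\<And>p g h. g \<in> L2w s \<Longrightarrow> h \<in> L2w s \<Longrightarrow>
      coll p (\<lambda>a b c. ennreal (\<bar>g a\<bar> * \<bar>h b\<bar>)) \<le> ennreal (K * L2w_norm s g * L2w_norm s h)"
    by (rule collision_term.intro[OF momentum_measurable(1,2,3) K],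
        rule pointwise_term_bound[OF _ K L2w_norm_nonneg L2w_norm_nonneg m(2) _ le]) (assumption | simp)+
qed

lemma nu_integral_nonneg:
  assumes "\<And>a b c. \<Phi> a b c \<ge> 0"
  shows "nu_integral \<omega> p \<Phi> \<ge> 0"
  unfolding nu_integral_def set_lebesgue_integral_def
  by (intro integral_nonneg_AE AE_I2) (simp add: assms)

lemma collision_zero: "collision \<omega>2 (\<lambda>x. 0) = (\<lambda>p. 0)"
  by (simp add: fun_eq_iff collision_def T1_def T2_def T3_def nu_integral_def set_lebesgue_integral_def)

lemma collision_estimates:
  assumes s: "s > 1 / 2"
  obtains C :: real where "C > 0"
    "\<And>f. f \<in> L2w s \<Longrightarrow> collision \<omega>2 f \<in> L2w s"
    "\<And>f g. f \<in> L2w s \<Longrightarrow> g \<in> L2w s \<Longrightarrow> L2w_norm s (\<lambda>p. collision \<omega>2 f p - collision \<omega>2 g p) \<le>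
       C * ((L2w_norm s f)\<^sup>2 + (L2w_norm s g)\<^sup>2) * L2w_norm s (\<lambda>p. f p - g p)"
    "\<And>f M. f \<in> L2w s \<Longrightarrow> AE p in lborel. f p \<ge> 0 \<Longrightarrow> L2w_norm s f \<le> M \<Longrightarrow>
       AE p in lborel. collision \<omega>2 f p + C * M\<^sup>2 * f p \<ge> 0"
proof -
  obtain K1 where K1: "K1 \<ge> 0" "\<And>f g h. f \<in> L2w s \<Longrightarrow> g \<in> L2w s \<Longrightarrow> h \<in> L2w s \<Longrightarrow>
    (\<integral>\<^sup>+p. ennreal ((bracket p powr s)\<^sup>2) * (coll p (\<lambda>a b c. ennreal (\<bar>f a\<bar> * (\<bar>g b\<bar> * \<bar>h c\<bar>))))\<^sup>2 \<partial>lborel)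
      \<le> ennreal ((K1 * L2w_norm s f * L2w_norm s g * L2w_norm s h)\<^sup>2)"
    using coll_p1_p2_p3_bound[OF s] by blast
  obtain K2 where K2: "K2 \<ge> 0" "\<And>p g h. g \<in> L2w s \<Longrightarrow> h \<in> L2w s \<Longrightarrow>
    coll p (\<lambda>a b c. ennreal (\<bar>g b\<bar> * \<bar>h c\<bar>)) \<le> ennreal (K2 * L2w_norm s g * L2w_norm s h)"
    using coll_p2_p3_bound[OF s] by blast
  obtain K3 where K3: "K3 \<ge> 0" "\<And>p g h. g \<in> L2w s \<Longrightarrow> h \<in> L2w s \<Longrightarrow>
    coll p (\<lambda>a b c. ennreal (\<bar>g a\<bar> * \<bar>h b\<bar>)) \<le> ennreal (K3 * L2w_norm s g * L2w_norm s h)"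
    using coll_p1_p2_bound[OF s] by blast
  interpret t1: collision_term "\<lambda>p p1 p2 p3. p1" "\<lambda>p p1 p2 p3. p2" "\<lambda>p p1 p2 p3. p3" s K1
    by (rule collision_term.intro[OF momentum_measurable(2,3,4) K1])
  interpret t2: collision_term "\<lambda>p p1 p2 p3. p" "\<lambda>p p1 p2 p3. p2" "\<lambda>p p1 p2 p3. p3" s K2
    by (rule collision_term_p(1)[OF K2])
  interpret t3: collision_term "\<lambda>p p1 p2 p3. p" "\<lambda>p p1 p2 p3. p1" "\<lambda>p p1 p2 p3. p2" s K3
    by (rule collision_term_p(2)[OF K3])
  have col: "collision \<omega>2 f = (\<lambda>p. (t1.T f f f p + t2.T f f f p) - 2 * t3.T f f f p)" for f
    unfolding fun_eq_iff collision_def T1_def T2_def T3_def t1.T_def t2.T_def t3.T_def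
      t1.integrand_def[abs_def] t2.integrand_def[abs_def] t3.integrand_def[abs_def] by (simp only: simp_thms)
  have Q_L2w: "collision \<omega>2 f \<in> L2w s" if "f \<in> L2w s" for f
    unfolding col by (intro wl2_add wl2_diff wl2_scale t1.T_L2w t2.T_L2w t3.T_L2w that)
  \<comment> \<open>The quarter is the one of \<open>T_cube_lipschitz\<close>, and K3 is doubled by
    the coefficient 2 of the loss term. The summand 1 in C makes it positive even if
    \<open>sph_const\<close> is 0.\<close>
  define L where "L = sph_const / 4 * (K1 + K2 + 2 * K3)"
  define C where "C = L + 1"
  have L: "L \<ge> 0" using sph_const_nonneg K1(1) K2(1) K3(1) by (simp add: L_def)
  have Lip: "L2w_norm s (\<lambda>p. collision \<omega>2 f p - collision \<omega>2 g p) \<le>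
       C * ((L2w_norm s f)\<^sup>2 + (L2w_norm s g)\<^sup>2) * L2w_norm s (\<lambda>p. f p - g p)"
    if f: "f \<in> L2w s" and g: "g \<in> L2w s" for f g
  proof -
    define D1 where "D1 = (\<lambda>p. t1.T f f f p - t1.T g g g p)"
    define D2 where "D2 = (\<lambda>p. t2.T f f f p - t2.T g g g p)"
    define D3 where "D3 = (\<lambda>p. t3.T f f f p - t3.T g g g p)"
    have D: "D1 \<in> L2w s" "D2 \<in> L2w s" "D3 \<in> L2w s"
      unfolding D1_def D2_def D3_def by (intro wl2_diff t1.T_L2w t2.T_L2w t3.T_L2w f g)+
    have D3': "(\<lambda>p. (- 2) * D3 p) \<in> L2w s" by (rule wl2_scale[OF D(3)])
    define E where "E = ((L2w_norm s f)\<^sup>2 + (L2w_norm s g)\<^sup>2) * L2w_norm s (\<lambda>p. f p - g p)"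
    have E: "E \<ge> 0" by (simp add: E_def)
    have "(\<lambda>p. collision \<omega>2 f p - collision \<omega>2 g p) = (\<lambda>p. (D1 p + D2 p) + (- 2) * D3 p)"
      by (simp add: col D1_def D2_def D3_def fun_eq_iff)
    then have "L2w_norm s (\<lambda>p. collision \<omega>2 f p - collision \<omega>2 g p) \<le> L2w_norm s (\<lambda>p. D1 p + D2 p) + L2w_norm s (\<lambda>p. (- 2) * D3 p)"
      using L2w_norm_triangle[OF wl2_add(1)[OF D(1,2)] D3'] by simp
    also have "L2w_norm s (\<lambda>p. D1 p + D2 p) \<le> L2w_norm s D1 + L2w_norm s D2" by (rule L2w_norm_triangle[OF D(1,2)])
    also have "L2w_norm s (\<lambda>p. (- 2) * D3 p) = 2 * L2w_norm s D3"
      using wl2_scale[OF D(3), of "- 2"] norm_wl2[OF D3'] norm_wl2[OF D(3)] by simp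
    also have "L2w_norm s D1 \<le> sph_const / 4 * K1 * E"
      using t1.T_cube_lipschitz[OF f g] by (simp add: D1_def E_def mult.assoc)
    also have "L2w_norm s D2 \<le> sph_const / 4 * K2 * E"
      using t2.T_cube_lipschitz[OF f g] by (simp add: D2_def E_def mult.assoc)
    also have "L2w_norm s D3 \<le> sph_const / 4 * K3 * E"
      using t3.T_cube_lipschitz[OF f g] by (simp add: D3_def E_def mult.assoc)
    also have "sph_const / 4 * K1 * E + sph_const / 4 * K2 * E + 2 * (sph_const / 4 * K3 * E) = L * E"
      by (simp add: L_def algebra_simps)
    also have "\<dots> \<le> C * E" using E by (simp add: C_def distrib_right)
    finally show ?thesis by (simp add: E_def mult.assoc)
  qed
  have Pos: "AE p in lborel. collision \<omega>2 f p + C * M\<^sup>2 * f p \<ge> 0"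
    if f: "f \<in> L2w s" and pos: "AE p in lborel. f p \<ge> 0" and M: "L2w_norm s f \<le> M" for f M
  proof -
    \<comment> \<open>Non-negativity almost everywhere says nothing about the values on a single
      sphere, so f is replaced by a representative that is non-negative everywhere; the Lipschitz
      bound at distance 0 shows that this changes Q[f] on a null set only.\<close>
    define g where "g x = max 0 (f x)" for x
    have fg: "AE p in lborel. f p = g p" using pos by eventually_elim (simp add: g_def)
    note [measurable] = L2w_measurable[OF f]
    have gm [measurable]: "g \<in> borel_measurable borel" unfolding g_def by measurable
    have "wnorm2 s g = wnorm2 s f" unfolding wnorm2_def by (rule nn_integral_cong_AE) (use fg in auto)
    then have g: "g \<in> L2w s" by (intro L2wI gm) (simp only: wnorm2_L2w[OF f], simp)
    have ng: "L2w_norm s g \<le> M" using L2w_norm_cong_AE[OF f g fg] M by simp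
    have "wl2 s f = wl2 s g" using wl2_eq_iff[OF f g] fg by simp
    then have "L2w_norm s (\<lambda>p. f p - g p) = 0" using L2w_norm_diff[OF f g] by simp
    then have "L2w_norm s (\<lambda>p. collision \<omega>2 f p - collision \<omega>2 g p) \<le> 0" using Lip[OF f g] by simp
    then have "wl2 s (collision \<omega>2 f) = wl2 s (collision \<omega>2 g)"
      using L2w_norm_diff[OF Q_L2w[OF f] Q_L2w[OF g]] by simp
    then have "AE p in lborel. collision \<omega>2 f p = collision \<omega>2 g p"
      using wl2_eq_iff[OF Q_L2w[OF f] Q_L2w[OF g]] by simp
    moreover have "collision \<omega>2 g p + C * M\<^sup>2 * g p \<ge> 0" for p
    proof -
      have g0: "g x \<ge> 0" for x by (simp add: g_def)
      have "t1.T g g g p \<ge> 0" "t2.T g g g p \<ge> 0"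
        unfolding t1.T_def t2.T_def
        by (intro nu_integral_nonneg, simp only: t1.integrand_def t2.integrand_def, intro mult_nonneg_nonneg g0)+
      \<comment> \<open>The loss term keeps its factor g(p), so it is controlled pointwise by a
        multiple of g(p) and not merely in norm.\<close>
      moreover have "t3.T g g g p \<le> L / 2 * M\<^sup>2 * g p"
      proof -
        have m: "(\<lambda>(a, b, c). ennreal (\<bar>g a\<bar> * \<bar>g b\<bar>)) \<in> borel_measurable (borel \<Otimes>\<^sub>M borel \<Otimes>\<^sub>M borel)" by measurable
        have "coll p (\<lambda>a b c. ennreal \<bar>t3.integrand g g g p a b c\<bar>) = coll p (\<lambda>a b c. ennreal \<bar>g p\<bar> * ennreal (\<bar>g a\<bar> * \<bar>g b\<bar>))"
          by (simp only: t3.integrand_def abs_mult ennreal_mult abs_ge_zero mult_nonneg_nonneg mult.assoc)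
        also have "\<dots> = ennreal \<bar>g p\<bar> * coll p (\<lambda>a b c. ennreal (\<bar>g a\<bar> * \<bar>g b\<bar>))" by (rule coll_cmult[OF m])
        also have "\<dots> \<le> ennreal \<bar>g p\<bar> * ennreal (K3 * L2w_norm s g * L2w_norm s g)" by (intro mult_left_mono K3(2) g) simp
        also have "\<dots> = ennreal (\<bar>g p\<bar> * (K3 * L2w_norm s g * L2w_norm s g))" by (rule ennreal_mult[symmetric]) (use K3 in auto)
        finally have le: "coll p (\<lambda>a b c. ennreal \<bar>t3.integrand g g g p a b c\<bar>) \<le> ennreal (\<bar>g p\<bar> * (K3 * L2w_norm s g * L2w_norm s g))" .
        have "ennreal \<bar>t3.T g g g p\<bar> \<le> ennreal (sph_const / 8) * coll p (\<lambda>a b c. ennreal \<bar>t3.integrand g g g p a b c\<bar>)"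
          unfolding t3.T_def
          by (rule nu_integral_finite(3)[OF t3.integrand_measurable(2)[OF gm gm gm]]) (rule le_less_trans[OF le], simp)
        also have "\<dots> \<le> ennreal (sph_const / 8) * ennreal (\<bar>g p\<bar> * (K3 * L2w_norm s g * L2w_norm s g))"
          by (rule mult_left_mono[OF le]) simp
        also have "\<dots> = ennreal (sph_const / 8 * (\<bar>g p\<bar> * (K3 * L2w_norm s g * L2w_norm s g)))"
          by (rule ennreal_mult[symmetric]) (use sph_const_nonneg K3 in auto)
        finally have "\<bar>t3.T g g g p\<bar> \<le> sph_const / 8 * (\<bar>g p\<bar> * (K3 * L2w_norm s g * L2w_norm s g))"
          by (rule ennreal_le_iff[THEN iffD1, rotated]) (use sph_const_nonneg K3 in auto)
        also have "\<dots> = sph_const / 8 * K3 * (L2w_norm s g)\<^sup>2 * g p" using g0[of p] by (simp add: power2_eq_square)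
        also have "\<dots> \<le> L / 2 * M\<^sup>2 * g p"
        proof (intro mult_right_mono mult_mono power_mono ng g0)
          have "0 \<le> sph_const * K1" "0 \<le> sph_const * K2" "0 \<le> sph_const * K3"
            using sph_const_nonneg K1(1) K2(1) K3(1) by auto
          then show "sph_const / 8 * K3 \<le> L / 2" by (simp add: L_def algebra_simps)
        qed (use L in auto)
        finally show ?thesis by simp
      qed
      moreover have "L * M\<^sup>2 * g p \<le> C * M\<^sup>2 * g p" using g0[of p] by (intro mult_right_mono) (auto simp: C_def)
      ultimately show ?thesis unfolding col by simp
    qed
    ultimately show ?thesis using fg by auto
  qed
  show thesis by (rule that[of C]) (use L Q_L2w Lip Pos in \<open>auto simp: C_def\<close>)
qed

section \<open>The Cauchy problem\<close>

definition nonneg_l2 :: "l2 set" where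
  "nonneg_l2 = {abs_l2 \<phi> | \<phi>. \<phi> \<in> square_integrable \<and> (\<forall>x. \<phi> x \<ge> 0)}"

text \<open>The cone of non-negative classes is its own dual: testing f with its negative part gives
  minus the squared norm of that part.\<close>

lemma inner_nonneg_l2_iff:
  assumes f: "f \<in> square_integrable"
  shows "(\<forall>d\<in>nonneg_l2. inner (abs_l2 f) d \<ge> 0) \<longleftrightarrow> (AE x in lborel. f x \<ge> 0)"
proof
  note [measurable] = square_integrable_measurable[OF f]
  define \<phi> where "\<phi> x = max 0 (- f x)" for x
  have \<phi>_eq: "\<phi> = (\<lambda>x. (1 / 2) * (\<bar>f x\<bar> - f x))" by (auto simp: \<phi>_def fun_eq_iff max_def)
  have \<phi>: "\<phi> \<in> square_integrable"
    unfolding \<phi>_eq by (rule square_integrable_scale[OF square_integrable_diff[OF square_integrable_abs[OF f] f]])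
  have eq: "f x * \<phi> x = - ((\<phi> x)\<^sup>2)" for x by (simp add: \<phi>_def max_def power2_eq_square)
  have int: "integrable lborel (\<lambda>x. (\<phi> x)\<^sup>2)" using \<phi> by (simp add: square_integrable_def)
  assume "\<forall>d\<in>nonneg_l2. inner (abs_l2 f) d \<ge> 0"
  moreover have "abs_l2 \<phi> \<in> nonneg_l2" using \<phi> by (auto simp: nonneg_l2_def \<phi>_def)
  ultimately have "inner (abs_l2 f) (abs_l2 \<phi>) \<ge> 0" by blast
  then have "(LINT x|lborel. (\<phi> x)\<^sup>2) \<le> 0" by (simp add: inner_abs_l2[OF f \<phi>] eq)
  moreover have "(LINT x|lborel. (\<phi> x)\<^sup>2) \<ge> 0" by (simp add: integral_nonneg_AE)
  ultimately have "(LINT x|lborel. (\<phi> x)\<^sup>2) = 0" by simp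
  then have "AE x in lborel. (\<phi> x)\<^sup>2 = 0" by (subst (asm) integral_nonneg_eq_0_iff_AE[OF int]) auto
  then show "AE x in lborel. f x \<ge> 0" by eventually_elim (auto simp: \<phi>_def max_def split: if_splits)
next
  assume pos: "AE x in lborel. f x \<ge> 0"
  show "\<forall>d\<in>nonneg_l2. inner (abs_l2 f) d \<ge> 0"
  proof
    fix d assume "d \<in> nonneg_l2"
    then obtain \<phi> where d: "d = abs_l2 \<phi>" and \<phi>: "\<phi> \<in> square_integrable" and nn: "\<And>x. \<phi> x \<ge> 0"
      by (auto simp: nonneg_l2_def)
    have "AE x in lborel. f x * \<phi> x \<ge> 0" using pos by eventually_elim (simp add: nn)
    then show "inner (abs_l2 f) d \<ge> 0" unfolding d inner_abs_l2[OF f \<phi>] by (rule integral_nonneg_AE)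
  qed
qed

lemma inner_wl2_nonneg_iff:
  assumes f: "f \<in> L2w s"
  shows "(\<forall>d\<in>nonneg_l2. inner (wl2 s f) d \<ge> 0) \<longleftrightarrow> (AE x in lborel. f x \<ge> 0)"
  unfolding wl2_def inner_nonneg_l2_iff[OF f[folded square_integrable_wnorm2_iff]]
  by (intro AE_cong) (simp add: zero_le_mult_iff)

definition collision_l2 :: "real \<Rightarrow> l2 \<Rightarrow> l2" where
  "collision_l2 s u = wl2 s (collision \<omega>2 (unwl2 s u))"

lemma collision_field:
  assumes s: "s > 1 / 2"
  shows "\<exists>C. cubic_vector_field (collision_l2 s) C nonneg_l2 \<and>
    (\<forall>f\<in>L2w s. collision \<omega>2 f \<in> L2w s \<and> collision_l2 s (wl2 s f) = wl2 s (collision \<omega>2 f))"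
proof -
  obtain C where C: "C > 0"
    and Q: "\<And>f. f \<in> L2w s \<Longrightarrow> collision \<omega>2 f \<in> L2w s"
    and lip: "\<And>f g. f \<in> L2w s \<Longrightarrow> g \<in> L2w s \<Longrightarrow> L2w_norm s (\<lambda>p. collision \<omega>2 f p - collision \<omega>2 g p) \<le>
       C * ((L2w_norm s f)\<^sup>2 + (L2w_norm s g)\<^sup>2) * L2w_norm s (\<lambda>p. f p - g p)"
    and pos: "\<And>f M. f \<in> L2w s \<Longrightarrow> AE p in lborel. f p \<ge> 0 \<Longrightarrow> L2w_norm s f \<le> M \<Longrightarrow>
       AE p in lborel. collision \<omega>2 f p + C * M\<^sup>2 * f p \<ge> 0"
    using collision_estimates[OF s] by blast
  have lip': "norm (wl2 s (collision \<omega>2 f) - wl2 s (collision \<omega>2 g)) \<le>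
      C * ((norm (wl2 s f))\<^sup>2 + (norm (wl2 s g))\<^sup>2) * norm (wl2 s f - wl2 s g)"
    if f: "f \<in> L2w s" and g: "g \<in> L2w s" for f g
    using lip[OF f g] L2w_norm_diff[OF f g] L2w_norm_diff[OF Q[OF f] Q[OF g]] norm_wl2[OF f] norm_wl2[OF g] by simp
  \<comment> \<open>\<open>unwl2\<close> may return another representative than f; it has distance 0
    from f, and by the Lipschitz bound so have the images.\<close>
  have wl2: "collision_l2 s (wl2 s f) = wl2 s (collision \<omega>2 f)" if f: "f \<in> L2w s" for f
    using lip'[OF unwl2_L2w f, of "wl2 s f"] by (simp add: collision_l2_def wl2_unwl2)
  have ex: "\<exists>f\<in>L2w s. u = wl2 s f" for u using unwl2_L2w wl2_unwl2 by metis
  have z: "(\<lambda>x. 0) \<in> L2w s" by (simp add: L2w_def)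
  have z': "wl2 s (\<lambda>x. 0) = 0" using wl2_scale(2)[OF z, of 0] by simp
  show ?thesis
  proof (intro exI[of _ C] conjI ballI Q wl2)
    show "cubic_vector_field (collision_l2 s) C nonneg_l2"
    proof
      show "C > 0" by (rule C)
      show "collision_l2 s 0 = 0" using wl2[OF z] by (simp add: z' collision_zero)
      fix x y
      obtain f g where f: "f \<in> L2w s" "x = wl2 s f" and g: "g \<in> L2w s" "y = wl2 s g" using ex by meson
      show "norm (collision_l2 s x - collision_l2 s y) \<le> C * ((norm x)\<^sup>2 + (norm y)\<^sup>2) * norm (x - y)"
        using lip'[OF f(1) g(1)] by (simp add: f g wl2)
    next
      fix x M d assume x: "\<forall>d\<in>nonneg_l2. inner x d \<ge> 0" and M: "norm x \<le> M"
      obtain f where f: "f \<in> L2w s" "x = wl2 s f" using ex by meson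
      have "AE p in lborel. f p \<ge> 0" using x inner_wl2_nonneg_iff[OF f(1)] f(2) by simp
      then have p: "AE p in lborel. collision \<omega>2 f p + C * M\<^sup>2 * f p \<ge> 0"
        using M norm_wl2[OF f(1)] f by (intro pos) auto
      have eq: "collision_l2 s x + (C * M\<^sup>2) *\<^sub>R x = wl2 s (\<lambda>p. collision \<omega>2 f p + C * M\<^sup>2 * f p)"
        unfolding f(2) wl2[OF f(1)] wl2_add(2)[OF Q[OF f(1)] wl2_scale(1)[OF f(1)]] wl2_scale(2)[OF f(1)] ..
      show "\<forall>d\<in>nonneg_l2. inner (collision_l2 s x + (C * M\<^sup>2) *\<^sub>R x) d \<ge> 0"
        unfolding eq inner_wl2_nonneg_iff[OF wl2_add(1)[OF Q[OF f(1)] wl2_scale(1)[OF f(1)]]] by (rule p)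
    qed
  qed
qed

section \<open>Curves of functions as curves in the Hilbert space\<close>

lemma has_L2w_deriv_iff:
  assumes F: "\<And>u. u \<in> {0..T} \<Longrightarrow> F u \<in> L2w s" and t: "t \<in> {0..T}" and g: "g \<in> L2w s"
  shows "has_L2w_deriv s T F t g \<longleftrightarrow>
    ((\<lambda>u. wl2 s (F u)) has_vector_derivative wl2 s g) (at t within {0..T})"
proof -
  have eq: "L2w_norm s (\<lambda>p. (F u p - F t p) / (u - t) - g p) =
      norm ((1 / norm (u - t)) *\<^sub>R (wl2 s (F u) - (wl2 s (F t) + (u - t) *\<^sub>R wl2 s g)))"
    if u: "u \<in> {0..T}" "u \<noteq> t" for u
  proof -
    let ?h = "\<lambda>p. inverse (u - t) * (F u p - F t p)"
    have d: "(\<lambda>p. F u p - F t p) \<in> L2w s" by (intro wl2_diff F u t)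
    have h: "?h \<in> L2w s" by (intro wl2_scale d)
    have "L2w_norm s (\<lambda>p. (F u p - F t p) / (u - t) - g p) = L2w_norm s (\<lambda>p. ?h p - g p)"
      by (simp add: divide_inverse mult.commute)
    also have "\<dots> = norm (inverse (u - t) *\<^sub>R (wl2 s (F u) - wl2 s (F t)) - wl2 s g)"
      by (simp only: L2w_norm_diff[OF h g] wl2_scale(2)[OF d] wl2_diff(2)[OF F[OF u(1)] F[OF t]])
    also have "inverse (u - t) *\<^sub>R (wl2 s (F u) - wl2 s (F t)) - wl2 s g =
        inverse (u - t) *\<^sub>R (wl2 s (F u) - (wl2 s (F t) + (u - t) *\<^sub>R wl2 s g))"
      using u by (simp add: scaleR_diff_right scaleR_add_right)
    also have "norm \<dots> = norm ((1 / norm (u - t)) *\<^sub>R (wl2 s (F u) - (wl2 s (F t) + (u - t) *\<^sub>R wl2 s g)))"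
      by (simp add: divide_inverse)
    finally show ?thesis .
  qed
  have "((\<lambda>u. L2w_norm s (\<lambda>p. (F u p - F t p) / (u - t) - g p)) \<longlongrightarrow> 0) (at t within {0..T}) \<longleftrightarrow>
    ((\<lambda>u. norm ((1 / norm (u - t)) *\<^sub>R (wl2 s (F u) - (wl2 s (F t) + (u - t) *\<^sub>R wl2 s g)))) \<longlongrightarrow> 0) (at t within {0..T})"
    by (rule Lim_cong_within) (auto simp: eq)
  also have "\<dots> \<longleftrightarrow> ((\<lambda>u. wl2 s (F u)) has_vector_derivative wl2 s g) (at t within {0..T})"
    unfolding has_vector_derivative_def has_derivative_within tendsto_norm_zero_iff
    by (simp add: bounded_linear_scaleR_left)
  finally show ?thesis using g by (simp add: has_L2w_deriv_def)
qed

lemma has_L2w_deriv_L2w: "has_L2w_deriv s T F t g \<Longrightarrow> g \<in> L2w s"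
  by (simp add: has_L2w_deriv_def)

text \<open>The arbitrarily chosen derivative represents the vector derivative, because derivatives
  within a nondegenerate closed interval are unique, at its ends too.\<close>

lemma wl2_L2w_deriv:
  assumes F: "\<And>u. u \<in> {0..T} \<Longrightarrow> F u \<in> L2w s" and t: "t \<in> {0..T}" and T: "T > 0"
    and D: "((\<lambda>u. wl2 s (F u)) has_vector_derivative w) (at t within {0..T})"
  shows "has_L2w_deriv s T F t (L2w_deriv s T F t)" "wl2 s (L2w_deriv s T F t) = w"
proof -
  have "has_L2w_deriv s T F t (unwl2 s w)"
    using has_L2w_deriv_iff[OF F t unwl2_L2w] D by (simp add: wl2_unwl2)
  then show d: "has_L2w_deriv s T F t (L2w_deriv s T F t)" unfolding L2w_deriv_def by (rule someI[where P = "has_L2w_deriv s T F t"])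
  have "((\<lambda>u. wl2 s (F u)) has_vector_derivative wl2 s (L2w_deriv s T F t)) (at t within {0..T})"
    using has_L2w_deriv_iff[OF F t has_L2w_deriv_L2w[OF d]] d by simp
  then show "wl2 s (L2w_deriv s T F t) = w"
    by (rule vector_derivative_unique_within_closed_interval[OF T, unfolded cbox_interval, OF t _ D])
qed

lemma continuous_L2w_iff:
  "continuous_L2w s T F \<longleftrightarrow> (\<forall>t\<in>{0..T}. F t \<in> L2w s) \<and> continuous_on {0..T} (\<lambda>t. wl2 s (F t))"
proof -
  have "((\<lambda>u. L2w_norm s (\<lambda>p. F u p - F t p)) \<longlongrightarrow> 0) (at t within {0..T}) \<longleftrightarrow>
      ((\<lambda>u. wl2 s (F u)) \<longlongrightarrow> wl2 s (F t)) (at t within {0..T})"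
    if "\<forall>t\<in>{0..T}. F t \<in> L2w s" "t \<in> {0..T}" for t
  proof -
    have "((\<lambda>u. L2w_norm s (\<lambda>p. F u p - F t p)) \<longlongrightarrow> 0) (at t within {0..T}) \<longleftrightarrow>
      ((\<lambda>u. norm (wl2 s (F u) - wl2 s (F t))) \<longlongrightarrow> 0) (at t within {0..T})"
      by (rule Lim_cong_within) (use that in \<open>auto simp: L2w_norm_diff\<close>)
    then show ?thesis by (simp add: tendsto_norm_zero_iff LIM_zero_iff)
  qed
  then show ?thesis unfolding continuous_L2w_def continuous_on_def by blast
qed

text \<open>The initial-value problem for representatives is an ordinary differential equation for
  classes. The continuity of the derivative demanded by \<open>C1_L2w\<close> follows from the
  equation and the continuity of N.\<close>

lemma solves_ivp_iff:
  assumes T: "T > 0" and f0: "f0 \<in> L2w s"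
    and Q: "\<And>f. f \<in> L2w s \<Longrightarrow> collision \<omega> f \<in> L2w s"
    and N: "\<And>f. f \<in> L2w s \<Longrightarrow> N (wl2 s f) = wl2 s (collision \<omega> f)"
    and cont: "continuous_on UNIV N"
  shows "solves_ivp \<omega> s T f0 F \<longleftrightarrow> (\<forall>t\<in>{0..T}. F t \<in> L2w s \<and>
      ((\<lambda>u. wl2 s (F u)) has_vector_derivative N (wl2 s (F t))) (at t within {0..T})) \<and> wl2 s (F 0) = wl2 s f0"
proof (cases "\<forall>t\<in>{0..T}. F t \<in> L2w s")
  case False
  then show ?thesis by (auto simp: solves_ivp_def C1_L2w_def continuous_L2w_def)
next
  case True
  then have F: "\<And>u. u \<in> {0..T} \<Longrightarrow> F u \<in> L2w s" by blast
  have init: "wl2 s (F 0) = wl2 s f0 \<longleftrightarrow> (AE p in lborel. F 0 p = f0 p)"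
    using T by (intro wl2_eq_iff F f0) auto
  show ?thesis
  proof
    assume sol: "solves_ivp \<omega> s T f0 F"
    have "((\<lambda>u. wl2 s (F u)) has_vector_derivative N (wl2 s (F t))) (at t within {0..T})" if t: "t \<in> {0..T}" for t
    proof -
      have "\<exists>g. has_L2w_deriv s T F t g" using sol t by (auto simp: solves_ivp_def C1_L2w_def)
      then have d: "has_L2w_deriv s T F t (L2w_deriv s T F t)" unfolding L2w_deriv_def by (rule someI_ex)
      have "AE p in lborel. L2w_deriv s T F t p = collision \<omega> (F t) p" using sol t by (auto simp: solves_ivp_def)
      then have "wl2 s (L2w_deriv s T F t) = N (wl2 s (F t))"
        using wl2_eq_iff[OF has_L2w_deriv_L2w[OF d] Q[OF F[OF t]]] N[OF F[OF t]] by simp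
      then show ?thesis using has_L2w_deriv_iff[OF F t has_L2w_deriv_L2w[OF d]] d by simp
    qed
    then show "(\<forall>t\<in>{0..T}. F t \<in> L2w s \<and>
      ((\<lambda>u. wl2 s (F u)) has_vector_derivative N (wl2 s (F t))) (at t within {0..T})) \<and> wl2 s (F 0) = wl2 s f0"
      using sol F init by (auto simp: solves_ivp_def)
  next
    assume *: "(\<forall>t\<in>{0..T}. F t \<in> L2w s \<and>
      ((\<lambda>u. wl2 s (F u)) has_vector_derivative N (wl2 s (F t))) (at t within {0..T})) \<and> wl2 s (F 0) = wl2 s f0"
    have d: "has_L2w_deriv s T F t (L2w_deriv s T F t)" "wl2 s (L2w_deriv s T F t) = N (wl2 s (F t))"
      if t: "t \<in> {0..T}" for t
      using wl2_L2w_deriv[where F = F, OF F t T] * t by blast+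
    have c: "continuous_on {0..T} (\<lambda>t. wl2 s (F t))"
      unfolding continuous_on_eq_continuous_within using * has_vector_derivative_continuous by blast
    have "continuous_on {0..T} (\<lambda>t. N (wl2 s (F t)))"
      by (rule continuous_on_compose2[OF cont c]) simp
    then have c': "continuous_on {0..T} (\<lambda>t. wl2 s (L2w_deriv s T F t))"
      by (rule continuous_on_eq) (simp add: d)
    have "AE p in lborel. L2w_deriv s T F t p = collision \<omega> (F t) p" if t: "t \<in> {0..T}" for t
      using d[OF t] N[OF F[OF t]] wl2_eq_iff[OF has_L2w_deriv_L2w[OF d(1)[OF t]] Q[OF F[OF t]]] by simp
    then show "solves_ivp \<omega> s T f0 F"
      unfolding solves_ivp_def C1_L2w_def mem_Collect_eq continuous_L2w_iff
      using F c c' d(1) has_L2w_deriv_L2w[OF d(1)] init * by blast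
  qed
qed

lemma C1_norm_le:
  assumes T: "T > 0" and F: "\<And>u. u \<in> {0..T} \<Longrightarrow> F u \<in> L2w s"
    and D: "\<And>t. t \<in> {0..T} \<Longrightarrow> ((\<lambda>u. wl2 s (F u)) has_vector_derivative w t) (at t within {0..T})"
    and A: "\<And>t. t \<in> {0..T} \<Longrightarrow> norm (wl2 s (F t)) \<le> A"
    and B: "\<And>t. t \<in> {0..T} \<Longrightarrow> norm (w t) \<le> B"
  shows "C1_norm s T F \<le> A + B"
  unfolding C1_norm_def
proof (intro add_mono cSUP_least)
  fix t assume t: "t \<in> {0..T}"
  show "L2w_norm s (F t) \<le> A" using A[OF t] norm_wl2[OF F[OF t]] by simp
  note d = wl2_L2w_deriv[OF F t T D[OF t]]
  show "L2w_norm s (L2w_deriv s T F t) \<le> B"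
    using B[OF t] d(2) norm_wl2[OF has_L2w_deriv_L2w[OF d(1)]] by simp
qed (use T in auto)

theorem theorem2p2:
  fixes \<omega> :: "real^3 \<Rightarrow> real" and s :: real
  assumes "\<omega> = (\<lambda>p. (norm p)\<^sup>2)" and "s > 1/2"
  shows "\<exists>c>0. \<forall>R>0. \<exists>T \<ge> c / R\<^sup>2.
    \<exists>S :: (real^3 \<Rightarrow> real) \<Rightarrow> real \<Rightarrow> real^3 \<Rightarrow> real.
      (\<forall>f0\<in>L2w s. L2w_norm s f0 \<le> R \<longrightarrow>
         solves_ivp \<omega> s T f0 (S f0) \<and>
         (\<forall>f. solves_ivp \<omega> s T f0 f \<longrightarrow> (\<forall>t\<in>{0..T}. AE p in lborel. f t p = S f0 t p)) \<and>
         (\<forall>t\<in>{0..T}. L2w_norm s (S f0 t) \<le> 2 * R)) \<and>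
      (\<forall>f0\<in>L2w s. L2w_norm s f0 \<le> R \<longrightarrow>
         (\<forall>\<epsilon>>0. \<exists>\<delta>>0. \<forall>g0\<in>L2w s. L2w_norm s g0 \<le> R \<longrightarrow> L2w_norm s (\<lambda>p. g0 p - f0 p) < \<delta> \<longrightarrow>
            C1_norm s T (\<lambda>t p. S g0 t p - S f0 t p) < \<epsilon>)) \<and>
      (\<forall>f0\<in>L2w s. L2w_norm s f0 \<le> R \<longrightarrow> (AE p in lborel. f0 p \<ge> 0) \<longrightarrow>
         (\<forall>t\<in>{0..T}. AE p in lborel. S f0 t p \<ge> 0))"
proof -
  obtain C where C: "cubic_vector_field (collision_l2 s) C nonneg_l2 \<and>
      (\<forall>f\<in>L2w s. collision \<omega> f \<in> L2w s \<and> collision_l2 s (wl2 s f) = wl2 s (collision \<omega> f))"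
    using collision_field[OF assms(2), folded assms(1)] by (elim exE)
  then have field: "cubic_vector_field (collision_l2 s) C nonneg_l2" by (rule conjunct1)
  from C have Q: "collision \<omega> f \<in> L2w s" and N: "collision_l2 s (wl2 s f) = wl2 s (collision \<omega> f)"
    if "f \<in> L2w s" for f using that by blast+
  interpret cubic_vector_field "collision_l2 s" C nonneg_l2 by (rule field)
  show ?thesis
  proof (rule exI[of _ "1 / (24 * C)"], intro conjI allI impI, goal_cases)
    case 1
    show ?case using Cpos by simp
  next
    case (2 R)
    then have R: "R > 0" .
    \<comment> \<open>The lifespan from \<open>local_solution\<close>, equal to c / R^2 and common
      to all data in the ball of radius R.\<close>
    define T where "T = 1 / (24 * C * R\<^sup>2)"
    have T: "T > 0" using R Cpos by (simp add: T_def)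
    \<comment> \<open>The conditional cone statement belongs to the selected property, so that one
      solution map has both the norm bound and the preservation of positivity.\<close>
    define good where "good x0 x \<longleftrightarrow> x 0 = x0 \<and>
      (\<forall>t\<in>{0..T}. (x has_vector_derivative collision_l2 s (x t)) (at t within {0..T})) \<and>
      (\<forall>t\<in>{0..T}. norm (x t) \<le> 2 * R) \<and>
      ((\<forall>d\<in>nonneg_l2. inner x0 d \<ge> 0) \<longrightarrow> (\<forall>t\<in>{0..T}. \<forall>d\<in>nonneg_l2. inner (x t) d \<ge> 0))" for x0 x
    define sol where "sol x0 = (SOME x. good x0 x)" for x0
    have ex: "\<exists>x. good x0 x" if "norm x0 \<le> R" for x0
    proof (rule local_solution[OF R that T_def])
      fix x assume x: "x 0 = x0"
        "\<And>t. t \<in> {0..T} \<Longrightarrow> (x has_vector_derivative collision_l2 s (x t)) (at t within {0..T})"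
        "\<And>t. t \<in> {0..T} \<Longrightarrow> norm (x t) \<le> 2 * R"
        "\<And>t. \<forall>d\<in>nonneg_l2. inner x0 d \<ge> 0 \<Longrightarrow> t \<in> {0..T} \<Longrightarrow> \<forall>d\<in>nonneg_l2. inner (x t) d \<ge> 0"
      have "good x0 x" unfolding good_def
        by (intro conjI ballI impI x(1-3)) (use x(4) in blast)+
      then show "\<exists>x. good x0 x" by (rule exI[where P = "good x0"])
    qed
    have sol: "good x0 (sol x0)" if "norm x0 \<le> R" for x0
      unfolding sol_def by (rule someI_ex[OF ex[OF that]])
    define S where "S f0 t = unwl2 s (sol (wl2 s f0) t)" for f0 t
    have S: "S f0 t \<in> L2w s" "wl2 s (S f0 t) = sol (wl2 s f0) t" for f0 t
      by (simp_all add: S_def unwl2_L2w wl2_unwl2)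
    have good: "good (wl2 s f0) (\<lambda>t. wl2 s (S f0 t))" if "f0 \<in> L2w s" "L2w_norm s f0 \<le> R" for f0
      unfolding S using that by (intro sol) (simp add: norm_wl2)
    have ivp: "solves_ivp \<omega> s T f0 F \<longleftrightarrow> (\<forall>t\<in>{0..T}. F t \<in> L2w s \<and>
        ((\<lambda>u. wl2 s (F u)) has_vector_derivative collision_l2 s (wl2 s (F t))) (at t within {0..T})) \<and>
        wl2 s (F 0) = wl2 s f0" if "f0 \<in> L2w s" for f0 F
      by (rule solves_ivp_iff[OF T that Q N continuous_on_N])
    have solution: "solves_ivp \<omega> s T f0 (S f0)"
      and unique: "\<And>f t. solves_ivp \<omega> s T f0 f \<Longrightarrow> t \<in> {0..T} \<Longrightarrow> AE p in lborel. f t p = S f0 t p"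
      and bound: "\<And>t. t \<in> {0..T} \<Longrightarrow> L2w_norm s (S f0 t) \<le> 2 * R"
      and nonneg: "\<And>t. AE p in lborel. f0 p \<ge> 0 \<Longrightarrow> t \<in> {0..T} \<Longrightarrow> AE p in lborel. S f0 t p \<ge> 0"
      if f0: "f0 \<in> L2w s" "L2w_norm s f0 \<le> R" for f0
    proof -
      note g = good[OF f0, unfolded good_def]
      show "solves_ivp \<omega> s T f0 (S f0)" unfolding ivp[OF f0(1)] using g S(1) by blast
      show "AE p in lborel. f t p = S f0 t p" if f: "solves_ivp \<omega> s T f0 f" and t: "t \<in> {0..T}" for f t
      proof -
        note f' = f[unfolded ivp[OF f0(1)]]
        have "wl2 s (f t) = wl2 s (S f0 t)"
          by (rule solution_unique[where x = "\<lambda>t. wl2 s (f t)" and T = T]) (use f' g t T in auto)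
        then show ?thesis using wl2_eq_iff[of "f t" s "S f0 t"] f' t S(1) by blast
      qed
      show "L2w_norm s (S f0 t) \<le> 2 * R" if "t \<in> {0..T}" for t
      proof -
        have "norm (wl2 s (S f0 t)) \<le> 2 * R" using g that by blast
        then show ?thesis by (simp add: norm_wl2[OF S(1)])
      qed
      show "AE p in lborel. S f0 t p \<ge> 0" if "AE p in lborel. f0 p \<ge> 0" "t \<in> {0..T}" for t
        using g that inner_wl2_nonneg_iff[OF f0(1)] inner_wl2_nonneg_iff[OF S(1)[of f0 t]] by blast
    qed
    \<comment> \<open>L is the Lipschitz constant of the field on the ball of radius 2 R. In E the
      term exp(L T) bounds the growth of the difference of two solutions, and L exp(L T) that of the
      derivatives; the solution map is thus even Lipschitz continuous.\<close>
    define L where "L = 2 * C * (2 * R)\<^sup>2"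
    define E where "E = exp (L * T) + L * exp (L * T)"
    have L: "L \<ge> 0" using Cpos by (simp add: L_def)
    have E: "E > 0" using L by (simp add: E_def add_pos_nonneg)
    have dep: "C1_norm s T (\<lambda>t p. S g0 t p - S f0 t p) \<le> E * L2w_norm s (\<lambda>p. g0 p - f0 p)"
      if f0: "f0 \<in> L2w s" "L2w_norm s f0 \<le> R" and g0: "g0 \<in> L2w s" "L2w_norm s g0 \<le> R" for f0 g0
    proof -
      note f = good[OF f0, unfolded good_def] and g = good[OF g0, unfolded good_def]
      note diff = wl2_diff[OF S(1)[of g0] S(1)[of f0]]
      define n where "n = norm (wl2 s g0 - wl2 s f0)"
      have close: "norm (wl2 s (S g0 t) - wl2 s (S f0 t)) \<le> exp (L * T) * n" if "t \<in> {0..T}" for t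
        using solution_dependence[of T "\<lambda>t. wl2 s (S g0 t)" "\<lambda>t. wl2 s (S f0 t)" "2 * R" t] f g that
        by (auto simp: L_def n_def)
      have "C1_norm s T (\<lambda>t p. S g0 t p - S f0 t p) \<le> exp (L * T) * n + L * (exp (L * T) * n)"
      proof (rule C1_norm_le[OF T diff(1)])
        fix t assume t: "t \<in> {0..T}"
        show "((\<lambda>u. wl2 s (\<lambda>p. S g0 u p - S f0 u p)) has_vector_derivative
            (collision_l2 s (wl2 s (S g0 t)) - collision_l2 s (wl2 s (S f0 t)))) (at t within {0..T})"
          unfolding diff(2) by (intro has_vector_derivative_diff) (use f g t in auto)
        show "norm (wl2 s (\<lambda>p. S g0 t p - S f0 t p)) \<le> exp (L * T) * n"
          unfolding diff(2) by (rule close[OF t])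
        have "norm (collision_l2 s (wl2 s (S g0 t)) - collision_l2 s (wl2 s (S f0 t))) \<le>
            L * norm (wl2 s (S g0 t) - wl2 s (S f0 t))"
          unfolding L_def by (rule N_lip_ball) (use f g t in auto)
        also have "\<dots> \<le> L * (exp (L * T) * n)" by (rule mult_left_mono[OF close[OF t] L])
        finally show "norm (collision_l2 s (wl2 s (S g0 t)) - collision_l2 s (wl2 s (S f0 t))) \<le> L * (exp (L * T) * n)" .
      qed
      also have "\<dots> = E * L2w_norm s (\<lambda>p. g0 p - f0 p)"
        by (simp add: E_def n_def L2w_norm_diff[OF g0(1) f0(1)] distrib_right)
      finally show ?thesis .
    qed
    have cont: "\<exists>\<delta>>0. \<forall>g0\<in>L2w s. L2w_norm s g0 \<le> R \<longrightarrow> L2w_norm s (\<lambda>p. g0 p - f0 p) < \<delta> \<longrightarrow>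
        C1_norm s T (\<lambda>t p. S g0 t p - S f0 t p) < \<epsilon>"
      if f0: "f0 \<in> L2w s" "L2w_norm s f0 \<le> R" and \<epsilon>: "\<epsilon> > 0" for f0 \<epsilon>
    proof (intro exI[of _ "\<epsilon> / E"] conjI ballI impI)
      show "\<epsilon> / E > 0" using \<epsilon> E by simp
      fix g0 assume g0: "g0 \<in> L2w s" "L2w_norm s g0 \<le> R" and "L2w_norm s (\<lambda>p. g0 p - f0 p) < \<epsilon> / E"
      then have "E * L2w_norm s (\<lambda>p. g0 p - f0 p) < \<epsilon>" using E by (simp add: field_simps)
      with dep[OF f0 g0] show "C1_norm s T (\<lambda>t p. S g0 t p - S f0 t p) < \<epsilon>" by simp
    qed
    show ?case
    proof (rule exI[of _ T], rule conjI, goal_cases)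
      case 1
      show "1 / (24 * C) / R\<^sup>2 \<le> T" by (simp add: T_def)
    next
      case 2
      show ?case
        by (rule exI[of _ S], intro conjI ballI impI allI) (fact solution unique bound cont nonneg)+
    qed
  qed
qed

end
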